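(* For any quantum automaton $\mathcal{A}$ and any $\lambda\in[0,1)$: (1) it is decidable whether $\mathcal{L}^{>\lambda}(\mathcal{A}|\mathrm{ND})=\emptyset$; (2) it is decidable whether $\mathcal{L}^{>\lambda}(\mathcal{A}|\mathrm{D})=\emptyset$.
   Context: A quantum automaton is a tuple $\mathcal{A}=(\mathcal{H},|s_0\rangle,\Sigma,\{U_\sigma:\sigma\in\Sigma\},F)$ where $\mathcal{H}$ is a finite-dimensional complex Hilbert space, $|s_0\rangle$ a unit vector, $\Sigma$ a finite alphabet, each $U_\sigma$ unitary, and $F$ a subspace. For decidability, the automaton (the vector $|s_0\rangle$, the matrices $U_\sigma$ and a basis of $F$) is given with algebraic-number entries, and $\lambda$ is given as part of the input. For $w=\sigma_1\sigma_2\cdots\in\Sigma^\omega$: Non-disturbing: run $|s_n\rangle=U_{\sigma_n}\cdots U_{\sigma_1}|s_0\rangle$, $f^{\mathrm{ND}}_{\mathcal{A}}(w)=\sup_{|\psi\rangle}\sup_{\{n_i\}}\inf_{i\ge1}|\langle\psi|s_{n_i}\rangle|^2$ (sup over unit $|\psi\rangle\in F$ and strictly increasing $0\le n_1<n_2<\cdots$). Disturbing: for unit $|\psi\rangle\in F$ and checkpoints $\{n_i\}$, run $|s_0\rangle$ and for $n\ge1$: $|s_n\rangle=U_{\sigma_n}|\psi\rangle$ if $n-1=n_i$ for some $i$, else $U_{\sigma_n}|s_{n-1}\rangle$; $f^{\mathrm{D}}_{\mathcal{A}}(w)=\sup_{|\psi\rangle}\sup_{\{n_i\}}\inf_{i\ge1}|\langle\psi|s_{n_i}\rangle|^2$.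 $\mathcal{L}^{>\lambda}(\mathcal{A}|X)=\{w\in\Sigma^\omega:f^X_{\mathcal{A}}(w)>\lambda\}$ for $X\in\{\mathrm{ND},\mathrm{D}\}$. *)

theory Defs
  imports Complex_Main "HOL-Library.Extended_Real" "HOL-Library.Nat_Bijection"
begin

section \<open>Quantum automata over C^d (vectors as nat => complex, only indices < d matter)\<close>

definition cinner :: "nat \<Rightarrow> (nat \<Rightarrow> complex) \<Rightarrow> (nat \<Rightarrow> complex) \<Rightarrow> complex" where
  "cinner d x y = (\<Sum>j<d. cnj (x j) * y j)"

definition unit_vec :: "nat \<Rightarrow> (nat \<Rightarrow> complex) \<Rightarrow> bool" where
  "unit_vec d x \<longleftrightarrow> (\<Sum>j<d. (cmod (x j))^2) = 1"

definition mat_vec :: "nat \<Rightarrow> (nat \<Rightarrow> nat \<Rightarrow> complex) \<Rightarrow> (nat \<Rightarrow> complex) \<Rightarrow> (nat \<Rightarrow> complex)" where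
  "mat_vec d A x = (\<lambda>i. \<Sum>j<d. A i j * x j)"

definition unitary_mat :: "nat \<Rightarrow> (nat \<Rightarrow> nat \<Rightarrow> complex) \<Rightarrow> bool" where
  "unitary_mat d A \<longleftrightarrow>
     (\<forall>i<d. \<forall>j<d. (\<Sum>l<d. cnj (A l i) * A l j) = (if i = j then 1 else 0))"

definition in_span :: "nat \<Rightarrow> (nat \<Rightarrow> complex) list \<Rightarrow> (nat \<Rightarrow> complex) \<Rightarrow> bool" where
  "in_span d B x \<longleftrightarrow> (\<exists>c. \<forall>j<d. x j = (\<Sum>l<length B. c l * (B ! l) j))"

text \<open>Words: w i is the (i+1)-th letter sigma_(i+1); U maps letters to matrices.\<close>
fun nd_run :: "nat \<Rightarrow> (nat \<Rightarrow> nat \<Rightarrow> nat \<Rightarrow> complex) \<Rightarrow> (nat \<Rightarrow> nat)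
    \<Rightarrow> (nat \<Rightarrow> complex) \<Rightarrow> nat \<Rightarrow> (nat \<Rightarrow> complex)" where
  "nd_run d U w s0 0 = s0"
| "nd_run d U w s0 (Suc m) = mat_vec d (U (w m)) (nd_run d U w s0 m)"

text \<open>Disturbing run: checkpoints are N 0 < N 1 < ... (N i is n_(i+1)).\<close>
fun d_run :: "nat \<Rightarrow> (nat \<Rightarrow> nat \<Rightarrow> nat \<Rightarrow> complex) \<Rightarrow> (nat \<Rightarrow> nat)
    \<Rightarrow> (nat \<Rightarrow> complex) \<Rightarrow> (nat \<Rightarrow> complex) \<Rightarrow> (nat \<Rightarrow> nat) \<Rightarrow> nat \<Rightarrow> (nat \<Rightarrow> complex)" where
  "d_run d U w s0 \<psi> N 0 = s0"
| "d_run d U w s0 \<psi> N (Suc m) =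
     mat_vec d (U (w m)) (if m \<in> range N then \<psi> else d_run d U w s0 \<psi> N m)"

definition f_ND :: "nat \<Rightarrow> (nat \<Rightarrow> nat \<Rightarrow> nat \<Rightarrow> complex) \<Rightarrow> (nat \<Rightarrow> complex) list
    \<Rightarrow> (nat \<Rightarrow> complex) \<Rightarrow> (nat \<Rightarrow> nat) \<Rightarrow> ereal" where
  "f_ND d U B s0 w =
     (SUP \<psi>\<in>{\<psi>. unit_vec d \<psi> \<and> in_span d B \<psi>}. SUP N\<in>{N::nat\<Rightarrow>nat. strict_mono N}.
        INF i. ereal ((cmod (cinner d \<psi> (nd_run d U w s0 (N i))))^2))"

definition f_D :: "nat \<Rightarrow> (nat \<Rightarrow> nat \<Rightarrow> nat \<Rightarrow> complex) \<Rightarrow> (nat \<Rightarrow> complex) list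
    \<Rightarrow> (nat \<Rightarrow> complex) \<Rightarrow> (nat \<Rightarrow> nat) \<Rightarrow> ereal" where
  "f_D d U B s0 w =
     (SUP \<psi>\<in>{\<psi>. unit_vec d \<psi> \<and> in_span d B \<psi>}. SUP N\<in>{N::nat\<Rightarrow>nat. strict_mono N}.
        INF i. ereal ((cmod (cinner d \<psi> (d_run d U w s0 \<psi> N (N i))))^2))"

definition lang_ND where
  "lang_ND d k U B s0 lam = {w. (\<forall>i. w i < k) \<and> f_ND d U B s0 w > ereal lam}"

definition lang_D where
  "lang_D d k U B s0 lam = {w. (\<forall>i. w i < k) \<and> f_D d U B s0 w > ereal lam}"

datatype recf = Zero | Succ | Proj nat | Comp recf "recf list" | Prim recf recf | Mn recf

inductive reval :: "recf \<Rightarrow> nat list \<Rightarrow> nat \<Rightarrow> bool" where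
  "reval Zero xs 0"
| "reval Succ (x # xs) (Suc x)"
| "i < length xs \<Longrightarrow> reval (Proj i) xs (xs ! i)"
| "length ys = length gs \<Longrightarrow> (\<forall>i<length gs. reval (gs ! i) xs (ys ! i))
     \<Longrightarrow> reval f ys z \<Longrightarrow> reval (Comp f gs) xs z"
| "reval f xs y \<Longrightarrow> reval (Prim f g) (0 # xs) y"
| "reval (Prim f g) (n # xs) y \<Longrightarrow> reval g (y # n # xs) z \<Longrightarrow> reval (Prim f g) (Suc n # xs) z"
| "reval f (n # xs) 0 \<Longrightarrow> (\<forall>m<n. \<exists>y. reval f (m # xs) (Suc y)) \<Longrightarrow> reval (Mn f) xs n"

definition decidable_on :: "nat set \<Rightarrow> (nat \<Rightarrow> bool) \<Rightarrow> bool" where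
  "decidable_on V P \<longleftrightarrow> (\<exists>f. \<forall>c\<in>V. reval f [c] (if P c then 1 else 0))"

definition rat_val :: "nat \<Rightarrow> real" where
  "rat_val c = (case prod_decode c of (a, b) \<Rightarrow> of_int (int_decode a) / of_int (int_decode b))"

text \<open>An algebraic number is coded by integer polynomial coefficients and a rational
  rectangle [re1,re2] x [im1,im2] isolating a unique root.\<close>
definition alg_coeffs :: "nat \<Rightarrow> int list" where
  "alg_coeffs c = map int_decode (list_decode (fst (prod_decode c)))"

definition alg_rect :: "nat \<Rightarrow> real list" where
  "alg_rect c = map rat_val (list_decode (snd (prod_decode c)))"

definition alg_prop :: "nat \<Rightarrow> complex \<Rightarrow> bool" where
  "alg_prop c z \<longleftrightarrow>
     (\<Sum>i<length (alg_coeffs c). of_int (alg_coeffs c ! i) * z ^ i) = 0 \<and>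
     alg_rect c ! 0 \<le> Re z \<and> Re z \<le> alg_rect c ! 1 \<and>
     alg_rect c ! 2 \<le> Im z \<and> Im z \<le> alg_rect c ! 3"

definition alg_ok :: "nat \<Rightarrow> bool" where
  "alg_ok c \<longleftrightarrow> length (alg_rect c) = 4 \<and> (\<exists>!z. alg_prop c z)"

definition alg_val :: "nat \<Rightarrow> complex" where
  "alg_val c = (THE z. alg_prop c z)"

definition inst :: "nat \<Rightarrow> nat list" where "inst c = list_decode c"
definition i_d where "i_d c = inst c ! 0"
definition i_k where "i_k c = inst c ! 1"
definition i_s0c where "i_s0c c = list_decode (inst c ! 2)"
definition i_Uc where "i_Uc c = map (\<lambda>m. map list_decode (list_decode m)) (list_decode (inst c ! 3))"
definition i_Bc where "i_Bc c = map list_decode (list_decode (inst c ! 4))"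
definition i_lc where "i_lc c = inst c ! 5"

definition i_s0 :: "nat \<Rightarrow> nat \<Rightarrow> complex" where
  "i_s0 c = (\<lambda>j. alg_val (i_s0c c ! j))"
definition i_U :: "nat \<Rightarrow> nat \<Rightarrow> nat \<Rightarrow> nat \<Rightarrow> complex" where
  "i_U c = (\<lambda>\<sigma> i j. alg_val (i_Uc c ! \<sigma> ! i ! j))"
definition i_B :: "nat \<Rightarrow> (nat \<Rightarrow> complex) list" where
  "i_B c = map (\<lambda>v j. alg_val (v ! j)) (i_Bc c)"
definition i_lambda :: "nat \<Rightarrow> real" where
  "i_lambda c = Re (alg_val (i_lc c))"

definition valid_inst :: "nat \<Rightarrow> bool" where
  "valid_inst c \<longleftrightarrow>
     length (inst c) = 6 \<and>
     length (i_s0c c) = i_d c \<and> (\<forall>x\<in>set (i_s0c c). alg_ok x) \<and>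
     length (i_Uc c) = i_k c \<and>
     (\<forall>M\<in>set (i_Uc c). length M = i_d c \<and>
        (\<forall>r\<in>set M. length r = i_d c \<and> (\<forall>x\<in>set r. alg_ok x))) \<and>
     (\<forall>v\<in>set (i_Bc c). length v = i_d c \<and> (\<forall>x\<in>set v. alg_ok x)) \<and>
     alg_ok (i_lc c) \<and> Im (alg_val (i_lc c)) = 0 \<and>
     0 \<le> i_lambda c \<and> i_lambda c < 1 \<and>
     unit_vec (i_d c) (i_s0 c) \<and>
     (\<forall>\<sigma><i_k c. unitary_mat (i_d c) (i_U c \<sigma>))"

definition inst_lang_ND :: "nat \<Rightarrow> (nat \<Rightarrow> nat) set" where
  "inst_lang_ND c = lang_ND (i_d c) (i_k c) (i_U c) (i_B c) (i_s0 c) (i_lambda c)"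
definition inst_lang_D :: "nat \<Rightarrow> (nat \<Rightarrow> nat) set" where
  "inst_lang_D c = lang_D (i_d c) (i_k c) (i_U c) (i_B c) (i_s0 c) (i_lambda c)"

end

theory Submission
  imports Defs "HOL-Analysis.Analysis" "Jordan_Normal_Form.Determinant"
begin

text \<open>
  Unitary maps are recurrent: powers of a letter bring any state back arbitrarily close to itself. Hence
  under both semantics the language is nonempty iff there is a letter and some finite word leads to a
  state whose squared projection onto the accepting subspace exceeds the threshold.

  If such a word exists, it is found by enumeration, because a strict inequality between algebraic numbers
  can be confirmed by approximation. Otherwise there is a polynomial certificate. The closure of the orbit
  of the initial state is a real variety: a point outside is separated from it by a polynomial
  (Stone-Weierstrass), and averaging this polynomial along the dynamics yields one that is constant on the
  orbit. Gaussian elimination makes the coefficients polynomials in the given algebraic numbers, and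
  Hilbert's basis theorem makes the number of equations finite. So some variety contains the initial state,
  is invariant under all letters and satisfies the threshold inequality.

  Checking a certificate means checking \<open>h \<le> 0\<close> on a compact set \<open>p = 0\<close> for integer polynomials, the
  algebraic numbers being isolated by equations as well. This needs no quantifier elimination: the
  supremum of \<open>h\<close> on \<open>p = 0\<close> is a limit of minima of coercive polynomials, whose values are eigenvalues
  of explicit integer matrices. Hence the supremum is a root of an integer polynomial with computably
  bounded coefficients, so it is nonpositive as soon as it lies below an explicit positive gap, and that can be
  confirmed on a grid.
\<close>

text \<open>The obstacle is that neither search has a known bound: accepting words may be long and
  invariants of high degree. So two complementary semi-decision procedures run in parallel, and all
  quantitative work goes into checking one given certificate. In the disturbing semantics a
  checkpoint resets the state to the accepting vector, whose overlap with itself is 1. Since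
  \<lambda> < 1, later checkpoints can be met by returning near that vector, so only the first one
  decides, as in the other semantics. Letters generate only a semigroup, but by recurrence some
  power of a word approximates its inverse at a given state. This makes the orbit closure minimal
  and prevents outside points from approaching it, the two facts behind the averaging argument.
  Vanishing on the orbit is a linear condition on coefficients with entries in the ring generated by
  the real and imaginary parts of the input. A real separating polynomial can therefore be replaced
  by one over that ring, and each coefficient is then written as an integer polynomial in variables
  pinned to the input.\<close>

hide_const (open) Matrix.unit_vec

section \<open>Integer polynomials as lists of terms\<close>

text \<open>A term is a coefficient with a word of variable indices, repetition giving the exponent.
  Terms are never merged, so addition is concatenation.\<close>

type_synonym ipoly = "(int \<times> nat list) list"

definition mon :: "nat list \<Rightarrow> (nat \<Rightarrow> real) \<Rightarrow> real" where
  "mon m z = prod_list (map z m)"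

definition ev :: "ipoly \<Rightarrow> (nat \<Rightarrow> real) \<Rightarrow> real" where
  "ev P z = (\<Sum>t\<leftarrow>P. real_of_int (fst t) * mon (snd t) z)"

definition vars_in :: "nat set \<Rightarrow> ipoly \<Rightarrow> bool" where
  "vars_in V P \<longleftrightarrow> (\<forall>t\<in>set P. set (snd t) \<subseteq> V)"

text \<open>An upper bound for the degree; summing the word lengths avoids a maximum over a possibly
  empty list.\<close>

definition pdeg :: "ipoly \<Rightarrow> nat" where
  "pdeg P = (\<Sum>t\<leftarrow>P. length (snd t))"

text \<open>The l1 norm of the list as written: exactly additive under \<open>@\<close> and
  multiplicative under \<open>pmul\<close>, because cancellation is never carried out.\<close>

definition pnorm :: "ipoly \<Rightarrow> nat" where
  "pnorm P = (\<Sum>t\<leftarrow>P. nat \<bar>fst t\<bar>)"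

definition deg_le :: "nat \<Rightarrow> ipoly \<Rightarrow> bool" where
  "deg_le E P \<longleftrightarrow> (\<forall>t\<in>set P. length (snd t) \<le> E)"

definition pscale :: "int \<Rightarrow> ipoly \<Rightarrow> ipoly" where
  "pscale a P = map (\<lambda>t. (a * fst t, snd t)) P"

definition pmul :: "ipoly \<Rightarrow> ipoly \<Rightarrow> ipoly" where
  "pmul P Q = concat (map (\<lambda>t. map (\<lambda>s. (fst t * fst s, snd t @ snd s)) Q) P)"

lemma mon_Nil [simp]: "mon [] z = 1"
  and mon_Cons [simp]: "mon (i # m) z = z i * mon m z"
  and mon_append [simp]: "mon (m @ m') z = mon m z * mon m' z"
  by (simp_all add: mon_def)

lemma mon_replicate [simp]: "mon (replicate k i) z = z i ^ k"
  by (induction k) auto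

lemma ev_Nil [simp]: "ev [] z = 0"
  and ev_Cons [simp]: "ev (t # P) z = real_of_int (fst t) * mon (snd t) z + ev P z"
  and ev_append [simp]: "ev (P @ Q) z = ev P z + ev Q z"
  by (simp_all add: ev_def)

lemma ev_pscale [simp]: "ev (pscale a P) z = real_of_int a * ev P z"
  by (induction P) (simp_all add: pscale_def algebra_simps)

lemma ev_map_mul: "ev (map (\<lambda>s. (a * fst s, m @ snd s)) Q) z = real_of_int a * mon m z * ev Q z"
  by (induction Q) (simp_all add: algebra_simps)

lemma ev_pmul [simp]: "ev (pmul P Q) z = ev P z * ev Q z"
  by (induction P) (simp_all add: pmul_def ev_map_mul algebra_simps)

lemma ev_concat: "ev (concat Ps) z = (\<Sum>P\<leftarrow>Ps. ev P z)"
  by (induction Ps) auto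

lemma vars_in_simps [simp]:
  "vars_in V []" "vars_in V (t # P) \<longleftrightarrow> set (snd t) \<subseteq> V \<and> vars_in V P"
  "vars_in V (P @ Q) \<longleftrightarrow> vars_in V P \<and> vars_in V Q"
  by (auto simp: vars_in_def)

lemma vars_in_pscale [simp]: "vars_in V P \<Longrightarrow> vars_in V (pscale a P)"
  by (auto simp: vars_in_def pscale_def)

lemma vars_in_pmul [simp]: "vars_in V P \<Longrightarrow> vars_in V Q \<Longrightarrow> vars_in V (pmul P Q)"
  by (fastforce simp: vars_in_def pmul_def)

lemma vars_in_concat: "vars_in V (concat Ps) \<longleftrightarrow> (\<forall>P\<in>set Ps. vars_in V P)"
  by (auto simp: vars_in_def)

lemma vars_in_mono: "vars_in V P \<Longrightarrow> V \<subseteq> W \<Longrightarrow> vars_in W P"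
  by (auto simp: vars_in_def)

lemma pnorm_simps [simp]: "pnorm [] = 0" "pnorm (t # P) = nat \<bar>fst t\<bar> + pnorm P"
  "pnorm (P @ Q) = pnorm P + pnorm Q"
  by (simp_all add: pnorm_def)

lemma pnorm_pscale [simp]: "pnorm (pscale a P) = nat \<bar>a\<bar> * pnorm P"
  by (induction P) (auto simp: pscale_def abs_mult nat_mult_distrib algebra_simps)

lemma pnorm_pmul [simp]: "pnorm (pmul P Q) = pnorm P * pnorm Q"
proof (induction P)
  case (Cons t P)
  have "pnorm (map (\<lambda>s. (fst t * fst s, snd t @ snd s)) Q) = nat \<bar>fst t\<bar> * pnorm Q" for t :: "int \<times> nat list"
    by (induction Q) (auto simp: abs_mult nat_mult_distrib algebra_simps)
  with Cons show ?case by (simp add: pmul_def distrib_right)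
qed (simp add: pmul_def)

lemma deg_le_pdeg: "deg_le (pdeg P) P"
  unfolding deg_le_def pdeg_def by (intro ballI member_le_sum_list) auto

lemma deg_le_mono: "deg_le E P \<Longrightarrow> E \<le> E' \<Longrightarrow> deg_le E' P"
  by (force simp: deg_le_def)

lemma mon_cong: "(\<And>i. i \<in> set m \<Longrightarrow> z i = z' i) \<Longrightarrow> mon m z = mon m z'"
  by (induction m) auto

lemma ev_cong: "vars_in V P \<Longrightarrow> (\<And>i. i \<in> V \<Longrightarrow> z i = z' i) \<Longrightarrow> ev P z = ev P z'"
proof (induction P)
  case (Cons t P)
  have "mon (snd t) z = mon (snd t) z'" using Cons.prems by (intro mon_cong) auto
  with Cons show ?case by auto
qed auto

lemma continuous_on_mon [continuous_intros]: "continuous_on S (mon m)"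
proof (induction m)
  case (Cons i m)
  have "continuous_on S (\<lambda>z. z i * mon m z)"
    by (intro continuous_on_mult Cons continuous_on_subset[OF continuous_on_product_coordinates]) auto
  moreover have "mon (i # m) = (\<lambda>z. z i * mon m z)" by (rule ext) simp
  ultimately show ?case by simp
qed (simp add: mon_def)

lemma continuous_on_ev [continuous_intros]: "continuous_on S (ev P)"
proof (induction P)
  case (Cons t P)
  have "continuous_on S (\<lambda>z. real_of_int (fst t) * mon (snd t) z + ev P z)"
    by (intro continuous_on_add continuous_on_mult continuous_on_const continuous_on_mon Cons)
  moreover have "ev (t # P) = (\<lambda>z. real_of_int (fst t) * mon (snd t) z + ev P z)" by (rule ext) simp
  ultimately show ?case by simp
qed (simp add: ev_def)

lemma tendsto_mon:
  assumes "\<And>i. i \<in> set m \<Longrightarrow> ((\<lambda>s. \<zeta> s i) \<longlongrightarrow> z i) F"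
  shows "((\<lambda>s. mon m (\<zeta> s)) \<longlongrightarrow> mon m z) F"
  using assms by (induction m) (auto intro!: tendsto_mult)

lemma tendsto_ev:
  assumes "\<And>i. i \<in> V \<Longrightarrow> ((\<lambda>s. \<zeta> s i) \<longlongrightarrow> z i) F" "vars_in V P"
  shows "((\<lambda>s. ev P (\<zeta> s)) \<longlongrightarrow> ev P z) F"
  using assms(2)
proof (induction P)
  case (Cons t P)
  have "((\<lambda>s. mon (snd t) (\<zeta> s)) \<longlongrightarrow> mon (snd t) z) F"
    using Cons.prems assms(1) by (intro tendsto_mon) auto
  with Cons show ?case by (auto intro!: tendsto_intros)
qed auto

lemma abs_mon_le:
  assumes "\<And>i. i \<in> set m \<Longrightarrow> \<bar>z i\<bar> \<le> W"
  shows "\<bar>mon m z\<bar> \<le> W ^ length m"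
  using assms
proof (induction m)
  case (Cons i m)
  have "0 \<le> W" using Cons.prems[of i] by (auto intro: order_trans[OF abs_ge_zero])
  with Cons show ?case by (auto simp: abs_mult intro!: mult_mono)
qed auto

lemma abs_ev_le:
  assumes "vars_in V P" "\<And>i. i \<in> V \<Longrightarrow> \<bar>z i\<bar> \<le> W" "W \<ge> 1" "deg_le E P"
  shows "\<bar>ev P z\<bar> \<le> real (pnorm P) * W ^ E"
  using assms(1,4)
proof (induction P)
  case (Cons t P)
  have "\<bar>mon (snd t) z\<bar> \<le> W ^ length (snd t)"
    using Cons.prems assms(2) by (intro abs_mon_le) auto
  also have "\<dots> \<le> W ^ E"
    using Cons.prems assms(3) by (intro power_increasing) (auto simp: deg_le_def)
  finally have "\<bar>real_of_int (fst t) * mon (snd t) z\<bar> \<le> real (nat \<bar>fst t\<bar>) * W ^ E"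
    by (auto simp: abs_mult intro!: mult_left_mono)
  with Cons show ?case by (auto simp: algebra_simps deg_le_def)
qed auto

text \<open>Coordinates from \<open>n\<close> on are pinned to 0, which makes the box compact in the
  product topology of \<open>nat \<Rightarrow> real\<close>.\<close>

definition cbx :: "nat \<Rightarrow> real \<Rightarrow> (nat \<Rightarrow> real) set" where
  "cbx n R = {z. (\<forall>i<n. \<bar>z i\<bar> \<le> R) \<and> (\<forall>i\<ge>n. z i = 0)}"

lemma compact_PiE_UNIV:
  fixes S :: "'i \<Rightarrow> 'a::topological_space set"
  assumes "\<And>i. compact (S i)"
  shows "compact {z. \<forall>i. z i \<in> S i}"
proof -
  have "compactin (product_topology (\<lambda>_. euclidean) UNIV) (Pi\<^sub>E UNIV S)"
    using assms by (auto simp: compactin_PiE)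
  moreover have "Pi\<^sub>E UNIV S = {z. \<forall>i. z i \<in> S i}" by (auto simp: PiE_def Pi_def)
  ultimately show ?thesis by (simp add: euclidean_product_topology)
qed

lemma compact_cbx: "compact (cbx n R)"
proof -
  have "cbx n R = {z. \<forall>i. z i \<in> (if i < n then {-R..R} else {0})}"
    by (auto simp: cbx_def abs_le_iff minus_le_iff not_less Ball_def all_conj_distrib imp_conjL
        intro!: Collect_cong split: if_split_asm)
  moreover have "compact \<dots>" by (rule compact_PiE_UNIV) auto
  ultimately show ?thesis by simp
qed

lemma cbx_subsequence:
  fixes \<zeta> :: "nat \<Rightarrow> nat \<Rightarrow> real"
  assumes "\<And>s. \<zeta> s \<in> cbx n R"
  obtains r z where "strict_mono r" "z \<in> cbx n R" "\<And>i. (\<lambda>s. \<zeta> (r s) i) \<longlonglongrightarrow> z i"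
proof -
  have "seq_compact (cbx n R)" by (rule compact_imp_seq_compact[OF compact_cbx])
  then obtain z r where "z \<in> cbx n R" "strict_mono r" and lim: "(\<zeta> \<circ> r) \<longlonglongrightarrow> z"
    using assms unfolding seq_compact_def by metis
  moreover have "(\<lambda>s. \<zeta> (r s) i) \<longlonglongrightarrow> z i" for i
    using continuous_on_tendsto_compose[OF continuous_on_product_coordinates[of i] lim]
    by (simp add: o_def)
  ultimately show ?thesis using that by blast
qed

lemma mon_counts:
  assumes "set m \<subseteq> {..<k}"
  shows "mon m \<zeta> = (\<Prod>i<k. \<zeta> i ^ count_list m i)"
  using assms
proof (induction m)
  case (Cons j m)
  have "(\<Prod>i<k. \<zeta> i ^ count_list (j # m) i) = (\<Prod>i<k. (if i = j then \<zeta> j else 1) * \<zeta> i ^ count_list m i)"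
    by (intro prod.cong) auto
  also have "\<dots> = \<zeta> j * mon m \<zeta>" using Cons by (auto simp: prod.distrib)
  finally show ?case by simp
qed auto

lemma mon_split_var: "mon m \<zeta> = \<zeta> v ^ count_list m v * mon (filter (\<lambda>i. i \<noteq> v) m) \<zeta>"
  by (induction m) (auto simp: algebra_simps)

text \<open>Packs a bounded vector into one number. Both the reduced monomials and the points of the
  search grid are numbered in this way.\<close>

lemma digits_exist:
  assumes "\<forall>i<n. f i < (b::nat)"
  shows "\<exists>N<b ^ n. \<forall>i<n. N div b ^ i mod b = f i"
  using assms
proof (induction n)
  case (Suc n)
  then obtain N where N: "N < b ^ n" "\<forall>i<n. N div b ^ i mod b = f i" by auto
  have b: "f n < b" using Suc.prems by auto
  have "f n * b ^ n + N < b ^ Suc n"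
  proof -
    have "f n * b ^ n + N < f n * b ^ n + b ^ n" using N by auto
    also have "\<dots> = Suc (f n) * b ^ n" by simp
    also have "\<dots> \<le> b * b ^ n" using b by (intro mult_right_mono) auto
    finally show ?thesis by simp
  qed
  moreover have "(f n * b ^ n + N) div b ^ i mod b = f i" if "i < Suc n" for i
  proof (cases "i = n")
    case True
    then show ?thesis using N b by simp
  next
    case False
    with that obtain j where j: "n = i + Suc j" by (metis add_Suc_right less_imp_Suc_add less_antisym)
    have "f n * b ^ n + N = N + b ^ i * (f n * b ^ j * b)" by (simp add: j power_add algebra_simps)
    moreover have "b ^ i > 0" using b by simp
    ultimately have "(f n * b ^ n + N) div b ^ i = N div b ^ i + f n * b ^ j * b"
      by (metis add.commute div_mult_self2 less_not_refl2)
    then show ?thesis using N j by simp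
  qed
  ultimately show ?case by blast
qed auto

section \<open>Leading coefficients and small roots\<close>

text \<open>The coefficient of the \<open>J\<close>-th power of variable \<open>v\<close>, as a
  polynomial in the other variables.\<close>

definition pco :: "nat \<Rightarrow> nat \<Rightarrow> ipoly \<Rightarrow> ipoly" where
  "pco v J P = map (\<lambda>t. (fst t, filter (\<lambda>i. i \<noteq> v) (snd t))) (filter (\<lambda>t. count_list (snd t) v = J) P)"

lemma pco_Nil [simp]: "pco v J [] = []" by (simp add: pco_def)
lemma pco_Cons [simp]: "pco v J (t # P) =
    (if count_list (snd t) v = J then [(fst t, filter (\<lambda>i. i \<noteq> v) (snd t))] else []) @ pco v J P"
  by (simp add: pco_def)

lemma ev_pco:
  assumes "deg_le d P"
  shows "ev P \<zeta> = (\<Sum>J\<le>d. \<zeta> v ^ J * ev (pco v J P) \<zeta>)"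
  using assms
proof (induction P)
  case (Cons t P)
  have c: "count_list (snd t) v \<le> d"
    using Cons.prems count_le_length[of "snd t" v] by (auto simp: deg_le_def)
  have "(\<Sum>J\<le>d. \<zeta> v ^ J * ev (pco v J (t # P)) \<zeta>) =
    (\<Sum>J\<le>d. (if J = count_list (snd t) v then \<zeta> v ^ J * (real_of_int (fst t) * mon (filter (\<lambda>i. i \<noteq> v) (snd t)) \<zeta>) else 0)
       + \<zeta> v ^ J * ev (pco v J P) \<zeta>)"
    by (intro sum.cong) (auto simp: algebra_simps)
  also have "\<dots> = \<zeta> v ^ count_list (snd t) v * (real_of_int (fst t) * mon (filter (\<lambda>i. i \<noteq> v) (snd t)) \<zeta>) + ev P \<zeta>"
    using Cons c by (simp add: sum.distrib deg_le_def)
  finally show ?case by (simp add: mon_split_var[of "snd t" \<zeta> v])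
qed auto

lemma pnorm_pco: "pnorm (pco v J P) \<le> pnorm P"
  by (induction P) auto

lemma sum_pnorm_pco: "(\<Sum>J\<le>d. pnorm (pco v J P)) \<le> pnorm P"
proof (induction P)
  case (Cons t P)
  have "(\<Sum>J\<le>d. pnorm (pco v J (t # P))) = (\<Sum>J\<le>d. (if J = count_list (snd t) v then nat \<bar>fst t\<bar> else 0) + pnorm (pco v J P))"
    by (intro sum.cong) auto
  also have "\<dots> \<le> nat \<bar>fst t\<bar> + pnorm P" using Cons by (simp add: sum.distrib)
  finally show ?case by simp
qed auto

lemma vars_in_pco: "vars_in V P \<Longrightarrow> vars_in (V - {v}) (pco v J P)"
  by (fastforce simp: vars_in_def pco_def)

text \<open>When zeros of \<open>P\<close> escape to infinity in direction \<open>v\<close> while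
  the other coordinates converge, dividing by the top power of \<open>v\<close> leaves only the
  leading coefficient in the limit. This eliminates a parameter that tends to infinity without
  increasing the norm.\<close>

lemma leading_coefficient_limit:
  assumes nz: "ev P \<xi> \<noteq> 0" and vars: "vars_in V P"
  obtains P' where "vars_in (V - {v}) P'" "pnorm P' \<le> pnorm P" "\<exists>\<zeta>. ev P' \<zeta> \<noteq> 0"
    "\<And>\<zeta>s \<zeta>. (\<And>s. ev P (\<zeta>s s) = 0) \<Longrightarrow> (\<And>i. i \<noteq> v \<Longrightarrow> (\<lambda>s::nat. \<zeta>s s i) \<longlonglongrightarrow> \<zeta> i) \<Longrightarrow>
        filterlim (\<lambda>s. \<zeta>s s v) at_top sequentially \<Longrightarrow> ev P' \<zeta> = 0"
proof -
  define d where "d = pdeg P"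
  note E = ev_pco[OF deg_le_pdeg[of P], folded d_def, where v = v]
  define S where "S = {J. J \<le> d \<and> (\<exists>\<zeta>. ev (pco v J P) \<zeta> \<noteq> 0)}"
  have "S \<noteq> {}"
  proof
    assume "S = {}"
    then have "ev (pco v J P) \<xi> = 0" if "J \<le> d" for J using that by (auto simp: S_def)
    then have "ev P \<xi> = 0" by (simp add: E)
    with nz show False by simp
  qed
  moreover have fS: "finite S" by (simp add: S_def)
  ultimately have J: "Max S \<in> S" by (rule Max_in[rotated])
  define J where "J = Max S"
  have Jd: "J \<le> d" and Jnz: "\<exists>\<zeta>. ev (pco v J P) \<zeta> \<noteq> 0" using J by (auto simp: S_def J_def)
  have top: "ev (pco v j P) \<zeta> = 0" if "j > J" "j \<le> d" for j \<zeta>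
  proof (rule ccontr)
    assume "\<not> ?thesis"
    then have "j \<in> S" using that by (auto simp: S_def)
    then show False using Max_ge[OF fS, of j] that by (simp add: J_def)
  qed
  have E': "ev P \<zeta> = (\<Sum>j<J. \<zeta> v ^ j * ev (pco v j P) \<zeta>) + \<zeta> v ^ J * ev (pco v J P) \<zeta>" for \<zeta>
  proof -
    have "ev P \<zeta> = (\<Sum>j\<le>J. \<zeta> v ^ j * ev (pco v j P) \<zeta>)"
      unfolding E using Jd top by (intro sum.mono_neutral_right) auto
    then show ?thesis by (simp add: lessThan_Suc_atMost[symmetric])
  qed
  show ?thesis
  proof (rule that[OF vars_in_pco[OF vars] pnorm_pco Jnz])
    fix \<zeta>s :: "nat \<Rightarrow> nat \<Rightarrow> real" and \<zeta>
    assume z: "\<And>s. ev P (\<zeta>s s) = 0" and lim: "\<And>i. i \<noteq> v \<Longrightarrow> (\<lambda>s. \<zeta>s s i) \<longlonglongrightarrow> \<zeta> i"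
      and inf: "filterlim (\<lambda>s. \<zeta>s s v) at_top sequentially"
    have evl: "(\<lambda>s. ev (pco v j P) (\<zeta>s s)) \<longlonglongrightarrow> ev (pco v j P) \<zeta>" for j
      by (rule tendsto_ev[OF _ vars_in_pco[OF vars]]) (auto intro: lim)
    have inv: "(\<lambda>s. inverse (\<zeta>s s v)) \<longlonglongrightarrow> 0"
      by (rule tendsto_inverse_0_at_top[OF inf])
    have "(\<lambda>s. (\<Sum>j<J. inverse (\<zeta>s s v) ^ (J - j) * ev (pco v j P) (\<zeta>s s)) + ev (pco v J P) (\<zeta>s s))
       \<longlonglongrightarrow> (\<Sum>j<J. 0 ^ (J - j) * ev (pco v j P) \<zeta>) + ev (pco v J P) \<zeta>"
      by (intro tendsto_intros evl inv)
    moreover have "\<forall>\<^sub>F s in sequentially. (\<Sum>j<J. inverse (\<zeta>s s v) ^ (J - j) * ev (pco v j P) (\<zeta>s s)) + ev (pco v J P) (\<zeta>s s) = 0"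
    proof -
      have "\<forall>\<^sub>F s in sequentially. \<zeta>s s v > 0" using inf by (simp add: filterlim_at_top_dense)
      then show ?thesis
      proof eventually_elim
        case (elim s)
        have "0 = ev P (\<zeta>s s) / \<zeta>s s v ^ J" by (simp add: z)
        also have "\<dots> = (\<Sum>j<J. \<zeta>s s v ^ j * ev (pco v j P) (\<zeta>s s) / \<zeta>s s v ^ J) + ev (pco v J P) (\<zeta>s s)"
          using elim by (simp add: E' add_divide_distrib sum_divide_distrib)
        also have "(\<Sum>j<J. \<zeta>s s v ^ j * ev (pco v j P) (\<zeta>s s) / \<zeta>s s v ^ J) =
          (\<Sum>j<J. inverse (\<zeta>s s v) ^ (J - j) * ev (pco v j P) (\<zeta>s s))"
          using elim by (intro sum.cong) (auto simp: power_diff field_simps power_inverse)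
        finally show ?case by simp
      qed
    qed
    ultimately have "(\<lambda>s::nat. 0::real) \<longlonglongrightarrow> (\<Sum>j<J. 0 ^ (J - j) * ev (pco v j P) \<zeta>) + ev (pco v J P) \<zeta>"
      by (rule Lim_transform_eventually)
    then have "(\<Sum>j<J. 0 ^ (J - j) * ev (pco v j P) \<zeta>) + ev (pco v J P) \<zeta> = 0"
      by (simp add: LIMSEQ_const_iff)
    moreover have "(\<Sum>j<J. 0 ^ (J - j) * ev (pco v j P) \<zeta>) = (\<Sum>j<J. 0)"
      by (intro sum.cong) auto
    ultimately show "ev (pco v J P) \<zeta> = 0" by simp
  qed
qed

lemma ev_no_vars: "vars_in {} P \<Longrightarrow> \<exists>a::int. \<forall>\<zeta>. ev P \<zeta> = of_int a"
proof (induction P)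
  case (Cons t P)
  then obtain a where "\<forall>\<zeta>. ev P \<zeta> = of_int a" by auto
  with Cons.prems show ?case by (intro exI[of _ "fst t + a"]) simp
qed (auto intro: exI[of _ 0])

text \<open>Cauchy's lower bound for the nonzero roots of an integer polynomial.\<close>

lemma small_root_eq_0:
  assumes nz: "ev P \<xi> \<noteq> 0" and vars: "vars_in {v} P" and root: "ev P \<zeta> = 0"
    and small: "\<bar>\<zeta> v\<bar> * real (pnorm P) < 1"
  shows "\<zeta> v = 0"
proof (rule ccontr)
  assume t0: "\<zeta> v \<noteq> 0"
  define t where "t = \<zeta> v"
  define d where "d = pdeg P"
  note E = ev_pco[OF deg_le_pdeg[of P], folded d_def, where v = v]
  have "\<exists>a::int. \<forall>\<zeta>. ev (pco v J P) \<zeta> = of_int a" for J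
    using vars_in_pco[OF vars, of v J] by (intro ev_no_vars) simp
  then obtain c where c: "\<And>J \<zeta>. ev (pco v J P) \<zeta> = real_of_int (c J)" by metis
  have "\<exists>J\<le>d. c J \<noteq> 0"
  proof (rule ccontr)
    assume "\<not> ?thesis"
    then have "ev P \<xi> = 0" by (simp add: E c)
    with nz show False by simp
  qed
  \<comment> \<open>\<open>J\<close> is the lowest degree with a nonzero coefficient. After division
    by \<open>t ^ J\<close> that coefficient, an integer of absolute value at least 1, is minus a
    sum in which every term carries a factor \<open>t\<close>.\<close>
  then obtain J where J: "J \<le> d" "c J \<noteq> 0" and least: "\<And>j. j < J \<Longrightarrow> c j = 0"
    using exists_least_iff[of "\<lambda>J. J \<le> d \<and> c J \<noteq> 0"] by (metis (no_types, lifting) le_trans less_imp_le)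
  have cb: "\<bar>real_of_int (c j)\<bar> \<le> real (pnorm (pco v j P))" for j
  proof -
    have "\<bar>ev Q (\<lambda>_. 1)\<bar> \<le> real (pnorm Q)" for Q
      using abs_ev_le[of UNIV Q "\<lambda>_. 1" 1, OF _ _ _ deg_le_pdeg] by (auto simp: vars_in_def)
    from this[of "pco v j P"] show ?thesis by (simp add: c)
  qed
  have P1: "pnorm P \<ge> 1"
  proof (rule ccontr)
    assume "\<not> ?thesis"
    then have "pnorm (pco v J P) = 0" using pnorm_pco[of v J P] by simp
    with cb[of J] J(2) show False by simp
  qed
  have t1: "\<bar>t\<bar> \<le> 1"
  proof -
    have "\<bar>t\<bar> * 1 \<le> \<bar>t\<bar> * real (pnorm P)" using P1 by (intro mult_left_mono) auto
    with small show ?thesis by (simp add: t_def)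
  qed
  have "0 = (\<Sum>j\<le>d. t ^ j * real_of_int (c j))" using root by (simp add: E c t_def)
  also have "\<dots> = (\<Sum>j\<in>{J..d}. t ^ j * real_of_int (c j))"
    by (intro sum.mono_neutral_right) (auto simp: least)
  also have "\<dots> = (\<Sum>j\<in>{J..d}. t ^ J * (t ^ (j - J) * real_of_int (c j)))"
    by (intro sum.cong) (auto simp: power_add[symmetric] mult.assoc[symmetric])
  also have "\<dots> = t ^ J * (\<Sum>j\<in>{J..d}. t ^ (j - J) * real_of_int (c j))"
    by (simp add: sum_distrib_left)
  finally have "(\<Sum>j\<in>{J..d}. t ^ (j - J) * real_of_int (c j)) = 0" using t0 by (simp add: t_def)
  moreover have "(\<Sum>j\<in>{J..d}. t ^ (j - J) * real_of_int (c j)) =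
      real_of_int (c J) + (\<Sum>j\<in>{Suc J..d}. t ^ (j - J) * real_of_int (c j))"
    using J(1) by (simp add: sum.atLeast_Suc_atMost)
  ultimately have "\<bar>real_of_int (c J)\<bar> = \<bar>\<Sum>j\<in>{Suc J..d}. t ^ (j - J) * real_of_int (c j)\<bar>" by linarith
  also have "\<dots> \<le> (\<Sum>j\<in>{Suc J..d}. \<bar>t\<bar> * real (pnorm (pco v j P)))"
  proof (rule order_trans[OF sum_abs], rule sum_mono)
    fix j assume "j \<in> {Suc J..d}"
    then have "1 \<le> j - J" by auto
    then have "\<bar>t ^ (j - J)\<bar> \<le> \<bar>t\<bar>"
      using power_decreasing[of 1 "j - J" "\<bar>t\<bar>"] t1 by (simp add: power_abs)
    then show "\<bar>t ^ (j - J) * real_of_int (c j)\<bar> \<le> \<bar>t\<bar> * real (pnorm (pco v j P))"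
      unfolding abs_mult by (intro mult_mono cb) auto
  qed
  also have "\<dots> \<le> (\<Sum>j\<le>d. \<bar>t\<bar> * real (pnorm (pco v j P)))"
    by (intro sum_mono2) auto
  also have "\<dots> = \<bar>t\<bar> * real (\<Sum>j\<le>d. pnorm (pco v j P))" by (simp add: sum_distrib_left)
  also have "\<dots> \<le> \<bar>t\<bar> * real (pnorm P)"
    by (intro mult_left_mono of_nat_mono sum_pnorm_pco) auto
  also have "\<dots> < 1" using small by (simp add: t_def)
  finally show False using J(2) by simp
qed

section \<open>Integer polynomial functions of bounded norm\<close>

text \<open>Keeps only the existence of a representing polynomial and its norm bound, so that a
  determinant can be bounded without writing out its terms.\<close>

definition ipf :: "nat set \<Rightarrow> nat \<Rightarrow> ((nat \<Rightarrow> real) \<Rightarrow> real) \<Rightarrow> bool" where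
  "ipf V K f \<longleftrightarrow> (\<exists>P. vars_in V P \<and> pnorm P \<le> K \<and> (\<forall>z. f z = ev P z))"

lemma ipf_ev: "vars_in V P \<Longrightarrow> pnorm P \<le> K \<Longrightarrow> ipf V K (ev P)"
  by (auto simp: ipf_def)

lemma ipf_const: "nat \<bar>a\<bar> \<le> K \<Longrightarrow> ipf V K (\<lambda>_. real_of_int a)"
  unfolding ipf_def by (intro exI[of _ "[(a, [])]"]) auto

lemma ipf_add: "ipf V K f \<Longrightarrow> ipf V L g \<Longrightarrow> ipf V (K + L) (\<lambda>z. f z + g z)"
proof -
  assume "ipf V K f" "ipf V L g"
  then obtain P Q where "vars_in V P" "pnorm P \<le> K" "\<forall>z. f z = ev P z"
    "vars_in V Q" "pnorm Q \<le> L" "\<forall>z. g z = ev Q z" by (auto simp: ipf_def)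
  then show ?thesis unfolding ipf_def by (intro exI[of _ "P @ Q"]) auto
qed

lemma ipf_mult: "ipf V K f \<Longrightarrow> ipf V L g \<Longrightarrow> ipf V (K * L) (\<lambda>z. f z * g z)"
proof -
  assume "ipf V K f" "ipf V L g"
  then obtain P Q where "vars_in V P" "pnorm P \<le> K" "\<forall>z. f z = ev P z"
    "vars_in V Q" "pnorm Q \<le> L" "\<forall>z. g z = ev Q z" by (auto simp: ipf_def)
  then show ?thesis unfolding ipf_def by (intro exI[of _ "pmul P Q"]) (auto intro: mult_le_mono)
qed

lemma ipf_minus: "ipf V K f \<Longrightarrow> ipf V K (\<lambda>z. - f z)"
proof -
  assume "ipf V K f"
  then obtain P where "vars_in V P" "pnorm P \<le> K" "\<forall>z. f z = ev P z" by (auto simp: ipf_def)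
  then show ?thesis unfolding ipf_def by (intro exI[of _ "pscale (-1) P"]) auto
qed

lemma ipf_sum: "finite S \<Longrightarrow> (\<And>x. x \<in> S \<Longrightarrow> ipf V K (f x)) \<Longrightarrow> ipf V (card S * K) (\<lambda>z. \<Sum>x\<in>S. f x z)"
proof (induction S rule: finite_induct)
  case empty
  then show ?case using ipf_const[of 0 0 V] by simp
next
  case (insert x S)
  have "ipf V (K + card S * K) (\<lambda>z. f x z + (\<Sum>x\<in>S. f x z))"
    using insert by (intro ipf_add) auto
  with insert show ?case by simp
qed

lemma ipf_prod: "finite S \<Longrightarrow> (\<And>x. x \<in> S \<Longrightarrow> ipf V K (f x)) \<Longrightarrow> ipf V (K ^ card S) (\<lambda>z. \<Prod>x\<in>S. f x z)"
proof (induction S rule: finite_induct)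
  case empty
  then show ?case using ipf_const[of 1 1 V] by simp
next
  case (insert x S)
  have "ipf V (K * K ^ card S) (\<lambda>z. f x z * (\<Prod>x\<in>S. f x z))"
    using insert by (intro ipf_mult) auto
  with insert show ?case by simp
qed

text \<open>Leibniz formula: \<open>fact N\<close> signed products of \<open>N\<close> entries each;
  norms multiply within a product and add over the permutations.\<close>

lemma ipf_det:
  assumes "\<And>i j. i < N \<Longrightarrow> j < N \<Longrightarrow> ipf V K (f i j)"
  shows "ipf V (fact N * K ^ N) (\<lambda>z. det (mat N N (\<lambda>(i, j). f i j z)))"
proof -
  let ?P = "{p. p permutes {0..<N}}"
  have "ipf V (card ?P * (1 * K ^ N)) (\<lambda>z. \<Sum>p\<in>?P. signof p * (\<Prod>i\<in>{0..<N}. f i (p i) z))"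
  proof (rule ipf_sum)
    fix p assume "p \<in> ?P"
    then have p: "p permutes {0..<N}" by simp
    have "ipf V 1 (\<lambda>_. real_of_int (sign p))" by (rule ipf_const) (auto simp: sign_def)
    moreover have "ipf V (K ^ card {0..<N}) (\<lambda>z. \<Prod>i\<in>{0..<N}. f i (p i) z)"
      using p by (intro ipf_prod assms) (auto dest: permutes_in_image)
    ultimately have "ipf V (1 * K ^ card {0..<N}) (\<lambda>z. real_of_int (sign p) * (\<Prod>i\<in>{0..<N}. f i (p i) z))"
      by (rule ipf_mult)
    then show "ipf V (1 * K ^ N) (\<lambda>z. signof p * (\<Prod>i\<in>{0..<N}. f i (p i) z))" by simp
  qed (simp add: finite_permutations)
  moreover have "det (mat N N (\<lambda>(i, j). f i j z)) = (\<Sum>p\<in>?P. signof p * (\<Prod>i\<in>{0..<N}. f i (p i) z))" for z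
    unfolding det_def by (auto intro!: sum.cong prod.cong dest: permutes_in_image)
  moreover have "card ?P = fact N" by (simp add: card_permutations)
  ultimately show ?thesis by simp
qed

section \<open>A gap theorem for constrained minima\<close>

fun dmon :: "nat \<Rightarrow> nat list \<Rightarrow> nat list list" where
  "dmon i [] = []"
| "dmon i (j # m) = (if j = i then [m] else []) @ map ((#) j) (dmon i m)"

definition pder :: "nat \<Rightarrow> ipoly \<Rightarrow> ipoly" where
  "pder i P = concat (map (\<lambda>t. map (\<lambda>m. (fst t, m)) (dmon i (snd t))) P)"

text \<open>Product rule: \<open>dmon\<close> deletes one occurrence of \<open>i\<close> at a time,
  so that a variable with exponent k contributes k equal monomials.\<close>

lemma DERIV_mon:
  "((\<lambda>t. mon m (z(i := t))) has_real_derivative (\<Sum>m'\<leftarrow>dmon i m. mon m' (z(i := x)))) (at x)"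
proof (induction m)
  case (Cons j m)
  have s: "(\<Sum>m'\<leftarrow>map ((#) j) (dmon i m). mon m' (z(i := x))) = (z(i := x)) j * (\<Sum>m'\<leftarrow>dmon i m. mon m' (z(i := x)))"
    by (induction "dmon i m") (auto simp: sum_list_const_mult o_def)
  have d: "((\<lambda>t. (z(i := t)) j) has_real_derivative (if j = i then 1 else 0)) (at x)"
    by (auto intro!: derivative_eq_intros)
  have "((\<lambda>t. (z(i := t)) j * mon m (z(i := t))) has_real_derivative
      (if j = i then 1 else 0) * mon m (z(i := x)) + (\<Sum>m'\<leftarrow>dmon i m. mon m' (z(i := x))) * (z(i := x)) j) (at x)"
    by (rule DERIV_mult[OF d Cons])
  moreover have "(if j = i then 1 else 0) * mon m (z(i := x)) + (\<Sum>m'\<leftarrow>dmon i m. mon m' (z(i := x))) * (z(i := x)) j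
      = (\<Sum>m'\<leftarrow>dmon i (j # m). mon m' (z(i := x)))"
    unfolding dmon.simps map_append sum_list_append s by simp
  ultimately show ?case by (simp only: mon_Cons)
qed simp

lemma DERIV_ev:
  "((\<lambda>t. ev P (z(i := t))) has_real_derivative ev (pder i P) (z(i := x))) (at x)"
proof (induction P)
  case (Cons t P)
  have e: "ev (map (\<lambda>m. (fst t, m)) ms) \<zeta> = real_of_int (fst t) * (\<Sum>m'\<leftarrow>ms. mon m' \<zeta>)" for ms \<zeta>
    by (induction ms) (auto simp: algebra_simps)
  have "((\<lambda>u. real_of_int (fst t) * mon (snd t) (z(i := u)) + ev P (z(i := u))) has_real_derivative
      real_of_int (fst t) * (\<Sum>m'\<leftarrow>dmon i (snd t). mon m' (z(i := x))) + ev (pder i P) (z(i := x))) (at x)"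
    by (intro DERIV_add DERIV_cmult DERIV_mon Cons)
  then show ?case by (simp only: ev_Cons pder_def list.map concat.simps ev_append e)
qed (simp add: pder_def)

lemma dmon_props:
  "length (dmon i m) \<le> length m"
  "m' \<in> set (dmon i m) \<Longrightarrow> Suc (length m') = length m \<and> set m' \<subseteq> set m"
  by (induction m arbitrary: m') (force split: if_splits)+

lemma pder_props:
  assumes "deg_le E P"
  shows "pnorm (pder i P) \<le> E * pnorm P" "\<And>t. t \<in> set (pder i P) \<Longrightarrow> length (snd t) < E"
    "vars_in V P \<Longrightarrow> vars_in V (pder i P)"
proof -
  show "pnorm (pder i P) \<le> E * pnorm P" using assms
  proof (induction P)
    case (Cons t P)
    have "pnorm (map (\<lambda>m. (fst t, m)) ms) = length ms * nat \<bar>fst t\<bar>" for ms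
      by (induction ms) auto
    moreover have "length (dmon i (snd t)) \<le> E"
      using dmon_props(1)[of i "snd t"] Cons.prems by (auto simp: deg_le_def)
    ultimately show ?case using Cons by (simp add: pder_def distrib_left deg_le_def add_mono)
  qed (simp add: pder_def)
  show "length (snd t) < E" if "t \<in> set (pder i P)" for t
    using that assms by (fastforce simp: pder_def deg_le_def dest: dmon_props(2))
  show "vars_in V P \<Longrightarrow> vars_in V (pder i P)"
    by (fastforce simp: pder_def vars_in_def dest: dmon_props(2))
qed

section \<open>Reduction modulo equations for pure powers\<close>

definition reduced :: "nat \<Rightarrow> nat \<Rightarrow> ipoly \<Rightarrow> bool" where
  "reduced n M P \<longleftrightarrow> (\<forall>t\<in>set P. \<forall>i<n. count_list (snd t) i < M)"

text \<open>Only variables below \<open>n\<close> count; indices from \<open>n\<close> on are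
  parameters. This is the quantity that rewriting decreases.\<close>

definition zdeg :: "nat \<Rightarrow> nat list \<Rightarrow> nat" where
  "zdeg n m = length (filter (\<lambda>j. j < n) m)"

lemma zdeg_append [simp]: "zdeg n (m @ m') = zdeg n m + zdeg n m'"
  by (simp add: zdeg_def)

lemma zdeg_le_length: "zdeg n m \<le> length m" by (simp add: zdeg_def)

lemma zdeg_split: "i < n \<Longrightarrow> zdeg n m = count_list m i + zdeg n (filter (\<lambda>j. j \<noteq> i) m)"
  by (induction m) (auto simp: zdeg_def)

lemma pscale_set: "set (pscale a P) = (\<lambda>t. (a * fst t, snd t)) ` set P"
  by (simp add: pscale_def)

lemma combine_norm:
  assumes "\<And>t. t \<in> set Q \<Longrightarrow> pnorm (f t) \<le> K"
  shows "pnorm (concat (map (\<lambda>t. pscale (fst t) (f t)) Q)) \<le> pnorm Q * K"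
  using assms by (induction Q) (auto simp: distrib_right add_mono)

lemma combine_ev:
  assumes "\<And>t. t \<in> set Q \<Longrightarrow> ev (f t) \<zeta> = mon (snd t) \<zeta> * c"
  shows "ev (concat (map (\<lambda>t. pscale (fst t) (f t)) Q)) \<zeta> = ev Q \<zeta> * c"
  using assms by (induction Q) (auto simp: algebra_simps)

text \<open>Replacing \<open>M\<close> copies of a variable \<open>i\<close> by \<open>r i\<close>
  strictly lowers \<open>zdeg\<close>, since the terms of \<open>r i\<close> have
  \<open>zdeg\<close> below \<open>M\<close>. Each replacement costs at most a factor
  \<open>B\<close> in norm, hence the exponent \<open>zdeg n m\<close>.\<close>

lemma reduce_monomial:
  assumes r: "\<And>i. i < n \<Longrightarrow> vars_in V (r i)" "\<And>i t. i < n \<Longrightarrow> t \<in> set (r i) \<Longrightarrow> zdeg n (snd t) < M"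
    "\<And>i. i < n \<Longrightarrow> pnorm (r i) \<le> B" and B: "B \<ge> 1"
  shows "set m \<subseteq> V \<Longrightarrow> \<exists>R. vars_in V R \<and> reduced n M R \<and> pnorm R \<le> B ^ zdeg n m \<and>
    (\<forall>\<zeta>. (\<forall>i<n. \<zeta> i ^ M = ev (r i) \<zeta>) \<longrightarrow> ev R \<zeta> = mon m \<zeta>)"
proof (induction "zdeg n m" arbitrary: m rule: less_induct)
  case less
  show ?case
  proof (cases "\<forall>i<n. count_list m i < M")
    case True
    then show ?thesis using less.prems B by (intro exI[of _ "[(1, m)]"]) (auto simp: reduced_def)
  next
    case False
    then obtain i where i: "i < n" "count_list m i \<ge> M" by auto
    define m' where "m' = filter (\<lambda>j. j \<noteq> i) m @ replicate (count_list m i - M) i"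
    have zm: "zdeg n m = M + zdeg n m'"
      using zdeg_split[OF i(1), of m] i by (simp add: m'_def) (simp add: zdeg_def)
    have mm: "mon m \<zeta> = \<zeta> i ^ M * mon m' \<zeta>" for \<zeta>
    proof -
      have "mon m \<zeta> = \<zeta> i ^ (M + (count_list m i - M)) * mon (filter (\<lambda>j. j \<noteq> i) m) \<zeta>"
        using i by (subst mon_split_var[of _ _ i]) simp
      then show ?thesis by (simp add: m'_def power_add)
    qed
    have "i \<in> set m" if "count_list m i - M \<noteq> 0"
      using that count_list_0_iff[of m i] by (cases "i \<in> set m") auto
    then have sm': "set m' \<subseteq> V" using less.prems by (auto simp: m'_def set_replicate_conv_if)
    have "\<forall>t\<in>set (r i). \<exists>R. vars_in V R \<and> reduced n M R \<and> pnorm R \<le> B ^ (zdeg n m - 1) \<and>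
        (\<forall>\<zeta>. (\<forall>i<n. \<zeta> i ^ M = ev (r i) \<zeta>) \<longrightarrow> ev R \<zeta> = mon (snd t) \<zeta> * mon m' \<zeta>)"
    proof
      fix t assume t: "t \<in> set (r i)"
      have z: "zdeg n (snd t @ m') < zdeg n m" using r(2)[OF i(1) t] zm by simp
      have "set (snd t @ m') \<subseteq> V" using r(1)[OF i(1)] t sm' by (auto simp: vars_in_def)
      from less.hyps[OF z this] obtain R where R: "vars_in V R" "reduced n M R"
        "pnorm R \<le> B ^ zdeg n (snd t @ m')"
        "\<forall>\<zeta>. (\<forall>i<n. \<zeta> i ^ M = ev (r i) \<zeta>) \<longrightarrow> ev R \<zeta> = mon (snd t @ m') \<zeta>" by blast
      have "B ^ zdeg n (snd t @ m') \<le> B ^ (zdeg n m - 1)" using z B by (intro power_increasing) auto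
      with R show "\<exists>R. vars_in V R \<and> reduced n M R \<and> pnorm R \<le> B ^ (zdeg n m - 1) \<and>
        (\<forall>\<zeta>. (\<forall>i<n. \<zeta> i ^ M = ev (r i) \<zeta>) \<longrightarrow> ev R \<zeta> = mon (snd t) \<zeta> * mon m' \<zeta>)"
        by (intro exI[of _ R]) auto
    qed
    then obtain F where F: "\<And>t. t \<in> set (r i) \<Longrightarrow> vars_in V (F t) \<and> reduced n M (F t) \<and>
        pnorm (F t) \<le> B ^ (zdeg n m - 1) \<and>
        (\<forall>\<zeta>. (\<forall>i<n. \<zeta> i ^ M = ev (r i) \<zeta>) \<longrightarrow> ev (F t) \<zeta> = mon (snd t) \<zeta> * mon m' \<zeta>)"
      by metis
    define R where "R = concat (map (\<lambda>t. pscale (fst t) (F t)) (r i))"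
    have "vars_in V R" using F by (auto simp: R_def vars_in_concat)
    moreover have "reduced n M R" using F by (fastforce simp: R_def reduced_def pscale_set)
    moreover have "pnorm R \<le> B ^ zdeg n m"
    proof (cases "r i = []")
      case True
      then show ?thesis by (simp add: R_def)
    next
      case False
      then obtain t where "t \<in> set (r i)" by (meson last_in_set)
      then have "M > 0" using r(2)[OF i(1)] by (metis gr0I less_nat_zero_code)
      have "pnorm R \<le> pnorm (r i) * B ^ (zdeg n m - 1)"
        unfolding R_def by (rule combine_norm) (use F in auto)
      also have "\<dots> \<le> B * B ^ (zdeg n m - 1)" by (intro mult_le_mono r(3) i) auto
      also have "\<dots> = B ^ zdeg n m" using zm \<open>M > 0\<close> by (metis Suc_diff_1 add_gr_0 power_Suc)
      finally show ?thesis .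
    qed
    moreover have "ev R \<zeta> = mon m \<zeta>" if "\<forall>i<n. \<zeta> i ^ M = ev (r i) \<zeta>" for \<zeta>
    proof -
      have "ev R \<zeta> = ev (r i) \<zeta> * mon m' \<zeta>"
        unfolding R_def by (rule combine_ev) (use F that in auto)
      then show ?thesis using that i mm by simp
    qed
    ultimately show ?thesis by blast
  qed
qed

text \<open>Exponent vectors with entries below \<open>M\<close> are numbered by their base-\<open>M\<close> digits; the variables
  \<open>n\<close> and \<open>n + 1\<close> are parameters and become \<open>0\<close> and \<open>1\<close> in the coefficients.\<close>

lemma reduced_expansion:
  assumes R: "vars_in {..<n + 2} R" "reduced n M R"
  obtains C where "\<And>\<beta>. vars_in {0, 1} (C \<beta>)" "\<And>\<beta>. pnorm (C \<beta>) \<le> pnorm R"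
    "\<And>\<zeta> \<eta>. \<eta> 0 = \<zeta> n \<Longrightarrow> \<eta> 1 = \<zeta> (n + 1) \<Longrightarrow>
      ev R \<zeta> = (\<Sum>\<beta><M ^ n. ev (C \<beta>) \<eta> * (\<Prod>i<n. \<zeta> i ^ (\<beta> div M ^ i mod M)))"
proof -
  have "\<exists>\<beta><M ^ n. \<forall>i<n. \<beta> div M ^ i mod M = count_list (snd t) i" if "t \<in> set R" for t
    using R that by (intro digits_exist) (auto simp: reduced_def)
  then obtain co where co: "\<And>t. t \<in> set R \<Longrightarrow> co t < M ^ n"
     "\<And>t i. t \<in> set R \<Longrightarrow> i < n \<Longrightarrow> co t div M ^ i mod M = count_list (snd t) i" by metis
  define ek where "ek m = replicate (count_list m n) (0::nat) @ replicate (count_list m (n + 1)) 1" for m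
  define C where "C P \<beta> = map (\<lambda>t. (fst t, ek (snd t))) (filter (\<lambda>t. co t = \<beta>) P)" for P \<beta>
  have "vars_in {0, 1} (C R \<beta>)" for \<beta> by (auto simp: C_def ek_def vars_in_def)
  moreover have "pnorm (C P \<beta>) \<le> pnorm P" for P \<beta> by (induction P) (auto simp: C_def)
  moreover have "ev P \<zeta> = (\<Sum>\<beta><M ^ n. ev (C P \<beta>) \<eta> * (\<Prod>i<n. \<zeta> i ^ (\<beta> div M ^ i mod M)))"
    if "\<eta> 0 = \<zeta> n" "\<eta> 1 = \<zeta> (n + 1)" "set P \<subseteq> set R" for \<zeta> \<eta> P
    using that(3)
  proof (induction P)
    case (Cons t P)
    then have t: "t \<in> set R" by auto
    let ?v = "\<lambda>\<beta>. \<Prod>i<n. \<zeta> i ^ (\<beta> div M ^ i mod M)"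
    have m: "mon (snd t) \<zeta> = mon (ek (snd t)) \<eta> * ?v (co t)"
    proof -
      have "mon (snd t) \<zeta> = (\<Prod>i<n + 2. \<zeta> i ^ count_list (snd t) i)"
        using R t by (intro mon_counts) (auto simp: vars_in_def)
      also have "\<dots> = (\<Prod>i<n. \<zeta> i ^ count_list (snd t) i) * \<zeta> n ^ count_list (snd t) n * \<zeta> (n + 1) ^ count_list (snd t) (n + 1)"
        by (simp add: numeral_2_eq_2)
      also have "(\<Prod>i<n. \<zeta> i ^ count_list (snd t) i) = ?v (co t)" using co(2)[OF t] by simp
      finally show ?thesis using that(1,2) by (simp add: ek_def)
    qed
    have "(\<Sum>\<beta><M ^ n. ev (C (t # P) \<beta>) \<eta> * ?v \<beta>) =
      (\<Sum>\<beta><M ^ n. (if \<beta> = co t then real_of_int (fst t) * mon (ek (snd t)) \<eta> * ?v \<beta> else 0) + ev (C P \<beta>) \<eta> * ?v \<beta>)"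
      by (intro sum.cong) (auto simp: C_def algebra_simps)
    also have "\<dots> = real_of_int (fst t) * mon (snd t) \<zeta> + ev P \<zeta>"
      using Cons co(1)[OF t] by (simp add: sum.distrib m)
    finally show ?case by simp
  qed (simp add: C_def)
  ultimately show ?thesis using that[of "C R"] by blast
qed

text \<open>A bound for the coefficients of the determinant in \<open>value_polynomial\<close>: \<open>(2 * E + 1) ^ n\<close> is the
  number of reduced monomials, and the power of \<open>2 * E * H + 1\<close> bounds the growth under reduction.\<close>

definition gapb :: "nat \<Rightarrow> nat \<Rightarrow> nat \<Rightarrow> nat" where
  "gapb n E H = fact ((2 * E + 1) ^ n) *
     (2 * E + 2 + (2 * (2 * E + 2) * H + n) * (2 * E * H + 1) ^ (2 * E + 2 + n * (2 * E + 1))) ^ ((2 * E + 1) ^ n)"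

section \<open>Penalised coercive minimisation\<close>

locale penalty =
  fixes n E H :: nat and p h :: ipoly
  assumes vars: "vars_in {..<n} p" "vars_in {..<n} h"
    and deg: "deg_le E p" "deg_le E h"
    and norm: "pnorm p \<le> H" "pnorm h \<le> H"
    and nonneg: "\<And>z. 0 \<le> ev p z"
begin

text \<open>\<open>k\<close> weights the constraint \<open>p = 0\<close>; the even power makes the function coercive, and its exponent
  exceeds the degrees of \<open>p\<close> and \<open>h\<close>, so that the equations for a critical point express
  \<open>z i ^ (2 * E + 1)\<close> by lower terms. Letting first \<open>k\<close> and then \<open>e\<close> tend to infinity yields the
  infimum of \<open>h\<close> on \<open>p = 0\<close>.\<close>

definition \<Psi> :: "real \<Rightarrow> real \<Rightarrow> (nat \<Rightarrow> real) \<Rightarrow> real" where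
  "\<Psi> e k z = k * ev p z + ev h z + (1 / (e * (2 * E + 2))) * (\<Sum>i<n. z i ^ (2 * E + 2))"

text \<open>At a coordinate of largest absolute value \<open>W > 1\<close> the even power
  contributes at least \<open>c * W ^ (2 * E + 2)\<close>, whereas \<bar>h\<bar> is at most
  \<open>H * W ^ E\<close>. The bound does not mention \<open>p\<close>, so it holds for all penalty
  weights at once.\<close>

lemma coercive:
  fixes c C :: real
  assumes c: "c > 0" and le: "ev h z + c * (\<Sum>i<n. z i ^ (2 * E + 2)) \<le> C" and i: "i < n"
  shows "\<bar>z i\<bar> \<le> 1 + (H + \<bar>C\<bar>) / c"
proof (rule ccontr)
  assume neg: "\<not> ?thesis"
  define W where "W = Max ((\<lambda>j. \<bar>z j\<bar>) ` {..<n})"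
  have ne: "(\<lambda>j. \<bar>z j\<bar>) ` {..<n} \<noteq> {}" using i by auto
  have "W \<in> (\<lambda>j. \<bar>z j\<bar>) ` {..<n}" unfolding W_def by (rule Max_in) (use i in auto)
  then obtain j where j: "j < n" "W = \<bar>z j\<bar>" by auto
  have Wge: "\<bar>z k\<bar> \<le> W" if "k < n" for k unfolding W_def using that by (intro Max_ge) auto
  have W: "W > 1 + (H + \<bar>C\<bar>) / c" using Wge[OF i] neg by linarith
  moreover have "(H + \<bar>C\<bar>) / c \<ge> 0" using c by (auto intro!: divide_nonneg_pos add_nonneg_nonneg)
  ultimately have W1: "W > 1" by linarith
  have cW: "c * W > H + \<bar>C\<bar>"
  proof -
    have "(H + \<bar>C\<bar>) / c < W" using W by linarith
    then show ?thesis using c by (simp add: divide_less_eq mult.commute)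
  qed
  have "W ^ (2 * E + 2) = z j ^ (2 * E + 2)"
    by (simp only: j(2)) (rule power_even_abs, simp)
  also have "\<dots> \<le> (\<Sum>i<n. z i ^ (2 * E + 2))"
    using j by (intro member_le_sum) (auto intro!: zero_le_even_power simp del: power_Suc power_add_numeral2)
  finally have s: "c * W ^ (2 * E + 2) \<le> c * (\<Sum>i<n. z i ^ (2 * E + 2))" using c by simp
  have "\<bar>ev h z\<bar> \<le> real (pnorm h) * W ^ E"
    using vars(2) Wge W1 deg(2) by (intro abs_ev_le) auto
  also have "\<dots> \<le> H * W ^ E" using norm W1 by (intro mult_right_mono) auto
  finally have "c * W ^ (2 * E + 2) \<le> C + H * W ^ E" using le s by linarith
  also have "\<dots> \<le> (H + \<bar>C\<bar>) * W ^ E"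
  proof -
    have "C \<le> \<bar>C\<bar> * 1" by simp
    also have "\<dots> \<le> \<bar>C\<bar> * W ^ E" using W1 by (intro mult_left_mono one_le_power) auto
    finally show ?thesis by (simp add: algebra_simps)
  qed
  also have "\<dots> < c * W * W ^ E" using cW W1 by (intro mult_strict_right_mono) auto
  also have "\<dots> = c * W ^ (E + 1)" by simp
  also have "\<dots> \<le> c * W ^ (2 * E + 2)" using W1 c by (intro mult_left_mono power_increasing) auto
  finally show False by simp
qed

lemma continuous_on_powsum: "continuous_on S (\<lambda>z::nat \<Rightarrow> real. \<Sum>i<n. z i ^ k)"
  by (intro continuous_on_sum continuous_on_power continuous_on_subset[OF continuous_on_product_coordinates]) auto

lemma minimizer_exists:
  assumes e: "e > 0" and k: "k \<ge> 0"
  obtains z where "\<forall>i\<ge>n. z i = 0" "\<And>z'. \<Psi> e k z \<le> \<Psi> e k z'"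
proof -
  define C where "C = \<Psi> e k (\<lambda>_. 0)"
  define R where "R = 1 + (H + \<bar>C\<bar>) / (1 / (e * (2 * E + 2)))"
  have c: "1 / (e * (2 * E + 2)) > 0" using e by (auto intro!: divide_pos_pos mult_pos_pos)
  have "continuous_on (cbx n R) (\<Psi> e k)"
    unfolding \<Psi>_def by (intro continuous_intros continuous_on_powsum)
  moreover have "R \<ge> 0" unfolding R_def using c by (intro add_nonneg_nonneg divide_nonneg_pos) auto
  then have z0: "(\<lambda>_. 0) \<in> cbx n R" by (auto simp: cbx_def)
  ultimately obtain z where z: "z \<in> cbx n R" "\<And>z'. z' \<in> cbx n R \<Longrightarrow> \<Psi> e k z \<le> \<Psi> e k z'"
    using continuous_attains_inf[OF compact_cbx, of n R "\<Psi> e k"] by blast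
  show ?thesis
  proof (rule that)
    show "\<forall>i\<ge>n. z i = 0" using z by (auto simp: cbx_def)
    fix z'
    show "\<Psi> e k z \<le> \<Psi> e k z'"
    \<comment> \<open>Points whose value exceeds that at the origin lose to the origin, which lies
      in the box; all others lie in the box by coercivity.\<close>
    proof (cases "\<Psi> e k z' \<le> C")
      case True
      define y where "y i = (if i < n then z' i else 0)" for i
      have same: "\<Psi> e k y = \<Psi> e k z'"
        using ev_cong[OF vars(1), of y z'] ev_cong[OF vars(2), of y z'] by (simp add: \<Psi>_def y_def)
      have "0 \<le> k * ev p z'" using nonneg k by simp
      then have "ev h z' + 1 / (e * (2 * E + 2)) * (\<Sum>i<n. z' i ^ (2 * E + 2)) \<le> C"
        using True by (simp add: \<Psi>_def)
      then have "\<bar>z' i\<bar> \<le> R" if "i < n" for i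
        unfolding R_def by (rule coercive[OF c _ that])
      then have "y \<in> cbx n R" by (auto simp: cbx_def y_def)
      then show ?thesis using z(2) same by metis
    next
      case False
      with z(2)[OF z0] show ?thesis by (simp add: C_def)
    qed
  qed
qed

text \<open>The \<open>i\<close>-th partial derivative vanishes at a minimum; the factor
  \<open>1 / (e * (2 * E + 2))\<close> in \<open>\<Psi>\<close> cancels the exponent and leaves
  \<open>z i ^ (2 * E + 1) / e\<close>.\<close>

lemma minimizer_critical:
  assumes e: "e > 0" and min: "\<And>z'. \<Psi> e k z \<le> \<Psi> e k z'" and i: "i < n"
  shows "z i ^ (2 * E + 1) = - e * (k * ev (pder i p) z + ev (pder i h) z)"
proof -
  define c where "c = 1 / (e * (2 * E + 2))"
  define g where "g t = \<Psi> e k (z(i := t))" for t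
  have g: "g t = k * ev p (z(i := t)) + ev h (z(i := t)) + c * (t ^ (2 * E + 2) + (\<Sum>j\<in>{..<n} - {i}. z j ^ (2 * E + 2)))" for t
  proof -
    have "(\<Sum>j<n. (z(i := t)) j ^ (2 * E + 2)) = t ^ (2 * E + 2) + (\<Sum>j\<in>{..<n} - {i}. (z(i := t)) j ^ (2 * E + 2))"
      using i by (subst sum.remove[of _ i]) auto
    also have "(\<Sum>j\<in>{..<n} - {i}. (z(i := t)) j ^ (2 * E + 2)) = (\<Sum>j\<in>{..<n} - {i}. z j ^ (2 * E + 2))"
      by (intro sum.cong) auto
    finally show ?thesis by (simp add: g_def \<Psi>_def c_def)
  qed
  have pw: "((\<lambda>t. t ^ (2 * E + 2)) has_real_derivative (2 * E + 2) * x ^ (2 * E + 1)) (at x)" for x :: real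
    by (rule derivative_eq_intros refl)+ simp
  have "(g has_real_derivative k * ev (pder i p) (z(i := z i)) + ev (pder i h) (z(i := z i)) + c * ((2 * E + 2) * z i ^ (2 * E + 1) + 0)) (at (z i))"
    unfolding g[abs_def]
    by (intro DERIV_add DERIV_cmult DERIV_ev DERIV_const pw)
  then have d: "(g has_real_derivative k * ev (pder i p) z + ev (pder i h) z + c * ((2 * E + 2) * z i ^ (2 * E + 1))) (at (z i))"
    by simp
  have "k * ev (pder i p) z + ev (pder i h) z + c * ((2 * E + 2) * z i ^ (2 * E + 1)) = 0"
    by (rule DERIV_local_min[OF d, of 1]) (simp_all add: g_def min)
  moreover have "c * ((2 * E + 2) * z i ^ (2 * E + 1)) = z i ^ (2 * E + 1) / e"
  proof -
    have "1 / (e * d) * (d * y) = y / e" if "d > 0" for d y :: real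
      using that e by (simp add: field_simps)
    then show ?thesis unfolding c_def by simp
  qed
  moreover have "Z = - e * A" if "A + Z / e = 0" for A Z
    using that e by (simp add: field_simps eq_neg_iff_add_eq_0)
  ultimately show ?thesis by metis
qed

text \<open>Modulo the critical-point equations every polynomial reduces to a combination of the
  monomials with exponents below \<open>2 * E + 1\<close>. Multiplication by
  \<open>D * e * \<Psi> e k z\<close> acts on these by a matrix with entries in Z[e, k]. At a
  minimiser the vector of monomials is an eigenvector, so the minimum is a root of a determinant of
  controlled norm.\<close>

lemma value_polynomial:
  obtains Q where "vars_in {0, 1, 2} Q" "pnorm Q \<le> gapb n E H" "\<exists>\<zeta>. ev Q \<zeta> \<noteq> 0"
    "\<And>e k z \<eta>. e > 0 \<Longrightarrow> (\<And>z'. \<Psi> e k z \<le> \<Psi> e k z') \<Longrightarrow> \<eta> 0 = e \<Longrightarrow> \<eta> 1 = k \<Longrightarrow> \<eta> 2 = \<Psi> e k z \<Longrightarrow> ev Q \<eta> = 0"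
proof -
  define M D N B where "M = 2 * E + 1" and "D = 2 * E + 2" and "N = M ^ n" and "B = 2 * E * H + 1"
  define V where "V = {..<n + 2}"
  \<comment> \<open>The right-hand sides of the critical-point equations, with \<open>e\<close> as
    variable \<open>n\<close> and \<open>k\<close> as variable \<open>n + 1\<close>.\<close>
  define r where "r i = pscale (-1) (pmul [(1, [n])] (pmul [(1, [n + 1])] (pder i p) @ pder i h))" for i
  \<comment> \<open>\<open>T\<close> is \<open>D * e * \<Psi> e k z\<close>, the value with its
    denominator cleared.\<close>
  define T where "T = pscale (int D) (pmul [(1, [n])] (pmul [(1, [n + 1])] p @ h)) @ concat (map (\<lambda>i. [(1, replicate D i)]) [0..<n])"
  have vV: "vars_in V q" if "vars_in {..<n} q" for q using that by (rule vars_in_mono) (auto simp: V_def)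
  have nV: "n \<in> V" "n + 1 \<in> V" by (auto simp: V_def)
  have r1: "vars_in V (r i)" if "i < n" for i
    unfolding r_def using nV vV[OF pder_props(3)[OF deg(1) vars(1)]] vV[OF pder_props(3)[OF deg(2) vars(2)]]
    by simp
  have zd: "zdeg n (snd t) < M" if "i < n" "t \<in> set (r i)" for t i
  proof -
    from that(2) obtain s where s: "s \<in> set (pder i p) \<or> s \<in> set (pder i h)" "zdeg n (snd t) = zdeg n (snd s)"
      by (auto simp: r_def pscale_set pmul_def zdeg_def) blast+
    then have "length (snd s) < E" using pder_props(2)[OF deg(1)] pder_props(2)[OF deg(2)] by blast
    with s(2) zdeg_le_length[of n "snd s"] show ?thesis by (simp add: M_def)
  qed
  have rn: "pnorm (r i) \<le> B" for i
  proof -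
    have "pnorm (r i) = pnorm (pder i p) + pnorm (pder i h)" by (simp add: r_def)
    also have "\<dots> \<le> E * pnorm p + E * pnorm h" by (intro add_mono pder_props deg)
    also have "\<dots> \<le> E * H + E * H" using norm by (intro add_mono mult_le_mono) auto
    finally show ?thesis by (simp add: B_def)
  qed
  have T1: "vars_in V T"
  proof -
    have "vars_in V (concat (map (\<lambda>i. [(1, replicate D i)]) [0..<n]))"
      by (auto simp: vars_in_def V_def)
    then show ?thesis unfolding T_def using nV vV[OF vars(1)] vV[OF vars(2)] by simp
  qed
  have Tn: "pnorm T \<le> 2 * D * H + n"
  proof -
    have "pnorm (concat (map (\<lambda>i. [(1, replicate D i)]) is)) = length is" for "is" by (induction "is") auto
    then have "pnorm T = D * (pnorm p + pnorm h) + n" by (simp add: T_def)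
    also have "\<dots> \<le> D * (H + H) + n" using norm by (intro add_mono mult_le_mono) auto
    finally show ?thesis by (simp add: algebra_simps)
  qed
  have Tz: "zdeg n (snd t) \<le> D" if "t \<in> set T" for t
  proof -
    from that consider s where "s \<in> set p \<or> s \<in> set h" "zdeg n (snd t) = zdeg n (snd s)"
      | i where "snd t = replicate D i"
      by (auto simp: T_def pscale_set pmul_def zdeg_def) blast+
    then show ?thesis
    proof cases
      case 1
      then have "length (snd s) \<le> E" using deg by (auto simp: deg_le_def)
      with 1 zdeg_le_length[of n "snd s"] show ?thesis by (simp add: D_def)
    next
      case 2
      then show ?thesis using zdeg_le_length[of n "snd t"] by simp
    qed
  qed
  define bm where "bm \<alpha> = concat (map (\<lambda>i. replicate (\<alpha> div M ^ i mod M) i) [0..<n])" for \<alpha>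
  have bmm: "mon (bm \<alpha>) \<zeta> = (\<Prod>i<n. \<zeta> i ^ (\<alpha> div M ^ i mod M))" for \<alpha> \<zeta>
  proof -
    have "mon (concat (map (\<lambda>i. replicate (f i) i) [0..<k])) \<zeta> = (\<Prod>i<k. \<zeta> i ^ f i)" for f k
      by (induction k) auto
    then show ?thesis by (simp add: bm_def)
  qed
  have bmz: "zdeg n (bm \<alpha>) \<le> n * M" for \<alpha>
  proof -
    have "length (concat (map (\<lambda>i. replicate (\<alpha> div M ^ i mod M) i) [0..<k])) \<le> k * M" for k
    proof (induction k)
      case (Suc k)
      have "\<alpha> div M ^ k mod M \<le> M" by (simp add: M_def less_imp_le)
      with Suc show ?case by simp
    qed simp
    then show ?thesis using zdeg_le_length le_trans unfolding bm_def by blast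
  qed
  have bmV: "set (bm \<alpha>) \<subseteq> V" for \<alpha> by (auto simp: bm_def V_def)
  define ok where "ok \<zeta> \<longleftrightarrow> (\<forall>i<n. \<zeta> i ^ M = ev (r i) \<zeta>)" for \<zeta>
  define K where "K = B ^ (D + n * M)"
  have red: "\<exists>R. vars_in V R \<and> reduced n M R \<and> pnorm R \<le> K \<and> (\<forall>\<zeta>. ok \<zeta> \<longrightarrow> ev R \<zeta> = mon (snd t) \<zeta> * mon (bm \<alpha>) \<zeta>)"
    if t: "t \<in> set T" for t \<alpha>
  proof -
    have s: "set (snd t @ bm \<alpha>) \<subseteq> V" using T1 t bmV by (auto simp: vars_in_def)
    have "B \<ge> 1" by (simp add: B_def)
    have "\<exists>R. vars_in V R \<and> reduced n M R \<and> pnorm R \<le> B ^ zdeg n (snd t @ bm \<alpha>) \<and>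
      (\<forall>\<zeta>. ok \<zeta> \<longrightarrow> ev R \<zeta> = mon (snd t @ bm \<alpha>) \<zeta>)"
      unfolding ok_def by (rule reduce_monomial[of n V r M B]) (use r1 zd rn s \<open>B \<ge> 1\<close> in blast)+
    then obtain R where R: "vars_in V R" "reduced n M R" "pnorm R \<le> B ^ zdeg n (snd t @ bm \<alpha>)"
      "\<forall>\<zeta>. ok \<zeta> \<longrightarrow> ev R \<zeta> = mon (snd t @ bm \<alpha>) \<zeta>" by blast
    have "B ^ zdeg n (snd t @ bm \<alpha>) \<le> K"
      unfolding K_def using Tz[OF t] bmz[of \<alpha>] by (intro power_increasing) (auto simp: B_def)
    with R show ?thesis by (intro exI[of _ R]) auto
  qed
  have "\<exists>R. vars_in V R \<and> reduced n M R \<and> pnorm R \<le> (2 * D * H + n) * K \<and> (\<forall>\<zeta>. ok \<zeta> \<longrightarrow> ev R \<zeta> = ev T \<zeta> * mon (bm \<alpha>) \<zeta>)" for \<alpha>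
  proof -
    obtain F where F: "\<And>t. t \<in> set T \<Longrightarrow> vars_in V (F t) \<and> reduced n M (F t) \<and> pnorm (F t) \<le> K \<and>
       (\<forall>\<zeta>. ok \<zeta> \<longrightarrow> ev (F t) \<zeta> = mon (snd t) \<zeta> * mon (bm \<alpha>) \<zeta>)"
      using red[of _ \<alpha>] by metis
    define R where "R = concat (map (\<lambda>t. pscale (fst t) (F t)) T)"
    have "vars_in V R" using F by (auto simp: R_def vars_in_concat)
    moreover have "reduced n M R" using F by (fastforce simp: R_def reduced_def pscale_set)
    moreover have "pnorm R \<le> pnorm T * K" unfolding R_def by (rule combine_norm) (use F in auto)
    then have "pnorm R \<le> (2 * D * H + n) * K" using Tn by (meson le_trans mult_le_mono1)
    moreover have "\<forall>\<zeta>. ok \<zeta> \<longrightarrow> ev R \<zeta> = ev T \<zeta> * mon (bm \<alpha>) \<zeta>"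
      unfolding R_def using F by (auto intro!: combine_ev)
    ultimately show ?thesis by blast
  qed
  then obtain R where R: "\<And>\<alpha>. vars_in V (R \<alpha>)" "\<And>\<alpha>. reduced n M (R \<alpha>)"
    "\<And>\<alpha>. pnorm (R \<alpha>) \<le> (2 * D * H + n) * K" "\<And>\<alpha> \<zeta>. ok \<zeta> \<Longrightarrow> ev (R \<alpha>) \<zeta> = ev T \<zeta> * mon (bm \<alpha>) \<zeta>"
    by metis
  have "\<exists>C. (\<forall>\<beta>. vars_in {0, 1} (C \<beta>)) \<and> (\<forall>\<beta>. pnorm (C \<beta>) \<le> (2 * D * H + n) * K) \<and>
     (\<forall>\<zeta> \<eta>. \<eta> 0 = \<zeta> n \<longrightarrow> \<eta> 1 = \<zeta> (n + 1) \<longrightarrow> ev (R \<alpha>) \<zeta> = (\<Sum>\<beta><N. ev (C \<beta>) \<eta> * mon (bm \<beta>) \<zeta>))" for \<alpha>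
  proof -
    obtain C where "\<And>\<beta>. vars_in {0, 1} (C \<beta>)" "\<And>\<beta>. pnorm (C \<beta>) \<le> pnorm (R \<alpha>)"
      "\<And>\<zeta> \<eta>. \<eta> 0 = \<zeta> n \<Longrightarrow> \<eta> 1 = \<zeta> (n + 1) \<Longrightarrow>
      ev (R \<alpha>) \<zeta> = (\<Sum>\<beta><M ^ n. ev (C \<beta>) \<eta> * (\<Prod>i<n. \<zeta> i ^ (\<beta> div M ^ i mod M)))"
      by (rule reduced_expansion[OF R(1)[of \<alpha>, unfolded V_def] R(2)[of \<alpha>]]) blast
    then show ?thesis using R(3)[of \<alpha>] unfolding bmm N_def by (intro exI[of _ C]) (auto intro: le_trans)
  qed
  then have "\<exists>C. \<forall>\<alpha>. (\<forall>\<beta>. vars_in {0, 1} (C \<alpha> \<beta>)) \<and> (\<forall>\<beta>. pnorm (C \<alpha> \<beta>) \<le> (2 * D * H + n) * K) \<and>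
     (\<forall>\<zeta> \<eta>. \<eta> 0 = \<zeta> n \<longrightarrow> \<eta> 1 = \<zeta> (n + 1) \<longrightarrow> ev (R \<alpha>) \<zeta> = (\<Sum>\<beta><N. ev (C \<alpha> \<beta>) \<eta> * mon (bm \<beta>) \<zeta>))"
    by (intro choice allI)
  then obtain C where C0: "\<forall>\<alpha>. (\<forall>\<beta>. vars_in {0, 1} (C \<alpha> \<beta>)) \<and> (\<forall>\<beta>. pnorm (C \<alpha> \<beta>) \<le> (2 * D * H + n) * K) \<and>
     (\<forall>\<zeta> \<eta>. \<eta> 0 = \<zeta> n \<longrightarrow> \<eta> 1 = \<zeta> (n + 1) \<longrightarrow> ev (R \<alpha>) \<zeta> = (\<Sum>\<beta><N. ev (C \<alpha> \<beta>) \<eta> * mon (bm \<beta>) \<zeta>))"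
    by (elim exE)
  have C: "\<And>\<alpha> \<beta>. vars_in {0, 1} (C \<alpha> \<beta>)" "\<And>\<alpha> \<beta>. pnorm (C \<alpha> \<beta>) \<le> (2 * D * H + n) * K"
     "\<And>\<alpha> \<zeta> \<eta>. \<eta> 0 = \<zeta> n \<Longrightarrow> \<eta> 1 = \<zeta> (n + 1) \<Longrightarrow> ev (R \<alpha>) \<zeta> = (\<Sum>\<beta><N. ev (C \<alpha> \<beta>) \<eta> * mon (bm \<beta>) \<zeta>)"
    using C0 by simp_all
  \<comment> \<open>The characteristic matrix: \<open>\<eta> 0\<close> stands for \<open>e\<close>
    and \<open>\<eta> 2\<close> for the value, so the diagonal carries the eigenvalue
    \<open>D * e * \<Psi> e k z\<close>.\<close>
  define A where "A \<alpha> \<beta> \<eta> = (if \<alpha> = \<beta> then D * \<eta> 0 * \<eta> 2 else 0) + (- ev (C \<alpha> \<beta>) \<eta>)" for \<alpha> \<beta> and \<eta> :: "nat \<Rightarrow> real"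
  have "ipf {0, 1, 2} (D + (2 * D * H + n) * K) (A \<alpha> \<beta>)" for \<alpha> \<beta>
    unfolding A_def
  proof (intro ipf_add ipf_minus)
    show "ipf {0, 1, 2} ((2 * D * H + n) * K) (ev (C \<alpha> \<beta>))"
      using C(2) by (intro ipf_ev vars_in_mono[OF C(1)]) auto
    show "ipf {0, 1, 2} D (\<lambda>z. if \<alpha> = \<beta> then D * z 0 * z 2 else 0)"
      unfolding ipf_def
      by (rule exI[of _ "if \<alpha> = \<beta> then [(int D, [0, 2])] else []"]) auto
  qed
  then have "ipf {0, 1, 2} (fact N * (D + (2 * D * H + n) * K) ^ N) (\<lambda>\<eta>. det (mat N N (\<lambda>(i, j). A i j \<eta>)))"
    by (intro ipf_det)
  then obtain Q where Q: "vars_in {0, 1, 2} Q" "pnorm Q \<le> fact N * (D + (2 * D * H + n) * K) ^ N"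
    "\<And>\<eta>. det (mat N N (\<lambda>(i, j). A i j \<eta>)) = ev Q \<eta>" by (auto simp: ipf_def)
  have Npos: "N > 0" by (simp add: N_def M_def)
  show ?thesis
  proof (rule that[OF Q(1)])
    show "pnorm Q \<le> gapb n E H"
      using Q(2) by (simp add: gapb_def N_def M_def D_def K_def B_def)
    show "\<exists>\<zeta>. ev Q \<zeta> \<noteq> 0"
    proof (rule ccontr)
      assume neg: "\<not> ?thesis"
      \<comment> \<open>At \<open>e = 1\<close>, \<open>k = 0\<close> the matrix \<open>C\<close> is
        constant. Taking the value \<open>S + 1\<close>, with \<open>S\<close> the sum of the
        absolute values of its entries, makes the diagonal dominate; so there is no kernel vector
        and \<open>Q\<close> is not identically zero.\<close>
      define \<eta>0 where "\<eta>0 = (\<lambda>i::nat. if i = 0 then 1 else 0 :: real)"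
      define S where "S = (\<Sum>\<alpha><N. \<Sum>\<beta><N. \<bar>ev (C \<alpha> \<beta>) \<eta>0\<bar>)"
      define \<eta> where "\<eta> = \<eta>0(2 := S + 1)"
      have same: "ev (C \<alpha> \<beta>) \<eta> = ev (C \<alpha> \<beta>) \<eta>0" for \<alpha> \<beta>
        by (rule ev_cong[OF C(1)]) (auto simp: \<eta>_def \<eta>0_def)
      have "det (mat N N (\<lambda>(i, j). A i j \<eta>)) = 0" using Q(3) neg by simp
      then obtain v where v: "v \<in> carrier_vec N" "v \<noteq> 0\<^sub>v N" "mat N N (\<lambda>(i, j). A i j \<eta>) *\<^sub>v v = 0\<^sub>v N"
        using det_0_iff_vec_prod_zero_field[of "mat N N (\<lambda>(i, j). A i j \<eta>)" N] by auto
      define W where "W = Max ((\<lambda>j. \<bar>v $ j\<bar>) ` {..<N})"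
      have "W \<in> (\<lambda>j. \<bar>v $ j\<bar>) ` {..<N}" unfolding W_def by (rule Max_in) (use Npos in auto)
      then obtain i where i: "i < N" "W = \<bar>v $ i\<bar>" by auto
      have Wge: "\<bar>v $ k\<bar> \<le> W" if "k < N" for k unfolding W_def using that by (intro Max_ge) auto
      have "W > 0"
      proof (rule ccontr)
        assume "\<not> W > 0"
        then have "v $ k = 0" if "k < N" for k using Wge[OF that] by simp
        then have "v = 0\<^sub>v N" using v(1) by (intro eq_vecI) auto
        with v(2) show False by simp
      qed
      have "(mat N N (\<lambda>(i, j). A i j \<eta>) *\<^sub>v v) $ i = (\<Sum>j<N. A i j \<eta> * v $ j)"
        using i v(1) by (auto simp: scalar_prod_def atLeast0LessThan intro!: sum.cong)
      then have "0 = (\<Sum>j<N. A i j \<eta> * v $ j)" using v(3) i by simp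
      also have "\<dots> = (\<Sum>j<N. (if j = i then D * (S + 1) * v $ j else 0) + (- ev (C i j) \<eta>0 * v $ j))"
        by (intro sum.cong) (auto simp: A_def same, auto simp: \<eta>_def \<eta>0_def algebra_simps)
      also have "\<dots> = D * (S + 1) * v $ i - (\<Sum>j<N. ev (C i j) \<eta>0 * v $ j)"
        using i by (simp add: sum_subtractf)
      finally have "\<bar>D * (S + 1) * v $ i\<bar> = \<bar>\<Sum>j<N. ev (C i j) \<eta>0 * v $ j\<bar>" by simp
      also have "\<dots> \<le> (\<Sum>j<N. \<bar>ev (C i j) \<eta>0\<bar> * W)"
        by (rule order_trans[OF sum_abs], rule sum_mono) (auto simp: abs_mult intro!: mult_left_mono Wge)
      also have "\<dots> = (\<Sum>j<N. \<bar>ev (C i j) \<eta>0\<bar>) * W" by (simp add: sum_distrib_right)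
      also have "\<dots> \<le> S * W"
        unfolding S_def using \<open>W > 0\<close> i
        by (intro mult_right_mono member_le_sum[of i "{..<N}" "\<lambda>\<alpha>. \<Sum>\<beta><N. \<bar>ev (C \<alpha> \<beta>) \<eta>0\<bar>"]) (auto intro: sum_nonneg)
      finally have *: "\<bar>D * (S + 1) * v $ i\<bar> \<le> S * W" .
      have S0: "S \<ge> 0" by (auto simp: S_def intro!: sum_nonneg)
      have "(S + 1) * W \<le> D * (S + 1) * W"
        using S0 \<open>W > 0\<close> by (intro mult_right_mono) (auto simp: D_def)
      also have "\<dots> = \<bar>D * (S + 1) * v $ i\<bar>" using i S0 by (simp add: abs_mult)
      finally have "(S + 1) * W \<le> S * W" using * by simp
      with \<open>W > 0\<close> show False by simp
    qed
    fix e k z and \<eta> :: "nat \<Rightarrow> real"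
    assume e: "e > 0" and min: "\<And>z'. \<Psi> e k z \<le> \<Psi> e k z'" and \<eta>: "\<eta> 0 = e" "\<eta> 1 = k" "\<eta> 2 = \<Psi> e k z"
    define \<zeta> where "\<zeta> = z(n := e, n + 1 := k)"
    have \<zeta>q: "ev q \<zeta> = ev q z" if "vars_in {..<n} q" for q
      by (rule ev_cong[OF that]) (auto simp: \<zeta>_def)
    have rz: "ev (r i) \<zeta> = - e * (k * ev (pder i p) z + ev (pder i h) z)" for i
      unfolding r_def ev_pscale ev_pmul ev_append
      using \<zeta>q[OF pder_props(3)[OF deg(1) vars(1)]] \<zeta>q[OF pder_props(3)[OF deg(2) vars(2)]]
      by (simp add: \<zeta>_def)
    have okz: "ok \<zeta>"
      unfolding ok_def rz using minimizer_critical[OF e min] by (auto simp: M_def \<zeta>_def)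
    have "ev T \<zeta> = D * e * \<Psi> e k z"
    proof -
      have "ev (concat (map (\<lambda>i. [(1, replicate D i)]) [0..<j])) \<zeta> = (\<Sum>i<j. \<zeta> i ^ D)" for j
        by (induction j) auto
      then have "ev T \<zeta> = D * (e * (k * ev p z + ev h z)) + (\<Sum>i<n. \<zeta> i ^ D)"
        unfolding T_def ev_append ev_pscale ev_pmul using \<zeta>q[OF vars(1)] \<zeta>q[OF vars(2)] by (simp add: \<zeta>_def)
      also have "(\<Sum>i<n. \<zeta> i ^ D) = (\<Sum>i<n. z i ^ D)" by (simp add: \<zeta>_def)
      finally have T: "ev T \<zeta> = D * (e * (k * ev p z + ev h z)) + (\<Sum>i<n. z i ^ D)" .
      have "real D = 2 * E + 2" by (simp add: D_def)
      then have "\<Psi> e k z = k * ev p z + ev h z + (1 / (e * D)) * (\<Sum>i<n. z i ^ D)"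
        by (simp add: \<Psi>_def D_def)
      moreover have "real D * e \<noteq> 0" using e by (simp add: D_def)
      ultimately show ?thesis using T by (simp add: field_simps)
    qed
    then have eq: "D * e * \<Psi> e k z * mon (bm \<alpha>) \<zeta> = (\<Sum>\<beta><N. ev (C \<alpha> \<beta>) \<eta> * mon (bm \<beta>) \<zeta>)" for \<alpha>
      using R(4)[OF okz, of \<alpha>] C(3)[of \<eta> \<zeta> \<alpha>] \<eta> by (simp add: \<zeta>_def)
    define v where "v = vec N (\<lambda>\<beta>. mon (bm \<beta>) \<zeta>)"
    have "mat N N (\<lambda>(i, j). A i j \<eta>) *\<^sub>v v = 0\<^sub>v N"
    proof (rule eq_vecI)
      fix i assume "i < dim_vec (0\<^sub>v N)"
      then have i: "i < N" by simp
      have "(mat N N (\<lambda>(i, j). A i j \<eta>) *\<^sub>v v) $ i = (\<Sum>j<N. A i j \<eta> * mon (bm j) \<zeta>)"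
        using i by (auto simp: scalar_prod_def v_def atLeast0LessThan intro!: sum.cong)
      also have "\<dots> = (\<Sum>j<N. (if j = i then D * e * \<Psi> e k z * mon (bm j) \<zeta> else 0) + (- ev (C i j) \<eta> * mon (bm j) \<zeta>))"
        using \<eta> by (intro sum.cong) (auto simp: A_def algebra_simps)
      also have "\<dots> = 0" using i eq[of i] by (simp add: sum_subtractf)
      finally show "(mat N N (\<lambda>(i, j). A i j \<eta>) *\<^sub>v v) $ i = 0\<^sub>v N $ i" using i by simp
    qed simp
    \<comment> \<open>The number 0 encodes the zero exponent vector, whose monomial is the constant
      1.\<close>
    moreover have "v \<noteq> 0\<^sub>v N"
    proof
      assume "v = 0\<^sub>v N"
      then have "v $ 0 = 0" using Npos by simp
      then show False using Npos by (simp add: v_def bmm)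
    qed
    moreover have "v \<in> carrier_vec N" by (simp add: v_def)
    ultimately have "det (mat N N (\<lambda>(i, j). A i j \<eta>)) = 0"
      using det_0_iff_vec_prod_zero_field[of "mat N N (\<lambda>(i, j). A i j \<eta>)" N] by auto
    then show "ev Q \<eta> = 0" using Q(3) by simp
  qed
qed

text \<open>For the weights k = 0, 1, 2, ... the minimisers stay in one box, because
  \<open>p\<close> is nonnegative and the coercive bound ignores \<open>k\<close>. Their values are
  at most that at \<open>z0\<close>, so \<open>k * ev p\<close> stays bounded and a limit point
  satisfies \<open>p = 0\<close>.\<close>

lemma constrained_minimum:
  assumes e: "e > 0" and z0: "ev p z0 = 0"
  obtains \<tau> z ks ts where "filterlim ks at_top sequentially" "ts \<longlonglongrightarrow> \<tau>"
    "\<And>s::nat. \<exists>z. ts s = \<Psi> e (ks s) z \<and> (\<forall>z'. \<Psi> e (ks s) z \<le> \<Psi> e (ks s) z')"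
    "ev p z = 0" "\<tau> = \<Psi> e 0 z" "\<And>z'. ev p z' = 0 \<Longrightarrow> \<tau> \<le> \<Psi> e 0 z'"
proof -
  have "\<exists>z. (\<forall>i\<ge>n. z i = 0) \<and> (\<forall>z'. \<Psi> e (real s) z \<le> \<Psi> e (real s) z')" for s :: nat
    using minimizer_exists[OF e, of "real s"] by (metis of_nat_0_le_iff)
  then obtain Z where Z: "\<And>s i. i \<ge> n \<Longrightarrow> Z s i = 0" "\<And>s z'. \<Psi> e (real s) (Z s) \<le> \<Psi> e (real s) z'"
    by metis
  define c where "c = 1 / (e * (2 * E + 2))"
  have c: "c > 0" using e by (auto simp: c_def intro!: divide_pos_pos mult_pos_pos)
  have P0: "\<Psi> e k z = k * ev p z + \<Psi> e 0 z" for k z by (simp add: \<Psi>_def)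
  have P0': "\<Psi> e 0 z = ev h z + c * (\<Sum>i<n. z i ^ (2 * E + 2))" for z by (simp add: \<Psi>_def c_def)
  have up: "\<Psi> e (real s) (Z s) \<le> \<Psi> e 0 z'" if "ev p z' = 0" for s z'
    using Z(2)[of s z'] that by (simp add: P0[of "real s" z'])
  have lo: "\<Psi> e 0 (Z s) \<le> \<Psi> e (real s) (Z s)" for s
    using nonneg[of "Z s"] by (simp add: P0[of "real s"])
  define C where "C = \<Psi> e 0 z0"
  have "\<Psi> e 0 (Z s) \<le> C" for s using up[OF z0, of s] lo[of s] by (simp add: C_def)
  then have "\<bar>Z s i\<bar> \<le> 1 + (H + \<bar>C\<bar>) / c" if "i < n" for s i
    unfolding P0' by (rule coercive[OF c _ that])
  then have "Z s \<in> cbx n (1 + (H + \<bar>C\<bar>) / c)" for s using Z(1) by (auto simp: cbx_def)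
  then obtain r z where r: "strict_mono r" and z: "\<And>i. (\<lambda>s. Z (r s) i) \<longlonglongrightarrow> z i"
    using cbx_subsequence[of Z] by metis
  have evz: "(\<lambda>s. ev q (Z (r s))) \<longlonglongrightarrow> ev q z" for q
    by (rule tendsto_ev[of UNIV]) (auto intro: z simp: vars_in_def)
  have L0: "(\<lambda>s. \<Psi> e 0 (Z (r s))) \<longlonglongrightarrow> \<Psi> e 0 z"
    unfolding P0' by (intro tendsto_intros evz z)
  have rinf: "filterlim (\<lambda>s. real (r s)) at_top sequentially"
    by (rule filterlim_compose[OF filterlim_real_sequentially filterlim_subseq[OF r]])
  have pz: "ev p z = 0"
  proof -
    have "(\<lambda>s. (C - \<Psi> e 0 (Z (r s))) * inverse (real (r s))) \<longlonglongrightarrow> (C - \<Psi> e 0 z) * 0"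
      by (intro tendsto_intros L0 tendsto_inverse_0_at_top rinf)
    moreover have "\<forall>\<^sub>F s in sequentially. ev p (Z (r s)) \<le> (C - \<Psi> e 0 (Z (r s))) * inverse (real (r s))"
    proof -
      have "\<forall>\<^sub>F s in sequentially. real (r s) > 0" using rinf unfolding filterlim_at_top_dense by blast
      then show ?thesis
      proof eventually_elim
        case (elim s)
        have "real (r s) * ev p (Z (r s)) \<le> C - \<Psi> e 0 (Z (r s))"
          using up[OF z0, of "r s"] P0[of "real (r s)" "Z (r s)"] by (simp add: C_def)
        then show ?case using elim by (simp add: field_simps)
      qed
    qed
    ultimately have "ev p z \<le> 0"
      using tendsto_le[OF sequentially_bot _ evz[of p]] by fastforce
    with nonneg[of z] show ?thesis by simp
  qed
  define ts where "ts s = \<Psi> e (real (r s)) (Z (r s))" for s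
  have ts: "ts \<longlonglongrightarrow> \<Psi> e 0 z"
  proof (rule tendsto_sandwich[OF _ _ L0 tendsto_const])
    show "\<forall>\<^sub>F s in sequentially. \<Psi> e 0 (Z (r s)) \<le> ts s" using lo by (simp add: ts_def)
    show "\<forall>\<^sub>F s in sequentially. ts s \<le> \<Psi> e 0 z" using up[OF pz] by (simp add: ts_def)
  qed
  show ?thesis
  proof (rule that[OF rinf ts _ pz refl])
    show "\<exists>z. ts s = \<Psi> e (real (r s)) z \<and> (\<forall>z'. \<Psi> e (real (r s)) z \<le> \<Psi> e (real (r s)) z')" for s
      using Z(2) by (auto simp: ts_def)
    show "\<Psi> e 0 z \<le> \<Psi> e 0 z'" if "ev p z' = 0" for z'
      by (rule LIMSEQ_le_const2[OF ts]) (use up[OF that] in \<open>auto simp: ts_def\<close>)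
  qed
qed

text \<open>Eliminating \<open>k\<close> and then \<open>e\<close> from \<open>Q\<close> through
  leading coefficients leaves a nonzero integer polynomial in one variable that vanishes at the
  infimum of \<open>h\<close> on the constraint set. Its norm is at most \<open>gapb n E H\<close>,
  so a root closer to 0 than \<open>1 / gapb n E H\<close> is 0.\<close>

theorem gap:
  assumes low: "\<And>z. ev p z = 0 \<Longrightarrow> ev h z > - 1 / (2 * real (gapb n E H))" and z1: "ev p z1 = 0"
  shows "ev h z1 \<ge> 0"
proof (rule ccontr)
  assume neg: "\<not> ev h z1 \<ge> 0"
  define S where "S = {ev h z |z. ev p z = 0}"
  define m where "m = Inf S"
  have bdd: "bdd_below S" unfolding S_def using low by (intro bdd_belowI[of _ "- 1 / (2 * real (gapb n E H))"]) (auto intro: less_imp_le)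
  have ne: "S \<noteq> {}" using z1 by (auto simp: S_def)
  have mle: "m \<le> ev h z" if "ev p z = 0" for z
    unfolding m_def using that by (intro cInf_lower bdd) (auto simp: S_def)
  have mneg: "m < 0" using mle[OF z1] neg by simp
  have mge: "m \<ge> - 1 / (2 * real (gapb n E H))"
    unfolding m_def using low by (intro cInf_greatest ne) (auto simp: S_def intro: less_imp_le)
  obtain Q where Q: "vars_in {0, 1, 2} Q" "pnorm Q \<le> gapb n E H" "\<exists>\<zeta>. ev Q \<zeta> \<noteq> 0"
    "\<And>e k z \<eta>. e > 0 \<Longrightarrow> (\<And>z'. \<Psi> e k z \<le> \<Psi> e k z') \<Longrightarrow> \<eta> 0 = e \<Longrightarrow> \<eta> 1 = k \<Longrightarrow> \<eta> 2 = \<Psi> e k z \<Longrightarrow> ev Q \<eta> = 0"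
    using value_polynomial by metis
  from Q(3) obtain \<xi> where \<xi>: "ev Q \<xi> \<noteq> 0" by blast
  obtain Q1 where Q1: "vars_in ({0, 1, 2} - {1}) Q1" "pnorm Q1 \<le> pnorm Q" "\<exists>\<zeta>. ev Q1 \<zeta> \<noteq> 0"
    "\<And>\<zeta>s \<zeta>. (\<And>s. ev Q (\<zeta>s s) = 0) \<Longrightarrow> (\<And>i. i \<noteq> 1 \<Longrightarrow> (\<lambda>s::nat. \<zeta>s s i) \<longlonglongrightarrow> \<zeta> i) \<Longrightarrow>
        filterlim (\<lambda>s. \<zeta>s s 1) at_top sequentially \<Longrightarrow> ev Q1 \<zeta> = 0"
    using leading_coefficient_limit[OF \<xi> Q(1), of 1] by metis
  from Q1(3) obtain \<xi>1 where \<xi>1: "ev Q1 \<xi>1 \<noteq> 0" by blast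
  obtain Q2 where Q2: "vars_in ({0, 1, 2} - {1} - {0}) Q2" "pnorm Q2 \<le> pnorm Q1" "\<exists>\<zeta>. ev Q2 \<zeta> \<noteq> 0"
    "\<And>\<zeta>s \<zeta>. (\<And>s. ev Q1 (\<zeta>s s) = 0) \<Longrightarrow> (\<And>i. i \<noteq> 0 \<Longrightarrow> (\<lambda>s::nat. \<zeta>s s i) \<longlonglongrightarrow> \<zeta> i) \<Longrightarrow>
        filterlim (\<lambda>s. \<zeta>s s 0) at_top sequentially \<Longrightarrow> ev Q2 \<zeta> = 0"
    using leading_coefficient_limit[OF \<xi>1 Q1(1), of 0] by metis
  \<comment> \<open>For fixed \<open>e\<close>, \<open>\<tau>\<close> is the minimum of
    \<open>\<Psi> e 0\<close> on the constraint set. It is at least \<open>m\<close> because the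
    even powers only add to \<open>h\<close>.\<close>
  have tau: "\<exists>\<tau>. ev Q1 ((\<lambda>_. 0)(0 := e, 2 := \<tau>)) = 0 \<and> m \<le> \<tau> \<and> (\<forall>z. ev p z = 0 \<longrightarrow> \<tau> \<le> \<Psi> e 0 z)"
    if e: "e > 0" for e
  proof -
    obtain \<tau> z ks ts where T: "filterlim ks at_top sequentially" "ts \<longlonglongrightarrow> \<tau>"
      "\<And>s::nat. \<exists>z. ts s = \<Psi> e (ks s) z \<and> (\<forall>z'. \<Psi> e (ks s) z \<le> \<Psi> e (ks s) z')"
      "ev p z = 0" "\<tau> = \<Psi> e 0 z" "\<And>z'. ev p z' = 0 \<Longrightarrow> \<tau> \<le> \<Psi> e 0 z'"
      using constrained_minimum[OF e z1] by metis
    have "ev Q1 ((\<lambda>_. 0)(0 := e, 2 := \<tau>)) = 0"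
    proof (rule Q1(4)[of "\<lambda>s. (\<lambda>_. 0)(0 := e, 1 := ks s, 2 := ts s)"])
      show "ev Q ((\<lambda>_. 0)(0 := e, 1 := ks s, 2 := ts s)) = 0" for s
        using T(3)[of s] e by (auto intro!: Q(4))
    qed (use T in auto)
    moreover have "0 \<le> (\<Sum>i<n. z i ^ (2 * E + 2))" by (intro sum_nonneg zero_le_even_power) auto
    then have "0 \<le> (1 / (e * (2 * E + 2))) * (\<Sum>i<n. z i ^ (2 * E + 2))"
      using e by (intro mult_nonneg_nonneg) auto
    then have "ev h z \<le> \<tau>" using T(5) by (simp add: \<Psi>_def)
    then have "m \<le> \<tau>" using mle[OF T(4)] by simp
    ultimately show ?thesis using T(6) by blast
  qed
  define es where "es s = real (Suc s)" for s
  have es: "es s > 0" for s by (simp add: es_def)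
  obtain \<tau> where \<tau>: "\<And>s. ev Q1 ((\<lambda>_. 0)(0 := es s, 2 := \<tau> s)) = 0" "\<And>s. m \<le> \<tau> s"
    "\<And>s z. ev p z = 0 \<Longrightarrow> \<tau> s \<le> \<Psi> (es s) 0 z"
    using tau[OF es] by metis
  have esinf: "filterlim es at_top sequentially"
    unfolding es_def by (rule filterlim_compose[OF filterlim_real_sequentially filterlim_Suc])
  \<comment> \<open>The infimum \<open>m\<close> may fail to be attained. At a fixed point with
    \<open>h\<close> close to \<open>m\<close> the term divided by \<open>e\<close> vanishes as
    \<open>e\<close> grows, and this pulls the minima down to \<open>m\<close>.\<close>
  have "\<tau> \<longlonglongrightarrow> m"
  proof (rule order_tendstoI)
    fix a assume "a < m"
    then show "\<forall>\<^sub>F s in sequentially. a < \<tau> s" using \<tau>(2) by (intro always_eventually) (auto intro: less_le_trans)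
  next
    fix a assume "m < a"
    then obtain z where z: "ev p z = 0" "ev h z < a"
      using cInf_less_iff[OF ne bdd, of a] by (auto simp: m_def S_def)
    have "(\<lambda>s. ev h z + inverse (es s) * ((\<Sum>i<n. z i ^ (2 * E + 2)) / (2 * E + 2))) \<longlonglongrightarrow>
       ev h z + 0 * ((\<Sum>i<n. z i ^ (2 * E + 2)) / (2 * E + 2))"
      by (intro tendsto_intros tendsto_inverse_0_at_top esinf)
    moreover have "ev h z + inverse (es s) * ((\<Sum>i<n. z i ^ (2 * E + 2)) / (2 * E + 2)) = \<Psi> (es s) 0 z" for s
      by (simp add: \<Psi>_def field_simps)
    ultimately have "(\<lambda>s. \<Psi> (es s) 0 z) \<longlonglongrightarrow> ev h z" by simp
    then have "\<forall>\<^sub>F s in sequentially. \<Psi> (es s) 0 z < a" using z(2) by (rule order_tendstoD)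
    then show "\<forall>\<^sub>F s in sequentially. \<tau> s < a"
      by eventually_elim (use \<tau>(3)[OF z(1)] in \<open>auto intro: le_less_trans\<close>)
  qed
  define \<zeta> where "\<zeta> = (\<lambda>_::nat. 0::real)(2 := m)"
  have root: "ev Q2 \<zeta> = 0"
    by (rule Q2(4)[of "\<lambda>s. (\<lambda>_. 0)(0 := es s, 2 := \<tau> s)"]) (use \<tau>(1) \<open>\<tau> \<longlonglongrightarrow> m\<close> esinf in \<open>auto simp: \<zeta>_def\<close>)
  from Q2(3) obtain \<xi>2 where \<xi>2: "ev Q2 \<xi>2 \<noteq> 0" by blast
  have v2: "vars_in {2} Q2" using Q2(1) by (rule vars_in_mono) auto
  have G: "gapb n E H > 0" by (simp add: gapb_def)
  \<comment> \<open>The factor 2 in the hypothesis keeps this product at 1/2, strictly below the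
    threshold of \<open>small_root_eq_0\<close>.\<close>
  have "\<bar>\<zeta> 2\<bar> * real (pnorm Q2) \<le> 1 / (2 * real (gapb n E H)) * real (gapb n E H)"
    using mneg mge Q2(2) Q1(2) Q(2) by (intro mult_mono) (auto simp: \<zeta>_def)
  also have "\<dots> < 1" using G by simp
  finally have "\<zeta> 2 = 0" by (rule small_root_eq_0[OF \<xi>2 v2 root])
  then show False using mneg by (simp add: \<zeta>_def)
qed

end

section \<open>Computable functions between coded types\<close>

definition rc :: "nat \<Rightarrow> (nat list \<Rightarrow> nat) \<Rightarrow> bool" where
  "rc k F \<longleftrightarrow> (\<exists>r. \<forall>xs. length xs = k \<longrightarrow> reval r xs (F xs))"

lemma rc_proj: "i < k \<Longrightarrow> rc k (\<lambda>xs. xs ! i)"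
  unfolding rc_def by (intro exI[of _ "Proj i"]) (auto intro: reval.intros)

lemma rc_comp1: assumes "rc 1 f" "rc k g" shows "rc k (\<lambda>xs. f [g xs])"
proof -
  from assms obtain r s where r: "\<And>xs. length xs = 1 \<Longrightarrow> reval r xs (f xs)"
    and s: "\<And>xs. length xs = k \<Longrightarrow> reval s xs (g xs)" by (auto simp: rc_def)
  have "reval (Comp r [s]) xs (f [g xs])" if "length xs = k" for xs
    by (rule reval.intros(4)[of "[g xs]"]) (auto simp: r s that)
  then show ?thesis unfolding rc_def by blast
qed

lemma rc_comp2: assumes "rc 2 f" "rc k g" "rc k h" shows "rc k (\<lambda>xs. f [g xs, h xs])"
proof -
  from assms obtain r s t where r: "\<And>xs. length xs = 2 \<Longrightarrow> reval r xs (f xs)"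
    and s: "\<And>xs. length xs = k \<Longrightarrow> reval s xs (g xs)"
    and t: "\<And>xs. length xs = k \<Longrightarrow> reval t xs (h xs)" by (auto simp: rc_def)
  have "reval (Comp r [s, t]) xs (f [g xs, h xs])" if "length xs = k" for xs
    by (rule reval.intros(4)[of "[g xs, h xs]"]) (auto simp: r s t that less_Suc_eq nth_Cons')
  then show ?thesis unfolding rc_def by blast
qed

lemma rc_Suc: assumes "rc k f" shows "rc k (\<lambda>xs. Suc (f xs))"
proof -
  have "rc 1 (\<lambda>xs. Suc (hd xs))"
    unfolding rc_def by (intro exI[of _ Succ]) (auto simp: length_Suc_conv intro: reval.intros)
  from rc_comp1[OF this assms] show ?thesis by simp
qed

lemma rc_const: "rc k (\<lambda>_. c)"
proof (induction c)
  case 0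
  show ?case unfolding rc_def by (intro exI[of _ Zero]) (auto intro: reval.intros)
qed (rule rc_Suc)

lemma rc_prim:
  assumes "rc k f" "rc (k + 2) g"
  shows "rc (Suc k) (\<lambda>xs. rec_nat (f (tl xs)) (\<lambda>n y. g (y # n # tl xs)) (hd xs))"
proof -
  from assms obtain r s where r: "\<And>xs. length xs = k \<Longrightarrow> reval r xs (f xs)"
    and s: "\<And>xs. length xs = k + 2 \<Longrightarrow> reval s xs (g xs)" by (auto simp: rc_def)
  have "reval (Prim r s) (n # xs) (rec_nat (f xs) (\<lambda>n y. g (y # n # xs)) n)" if "length xs = k" for n xs
  proof (induction n)
    case 0
    show ?case using r that by (auto intro: reval.intros)
  next
    case (Suc n)
    have "reval s (rec_nat (f xs) (\<lambda>n y. g (y # n # xs)) n # n # xs) (g (rec_nat (f xs) (\<lambda>n y. g (y # n # xs)) n # n # xs))"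
      using s that by simp
    from reval.intros(6)[OF Suc this] show ?case by simp
  qed
  then show ?thesis unfolding rc_def by (intro exI[of _ "Prim r s"]) (auto simp: length_Suc_conv)
qed

lemma rc_cong: "rc k f \<Longrightarrow> (\<And>xs. length xs = k \<Longrightarrow> f xs = g xs) \<Longrightarrow> rc k g"
  by (auto simp: rc_def)

lemma rc_add2: "rc 2 (\<lambda>xs. xs ! 0 + xs ! 1)"
proof -
  have "rc (Suc 1) (\<lambda>xs. rec_nat (tl xs ! 0) (\<lambda>n y. Suc ((y # n # tl xs) ! 0)) (hd xs))"
    by (intro rc_prim rc_Suc rc_proj) auto
  moreover have "rec_nat a (\<lambda>n. Suc) b = b + a" for a b :: nat by (induction b) auto
  ultimately have "rc 2 (\<lambda>xs. hd xs + tl xs ! 0)" by (simp add: numeral_2_eq_2)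
  then show ?thesis by (rule rc_cong) (auto simp: numeral_2_eq_2 length_Suc_conv)
qed

lemma rc_add: "rc k f \<Longrightarrow> rc k g \<Longrightarrow> rc k (\<lambda>xs. f xs + g xs)"
  using rc_comp2[OF rc_add2] by simp

lemma rc_pred: assumes "rc k f" shows "rc k (\<lambda>xs. f xs - 1)"
proof -
  have "rc (Suc 0) (\<lambda>xs. rec_nat 0 (\<lambda>n y. (y # n # tl xs) ! 1) (hd xs))"
    by (intro rc_prim rc_const rc_proj) auto
  moreover have "rec_nat 0 (\<lambda>n y. n) b = b - 1" for b :: nat by (cases b) auto
  ultimately have "rc 1 (\<lambda>xs. hd xs - 1)" by simp
  from rc_comp1[OF this assms] show ?thesis by simp
qed

lemma rc_diff: assumes "rc k f" "rc k g" shows "rc k (\<lambda>xs. f xs - g xs)"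
proof -
  have "rc (Suc 1) (\<lambda>xs. rec_nat (tl xs ! 0) (\<lambda>n y. (y # n # tl xs) ! 0 - 1) (hd xs))"
    by (intro rc_prim rc_pred rc_proj) auto
  moreover have "rec_nat a (\<lambda>n y. y - 1) b = a - b" for a b :: nat by (induction b) auto
  ultimately have "rc 2 (\<lambda>xs. tl xs ! 0 - hd xs)" by (simp add: numeral_2_eq_2)
  from rc_comp2[OF this assms(2,1)] show ?thesis by simp
qed

section \<open>Inverting the Cantor pairing function\<close>

lemma rc_triangle: assumes "rc k f" shows "rc k (\<lambda>xs. triangle (f xs))"
proof -
  have "rc (Suc 0) (\<lambda>xs. rec_nat 0 (\<lambda>n y. (y # n # tl xs) ! 0 + Suc ((y # n # tl xs) ! 1)) (hd xs))"
    by (intro rc_prim rc_const rc_add rc_Suc rc_proj) auto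
  moreover have "rec_nat 0 (\<lambda>n y. Suc (y + n)) b = triangle b" for b :: nat by (induction b) auto
  ultimately have "rc 1 (\<lambda>xs. triangle (hd xs))" by simp
  from rc_comp1[OF this assms] show ?thesis by simp
qed

lemma rc_pair: "rc k f \<Longrightarrow> rc k g \<Longrightarrow> rc k (\<lambda>xs. prod_encode (f xs, g xs))"
  unfolding prod_encode_def by (simp add: rc_add rc_triangle)

text \<open>The index of the diagonal of the Cantor pairing that contains \<open>c\<close>. While
  counting up to \<open>c\<close> it is incremented whenever the next triangular number is reached;
  truncated subtraction encodes this test.\<close>

definition tri_root :: "nat \<Rightarrow> nat" where
  "tri_root c = rec_nat 0 (\<lambda>n s. s + (1 - (triangle (Suc s) - Suc n))) c"

lemma tri_root: "triangle (tri_root c) \<le> c \<and> c < triangle (Suc (tri_root c))"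
proof (induction c)
  case (Suc c)
  have "tri_root (Suc c) = tri_root c + (1 - (triangle (Suc (tri_root c)) - Suc c))"
    by (simp add: tri_root_def)
  then have "tri_root (Suc c) = (if triangle (Suc (tri_root c)) \<le> Suc c then Suc (tri_root c) else tri_root c)"
    by auto
  with Suc show ?case by auto
qed (simp add: tri_root_def)

lemma triangle_mono: "a \<le> b \<Longrightarrow> triangle a \<le> triangle b"
  by (induction b) (auto simp: le_Suc_eq)

lemma tri_root_prod_encode: "tri_root (prod_encode (a, b)) = a + b"
proof -
  let ?c = "prod_encode (a, b)"
  have c: "triangle (a + b) \<le> ?c" "?c < triangle (Suc (a + b))" by (auto simp: prod_encode_def)
  have "\<not> tri_root ?c < a + b"
    using triangle_mono[of "Suc (tri_root ?c)" "a + b"] tri_root[of ?c] c by linarith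
  moreover have "\<not> tri_root ?c > a + b"
    using triangle_mono[of "Suc (a + b)" "tri_root ?c"] tri_root[of ?c] c by linarith
  ultimately show ?thesis by simp
qed

lemma rc_tri_root: assumes "rc k f" shows "rc k (\<lambda>xs. tri_root (f xs))"
proof -
  have "rc (Suc 0) (\<lambda>xs. rec_nat 0 (\<lambda>n y. (y # n # tl xs) ! 0 + (1 - (triangle (Suc ((y # n # tl xs) ! 0)) - Suc ((y # n # tl xs) ! 1)))) (hd xs))"
    by (intro rc_prim rc_const rc_add rc_Suc rc_diff rc_triangle rc_proj) auto
  then have "rc 1 (\<lambda>xs. tri_root (hd xs))" by (simp add: tri_root_def)
  from rc_comp1[OF this assms] show ?thesis by simp
qed

lemma rc_fst_decode: assumes "rc k f" shows "rc k (\<lambda>xs. fst (prod_decode (f xs)))"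
proof -
  have "fst (prod_decode c) = c - triangle (tri_root c)" for c
  proof -
    obtain a b where "c = prod_encode (a, b)" by (metis prod_decode_inverse surj_pair)
    then show ?thesis using tri_root_prod_encode[of a b] by simp (simp add: prod_encode_def)
  qed
  then show ?thesis by (simp add: rc_diff rc_triangle rc_tri_root assms)
qed

lemma rc_snd_decode: assumes "rc k f" shows "rc k (\<lambda>xs. snd (prod_decode (f xs)))"
proof -
  have "snd (prod_decode c) = tri_root c - fst (prod_decode c)" for c
  proof -
    obtain a b where "c = prod_encode (a, b)" by (metis prod_decode_inverse surj_pair)
    then show ?thesis using tri_root_prod_encode[of a b] by simp
  qed
  then show ?thesis by (simp add: rc_diff rc_fst_decode rc_tri_root assms)
qed

text \<open>Codes are bijections with the naturals: every number decodes, so an unbounded search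
  over numbers is a search over all values of the type.\<close>

class coded =
  fixes enc :: "'a \<Rightarrow> nat" and dec :: "nat \<Rightarrow> 'a"
  assumes dec_enc [simp]: "dec (enc x) = x" and enc_dec [simp]: "enc (dec n) = n"

instantiation nat :: coded
begin
definition enc_nat :: "nat \<Rightarrow> nat" where [simp]: "enc_nat n = n"
definition dec_nat :: "nat \<Rightarrow> nat" where [simp]: "dec_nat n = n"
instance by standard auto
end

instantiation int :: coded
begin
definition enc_int :: "int \<Rightarrow> nat" where "enc_int = int_encode"
definition dec_int :: "nat \<Rightarrow> int" where "dec_int = int_decode"
instance by standard (auto simp: enc_int_def dec_int_def)
end

instantiation prod :: (coded, coded) coded
begin
definition enc_prod :: "'a \<times> 'b \<Rightarrow> nat" where "enc_prod p = prod_encode (enc (fst p), enc (snd p))"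
definition dec_prod :: "nat \<Rightarrow> 'a \<times> 'b" where "dec_prod n = map_prod dec dec (prod_decode n)"
instance by standard (auto simp: enc_prod_def dec_prod_def)
end

instantiation list :: (coded) coded
begin
definition enc_list :: "'a list \<Rightarrow> nat" where "enc_list l = list_encode (map enc l)"
definition dec_list :: "nat \<Rightarrow> 'a list" where "dec_list n = map dec (list_decode n)"
instance by standard (auto simp: enc_list_def dec_list_def o_def)
end

definition computable :: "('a::coded \<Rightarrow> 'b::coded) \<Rightarrow> bool" where
  "computable f \<longleftrightarrow> (\<exists>r. \<forall>x. reval r [enc x] (enc (f x)))"

lemma computable_rc: "computable f \<longleftrightarrow> rc 1 (\<lambda>xs. enc (f (dec (xs ! 0))))"
proof
  assume "computable f"
  then obtain r where r: "\<And>x. reval r [enc x] (enc (f x))" by (auto simp: computable_def)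
  show "rc 1 (\<lambda>xs. enc (f (dec (xs ! 0))))"
    unfolding rc_def
  proof (intro exI[of _ r] allI impI)
    fix xs :: "nat list" assume "length xs = 1"
    then obtain n where "xs = [n]" by (auto simp: length_Suc_conv)
    then show "reval r xs (enc (f (dec (xs ! 0))))" using r[of "dec n"] by simp
  qed
next
  assume "rc 1 (\<lambda>xs. enc (f (dec (xs ! 0))))"
  then obtain r where r: "\<And>xs. length xs = 1 \<Longrightarrow> reval r xs (enc (f (dec (xs ! 0))))" by (auto simp: rc_def)
  show "computable f" unfolding computable_def
  proof (intro exI allI)
    fix x show "reval r [enc x] (enc (f x))" using r[of "[enc x]"] by simp
  qed
qed

named_theorems comp_intros

lemma c_id [comp_intros]: "computable (\<lambda>x. x)"
  unfolding computable_rc by (simp add: rc_proj)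

lemma c_const [comp_intros]: "computable (\<lambda>x. c)"
  unfolding computable_rc by (rule rc_const)

lemma c_comp: assumes "computable f" "computable g" shows "computable (\<lambda>x. f (g x))"
  using rc_comp1[OF assms(1)[unfolded computable_rc] assms(2)[unfolded computable_rc]]
  unfolding computable_rc by simp

lemma c_Pair [comp_intros]: "computable f \<Longrightarrow> computable g \<Longrightarrow> computable (\<lambda>x. (f x, g x))"
  unfolding computable_rc enc_prod_def by (simp add: rc_pair)

lemma c_fst [comp_intros]: assumes "computable f" shows "computable (\<lambda>x. fst (f x))"
proof -
  have "enc (fst p) = fst (prod_decode (enc p))" for p :: "'b \<times> 'c" by (simp add: enc_prod_def)
  then show ?thesis using assms unfolding computable_rc by (simp add: rc_fst_decode)
qed

lemma c_snd [comp_intros]: assumes "computable f" shows "computable (\<lambda>x. snd (f x))"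
proof -
  have "enc (snd p) = snd (prod_decode (enc p))" for p :: "'b \<times> 'c" by (simp add: enc_prod_def)
  then show ?thesis using assms unfolding computable_rc by (simp add: rc_snd_decode)
qed

lemma c_enc [comp_intros]: "computable f \<Longrightarrow> computable (\<lambda>x. enc (f x))"
  unfolding computable_rc by simp

lemma c_dec [comp_intros]: "computable f \<Longrightarrow> computable (\<lambda>x. dec (f x))"
  unfolding computable_rc by simp

lemma c_Suc [comp_intros]: "computable f \<Longrightarrow> computable (\<lambda>x. Suc (f x))"
  unfolding computable_rc by (simp add: rc_Suc)

lemma c_diff [comp_intros]: "computable f \<Longrightarrow> computable g \<Longrightarrow> computable (\<lambda>x. f x - g x :: nat)"
  unfolding computable_rc by (simp add: rc_diff)

lemma c_add [comp_intros]: "computable f \<Longrightarrow> computable g \<Longrightarrow> computable (\<lambda>x. f x + g x :: nat)"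
  unfolding computable_rc by (simp add: rc_add)

text \<open>Primitive recursion with parameter and result of arbitrary coded types. Later loops,
  folds and arithmetic operations are obtained as instances.\<close>

lemma c_rec [comp_intros]:
  fixes b :: "'a::coded \<Rightarrow> nat \<Rightarrow> 'b::coded \<Rightarrow> 'b"
  assumes "computable a" "computable (\<lambda>p. b (fst p) (fst (snd p)) (snd (snd p)))" "computable n"
  shows "computable (\<lambda>x. rec_nat (a x) (b x) (n x))"
proof -
  define B where "B p = b (fst p) (fst (snd p)) (snd (snd p))" for p
  have "rc 1 (\<lambda>xs. enc (B (dec (xs ! 0))))"
    using assms(2) unfolding computable_rc B_def .
  \<comment> \<open>The scheme supplies accumulator, counter and parameter in this order; they are
    repacked as nested pairs, parameter first.\<close>
  then have "rc (1 + 2) (\<lambda>ys. enc (B (dec ([prod_encode (ys ! 2, prod_encode (ys ! 1, ys ! 0))] ! 0))))"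
    by (rule rc_comp1) (intro rc_pair rc_proj; simp)+
  from rc_prim[OF assms(1)[unfolded computable_rc] this]
  have R: "rc 2 (\<lambda>xs. rec_nat (enc (a (dec (tl xs ! 0))))
      (\<lambda>n y. enc (B (dec (prod_encode (tl xs ! 0, prod_encode (n, y)))))) (hd xs))"
    by (simp add: numeral_2_eq_2)
  have eq: "rec_nat (enc (a x)) (\<lambda>n y. enc (B (dec (prod_encode (enc x, prod_encode (n, y)))))) k = enc (rec_nat (a x) (b x) k)" for x k
    by (induction k) (auto simp: dec_prod_def B_def)
  have "rc 1 (\<lambda>xs. rec_nat (enc (a (dec (tl [n (dec (xs ! 0)), xs ! 0] ! 0))))
      (\<lambda>m y. enc (B (dec (prod_encode (tl [n (dec (xs ! 0)), xs ! 0] ! 0, prod_encode (m, y)))))) (hd [n (dec (xs ! 0)), xs ! 0]))"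
    using assms(3) by (intro rc_comp2[OF R] rc_proj) (auto simp: computable_rc)
  moreover have "rec_nat (enc (a (dec (xs ! 0)))) (\<lambda>m y. enc (B (dec (prod_encode (xs ! 0, prod_encode (m, y)))))) (n (dec (xs ! 0)))
     = enc (rec_nat (a (dec (xs ! 0))) (b (dec (xs ! 0))) (n (dec (xs ! 0))))" for xs :: "nat list"
    using eq[of "dec (xs ! 0)"] by simp
  ultimately show ?thesis unfolding computable_rc by simp
qed

lemma c_mult [comp_intros]:
  fixes f g :: "'a::coded \<Rightarrow> nat"
  assumes "computable f" "computable g" shows "computable (\<lambda>x. f x * g x)"
proof -
  have "computable (\<lambda>x. rec_nat 0 (\<lambda>_ acc. acc + g x) (f x))"
    by (intro comp_intros assms c_comp[OF assms(2)])
  moreover have "rec_nat 0 (\<lambda>_ acc. acc + b) a = a * b" for a b :: nat by (induction a) auto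
  ultimately show ?thesis by simp
qed

lemma c_power [comp_intros]:
  fixes f g :: "'a::coded \<Rightarrow> nat"
  assumes "computable f" "computable g" shows "computable (\<lambda>x. f x ^ g x)"
proof -
  have "computable (\<lambda>x. rec_nat 1 (\<lambda>_ acc. acc * f x) (g x))"
    by (intro comp_intros assms c_comp[OF assms(1)])
  moreover have "rec_nat 1 (\<lambda>_ acc. acc * b) a = b ^ a" for a b :: nat by (induction a) auto
  ultimately show ?thesis by simp
qed

lemma c_fact [comp_intros]:
  assumes "computable f" shows "computable (\<lambda>x. fact (f x) :: nat)"
proof -
  have "computable (\<lambda>x. rec_nat 1 (\<lambda>n acc. Suc n * acc) (f x))"
    by (intro comp_intros assms)
  moreover have "rec_nat 1 (\<lambda>n acc. Suc n * acc) a = fact a" for a :: nat by (induction a) auto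
  ultimately show ?thesis by simp
qed

section \<open>Decidable predicates\<close>

definition cdec :: "('a::coded \<Rightarrow> bool) \<Rightarrow> bool" where
  "cdec P \<longleftrightarrow> computable (\<lambda>x. of_bool (P x) :: nat)"

lemma c_if [comp_intros]:
  assumes "cdec P" "computable f" "computable g"
  shows "computable (\<lambda>x. if P x then f x else g x)"
proof -
  have "computable (\<lambda>x. rec_nat (g x) (\<lambda>_ _. f x) (of_bool (P x)))"
    using assms(1) unfolding cdec_def by (intro comp_intros assms c_comp[OF assms(2)])
  moreover have "rec_nat (g x) (\<lambda>_ _. f x) (of_bool (P x)) = (if P x then f x else g x)" for x by simp
  ultimately show ?thesis by simp
qed

lemma cd_le [comp_intros]:
  fixes f g :: "'a::coded \<Rightarrow> nat"
  assumes "computable f" "computable g" shows "cdec (\<lambda>x. f x \<le> g x)"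
proof -
  have "computable (\<lambda>x. 1 - (f x - g x))" by (intro comp_intros assms)
  moreover have "1 - (a - b) = of_bool (a \<le> b)" for a b :: nat by auto
  ultimately show ?thesis by (simp add: cdec_def)
qed

lemma cd_not [comp_intros]: assumes "cdec P" shows "cdec (\<lambda>x. \<not> P x)"
proof -
  have "computable (\<lambda>x. 1 - of_bool (P x) :: nat)" using assms unfolding cdec_def by (intro comp_intros)
  moreover have "1 - of_bool p = (of_bool (\<not> p) :: nat)" for p by simp
  ultimately show ?thesis by (simp only: cdec_def)
qed

lemma cd_conj [comp_intros]: assumes "cdec P" "cdec Q" shows "cdec (\<lambda>x. P x \<and> Q x)"
proof -
  have "computable (\<lambda>x. of_bool (P x) * of_bool (Q x) :: nat)" using assms unfolding cdec_def by (intro comp_intros)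
  then show ?thesis unfolding cdec_def of_bool_conj .
qed

lemma cd_disj [comp_intros]: assumes "cdec P" "cdec Q" shows "cdec (\<lambda>x. P x \<or> Q x)"
  using cd_not[OF cd_conj[OF cd_not[OF assms(1)] cd_not[OF assms(2)]]] by simp

lemma cd_less [comp_intros]:
  fixes f g :: "'a::coded \<Rightarrow> nat"
  shows "computable f \<Longrightarrow> computable g \<Longrightarrow> cdec (\<lambda>x. f x < g x)"
  using cd_not[OF cd_le[of g f]] by (simp add: not_le)

lemma cd_eq [comp_intros]:
  assumes "computable f" "computable g" shows "cdec (\<lambda>x. f x = g x)"
proof -
  have "cdec (\<lambda>x. enc (f x) \<le> enc (g x) \<and> enc (g x) \<le> enc (f x))" by (intro comp_intros assms)
  moreover have "(enc a \<le> enc b \<and> enc b \<le> enc a) = (a = b)" for a b :: 'b by (metis dec_enc order_antisym order_refl)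
  ultimately show ?thesis by simp
qed

lemma cd_ball [comp_intros]:
  fixes n :: "'a::coded \<Rightarrow> nat"
  assumes "cdec (\<lambda>p. P (fst p) (snd p))" "computable n" shows "cdec (\<lambda>x. \<forall>i<n x. P x i)"
proof -
  have c: "computable (\<lambda>p. of_bool (P (fst p) (snd p)) :: nat)" using assms(1) by (simp add: cdec_def)
  have "computable (\<lambda>x. rec_nat 1 (\<lambda>i acc. acc * of_bool (P x i) :: nat) (n x))"
    by (intro comp_intros assms c_comp[OF c, where g = "\<lambda>q. (fst q, fst (snd q))", simplified])
  moreover have "rec_nat 1 (\<lambda>i acc. acc * of_bool (Q i)) k = (of_bool (\<forall>i<k. Q i) :: nat)" for Q k
    by (induction k) (auto simp: less_Suc_eq)
  ultimately show ?thesis by (simp add: cdec_def)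
qed

lemma cd_bex [comp_intros]:
  fixes n :: "'a::coded \<Rightarrow> nat"
  assumes "cdec (\<lambda>p. P (fst p) (snd p))" "computable n" shows "cdec (\<lambda>x. \<exists>i<n x. P x i)"
  using cd_not[OF cd_ball[OF cd_not[OF assms(1)] assms(2)]] by simp

lemma cd_comp: assumes "cdec P" "computable g" shows "cdec (\<lambda>x. P (g x))"
  using assms unfolding cdec_def by (rule c_comp)

lemma c_div [comp_intros]:
  fixes f g :: "'a::coded \<Rightarrow> nat"
  assumes "computable f" "computable g" shows "computable (\<lambda>x. f x div g x)"
proof -
  \<comment> \<open>The quotient grows by one exactly when \<open>Suc q * g x\<close> has been
    reached; the guard makes division by 0 return 0, as in HOL.\<close>
  have "computable (\<lambda>x. rec_nat 0 (\<lambda>n q. if Suc q * g x \<le> Suc n \<and> \<not> g x = 0 then Suc q else q) (f x))"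
    by (intro comp_intros assms c_comp[OF assms(2)])
  moreover have "rec_nat 0 (\<lambda>n q. if Suc q * b \<le> Suc n \<and> \<not> b = 0 then Suc q else q) a = a div b" for a b :: nat
  proof (cases "b = 0")
    case True
    have "rec_nat 0 (\<lambda>n q. q) a = (0::nat)" by (induction a) auto
    with True show ?thesis by simp
  next
    case False
    show ?thesis
    proof (induction a)
      case (Suc a)
      have "(Suc (a div b) * b \<le> Suc a) = (Suc a div b \<noteq> a div b)"
        using False by (metis Suc_n_not_le_n div_Suc less_eq_div_iff_mult_less_eq neq0_conv order_refl)
      with Suc False show ?case by (auto simp: div_Suc)
    qed simp
  qed
  ultimately show ?thesis by simp
qed

lemma c_mod [comp_intros]:
  fixes f g :: "'a::coded \<Rightarrow> nat"
  shows "computable f \<Longrightarrow> computable g \<Longrightarrow> computable (\<lambda>x. f x mod g x)"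
  unfolding minus_div_mult_eq_mod[symmetric] by (intro comp_intros)

section \<open>Computable list operations\<close>

lemma enc_Nil [simp]: "enc [] = 0" by (simp add: enc_list_def)

lemma enc_Cons: "enc (x # l) = Suc (enc (x, l))" by (simp add: enc_list_def enc_prod_def)

lemma length_le_enc: "length l \<le> enc l" for l :: "'a::coded list"
proof (induction l)
  case (Cons x l)
  have "enc l \<le> enc (x, l)" by (simp add: enc_prod_def le_prod_encode_2)
  with Cons show ?case by (simp add: enc_Cons)
qed simp

lemma c_Cons [comp_intros]:
  assumes "computable f" "computable g" shows "computable (\<lambda>x. f x # g x)"
proof -
  have "computable (\<lambda>x. dec (Suc (enc (f x, g x))) :: 'b list)" by (intro comp_intros assms)
  moreover have "dec (Suc (enc (a, l))) = a # l" for a :: 'b and l by (metis dec_enc enc_Cons)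
  ultimately show ?thesis by simp
qed

text \<open>A nonempty list is coded by the successor of the code of its head and tail. On
  \<open>[]\<close> the result is the decoding of 0, which callers avoid by an emptiness or length
  test.\<close>

definition uncons :: "'a::coded list \<Rightarrow> 'a \<times> 'a list" where
  "uncons l = dec (enc l - 1)"

lemma uncons_Cons [simp]: "uncons (x # l) = (x, l)" by (simp add: uncons_def enc_Cons)

lemma c_uncons [comp_intros]: "computable f \<Longrightarrow> computable (\<lambda>x. uncons (f x))"
  unfolding uncons_def by (intro comp_intros)

text \<open>The state pairs the accumulator with the remaining list. The code of a list is at least
  its length, so that many iterations suffice; once the list is exhausted the state stays
  fixed.\<close>

lemma c_foldl [comp_intros]:
  fixes b :: "'a::coded \<Rightarrow> 'b::coded \<Rightarrow> 'c::coded \<Rightarrow> 'b"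
  assumes b: "computable (\<lambda>p. b (fst p) (fst (snd p)) (snd (snd p)))" and a: "computable a" and l: "computable l"
  shows "computable (\<lambda>x. foldl (b x) (a x) (l x))"
proof -
  define st where "st x s = (if enc (snd s) = 0 then s else (b x (fst s) (fst (uncons (snd s))), snd (uncons (snd s))))" for x s
  have "computable (\<lambda>p. b (fst p) (fst (snd (snd p))) (fst (uncons (snd (snd (snd p))))))"
    using c_comp[OF b, where g = "\<lambda>p. (fst p, fst (snd (snd p)), fst (uncons (snd (snd (snd p)))))"]
    by (simp add: comp_intros)
  then have "computable (\<lambda>x. fst (rec_nat (a x, l x) (\<lambda>_. st x) (enc (l x))))"
    unfolding st_def by (intro comp_intros a l)
  moreover have iter: "rec_nat (a', l') (\<lambda>_. st x) k = (foldl (b x) a' l', [])" if "length l' \<le> k" for x a' l' k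
  proof -
    have step: "rec_nat s (\<lambda>_. st x) (Suc k) = rec_nat (st x s) (\<lambda>_. st x) k" for s k
      by (induction k) auto
    show ?thesis using that
    proof (induction k arbitrary: a' l')
      case (Suc k)
      show ?case
      proof (cases l')
        case Nil
        then have "st x (a', l') = (a', l')" by (simp add: st_def)
        then show ?thesis using Suc.IH[of l' a'] Nil step[of "(a', l')" k] by simp
      next
        case (Cons y ys)
        then have "st x (a', l') = (b x a' y, ys)" by (simp add: st_def enc_Cons)
        then show ?thesis using Suc Cons step[of "(a', l')" k] by simp
      qed
    qed simp
  qed
  have "fst (rec_nat (a x, l x) (\<lambda>_. st x) (enc (l x))) = foldl (b x) (a x) (l x)" for x
    using iter[OF length_le_enc] by simp
  ultimately show ?thesis by simp
qed

lemma c_rev [comp_intros]: assumes "computable f" shows "computable (\<lambda>x. rev (f x))"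
proof -
  have "computable (\<lambda>x. foldl (\<lambda>acc e. e # acc) [] (f x))" by (intro comp_intros assms)
  moreover have "foldl (\<lambda>acc e. e # acc) k l = rev l @ k" for l k :: "'b list"
    by (induction l arbitrary: k) auto
  ultimately show ?thesis by simp
qed

lemma c_append [comp_intros]: assumes "computable f" "computable g" shows "computable (\<lambda>x. f x @ g x)"
proof -
  have "computable (\<lambda>x. foldl (\<lambda>acc e. e # acc) (g x) (rev (f x)))" by (intro comp_intros assms)
  moreover have "foldl (\<lambda>acc e. e # acc) k l = rev l @ k" for l k :: "'b list"
    by (induction l arbitrary: k) auto
  ultimately show ?thesis by simp
qed

lemma c_map [comp_intros]:
  fixes b :: "'a::coded \<Rightarrow> 'b::coded \<Rightarrow> 'c::coded"
  assumes b: "computable (\<lambda>p. b (fst p) (snd p))" and l: "computable l"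
  shows "computable (\<lambda>x. map (b x) (l x))"
proof -
  have "computable (\<lambda>p. b (fst p) (snd (snd p)))"
    using c_comp[OF b, where g = "\<lambda>p. (fst p, snd (snd p))"] by (simp add: comp_intros)
  then have "computable (\<lambda>x. rev (foldl (\<lambda>acc e. b x e # acc) [] (l x)))" by (intro comp_intros l)
  moreover have "foldl (\<lambda>acc e. b x e # acc) k l = rev (map (b x) l) @ k" for x k l
    by (induction l arbitrary: k) auto
  ultimately show ?thesis by simp
qed

lemma c_concat [comp_intros]: assumes "computable f" shows "computable (\<lambda>x. concat (f x))"
proof -
  have "computable (\<lambda>x. foldl (\<lambda>acc e. acc @ e) [] (f x))" by (intro comp_intros assms)
  moreover have "foldl (\<lambda>acc e. acc @ e) k l = k @ concat l" for l :: "'b list list" and k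
    by (induction l arbitrary: k) auto
  ultimately show ?thesis by simp
qed

lemma c_length [comp_intros]: assumes "computable f" shows "computable (\<lambda>x. length (f x))"
proof -
  have "computable (\<lambda>x. foldl (\<lambda>acc e. Suc acc) 0 (f x))" by (intro comp_intros assms)
  moreover have "foldl (\<lambda>acc e. Suc acc) k l = k + length l" for l :: "'b list" and k
    by (induction l arbitrary: k) auto
  ultimately show ?thesis by simp
qed

lemma c_sum_list_nat [comp_intros]: assumes "computable f" shows "computable (\<lambda>x. sum_list (f x) :: nat)"
proof -
  have "computable (\<lambda>x. foldl (\<lambda>acc e. acc + e) 0 (f x))" by (intro comp_intros assms)
  moreover have "foldl (\<lambda>acc e. acc + e) k l = k + sum_list l" for l and k :: nat
    by (induction l arbitrary: k) auto
  ultimately show ?thesis by simp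
qed

lemma c_upt [comp_intros]: assumes "computable f" shows "computable (\<lambda>x. [0..<f x])"
proof -
  have "computable (\<lambda>x. rec_nat [] (\<lambda>n l. l @ [n]) (f x))" by (intro comp_intros assms)
  moreover have "rec_nat [] (\<lambda>n l. l @ [n]) k = [0..<k]" for k by (induction k) auto
  ultimately show ?thesis by simp
qed

text \<open>Total indexing: out of range the value is the one with code 0, a definite value that can
  be computed.\<close>

definition nth0 :: "'a::coded list \<Rightarrow> nat \<Rightarrow> 'a" where
  "nth0 l i = (if i < length l then l ! i else dec 0)"

lemma c_nth0 [comp_intros]:
  assumes "computable f" "computable g" shows "computable (\<lambda>x. nth0 (f x) (g x))"
proof -
  have "computable (\<lambda>x. if g x < length (f x) then fst (uncons (rec_nat (f x) (\<lambda>_ l. snd (uncons l)) (g x))) else dec 0)"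
    by (intro comp_intros assms)
  moreover have "fst (uncons (rec_nat l (\<lambda>_ l. snd (uncons l)) k)) = l ! k" if "k < length l" for l :: "'b list" and k
  proof -
    have "rec_nat l (\<lambda>_ l. snd (uncons l)) k = drop k l" using that
    proof (induction k)
      case (Suc k)
      then show ?case by (simp add: Cons_nth_drop_Suc[symmetric, of k l])
    qed simp
    then show ?thesis using that by (simp add: Cons_nth_drop_Suc[symmetric, of k l])
  qed
  then have "(if g x < length (f x) then fst (uncons (rec_nat (f x) (\<lambda>_ l. snd (uncons l)) (g x))) else dec 0) = nth0 (f x) (g x)" for x
    by (simp add: nth0_def)
  ultimately show ?thesis by simp
qed

lemma cd_list_ball [comp_intros]:
  fixes P :: "'a::coded \<Rightarrow> 'b::coded \<Rightarrow> bool"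
  assumes "cdec (\<lambda>p. P (fst p) (snd p))" "computable l" shows "cdec (\<lambda>x. \<forall>y\<in>set (l x). P x y)"
proof -
  have "cdec (\<lambda>p. P (fst p) (nth0 (l (fst p)) (snd p)))"
    using cd_comp[OF assms(1), where g = "\<lambda>p. (fst p, nth0 (l (fst p)) (snd p))"]
      c_Pair[OF c_fst[OF c_id] c_nth0[OF c_comp[OF assms(2) c_fst[OF c_id]] c_snd[OF c_id]]] by simp
  then have "cdec (\<lambda>x. \<forall>i<length (l x). P x (nth0 (l x) i))" by (intro comp_intros assms)
  moreover have "(\<forall>i<length (l x). P x (nth0 (l x) i)) = (\<forall>y\<in>set (l x). P x y)" for x
    by (simp add: nth0_def all_set_conv_all_nth)
  ultimately show ?thesis by simp
qed

lemma cd_member [comp_intros]: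
  assumes f: "computable f" and l: "computable l" shows "cdec (\<lambda>x. f x \<in> set (l x))"
proof -
  have "cdec (\<lambda>x. \<not> (\<forall>y\<in>set (l x). \<not> y = f x))" by (intro comp_intros l c_comp[OF f])
  then show ?thesis by auto
qed

section \<open>Integers\<close>

lemma c_nat_abs_parts:
  assumes "computable f" shows "computable (\<lambda>x. nat (f x))" "computable (\<lambda>x. nat (- f x))"
proof -
  \<comment> \<open>\<open>int_encode\<close> sends nonnegative integers to even codes and negative
    ones to odd codes.\<close>
  have 1: "nat i = (if enc i mod 2 = 0 then enc i div 2 else 0)" for i
    by (auto simp: enc_int_def int_encode_def sum_encode_def)
  have 2: "nat (- i) = (if enc i mod 2 = 0 then 0 else Suc (enc i div 2))" for i
    by (auto simp: enc_int_def int_encode_def sum_encode_def)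
  show "computable (\<lambda>x. nat (f x))" unfolding 1 by (intro comp_intros assms)
  show "computable (\<lambda>x. nat (- f x))" unfolding 2 by (intro comp_intros assms)
qed

lemmas [comp_intros] = c_nat_abs_parts

lemma c_nat_abs [comp_intros]: assumes "computable f" shows "computable (\<lambda>x. nat \<bar>f x\<bar>)"
proof -
  have "nat \<bar>i\<bar> = nat i + nat (- i)" for i :: int by auto
  then show ?thesis by (simp add: comp_intros assms)
qed

lemma c_int_diff_nat:
  assumes "computable f" "computable g" shows "computable (\<lambda>x. int (f x) - int (g x))"
proof -
  have *: "int a - int b = dec (if b \<le> a then 2 * (a - b) else Suc (2 * (b - a - 1)))" for a b
    by (auto simp: dec_int_def int_decode_def sum_decode_def)
  show ?thesis unfolding * by (intro comp_intros assms)
qed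

lemma c_int [comp_intros]: "computable f \<Longrightarrow> computable (\<lambda>x. int (f x))"
  using c_int_diff_nat[OF _ c_const[of 0]] by simp

lemma c_int_add [comp_intros]:
  assumes "computable f" "computable g" shows "computable (\<lambda>x. f x + g x :: int)"
proof -
  have "(\<lambda>x. f x + g x) = (\<lambda>x. int (nat (f x) + nat (g x)) - int (nat (- f x) + nat (- g x)))" by auto
  moreover have "computable (\<lambda>x. int (nat (f x) + nat (g x)) - int (nat (- f x) + nat (- g x)))"
    by (intro c_int_diff_nat comp_intros assms)
  ultimately show ?thesis by (simp only:)
qed

lemma c_int_uminus [comp_intros]:
  assumes "computable f" shows "computable (\<lambda>x. - f x :: int)"
proof -
  have "(\<lambda>x. - f x) = (\<lambda>x. int (nat (- f x)) - int (nat (f x)))" by auto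
  moreover have "computable (\<lambda>x. int (nat (- f x)) - int (nat (f x)))"
    by (intro c_int_diff_nat comp_intros assms)
  ultimately show ?thesis by (simp only:)
qed

lemma c_int_mult [comp_intros]:
  assumes "computable f" "computable g" shows "computable (\<lambda>x. f x * g x :: int)"
proof -
  have "i * j = int (nat i * nat j + nat (- i) * nat (- j)) - int (nat i * nat (- j) + nat (- i) * nat j)" for i j
  proof -
    have "i * j = (int (nat i) - int (nat (- i))) * (int (nat j) - int (nat (- j)))" by auto
    then show ?thesis by (simp only: of_nat_add of_nat_mult) (simp only: algebra_simps)
  qed
  then have "(\<lambda>x. f x * g x) = (\<lambda>x. int (nat (f x) * nat (g x) + nat (- f x) * nat (- g x)) - int (nat (f x) * nat (- g x) + nat (- f x) * nat (g x)))"
    by blast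
  moreover have "computable (\<lambda>x. int (nat (f x) * nat (g x) + nat (- f x) * nat (- g x)) - int (nat (f x) * nat (- g x) + nat (- f x) * nat (g x)))"
    by (intro c_int_diff_nat comp_intros assms)
  ultimately show ?thesis by (simp only:)
qed

lemma cd_int_less [comp_intros]:
  fixes f g :: "'a::coded \<Rightarrow> int"
  assumes "computable f" "computable g" shows "cdec (\<lambda>x. f x < g x)"
proof -
  have "(i < j) = (0 < nat (j + - i))" for i j :: int by auto
  then show ?thesis by (simp only:) (intro comp_intros assms)
qed

lemma c_sum_list_int [comp_intros]: assumes "computable f" shows "computable (\<lambda>x. sum_list (f x) :: int)"
proof -
  have "computable (\<lambda>x. foldl (\<lambda>acc e. acc + e) 0 (f x))" by (intro comp_intros assms)
  moreover have "foldl (\<lambda>acc e. acc + e) k l = k + sum_list l" for l and k :: int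
    by (induction l arbitrary: k) auto
  ultimately show ?thesis by simp
qed

lemma c_prod_list_int [comp_intros]: assumes "computable f" shows "computable (\<lambda>x. prod_list (f x) :: int)"
proof -
  have "computable (\<lambda>x. foldl (\<lambda>acc e. acc * e) 1 (f x))" by (intro comp_intros assms)
  moreover have "foldl (\<lambda>acc e. acc * e) k l = k * prod_list l" for l and k :: int
    by (induction l arbitrary: k) auto
  ultimately show ?thesis by simp
qed

lemma c_int_decode [comp_intros]: "computable f \<Longrightarrow> computable (\<lambda>x. int_decode (f x))"
  using c_dec[where 'b = int] by (simp add: dec_int_def)

lemma c_list_decode [comp_intros]: assumes "computable f" shows "computable (\<lambda>x. list_decode (f x))"
proof -
  have "map dec l = l" for l :: "nat list" by (induction l) auto
  then show ?thesis using c_dec[OF assms, where 'b = "nat list"] by (simp add: dec_list_def)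
qed

lemma c_prod_decode [comp_intros]: "computable f \<Longrightarrow> computable (\<lambda>x. prod_decode (f x))"
  using c_dec[where 'b = "nat \<times> nat"] by (simp add: dec_prod_def map_prod_def)

section \<open>Semi-decidable predicates\<close>

definition re :: "('a::coded \<Rightarrow> bool) \<Rightarrow> bool" where
  "re P \<longleftrightarrow> (\<exists>Q :: 'a \<times> nat \<Rightarrow> bool. cdec Q \<and> (\<forall>x. P x \<longleftrightarrow> (\<exists>n. Q (x, n))))"

lemma reE:
  fixes P :: "'a::coded \<Rightarrow> bool"
  assumes "re P"
  obtains Q :: "'a \<times> nat \<Rightarrow> bool" where "cdec Q" "\<And>x. P x = (\<exists>n. Q (x, n))"
proof -
  from assms obtain Q :: "'a \<times> nat \<Rightarrow> bool" where Q: "cdec Q" "\<forall>x. P x = (\<exists>n. Q (x, n))"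
    unfolding re_def by (elim exE conjE)
  show ?thesis by (rule that[OF Q(1)]) (rule Q(2)[rule_format])
qed

lemma re_dec: assumes "cdec P" shows "re P"
  unfolding re_def using cd_comp[OF assms c_fst[OF c_id]] by (intro exI[of _ "\<lambda>p. P (fst p)"]) auto

lemma re_ex:
  fixes P :: "'a::coded \<Rightarrow> 'b::coded \<Rightarrow> bool"
  assumes "re (\<lambda>p. P (fst p) (snd p))" shows "re (\<lambda>x. \<exists>y. P x y)"
proof -
  obtain Q :: "_ \<times> nat \<Rightarrow> bool" where Q: "cdec Q" "\<And>p. P (fst p) (snd p) = (\<exists>n. Q (p, n))"
    by (rule reE[OF assms(1)]) blast
  let ?Q = "\<lambda>p. Q ((fst p, fst (dec (snd p) :: 'b \<times> nat)), snd (dec (snd p) :: 'b \<times> nat))"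
  have "cdec ?Q" by (intro cd_comp[OF Q(1)] comp_intros)
  moreover have "(\<exists>y. P x y) = (\<exists>n. ?Q (x, n))" for x
  proof
    assume "\<exists>y. P x y"
    then obtain y n where "Q ((x, y), n)" using Q(2)[of "(x, _)"] by auto
    then show "\<exists>n. ?Q (x, n)" by (intro exI[of _ "enc (y, n)"]) simp
  next
    assume "\<exists>n. ?Q (x, n)"
    then show "\<exists>y. P x y" using Q(2)[of "(x, _)"] by auto
  qed
  ultimately show ?thesis unfolding re_def by blast
qed

lemma re_conj: assumes "re P" "re P'" shows "re (\<lambda>x. P x \<and> P' x)"
proof -
  obtain Q :: "_ \<times> nat \<Rightarrow> bool" where Q: "cdec Q" "\<And>x. P x = (\<exists>n. Q (x, n))" by (rule reE[OF assms(1)]) blast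
  obtain Q' :: "_ \<times> nat \<Rightarrow> bool" where Q': "cdec Q'" "\<And>x. P' x = (\<exists>n. Q' (x, n))" by (rule reE[OF assms(2)]) blast
  let ?Q = "\<lambda>p. Q (fst p, fst (prod_decode (snd p))) \<and> Q' (fst p, snd (prod_decode (snd p)))"
  have "cdec ?Q" by (intro cd_conj cd_comp[OF Q(1)] cd_comp[OF Q'(1)] comp_intros)
  moreover have "(P x \<and> P' x) = (\<exists>n. ?Q (x, n))" for x
  proof
    assume "P x \<and> P' x"
    then obtain n m where "Q (x, n)" "Q' (x, m)" using Q Q' by auto
    then show "\<exists>n. ?Q (x, n)" by (intro exI[of _ "prod_encode (n, m)"]) simp
  qed (use Q Q' in auto)
  ultimately show ?thesis unfolding re_def by blast
qed

lemma re_disj: assumes "re P" "re P'" shows "re (\<lambda>x. P x \<or> P' x)"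
proof -
  obtain Q :: "_ \<times> nat \<Rightarrow> bool" where Q: "cdec Q" "\<And>x. P x = (\<exists>n. Q (x, n))" by (rule reE[OF assms(1)]) blast
  obtain Q' :: "_ \<times> nat \<Rightarrow> bool" where Q': "cdec Q'" "\<And>x. P' x = (\<exists>n. Q' (x, n))" by (rule reE[OF assms(2)]) blast
  have "cdec (\<lambda>p. Q p \<or> Q' p)" by (intro cd_disj Q Q')
  then show ?thesis unfolding re_def by (intro exI[of _ "\<lambda>p. Q p \<or> Q' p"]) (auto simp: Q Q')
qed

text \<open>Finitely many witnesses have a common bound. Searching for this bound instead of the
  witnesses leaves only bounded quantifiers in the decidable core.\<close>

lemma re_ball:
  fixes n :: "'a::coded \<Rightarrow> nat"
  assumes "re (\<lambda>p. P (fst p) (snd p))" "computable n" shows "re (\<lambda>x. \<forall>i<n x. P x i)"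
proof -
  obtain Q :: "_ \<times> nat \<Rightarrow> bool" where Q: "cdec Q" "\<And>p. P (fst p) (snd p) = (\<exists>n. Q (p, n))"
    by (rule reE[OF assms(1)]) blast
  let ?Q = "\<lambda>p. \<forall>i<n (fst p). \<exists>m<snd p. Q ((fst p, i), m)"
  have "cdec (\<lambda>q. Q ((fst (fst (fst q)), snd (fst q)), snd q))"
    by (intro cd_comp[OF Q(1)] comp_intros)
  then have "cdec ?Q" by (intro comp_intros c_comp[OF assms(2)])
  moreover have "(\<forall>i<n x. P x i) = (\<exists>N. ?Q (x, N))" for x
  proof
    assume *: "\<forall>i<n x. P x i"
    have "\<exists>N. \<forall>i<k. \<exists>m<N. Q ((x, i), m)" if "k \<le> n x" for k
      using that
    proof (induction k)
      case (Suc k)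
      then obtain N where N: "\<forall>i<k. \<exists>m<N. Q ((x, i), m)" by auto
      have "P x k" using * Suc.prems by auto
      then obtain m where "Q ((x, k), m)" using Q(2)[of "(x, k)"] by auto
      have "\<exists>l<max N (Suc m). Q ((x, i), l)" if "i < Suc k" for i
      proof (cases "i = k")
        case True
        then show ?thesis using \<open>Q ((x, k), m)\<close> by (intro exI[of _ m]) auto
      next
        case False
        with that have "i < k" by simp
        then obtain l where "l < N" "Q ((x, i), l)" using N by blast
        then show ?thesis by (intro exI[of _ l]) auto
      qed
      then show ?case by blast
    qed simp
    then show "\<exists>N. ?Q (x, N)" by auto
  qed (use Q(2)[of "(x, _)"] in auto)
  ultimately show ?thesis unfolding re_def by blast
qed

text \<open>Post's argument: minimisation finds the first stage at which one of the two searches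
  succeeds, and on \<open>V\<close> exactly one of them can.\<close>

lemma re_imp_decidable_on:
  fixes P N :: "nat \<Rightarrow> bool"
  assumes "re P" "re N" and V: "\<And>c. c \<in> V \<Longrightarrow> P c \<longleftrightarrow> \<not> N c"
  shows "decidable_on V P"
proof -
  obtain Q :: "_ \<times> nat \<Rightarrow> bool" where Q: "cdec Q" "\<And>x. P x = (\<exists>n. Q (x, n))" by (rule reE[OF assms(1)]) blast
  obtain Q' :: "_ \<times> nat \<Rightarrow> bool" where Q': "cdec Q'" "\<And>x. N x = (\<exists>n. Q' (x, n))" by (rule reE[OF assms(2)]) blast
  \<comment> \<open>\<open>Mn\<close> stops at a zero, hence the complemented truth value.\<close>
  have "computable (\<lambda>p. 1 - of_bool (Q (snd p, fst p) \<or> Q' (snd p, fst p)) :: nat)"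
    using cd_disj[OF cd_comp[OF Q(1), of "\<lambda>p. (snd p, fst p)"] cd_comp[OF Q'(1), of "\<lambda>p. (snd p, fst p)"]]
    by (intro comp_intros) (auto simp: cdec_def comp_intros)
  then have s: "rc 1 (\<lambda>xs. 1 - of_bool (Q (snd (prod_decode (xs ! 0)), fst (prod_decode (xs ! 0))) \<or> Q' (snd (prod_decode (xs ! 0)), fst (prod_decode (xs ! 0)))))"
    unfolding computable_rc by (simp add: dec_prod_def)
  have "rc 2 (\<lambda>xs. 1 - of_bool (Q (xs ! 1, xs ! 0) \<or> Q' (xs ! 1, xs ! 0)))"
    using rc_comp1[OF s rc_pair[OF rc_proj[of 0 2] rc_proj[of 1 2]]] by simp
  then obtain r where r: "\<And>xs. length xs = 2 \<Longrightarrow> reval r xs (1 - of_bool (Q (xs ! 1, xs ! 0) \<or> Q' (xs ! 1, xs ! 0)))"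
    by (auto simp: rc_def)
  have "rc 1 (\<lambda>xs. of_bool (Q (prod_decode (xs ! 0))))"
    using Q(1) unfolding cdec_def computable_rc by (simp add: dec_prod_def map_prod_def)
  from rc_comp1[OF this rc_pair[OF rc_proj[of 0 2] rc_proj[of 1 2]]]
  obtain t where t: "\<And>xs. length xs = 2 \<Longrightarrow> reval t xs (of_bool (Q (xs ! 0, xs ! 1)))"
    by (auto simp: rc_def)
  have "reval (Comp t [Proj 0, Mn r]) [c] (if P c then 1 else 0)" if c: "c \<in> V" for c
  proof -
    define F where "F n \<longleftrightarrow> Q (c, n) \<or> Q' (c, n)" for n
    have "\<exists>n. F n" using V[OF c] Q(2)[of c] Q'(2)[of c] by (auto simp: F_def)
    then have L: "F (LEAST n. F n)" by (rule LeastI_ex)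
    let ?n = "LEAST n. F n"
    have "reval (Mn r) [c] ?n"
    proof (rule reval.intros(7))
      have "(of_bool (Q (c, ?n) \<or> Q' (c, ?n)) :: nat) = 1" using L unfolding F_def by simp
      then show "reval r [?n, c] 0" using r[of "[?n, c]"] by (simp del: of_bool_or_iff)
      show "\<forall>m<?n. \<exists>y. reval r [m, c] (Suc y)"
      proof (intro allI impI)
        fix m assume "m < ?n"
        then have "\<not> F m" by (rule not_less_Least)
        then have "reval r [m, c] (Suc 0)" using r[of "[m, c]"] by (simp add: F_def)
        then show "\<exists>y. reval r [m, c] (Suc y)" by blast
      qed
    qed
    moreover have "reval (Proj 0) [c] c" using reval.intros(3)[of 0 "[c]"] by simp
    moreover have "reval t [c, ?n] (of_bool (Q (c, ?n)))" using t[of "[c, ?n]"] by simp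
    ultimately have "reval (Comp t [Proj 0, Mn r]) [c] (of_bool (Q (c, ?n)))"
      by (intro reval.intros(4)[of "[c, ?n]"]) (auto simp: less_Suc_eq nth_Cons')
    moreover have "Q (c, ?n) \<longleftrightarrow> P c"
      using L V[OF c] Q(2)[of c] Q'(2)[of c] by (auto simp: F_def)
    ultimately show ?thesis by (simp add: of_bool_def)
  qed
  then show ?thesis unfolding decidable_on_def by blast
qed

section \<open>The polynomials attached to an instance\<close>

type_synonym cpoly = "ipoly \<times> ipoly"

section \<open>Arithmetic of complex-valued polynomials\<close>

definition cadd :: "cpoly \<Rightarrow> cpoly \<Rightarrow> cpoly" where
  "cadd p q = (fst p @ fst q, snd p @ snd q)"
definition cmul :: "cpoly \<Rightarrow> cpoly \<Rightarrow> cpoly" where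
  "cmul p q = (pmul (fst p) (fst q) @ pscale (-1) (pmul (snd p) (snd q)),
               pmul (fst p) (snd q) @ pmul (snd p) (fst q))"
definition ccnj :: "cpoly \<Rightarrow> cpoly" where
  "ccnj p = (fst p, pscale (-1) (snd p))"
definition psq :: "ipoly \<Rightarrow> ipoly" where
  "psq p = pmul p p"
definition cabs2 :: "cpoly \<Rightarrow> ipoly" where
  "cabs2 p = psq (fst p) @ psq (snd p)"
definition csum :: "cpoly list \<Rightarrow> cpoly" where
  "csum l = (concat (map fst l), concat (map snd l))"
definition cvar :: "nat \<Rightarrow> cpoly" where
  "cvar i = ([(1, [i])], [(1, [Suc i])])"
definition cconst :: "int \<Rightarrow> int \<Rightarrow> cpoly" where
  "cconst a b = ([(a, [])], [(b, [])])"
definition chorner :: "int list \<Rightarrow> cpoly \<Rightarrow> cpoly" where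
  "chorner l w = foldl (\<lambda>acc a. cadd (cconst a 0) (cmul w acc)) ([], []) (rev l)"

text \<open>A zero denominator in a rational code means the value 0, hence the case distinctions;
  squaring the denominator makes \<open>rden\<close> positive.\<close>

definition rden :: "nat \<Rightarrow> int" where
  "rden r = (if int_decode (snd (prod_decode r)) = 0 then 1
     else int_decode (snd (prod_decode r)) * int_decode (snd (prod_decode r)))"
definition rnum :: "nat \<Rightarrow> int" where
  "rnum r = (if int_decode (snd (prod_decode r)) = 0 then 0
     else int_decode (fst (prod_decode r)) * int_decode (snd (prod_decode r)))"

text \<open>The slack variable \<open>s\<close> turns an inequality between \<open>z v\<close> and the rational \<open>r\<close> (lower bound for
  \<open>b = 1\<close>, upper bound for \<open>b = -1\<close>) into an equation.\<close>

definition slack :: "int \<Rightarrow> nat \<Rightarrow> nat \<Rightarrow> nat \<Rightarrow> ipoly" where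
  "slack b r v s = [(b * rden r, [v]), (- (b * rnum r), []), (-1, [s, s])]"

definition rect_code :: "nat \<Rightarrow> nat \<Rightarrow> nat" where
  "rect_code a i = nth0 (list_decode (snd (prod_decode a))) i"

text \<open>The algebraic number with code \<open>a\<close> occupies the variables \<open>6 * a\<close> (real part) and
  \<open>6 * a + 1\<close> (imaginary part); \<open>6 * a + 2\<close> to \<open>6 * a + 5\<close> are slacks for its rectangle.\<close>

definition con :: "nat \<Rightarrow> ipoly" where
  "con a = cabs2 (chorner (map int_decode (list_decode (fst (prod_decode a)))) (cvar (6 * a)))
     @ psq (slack 1 (rect_code a 0) (6 * a) (6 * a + 2))
     @ psq (slack (-1) (rect_code a 1) (6 * a) (6 * a + 3))
     @ psq (slack 1 (rect_code a 2) (6 * a + 1) (6 * a + 4))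
     @ psq (slack (-1) (rect_code a 3) (6 * a + 1) (6 * a + 5))"

section \<open>The automaton read off its code\<close>

definition dd :: "nat \<Rightarrow> nat" where "dd c = nth0 (list_decode c) 0"
definition kk :: "nat \<Rightarrow> nat" where "kk c = nth0 (list_decode c) 1"
definition SS :: "nat \<Rightarrow> nat list" where "SS c = list_decode (nth0 (list_decode c) 2)"
definition UU :: "nat \<Rightarrow> nat list list list" where
  "UU c = map (\<lambda>m. map list_decode (list_decode m)) (list_decode (nth0 (list_decode c) 3))"
definition BB :: "nat \<Rightarrow> nat list list" where
  "BB c = map list_decode (list_decode (nth0 (list_decode c) 4))"
definition LL :: "nat \<Rightarrow> nat" where "LL c = nth0 (list_decode c) 5"

definition codes :: "nat \<Rightarrow> nat list" where
  "codes c = SS c @ concat (concat (UU c)) @ concat (BB c) @ [LL c]"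

text \<open>Every block of variables up to number \<open>c\<close> is constrained: blocks of codes
  foreign to the instance are forced to 0, so that the zero set is bounded in all variables below
  \<open>X0 c\<close>.\<close>

definition CON :: "nat \<Rightarrow> ipoly" where
  "CON c = concat (map (\<lambda>a. if a \<in> set (codes c) then con a
      else concat (map (\<lambda>r. [(1, [6 * a + r, 6 * a + r])]) [0..<6])) [0..<Suc c])"

definition X0 :: "nat \<Rightarrow> nat" where "X0 c = 6 * Suc c"

definition S0 :: "nat \<Rightarrow> cpoly list" where
  "S0 c = map (\<lambda>a. cvar (6 * a)) (SS c)"
definition MV :: "nat \<Rightarrow> nat \<Rightarrow> cpoly list \<Rightarrow> cpoly list" where
  "MV c \<sigma> xs = map (\<lambda>i. csum (map (\<lambda>j. cmul (cvar (6 * nth0 (nth0 (nth0 (UU c) \<sigma>) i) j)) (nth0 xs j)) [0..<dd c])) [0..<dd c]"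
definition WV :: "nat \<Rightarrow> nat list \<Rightarrow> cpoly list" where
  "WV c u = foldl (\<lambda>v \<sigma>. MV c \<sigma> v) (S0 c) u"
definition XV :: "nat \<Rightarrow> cpoly list" where
  "XV c = map (\<lambda>j. cvar (X0 c + 2 * j)) [0..<dd c]"
definition CV :: "nat \<Rightarrow> cpoly list" where
  "CV c = map (\<lambda>l. cvar (X0 c + 2 * dd c + 2 * l)) [0..<length (BB c)]"
definition BV :: "nat \<Rightarrow> cpoly list \<Rightarrow> cpoly list" where
  "BV c cs = map (\<lambda>j. csum (map (\<lambda>l. cmul (nth0 cs l) (cvar (6 * nth0 (nth0 (BB c) l) j))) [0..<length (BB c)])) [0..<dd c]"
text \<open>Multiplying the threshold by the squared norm of the vector makes the form homogeneous
  in \<open>cs\<close>; its sign alone then tells whether the normalised vector exceeds the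
  threshold.\<close>

definition hform :: "nat \<Rightarrow> cpoly list \<Rightarrow> cpoly list \<Rightarrow> ipoly" where
  "hform c cs xs = cabs2 (csum (map (\<lambda>j. cmul (ccnj (nth0 (BV c cs) j)) (nth0 xs j)) [0..<dd c]))
     @ pscale (-1) (pmul [(1, [6 * LL c])] (concat (map (\<lambda>j. cabs2 (nth0 (BV c cs) j)) [0..<dd c])))"
definition sph :: "cpoly list \<Rightarrow> ipoly" where
  "sph vs = psq ((-1, []) # concat (map cabs2 vs))"

text \<open>Variables below \<open>X\<close> hold the input numbers and stay. From \<open>X\<close>
  on, even offsets are real parts and odd offsets imaginary parts of the state that
  \<open>xs\<close> replaces.\<close>

definition sub1 :: "nat \<Rightarrow> cpoly list \<Rightarrow> nat \<Rightarrow> ipoly" where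
  "sub1 X xs i = (if i < X then [(1, [i])] else if (i - X) mod 2 = 0 then fst (nth0 xs ((i - X) div 2))
     else snd (nth0 xs ((i - X) div 2)))"
definition psub :: "nat \<Rightarrow> cpoly list \<Rightarrow> ipoly \<Rightarrow> ipoly" where
  "psub X xs q = concat (map (\<lambda>t. pscale (fst t) (foldl (\<lambda>acc i. pmul acc (sub1 X xs i)) [(1, [])] (snd t))) q)"

text \<open>Base \<open>2 * R * s + 1\<close> digits, shifted to be symmetric about 0, are the
  numerators of a grid point with mesh \<open>1 / s\<close> in the box of radius
  \<open>R\<close>.\<close>

definition digit :: "nat \<Rightarrow> nat \<Rightarrow> nat \<Rightarrow> nat \<Rightarrow> int" where
  "digit R s N i = int (N div (2 * R * s + 1) ^ i mod (2 * R * s + 1)) + - int (R * s)"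

text \<open>The grid test bounds the variation of \<open>P\<close> between grid points of mesh \<open>1 / s\<close> by a Lipschitz
  constant on the box; both sides are multiplied by a power of \<open>s\<close> to stay in the integers.\<close>

definition grid :: "nat \<Rightarrow> nat \<Rightarrow> ipoly \<Rightarrow> nat \<Rightarrow> bool" where
  "grid n R P s \<longleftrightarrow> 0 < s \<and> (\<forall>N<(2 * R * s + 1) ^ n.
     int (pnorm P * pdeg P * R ^ pdeg P * s ^ pdeg P) <
     int s * (\<Sum>t\<leftarrow>P. fst t * int (s ^ (pdeg P - length (snd t))) * prod_list (map (digit R s N) (snd t))))"

text \<open>Sums of degrees and of norms bound both polynomials at once, as the gap theorem
  requires; the reciprocal is the gap of that theorem.\<close>

definition gapn :: "nat \<Rightarrow> ipoly \<Rightarrow> ipoly \<Rightarrow> nat" where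
  "gapn n p h = 2 * gapb n (pdeg p + pdeg h) (pnorm p + pnorm h)"

text \<open>With \<open>G = gapn n p h\<close>, positivity of \<open>G * K * p - G * h + 1\<close>
  on the box shows that \<open>h\<close> is below \<open>1 / G\<close> wherever
  \<open>p = 0\<close>. The penalty weight \<open>K\<close> and the grid resolution \<open>s\<close>
  are found by search.\<close>

definition LEc :: "nat \<Rightarrow> nat \<Rightarrow> ipoly \<Rightarrow> ipoly \<Rightarrow> bool" where
  "LEc n R p h \<longleftrightarrow> (\<exists>K s. grid n R (pscale (int (gapn n p h * K)) p @ pscale (- int (gapn n p h)) h @ [(1, [])]) s)"

text \<open>The square of a slack variable for a code \<open>a\<close> is at most
  \<open>(a * a + 1) * a + a * a\<close>, hence at most \<open>(a + 2) ^ 3\<close>; one more bounds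
  the slack itself, and all codes are at most \<open>c\<close>. State and coefficient variables are
  at most 1 on their spheres.\<close>

definition RR :: "nat \<Rightarrow> nat" where "RR c = (c + 2) ^ 3 + 1"

text \<open>Integer coefficients suffice in \<open>cs\<close>, since the form is homogeneous and
  continuous. The weight \<open>K\<close> penalises points of the box that do not satisfy the
  equations for the input numbers.\<close>

definition POS :: "nat \<Rightarrow> bool" where
  "POS c \<longleftrightarrow> 0 < kk c \<and> (\<exists>u cs K s. (\<forall>\<sigma>\<in>set u. \<sigma> < kk c) \<and>
     grid (X0 c) (RR c) (pscale (int K) (CON c) @ hform c (map (\<lambda>p. cconst (fst p) (snd p)) cs) (WV c u)) s)"

text \<open>The witness \<open>q\<close> defines a variety that contains the initial state, is invariant under all letters
  within the unit sphere, and on which the acceptance condition fails; vectors of the accepting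
  subspace are parametrised by coefficient vectors of norm 1.\<close>

definition NEG :: "nat \<Rightarrow> bool" where
  "NEG c \<longleftrightarrow> kk c = 0 \<or> (\<exists>q. (\<forall>t\<in>set q. \<forall>i\<in>set (snd t). i < X0 c + 2 * dd c) \<and>
     LEc (X0 c) (RR c) (CON c) (psq (psub (X0 c) (S0 c) q)) \<and>
     (\<forall>\<sigma><kk c. LEc (X0 c + 2 * dd c) (RR c) (CON c @ psq q @ sph (XV c)) (psq (psub (X0 c) (MV c \<sigma> (XV c)) q))) \<and>
     LEc (X0 c + 2 * dd c + 2 * length (BB c)) (RR c) (CON c @ psq q @ sph (XV c) @ sph (CV c)) (hform c (CV c) (XV c)))"

section \<open>Computability of the searches\<close>

text \<open>Each constant is shown computable on a tuple of arguments once; these rules turn that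
  fact into an introduction rule for arbitrary computable arguments.\<close>

lemma c_lift1: "computable f \<Longrightarrow> computable a \<Longrightarrow> computable (\<lambda>x. f (a x))"
  by (rule c_comp)
lemma c_lift2: "computable (\<lambda>p. f (fst p) (snd p)) \<Longrightarrow> computable a \<Longrightarrow> computable b \<Longrightarrow> computable (\<lambda>x. f (a x) (b x))"
  using c_comp[of "\<lambda>p. f (fst p) (snd p)" "\<lambda>x. (a x, b x)"] by (simp add: c_Pair)
lemma c_lift3: "computable (\<lambda>p. f (fst p) (fst (snd p)) (snd (snd p))) \<Longrightarrow> computable a \<Longrightarrow> computable b \<Longrightarrow>
    computable d \<Longrightarrow> computable (\<lambda>x. f (a x) (b x) (d x))"
  using c_comp[of "\<lambda>p. f (fst p) (fst (snd p)) (snd (snd p))" "\<lambda>x. (a x, b x, d x)"] by (simp add: c_Pair)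
lemma c_lift4: "computable (\<lambda>p. f (fst p) (fst (snd p)) (fst (snd (snd p))) (snd (snd (snd p)))) \<Longrightarrow> computable a \<Longrightarrow> computable b \<Longrightarrow>
    computable d \<Longrightarrow> computable e \<Longrightarrow> computable (\<lambda>x. f (a x) (b x) (d x) (e x))"
  using c_comp[of "\<lambda>p. f (fst p) (fst (snd p)) (fst (snd (snd p))) (snd (snd (snd p)))" "\<lambda>x. (a x, b x, d x, e x)"] by (simp add: c_Pair)

lemma c_pscale0: "computable (\<lambda>p. pscale (fst p) (snd p))" unfolding pscale_def by (intro comp_intros)
lemmas [comp_intros] = c_lift2[OF c_pscale0]
lemma c_pmul0: "computable (\<lambda>p. pmul (fst p) (snd p))" unfolding pmul_def by (intro comp_intros)
lemmas [comp_intros] = c_lift2[OF c_pmul0]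
lemma c_pdeg0: "computable pdeg" unfolding pdeg_def by (intro comp_intros)
lemmas [comp_intros] = c_lift1[OF c_pdeg0]
lemma c_pnorm0: "computable pnorm" unfolding pnorm_def by (intro comp_intros)
lemmas [comp_intros] = c_lift1[OF c_pnorm0]
lemma c_cadd0: "computable (\<lambda>p. cadd (fst p) (snd p))" unfolding cadd_def by (intro comp_intros)
lemmas [comp_intros] = c_lift2[OF c_cadd0]
lemma c_cmul0: "computable (\<lambda>p. cmul (fst p) (snd p))" unfolding cmul_def by (intro comp_intros)
lemmas [comp_intros] = c_lift2[OF c_cmul0]
lemma c_ccnj0: "computable ccnj" unfolding ccnj_def by (intro comp_intros)
lemmas [comp_intros] = c_lift1[OF c_ccnj0]
lemma c_psq0: "computable psq" unfolding psq_def by (intro comp_intros)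
lemmas [comp_intros] = c_lift1[OF c_psq0]
lemma c_cabs20: "computable cabs2" unfolding cabs2_def by (intro comp_intros)
lemmas [comp_intros] = c_lift1[OF c_cabs20]
lemma c_csum0: "computable csum" unfolding csum_def by (intro comp_intros)
lemmas [comp_intros] = c_lift1[OF c_csum0]
lemma c_cvar0: "computable cvar" unfolding cvar_def by (intro comp_intros)
lemmas [comp_intros] = c_lift1[OF c_cvar0]
lemma c_cconst0: "computable (\<lambda>p. cconst (fst p) (snd p))" unfolding cconst_def by (intro comp_intros)
lemmas [comp_intros] = c_lift2[OF c_cconst0]
lemma c_chorner0: "computable (\<lambda>p. chorner (fst p) (snd p))" unfolding chorner_def by (intro comp_intros)
lemmas [comp_intros] = c_lift2[OF c_chorner0]
lemma c_rden0: "computable rden" unfolding rden_def by (intro comp_intros)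
lemmas [comp_intros] = c_lift1[OF c_rden0]
lemma c_rnum0: "computable rnum" unfolding rnum_def by (intro comp_intros)
lemmas [comp_intros] = c_lift1[OF c_rnum0]
lemma c_slack0: "computable (\<lambda>p. slack (fst p) (fst (snd p)) (fst (snd (snd p))) (snd (snd (snd p))))"
  unfolding slack_def by (intro comp_intros)
lemmas [comp_intros] = c_lift4[OF c_slack0]
lemma c_rect_code0: "computable (\<lambda>p. rect_code (fst p) (snd p))" unfolding rect_code_def by (intro comp_intros)
lemmas [comp_intros] = c_lift2[OF c_rect_code0]
lemma c_con0: "computable con" unfolding con_def by (intro comp_intros)
lemmas [comp_intros] = c_lift1[OF c_con0]
lemma c_dd0: "computable dd" unfolding dd_def by (intro comp_intros)
lemmas [comp_intros] = c_lift1[OF c_dd0]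
lemma c_kk0: "computable kk" unfolding kk_def by (intro comp_intros)
lemmas [comp_intros] = c_lift1[OF c_kk0]
lemma c_SS0: "computable SS" unfolding SS_def by (intro comp_intros)
lemmas [comp_intros] = c_lift1[OF c_SS0]
lemma c_UU0: "computable UU" unfolding UU_def by (intro comp_intros)
lemmas [comp_intros] = c_lift1[OF c_UU0]
lemma c_BB0: "computable BB" unfolding BB_def by (intro comp_intros)
lemmas [comp_intros] = c_lift1[OF c_BB0]
lemma c_LL0: "computable LL" unfolding LL_def by (intro comp_intros)
lemmas [comp_intros] = c_lift1[OF c_LL0]
lemma c_codes0: "computable codes" unfolding codes_def by (intro comp_intros)
lemmas [comp_intros] = c_lift1[OF c_codes0]
lemma c_CON0: "computable CON" unfolding CON_def by (intro comp_intros)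
lemmas [comp_intros] = c_lift1[OF c_CON0]
lemma c_X00: "computable X0" unfolding X0_def by (intro comp_intros)
lemmas [comp_intros] = c_lift1[OF c_X00]
lemma c_S00: "computable S0" unfolding S0_def by (intro comp_intros)
lemmas [comp_intros] = c_lift1[OF c_S00]
lemma c_MV0: "computable (\<lambda>p. MV (fst p) (fst (snd p)) (snd (snd p)))" unfolding MV_def by (intro comp_intros)
lemmas [comp_intros] = c_lift3[OF c_MV0]
lemma c_WV0: "computable (\<lambda>p. WV (fst p) (snd p))" unfolding WV_def by (intro comp_intros)
lemmas [comp_intros] = c_lift2[OF c_WV0]
lemma c_XV0: "computable XV" unfolding XV_def by (intro comp_intros)
lemmas [comp_intros] = c_lift1[OF c_XV0]
lemma c_CV0: "computable CV" unfolding CV_def by (intro comp_intros)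
lemmas [comp_intros] = c_lift1[OF c_CV0]
lemma c_BV0: "computable (\<lambda>p. BV (fst p) (snd p))" unfolding BV_def by (intro comp_intros)
lemmas [comp_intros] = c_lift2[OF c_BV0]
lemma c_hform0: "computable (\<lambda>p. hform (fst p) (fst (snd p)) (snd (snd p)))" unfolding hform_def by (intro comp_intros)
lemmas [comp_intros] = c_lift3[OF c_hform0]
lemma c_sph0: "computable sph" unfolding sph_def by (intro comp_intros)
lemmas [comp_intros] = c_lift1[OF c_sph0]
lemma c_sub10: "computable (\<lambda>p. sub1 (fst p) (fst (snd p)) (snd (snd p)))" unfolding sub1_def by (intro comp_intros)
lemmas [comp_intros] = c_lift3[OF c_sub10]
lemma c_psub0: "computable (\<lambda>p. psub (fst p) (fst (snd p)) (snd (snd p)))" unfolding psub_def by (intro comp_intros)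
lemmas [comp_intros] = c_lift3[OF c_psub0]
lemma c_gapb0: "computable (\<lambda>p. gapb (fst p) (fst (snd p)) (snd (snd p)))" unfolding gapb_def by (intro comp_intros)
lemmas [comp_intros] = c_lift3[OF c_gapb0]
lemma c_gapn0: "computable (\<lambda>p. gapn (fst p) (fst (snd p)) (snd (snd p)))" unfolding gapn_def by (intro comp_intros)
lemmas [comp_intros] = c_lift3[OF c_gapn0]
lemma c_RR0: "computable RR" unfolding RR_def by (intro comp_intros)
lemmas [comp_intros] = c_lift1[OF c_RR0]
lemma c_digit0: "computable (\<lambda>p. digit (fst p) (fst (snd p)) (fst (snd (snd p))) (snd (snd (snd p))))"
  unfolding digit_def by (intro comp_intros)
lemmas [comp_intros] = c_lift4[OF c_digit0]

lemma cd_grid0: "cdec (\<lambda>p. grid (fst p) (fst (snd p)) (fst (snd (snd p))) (snd (snd (snd p))))"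
  unfolding grid_def by (intro comp_intros)

lemma cd_grid [comp_intros]:
  assumes "computable a" "computable b" "computable f" "computable g"
  shows "cdec (\<lambda>x. grid (a x) (b x) (f x) (g x))"
  using cd_comp[OF cd_grid0, of "\<lambda>x. (a x, b x, f x, g x)"] assms by (simp add: c_Pair)

lemma re_LEc:
  assumes "computable a" "computable b" "computable f" "computable g"
  shows "re (\<lambda>x. LEc (a x) (b x) (f x) (g x))"
  unfolding LEc_def
  by (intro re_ex re_dec comp_intros c_comp[OF assms(1)] c_comp[OF assms(2)] c_comp[OF assms(3)] c_comp[OF assms(4)])

lemma re_POS: "re POS"
  unfolding POS_def by (intro re_conj re_ex re_dec comp_intros)

lemma re_NEG: "re NEG"
  unfolding NEG_def
  by (intro re_conj re_disj re_ex re_ball re_LEc; (intro re_dec)?; intro comp_intros)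

section \<open>Correctness of the positivity test\<close>

lemma mon_lipschitz:
  fixes R \<eta> :: real
  assumes "\<And>i. i \<in> set m \<Longrightarrow> \<bar>z i\<bar> \<le> R \<and> \<bar>w i\<bar> \<le> R \<and> \<bar>z i - w i\<bar> \<le> \<eta>" and R: "R \<ge> 1" and e: "\<eta> \<ge> 0"
  shows "\<bar>mon m z - mon m w\<bar> \<le> length m * R ^ length m * \<eta>"
  using assms(1)
proof (induction m)
  case (Cons i m)
  have IH: "\<bar>mon m z - mon m w\<bar> \<le> length m * R ^ length m * \<eta>" using Cons by auto
  have w: "\<bar>mon m w\<bar> \<le> R ^ length m" using Cons.prems by (intro abs_mon_le) auto
  have "mon (i # m) z - mon (i # m) w = z i * (mon m z - mon m w) + (z i - w i) * mon m w"
    by (simp add: algebra_simps)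
  then have "\<bar>mon (i # m) z - mon (i # m) w\<bar> \<le> \<bar>z i\<bar> * \<bar>mon m z - mon m w\<bar> + \<bar>z i - w i\<bar> * \<bar>mon m w\<bar>"
    by (metis abs_mult abs_triangle_ineq)
  also have "\<dots> \<le> R * (length m * R ^ length m * \<eta>) + \<eta> * R ^ length m"
    using IH w Cons.prems[of i] R e by (intro add_mono mult_mono) auto
  also have "\<dots> \<le> R * (length m * R ^ length m * \<eta>) + \<eta> * (R * R ^ length m)"
    using R e by (intro add_mono mult_left_mono) (auto simp: mult_le_cancel_right1)
  also have "\<dots> = length (i # m) * R ^ length (i # m) * \<eta>" by (simp add: algebra_simps)
  finally show ?case .
qed simp

lemma ev_lipschitz:
  fixes R \<eta> :: real
  assumes v: "vars_in V P" and b: "\<And>i. i \<in> V \<Longrightarrow> \<bar>z i\<bar> \<le> R \<and> \<bar>w i\<bar> \<le> R \<and> \<bar>z i - w i\<bar> \<le> \<eta>"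
    and R: "R \<ge> 1" and e: "\<eta> \<ge> 0" and d: "deg_le E P"
  shows "\<bar>ev P z - ev P w\<bar> \<le> pnorm P * E * R ^ E * \<eta>"
  using v d
proof (induction P)
  case (Cons t P)
  have l: "length (snd t) \<le> E" using Cons.prems by (auto simp: deg_le_def)
  have "\<bar>mon (snd t) z - mon (snd t) w\<bar> \<le> length (snd t) * R ^ length (snd t) * \<eta>"
    using Cons.prems b by (intro mon_lipschitz R e) auto
  also have "\<dots> \<le> E * R ^ E * \<eta>"
    using l R e by (intro mult_mono power_increasing) auto
  finally have m: "\<bar>mon (snd t) z - mon (snd t) w\<bar> \<le> E * R ^ E * \<eta>" .
  have "\<bar>ev (t # P) z - ev (t # P) w\<bar> = \<bar>of_int (fst t) * (mon (snd t) z - mon (snd t) w) + (ev P z - ev P w)\<bar>"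
    by (simp add: algebra_simps)
  also have "\<dots> \<le> \<bar>of_int (fst t)\<bar> * \<bar>mon (snd t) z - mon (snd t) w\<bar> + \<bar>ev P z - ev P w\<bar>"
    by (metis abs_mult abs_triangle_ineq)
  also have "\<dots> \<le> real (nat \<bar>fst t\<bar>) * (E * R ^ E * \<eta>) + pnorm P * E * R ^ E * \<eta>"
    using m Cons by (intro add_mono mult_mono) (auto simp: deg_le_def)
  finally show ?case by (simp add: algebra_simps)
qed simp

lemma grid_sum:
  assumes s: "s > 0" and d: "deg_le E P"
  shows "real_of_int (\<Sum>t\<leftarrow>P. fst t * int (s ^ (E - length (snd t))) * prod_list (map f (snd t)))
    = real s ^ E * ev P (\<lambda>i. of_int (f i) / real s)"
  using d
proof (induction P)
  case (Cons t P)
  have m: "real_of_int (prod_list (map f m)) = real s ^ length m * mon m (\<lambda>i. of_int (f i) / real s)" for m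
    using s by (induction m) auto
  have "length (snd t) \<le> E" using Cons.prems by (auto simp: deg_le_def)
  then have "real s ^ (E - length (snd t)) * real s ^ length (snd t) = real s ^ E"
    by (simp add: power_add[symmetric])
  then have "real_of_int (fst t * int (s ^ (E - length (snd t))) * prod_list (map f (snd t)))
     = real s ^ E * (of_int (fst t) * mon (snd t) (\<lambda>i. of_int (f i) / real s))"
    by (simp add: m algebra_simps)
  with Cons show ?case by (simp add: deg_le_def distrib_left)
qed simp

text \<open>Rounding each coordinate down to a multiple of \<open>1 / s\<close> leads to a grid
  point, where the value exceeds the Lipschitz bound for a displacement of \<open>1 / s\<close>. The
  sign therefore survives the way back.\<close>

lemma grid_imp_pos:
  assumes v: "vars_in {..<n} P" and R: "R \<ge> 1" and g: "grid n R P s" and z: "\<And>i. i < n \<Longrightarrow> \<bar>z i\<bar> \<le> real R"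
  shows "ev P z > 0"
proof -
  have s: "s > 0" using g by (simp add: grid_def)
  have fl: "- int (R * s) \<le> \<lfloor>z i * s\<rfloor> \<and> \<lfloor>z i * s\<rfloor> \<le> int (R * s)" if "i < n" for i
  proof -
    have "\<bar>z i * s\<bar> \<le> real R * s" using z[OF that] by (simp add: abs_mult mult_right_mono)
    then have "real_of_int (- int (R * s)) \<le> z i * s" "z i * s \<le> real_of_int (int (R * s))" by auto
    then show ?thesis unfolding le_floor_iff floor_le_iff by linarith
  qed
  have "\<forall>i<n. nat (\<lfloor>z i * s\<rfloor> + int (R * s)) < 2 * R * s + 1"
  proof (intro allI impI)
    fix i assume "i < n"
    from fl[OF this] have "\<lfloor>z i * s\<rfloor> + int (R * s) < int (2 * R * s + 1)" by simp
    then show "nat (\<lfloor>z i * s\<rfloor> + int (R * s)) < 2 * R * s + 1" by linarith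
  qed
  from digits_exist[OF this] obtain N where N: "N < (2 * R * s + 1) ^ n"
    "\<forall>i<n. N div (2 * R * s + 1) ^ i mod (2 * R * s + 1) = nat (\<lfloor>z i * s\<rfloor> + int (R * s))" by blast
  have dg: "digit R s N i = \<lfloor>z i * s\<rfloor>" if "i < n" for i
    using N(2) that fl[OF that] by (simp add: digit_def)
  define w where "w i = real_of_int (digit R s N i) / real s" for i
  define E where "E = pdeg P"
  have b: "\<bar>z i\<bar> \<le> R \<and> \<bar>w i\<bar> \<le> R \<and> \<bar>z i - w i\<bar> \<le> 1 / s" if "i \<in> {..<n}" for i
  proof -
    have i: "i < n" using that by simp
    have "\<bar>real_of_int \<lfloor>z i * s\<rfloor>\<bar> \<le> real (R * s)" using fl[OF i] by (metis abs_le_iff minus_le_iff of_int_abs of_int_le_iff of_int_of_nat_eq)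
    then have "\<bar>w i\<bar> \<le> R" using s by (simp add: w_def dg[OF i] abs_divide divide_le_eq)
    moreover have "\<bar>z i * s - \<lfloor>z i * s\<rfloor>\<bar> \<le> 1" by linarith
    then have "\<bar>(z i * s - \<lfloor>z i * s\<rfloor>) / s\<bar> \<le> 1 / s" using s by (simp add: abs_divide divide_right_mono)
    then have "\<bar>z i - w i\<bar> \<le> 1 / s" using s by (simp add: w_def dg[OF i] diff_divide_distrib)
    ultimately show ?thesis using z[OF i] by blast
  qed
  have "\<bar>ev P z - ev P w\<bar> \<le> pnorm P * E * real R ^ E * (1 / s)"
    using R by (intro ev_lipschitz[OF v b]) (auto simp: E_def deg_le_pdeg)
  moreover have "real (pnorm P * E * R ^ E * s ^ E) < real s * (real s ^ E * ev P w)"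
  proof -
    have "int (pnorm P * E * R ^ E * s ^ E) < int s * (\<Sum>t\<leftarrow>P. fst t * int (s ^ (E - length (snd t))) * prod_list (map (digit R s N) (snd t)))"
      using g N(1) unfolding grid_def E_def by blast
    then have "real_of_int (int (pnorm P * E * R ^ E * s ^ E)) < real_of_int (int s * (\<Sum>t\<leftarrow>P. fst t * int (s ^ (E - length (snd t))) * prod_list (map (digit R s N) (snd t))))"
      by (simp only: of_int_less_iff)
    then show ?thesis
      unfolding of_int_mult of_int_of_nat_eq grid_sum[OF s deg_le_pdeg[of P], folded E_def] w_def .
  qed
  then have "s ^ E * (pnorm P * E * real R ^ E) < s ^ E * (real s * ev P w)" by (simp add: algebra_simps)
  then have "pnorm P * E * real R ^ E < real s * ev P w" using s by (simp add: mult_less_cancel_left_pos)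
  then have "pnorm P * E * real R ^ E * (1 / s) < ev P w" using s by (simp add: field_simps)
  ultimately show ?thesis by linarith
qed

text \<open>On the compact box the minimum is positive, and a fine enough mesh makes the Lipschitz
  bound smaller than it.\<close>

lemma pos_imp_grid:
  assumes v: "vars_in {..<n} P" and R: "R \<ge> 1" and p: "\<And>z. (\<And>i. i < n \<Longrightarrow> \<bar>z i\<bar> \<le> real R) \<Longrightarrow> ev P z > 0"
  shows "\<exists>s. grid n R P s"
proof -
  have "(\<lambda>_. 0) \<in> cbx n (real R)" by (auto simp: cbx_def)
  then obtain z0 where z0: "z0 \<in> cbx n (real R)" "\<And>z. z \<in> cbx n (real R) \<Longrightarrow> ev P z0 \<le> ev P z"
    using continuous_attains_inf[OF compact_cbx _ continuous_on_ev, of n "real R" P] by blast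
  define \<mu> where "\<mu> = ev P z0"
  have mu: "\<mu> > 0" unfolding \<mu>_def using z0(1) by (intro p) (auto simp: cbx_def)
  have low: "\<mu> \<le> ev P w" if "\<And>i. i < n \<Longrightarrow> \<bar>w i\<bar> \<le> real R" for w
  proof -
    have "ev P w = ev P (\<lambda>i. if i < n then w i else 0)" by (rule ev_cong[OF v]) auto
    moreover have "(\<lambda>i. if i < n then w i else 0) \<in> cbx n (real R)" using that by (auto simp: cbx_def)
    ultimately show ?thesis using z0(2) by (simp add: \<mu>_def)
  qed
  define E where "E = pdeg P"
  obtain s0 :: nat where "(pnorm P * E * real R ^ E) / \<mu> < s0" using reals_Archimedean2 by blast
  define s where "s = Suc s0"
  have s: "s > 0" by (simp add: s_def)
  have "(pnorm P * E * real R ^ E) / \<mu> < real s" using \<open>_ < real s0\<close> by (simp add: s_def)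
  then have big: "pnorm P * E * real R ^ E < s * \<mu>" using mu by (simp add: divide_less_eq)
  have "grid n R P s" unfolding grid_def E_def[symmetric]
  proof (intro conjI s allI impI)
    fix N assume "N < (2 * R * s + 1) ^ n"
    define w where "w i = real_of_int (digit R s N i) / real s" for i
    have "\<bar>w i\<bar> \<le> R" for i
    proof -
      have "N div (2 * R * s + 1) ^ i mod (2 * R * s + 1) < 2 * R * s + 1" by simp
      then have "\<bar>digit R s N i\<bar> \<le> int (R * s)" unfolding digit_def by linarith
      then have "\<bar>real_of_int (digit R s N i)\<bar> \<le> real (R * s)" by (metis of_int_abs of_int_le_iff of_int_of_nat_eq)
      then show ?thesis using s by (simp add: w_def abs_divide divide_le_eq)
    qed
    then have "s * \<mu> \<le> s * ev P w" using low by (intro mult_left_mono) auto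
    then have "pnorm P * E * real R ^ E < s * ev P w" using big by linarith
    then have "pnorm P * E * real R ^ E * s ^ E < s * ev P w * s ^ E"
      using s by (intro mult_strict_right_mono) auto
    then have "real_of_int (int (pnorm P * E * R ^ E * s ^ E)) < real_of_int (int s * (\<Sum>t\<leftarrow>P. fst t * int (s ^ (E - length (snd t))) * prod_list (map (digit R s N) (snd t))))"
      unfolding of_int_mult of_int_of_nat_eq grid_sum[OF s deg_le_pdeg[of P], folded E_def] w_def by (simp add: algebra_simps)
    then show "int (pnorm P * E * R ^ E * s ^ E) < int s * (\<Sum>t\<leftarrow>P. fst t * int (s ^ (E - length (snd t))) * prod_list (map (digit R s N) (snd t)))"
      by (simp only: of_int_less_iff)
  qed
  then show ?thesis ..
qed

text \<open>If every weight failed, the counterexamples would accumulate at a point of the box with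
  \<open>p = 0\<close> and \<open>g \<le> 0\<close>.\<close>

lemma penalty_pos:
  assumes v: "vars_in {..<n} p" "vars_in {..<n} g" and p: "\<And>z. ev p z \<ge> 0"
    and g: "\<And>z. ev p z = 0 \<Longrightarrow> ev g z > 0"
  shows "\<exists>K::nat. \<forall>z. (\<forall>i<n. \<bar>z i\<bar> \<le> R) \<longrightarrow> real K * ev p z + ev g z > 0"
proof (rule ccontr)
  assume "\<not> ?thesis"
  then have "\<forall>K::nat. \<exists>z. (\<forall>i<n. \<bar>z i\<bar> \<le> R) \<and> real K * ev p z + ev g z \<le> 0" by (auto simp: not_less)
  then obtain Z where Z: "\<And>K i. i < n \<Longrightarrow> \<bar>Z K i\<bar> \<le> R" "\<And>K. real K * ev p (Z K) + ev g (Z K) \<le> 0" by metis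
  define Y where "Y K i = (if i < n then Z K i else 0)" for K i
  have same: "ev p (Y K) = ev p (Z K)" "ev g (Y K) = ev g (Z K)" for K
    by (auto intro!: ev_cong[OF v(1)] ev_cong[OF v(2)] simp: Y_def)
  have "Y K \<in> cbx n R" for K using Z(1) by (auto simp: cbx_def Y_def)
  then obtain r y where r: "strict_mono r" and y: "\<And>i. (\<lambda>s. Y (r s) i) \<longlonglongrightarrow> y i"
    using cbx_subsequence[of Y] by metis
  have lim: "(\<lambda>s. ev q (Y (r s))) \<longlonglongrightarrow> ev q y" for q
    by (rule tendsto_ev[of UNIV]) (auto intro: y simp: vars_in_def)
  have rinf: "filterlim (\<lambda>s. real (r s)) at_top sequentially"
    by (rule filterlim_compose[OF filterlim_real_sequentially filterlim_subseq[OF r]])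
  have le: "real (r s) * ev p (Y (r s)) \<le> - ev g (Y (r s))" for s using Z(2)[of "r s"] same by simp
  have "ev p y \<le> 0"
  proof (rule tendsto_le[OF sequentially_bot _ lim])
    have "(\<lambda>s. - ev g (Y (r s)) * inverse (real (r s))) \<longlonglongrightarrow> - ev g y * 0"
      by (intro tendsto_intros lim tendsto_inverse_0_at_top rinf)
    then show "(\<lambda>s. - ev g (Y (r s)) * inverse (real (r s))) \<longlonglongrightarrow> 0" by simp
    have "\<forall>\<^sub>F s in sequentially. real (r s) > 0" using rinf unfolding filterlim_at_top_dense by blast
    then show "\<forall>\<^sub>F s in sequentially. ev p (Y (r s)) \<le> - ev g (Y (r s)) * inverse (real (r s))"
    proof eventually_elim
      case (elim s)
      then show ?case using le[of s] by (simp add: field_simps)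
    qed
  qed
  then have "ev p y = 0" using p[of y] by simp
  then have pos: "ev g y > 0" by (rule g)
  have "ev g (Y (r s)) \<le> 0" for s using le[of s] p[of "Y (r s)"]
    by (smt (verit) mult_nonneg_nonneg of_nat_0_le_iff)
  then have "ev g y \<le> 0" by (intro LIMSEQ_le_const2[OF lim]) auto
  with pos show False by simp
qed

text \<open>A certificate only shows \<open>h < 1 / G\<close> on the zero set; the gap theorem
  sharpens this to \<open>h \<le> 0\<close>. Conversely \<open>h \<le> 0\<close> leaves a margin of
  1, so a penalty weight and a mesh exist.\<close>

lemma LEc_iff:
  assumes v: "vars_in {..<n} p" "vars_in {..<n} h" and p: "\<And>z. ev p z \<ge> 0"
    and box: "\<And>z i. ev p z = 0 \<Longrightarrow> i < n \<Longrightarrow> \<bar>z i\<bar> \<le> real R" and R: "R \<ge> 1"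
  shows "LEc n R p h \<longleftrightarrow> (\<forall>z. ev p z = 0 \<longrightarrow> ev h z \<le> 0)"
proof -
  define G where "G = gapn n p h"
  have G: "G > 0" by (simp add: G_def gapn_def gapb_def)
  define P where "P K = pscale (int (G * K)) p @ pscale (- int G) h @ [(1, [])]" for K
  have evP: "ev (P K) z = real G * K * ev p z - real G * ev h z + 1" for K z by (simp add: P_def)
  have vP: "vars_in {..<n} (P K)" for K using v by (simp add: P_def)
  have L: "LEc n R p h \<longleftrightarrow> (\<exists>K s. grid n R (P K) s)" by (simp add: LEc_def P_def G_def)
  show ?thesis
  proof
    assume "LEc n R p h"
    then obtain K s where g: "grid n R (P K) s" using L by blast
    \<comment> \<open>The gap theorem is about minima, hence the sign change of
      \<open>h\<close>.\<close>
    interpret penalty n "pdeg p + pdeg h" "pnorm p + pnorm h" p "pscale (-1) h"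
    proof
      show "vars_in {..<n} p" "vars_in {..<n} (pscale (-1) h)" using v by auto
      show "deg_le (pdeg p + pdeg h) p" using deg_le_pdeg[of p] by (rule deg_le_mono) simp
      have "deg_le (pdeg p + pdeg h) h" using deg_le_pdeg[of h] by (rule deg_le_mono) simp
      then show "deg_le (pdeg p + pdeg h) (pscale (-1) h)" by (auto simp: deg_le_def pscale_set)
    qed (use p in auto)
    show "\<forall>z. ev p z = 0 \<longrightarrow> ev h z \<le> 0"
    proof (intro allI impI)
      fix z assume z: "ev p z = 0"
      have "0 \<le> ev (pscale (-1) h) z"
      proof (rule gap[OF _ z])
        fix w assume w: "ev p w = 0"
        have "ev (P K) w > 0" by (rule grid_imp_pos[OF vP R g]) (use box[OF w] in auto)
        then have "real G * ev h w < 1" using w by (simp add: evP)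
        then have "ev h w < 1 / G" using G by (simp add: field_simps)
        then show "ev (pscale (-1) h) w > - 1 / (2 * real (gapb n (pdeg p + pdeg h) (pnorm p + pnorm h)))"
          by (simp add: G_def gapn_def)
      qed
      then show "ev h z \<le> 0" by simp
    qed
  next
    assume h: "\<forall>z. ev p z = 0 \<longrightarrow> ev h z \<le> 0"
    have "\<exists>K::nat. \<forall>z. (\<forall>i<n. \<bar>z i\<bar> \<le> real R) \<longrightarrow> real K * ev p z + ev (pscale (- int G) h @ [(1, [])]) z > 0"
    proof (rule penalty_pos)
      fix z assume "ev p z = 0"
      then have "real G * ev h z \<le> 0" using h by (simp add: mult_nonneg_nonpos)
      then show "0 < ev (pscale (- int G) h @ [(1, [])]) z" by simp
    qed (use v p in auto)
    then obtain K :: nat where K: "\<And>z. (\<forall>i<n. \<bar>z i\<bar> \<le> real R) \<Longrightarrow> real K * ev p z - real G * ev h z + 1 > 0"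
      by (auto simp: algebra_simps)
    have "\<exists>s. grid n R (P K) s"
    proof (rule pos_imp_grid[OF vP R])
      fix z assume "\<And>i. i < n \<Longrightarrow> \<bar>z i\<bar> \<le> real R"
      then have "real K * ev p z - real G * ev h z + 1 > 0" by (intro K) auto
      \<comment> \<open>The certificate carries the weight \<open>G * K\<close>, which is at least
        \<open>K\<close> because \<open>G \<ge> 1\<close>.\<close>
      moreover have "1 * (real K * ev p z) \<le> real G * (real K * ev p z)"
        using G p[of z] by (intro mult_right_mono) auto
      ultimately show "ev (P K) z > 0" by (simp add: evP mult.assoc)
    qed
    then show "LEc n R p h" using L by blast
  qed
qed

section \<open>Meaning of the polynomials of a valid instance\<close>

definition cev :: "cpoly \<Rightarrow> (nat \<Rightarrow> real) \<Rightarrow> complex" where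
  "cev p z = Complex (ev (fst p) z) (ev (snd p) z)"

definition cvars :: "nat set \<Rightarrow> cpoly \<Rightarrow> bool" where
  "cvars V p \<longleftrightarrow> vars_in V (fst p) \<and> vars_in V (snd p)"

lemma ev_psq [simp]: "ev (psq p) z = (ev p z)\<^sup>2"
  by (simp add: psq_def power2_eq_square)

lemma cev_simps [simp]:
  "cev (cadd p q) z = cev p z + cev q z"
  "cev (cmul p q) z = cev p z * cev q z"
  "cev (ccnj p) z = cnj (cev p z)"
  "cev (cvar i) z = Complex (z i) (z (Suc i))"
  "cev (cconst a b) z = Complex (of_int a) (of_int b)"
  "cev (csum l) z = (\<Sum>p\<leftarrow>l. cev p z)"
proof -
  show "cev (csum l) z = (\<Sum>p\<leftarrow>l. cev p z)"
    by (induction l) (auto simp: cev_def csum_def complex_eq_iff)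
qed (auto simp: cev_def cadd_def cmul_def ccnj_def cvar_def cconst_def complex_eq_iff)

lemma ev_cabs2 [simp]: "ev (cabs2 p) z = (cmod (cev p z))\<^sup>2"
  by (simp add: cabs2_def cev_def cmod_power2)

lemma cev_chorner: "cev (chorner l w) z = (\<Sum>i<length l. of_int (l ! i) * cev w z ^ i)"
proof (induction l)
  case Nil
  then show ?case by (simp add: chorner_def cev_def zero_complex.code)
next
  case (Cons a l)
  have "cev (chorner (a # l) w) z = of_int a + cev w z * cev (chorner l w) z"
    by (simp add: chorner_def complex_eq_iff)
  also have "\<dots> = (\<Sum>i<length (a # l). of_int ((a # l) ! i) * cev w z ^ i)"
    unfolding Cons length_Cons sum.lessThan_Suc_shift
    by (simp add: sum_distrib_left algebra_simps)
  finally show ?case .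
qed

lemma sum_list_upt_lessThan: "(\<Sum>j\<leftarrow>[0..<d]. f j) = (\<Sum>j<d. f j)"
  by (induction d) (auto simp: add.commute)

lemma nth0_map_upt [simp]: "j < d \<Longrightarrow> nth0 (map f [0..<d]) j = f j"
  by (simp add: nth0_def)

lemma ev_psub: "ev (psub X xs q) z = ev q (\<lambda>i. if i < X then z i
    else if (i - X) mod 2 = 0 then Re (cev (nth0 xs ((i - X) div 2)) z) else Im (cev (nth0 xs ((i - X) div 2)) z))"
    (is "_ = ev q ?\<theta>")
proof -
  have s: "ev (sub1 X xs i) z = ?\<theta> i" for i by (simp add: sub1_def cev_def)
  have "ev (foldl (\<lambda>acc i. pmul acc (sub1 X xs i)) P m) z = ev P z * mon m ?\<theta>" for m P
    by (induction m arbitrary: P) (auto simp: s)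
  then have "ev (foldl (\<lambda>acc i. pmul acc (sub1 X xs i)) [(1, [])] m) z = mon m ?\<theta>" for m by simp
  then show ?thesis by (induction q) (auto simp: psub_def)
qed

lemma vars_in_psq [simp]: "vars_in V p \<Longrightarrow> vars_in V (psq p)" by (simp add: psq_def)

lemma cvars_intros:
  "cvars V p \<Longrightarrow> cvars V q \<Longrightarrow> cvars V (cmul p q)"
  "cvars V p \<Longrightarrow> cvars V q \<Longrightarrow> cvars V (cadd p q)"
  "cvars V p \<Longrightarrow> cvars V (ccnj p)"
  "(\<And>p. p \<in> set l \<Longrightarrow> cvars V p) \<Longrightarrow> cvars V (csum l)"
  "i \<in> V \<Longrightarrow> Suc i \<in> V \<Longrightarrow> cvars V (cvar i)"
  "cvars V (cconst a b)"
  by (auto simp: cvars_def cmul_def cadd_def ccnj_def csum_def cvar_def cconst_def vars_in_concat)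

lemma vars_in_cabs2: "cvars V p \<Longrightarrow> vars_in V (cabs2 p)"
  by (simp add: cvars_def cabs2_def)

lemma cvars_chorner: "cvars V w \<Longrightarrow> cvars V (chorner l w)"
proof (induction l)
  case (Cons a l)
  have "chorner (a # l) w = cadd (cconst a 0) (cmul w (chorner l w))" by (simp add: chorner_def)
  with Cons show ?case by (auto intro!: cvars_intros)
qed (simp add: chorner_def cvars_def)

lemma vars_in_psub:
  assumes "\<And>t i. t \<in> set q \<Longrightarrow> i \<in> set (snd t) \<Longrightarrow> vars_in V (sub1 X xs i)"
  shows "vars_in V (psub X xs q)"
proof -
  have "vars_in V (foldl (\<lambda>acc i. pmul acc (sub1 X xs i)) P m)"
    if "vars_in V P" "\<And>i. i \<in> set m \<Longrightarrow> vars_in V (sub1 X xs i)" for m P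
    using that by (induction m arbitrary: P) auto
  then show ?thesis using assms by (auto simp: psub_def vars_in_concat intro!: vars_in_pscale)
qed

section \<open>Codes of rational and algebraic numbers\<close>

lemma rden_pos: "rden r > 0"
  by (auto simp: rden_def zero_less_mult_iff)

lemma rat_val_eq: "rat_val r = of_int (rnum r) / of_int (rden r)"
  by (auto simp: rat_val_def rnum_def rden_def split: prod.splits)

lemma abs_int_decode_le: "\<bar>int_decode x\<bar> \<le> int x"
  by (auto simp: int_decode_def sum_decode_def) presburger

lemma prod_decode_le: "fst (prod_decode r) \<le> r" "snd (prod_decode r) \<le> r"
  by (metis le_prod_encode_1 prod.collapse prod_decode_inverse)
     (metis le_prod_encode_2 prod.collapse prod_decode_inverse)

lemma list_decode_less: "x \<in> set (list_decode n) \<Longrightarrow> x < n"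
proof (induction n rule: list_decode.induct)
  case (2 n)
  obtain a b where ab: "prod_decode n = (a, b)" by (cases "prod_decode n")
  have "a \<le> n" "b \<le> n" using prod_decode_le[of n] by (auto simp: ab)
  moreover have "x = a \<or> x \<in> set (list_decode b)" using 2(2) by (simp add: ab)
  ultimately show ?case using 2(1)[OF ab[symmetric]] by auto
qed simp

lemma nth0_list_decode_le: "nth0 (list_decode c) i \<le> c"
  by (auto simp: nth0_def dest: nth_mem intro!: less_imp_le[OF list_decode_less])

lemma rden_le: "rden r \<le> int r * int r + 1"
proof -
  let ?d = "int_decode (snd (prod_decode r))"
  have d: "\<bar>?d\<bar> \<le> int r" using abs_int_decode_le[of "snd (prod_decode r)"] prod_decode_le(2)[of r] by linarith
  have "?d * ?d \<le> int r * int r" using mult_mono[OF d d] by (simp add: abs_mult_self_eq)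
  then show ?thesis by (simp add: rden_def)
qed

lemma abs_rnum_le: "\<bar>rnum r\<bar> \<le> int r * int r"
proof -
  let ?d = "int_decode (snd (prod_decode r))" and ?n = "int_decode (fst (prod_decode r))"
  have d: "\<bar>?d\<bar> \<le> int r" using abs_int_decode_le[of "snd (prod_decode r)"] prod_decode_le(2)[of r] by linarith
  have n: "\<bar>?n\<bar> \<le> int r" using abs_int_decode_le[of "fst (prod_decode r)"] prod_decode_le(1)[of r] by linarith
  have "\<bar>?n * ?d\<bar> \<le> int r * int r" using mult_mono[OF n d] by (simp add: abs_mult)
  then show ?thesis by (simp add: rnum_def)
qed

lemma abs_rat_val_le: "\<bar>rat_val r\<bar> \<le> real r"
proof (cases "int_decode (snd (prod_decode r)) = 0")
  case False
  let ?d = "int_decode (snd (prod_decode r))" and ?n = "int_decode (fst (prod_decode r))"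
  have "\<bar>rat_val r\<bar> = \<bar>real_of_int ?n\<bar> / \<bar>real_of_int ?d\<bar>" by (simp add: rat_val_def split: prod.splits)
  also have "\<dots> \<le> \<bar>real_of_int ?n\<bar> / 1" using False by (intro divide_left_mono) auto
  also have "\<dots> \<le> real (fst (prod_decode r))" using abs_int_decode_le[of "fst (prod_decode r)"] by linarith
  also have "\<dots> \<le> real r" using prod_decode_le(1)[of r] by simp
  finally show ?thesis .
qed (auto simp: rat_val_def split: prod.splits)

lemma ev_slack [simp]: "ev (slack b r v s) z = of_int b * (of_int (rden r) * z v - of_int (rnum r)) - (z s)\<^sup>2"
  by (simp add: slack_def algebra_simps power2_eq_square)

lemma rect_code_le: "rect_code a i \<le> a"
  using nth0_list_decode_le[of "snd (prod_decode a)" i] prod_decode_le(2)[of a] by (simp add: rect_code_def)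

lemma alg_rect_nth: "length (alg_rect a) = 4 \<Longrightarrow> i < 4 \<Longrightarrow> alg_rect a ! i = rat_val (rect_code a i)"
  by (simp add: alg_rect_def rect_code_def nth0_def)

lemma rat_val_le_iff: "rat_val r \<le> x \<longleftrightarrow> of_int (rnum r) \<le> of_int (rden r) * x"
  and le_rat_val_iff: "x \<le> rat_val r \<longleftrightarrow> of_int (rden r) * x \<le> of_int (rnum r)"
  using rden_pos[of r] by (auto simp: rat_val_eq field_simps)

lemma ev_con: "ev (con a) z = (cmod (\<Sum>i<length (alg_coeffs a). of_int (alg_coeffs a ! i) * Complex (z (6 * a)) (z (6 * a + 1)) ^ i))\<^sup>2
     + (ev (slack 1 (rect_code a 0) (6 * a) (6 * a + 2)) z)\<^sup>2
     + (ev (slack (-1) (rect_code a 1) (6 * a) (6 * a + 3)) z)\<^sup>2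
     + (ev (slack 1 (rect_code a 2) (6 * a + 1) (6 * a + 4)) z)\<^sup>2
     + (ev (slack (-1) (rect_code a 3) (6 * a + 1) (6 * a + 5)) z)\<^sup>2"
  unfolding con_def by (simp add: cev_chorner alg_coeffs_def del: ev_slack)

lemma sum5_sq_eq_0: "A\<^sup>2 + B\<^sup>2 + C\<^sup>2 + D\<^sup>2 + E\<^sup>2 = 0 \<Longrightarrow> A = 0 \<and> B = 0 \<and> C = 0 \<and> D = 0 \<and> E = (0::real)"
  by (smt (verit) zero_eq_power2 zero_le_power2)

text \<open>All squares vanish, so the first two variables form a root inside the rectangle, which
  isolates exactly one. The rectangle bounds these variables by \<open>a\<close>, and the slack
  equations then bound the others.\<close>

lemma con_eq_0D:
  assumes ok: "alg_ok a" and z: "ev (con a) z = 0"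
  shows "Complex (z (6 * a)) (z (6 * a + 1)) = alg_val a" "\<And>r. r < 6 \<Longrightarrow> \<bar>z (6 * a + r)\<bar> \<le> real ((a + 2) ^ 3 + 1)"
proof -
  let ?w = "Complex (z (6 * a)) (z (6 * a + 1))"
  note Z = sum5_sq_eq_0[OF z[unfolded ev_con]]
  have len: "length (alg_rect a) = 4" and ex: "\<exists>!z. alg_prop a z" using ok by (auto simp: alg_ok_def)
  have root: "(\<Sum>i<length (alg_coeffs a). of_int (alg_coeffs a ! i) * ?w ^ i) = 0" using Z by simp
  have s: "of_int (rden (rect_code a 0)) * z (6 * a) - of_int (rnum (rect_code a 0)) = (z (6 * a + 2))\<^sup>2"
    "- (of_int (rden (rect_code a 1)) * z (6 * a) - of_int (rnum (rect_code a 1))) = (z (6 * a + 3))\<^sup>2"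
    "of_int (rden (rect_code a 2)) * z (6 * a + 1) - of_int (rnum (rect_code a 2)) = (z (6 * a + 4))\<^sup>2"
    "- (of_int (rden (rect_code a 3)) * z (6 * a + 1) - of_int (rnum (rect_code a 3))) = (z (6 * a + 5))\<^sup>2"
    using Z by auto
  have r: "rat_val (rect_code a 0) \<le> z (6 * a)" "z (6 * a) \<le> rat_val (rect_code a 1)"
     "rat_val (rect_code a 2) \<le> z (6 * a + 1)" "z (6 * a + 1) \<le> rat_val (rect_code a 3)"
    unfolding rat_val_le_iff le_rat_val_iff
    using s zero_le_power2[of "z (6 * a + 2)"] zero_le_power2[of "z (6 * a + 3)"]
      zero_le_power2[of "z (6 * a + 4)"] zero_le_power2[of "z (6 * a + 5)"] by linarith+
  have "alg_prop a ?w" unfolding alg_prop_def using root r by (simp add: alg_rect_nth[OF len])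
  then show "?w = alg_val a" unfolding alg_val_def using ex by (metis (mono_tags) the1_equality)
  have rv: "\<bar>rat_val (rect_code a i)\<bar> \<le> real a" for i
    using abs_rat_val_le[of "rect_code a i"] rect_code_le[of a i] by (meson le_trans of_nat_mono order_trans)
  have b0: "\<bar>z (6 * a)\<bar> \<le> a" "\<bar>z (6 * a + 1)\<bar> \<le> a"
    using r rv[of 0] rv[of 1] rv[of 2] rv[of 3] by linarith+
  have cube: "real ((a + 2) ^ 3 + 1) = (real a + 2) ^ 3 + 1" by (simp add: add.commute)
  have bs: "\<bar>z i\<bar> \<le> real ((a + 2) ^ 3 + 1)"
    if e: "\<bar>of_int (rden (rect_code a j)) * x - of_int (rnum (rect_code a j))\<bar> = (z i)\<^sup>2" and x: "\<bar>x\<bar> \<le> real a" for i j x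
  proof -
    define \<rho> where "\<rho> = rect_code a j"
    have ra: "int \<rho> * int \<rho> \<le> int a * int a" using rect_code_le[of a j] unfolding \<rho>_def by (intro mult_mono) auto
    have "rden \<rho> \<le> int (a * a + 1)" using rden_le[of \<rho>] ra by simp
    then have 1: "real_of_int (rden \<rho>) \<le> real (a * a + 1)" by (metis of_int_le_iff of_int_of_nat_eq)
    have "\<bar>rnum \<rho>\<bar> \<le> int (a * a)" using abs_rnum_le[of \<rho>] ra by simp
    then have 2: "\<bar>real_of_int (rnum \<rho>)\<bar> \<le> real (a * a)" by (metis of_int_abs of_int_le_iff of_int_of_nat_eq)
    have "(z i)\<^sup>2 \<le> \<bar>of_int (rden \<rho>) * x\<bar> + \<bar>of_int (rnum \<rho>)\<bar>"
      using e unfolding \<rho>_def[symmetric] by (metis abs_triangle_ineq4)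
    also have "\<dots> \<le> real (a * a + 1) * real a + real (a * a)"
      using 1 2 x rden_pos[of \<rho>] by (intro add_mono) (auto simp: abs_mult intro!: mult_mono)
    also have "\<dots> \<le> (real a + 2) ^ 3" by (simp add: power3_eq_cube algebra_simps)
    finally have "(z i)\<^sup>2 \<le> (real a + 2) ^ 3" .
    \<comment> \<open>Expanding the square of \<open>\<bar>z i\<bar> - 1 / 2\<close> converts a
      bound on the square into one on the absolute value; this is the origin of the summand 1 in
      \<open>RR\<close>.\<close>
    moreover have "\<bar>z i\<bar> \<le> (z i)\<^sup>2 + 1"
      using zero_le_power2[of "\<bar>z i\<bar> - 1 / 2"] by (simp add: power2_eq_square algebra_simps)
    ultimately show ?thesis unfolding cube by linarith
  qed
  have small: "real a \<le> real ((a + 2) ^ 3 + 1)"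
  proof -
    have "a * 1 \<le> (a + 2) * ((a + 2) * (a + 2))" by (intro mult_mono) auto
    then show ?thesis by (simp add: power3_eq_cube)
  qed
  fix r :: nat assume "r < 6"
  then consider "r = 0" | "r = 1" | "r = 2" | "r = 3" | "r = 4" | "r = 5" by linarith
  then show "\<bar>z (6 * a + r)\<bar> \<le> real ((a + 2) ^ 3 + 1)"
  proof cases
    case 3 show ?thesis unfolding 3 by (rule bs[of 0 "z (6 * a)"]) (use s(1) b0 in auto)
  next
    case 4 show ?thesis unfolding 4 by (rule bs[of 1 "z (6 * a)"]) (use s(2) b0 in \<open>auto simp: abs_minus_commute\<close>)
  next
    case 5 show ?thesis unfolding 5 by (rule bs[of 2 "z (6 * a + 1)"]) (use s(3) b0 in auto)
  next
    case 6 show ?thesis unfolding 6 by (rule bs[of 3 "z (6 * a + 1)"]) (use s(4) b0 in \<open>auto simp: abs_minus_commute\<close>)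
  qed (use b0 small in auto)
qed

lemma con_eq_0I:
  assumes ok: "alg_ok a"
    and z: "z (6 * a) = Re (alg_val a)" "z (6 * a + 1) = Im (alg_val a)"
     "z (6 * a + 2) = sqrt (of_int (rden (rect_code a 0)) * Re (alg_val a) - of_int (rnum (rect_code a 0)))"
     "z (6 * a + 3) = sqrt (of_int (rnum (rect_code a 1)) - of_int (rden (rect_code a 1)) * Re (alg_val a))"
     "z (6 * a + 4) = sqrt (of_int (rden (rect_code a 2)) * Im (alg_val a) - of_int (rnum (rect_code a 2)))"
     "z (6 * a + 5) = sqrt (of_int (rnum (rect_code a 3)) - of_int (rden (rect_code a 3)) * Im (alg_val a))"
  shows "ev (con a) z = 0"
proof -
  have len: "length (alg_rect a) = 4" and ex: "\<exists>!z. alg_prop a z" using ok by (auto simp: alg_ok_def)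
  have P: "alg_prop a (alg_val a)" unfolding alg_val_def by (rule theI'[OF ex])
  have r: "of_int (rnum (rect_code a 0)) \<le> of_int (rden (rect_code a 0)) * Re (alg_val a)"
     "of_int (rden (rect_code a 1)) * Re (alg_val a) \<le> of_int (rnum (rect_code a 1))"
     "of_int (rnum (rect_code a 2)) \<le> of_int (rden (rect_code a 2)) * Im (alg_val a)"
     "of_int (rden (rect_code a 3)) * Im (alg_val a) \<le> of_int (rnum (rect_code a 3))"
    using P unfolding alg_prop_def by (simp_all add: alg_rect_nth[OF len] rat_val_le_iff le_rat_val_iff)
  have "Complex (Re (alg_val a)) (Im (alg_val a)) = alg_val a" by simp
  moreover have "(\<Sum>i<length (alg_coeffs a). of_int (alg_coeffs a ! i) * alg_val a ^ i) = 0"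
    using P by (simp add: alg_prop_def)
  ultimately show ?thesis unfolding ev_con ev_slack z using r by simp
qed

lemma vars_in_con: "vars_in {6 * a..<6 * a + 6} (con a)"
  unfolding con_def
  by (auto simp: slack_def intro!: vars_in_psq vars_in_cabs2 cvars_chorner cvars_intros)

lemma con_nonneg: "ev (con a) z \<ge> 0"
  unfolding ev_con by (simp del: ev_slack)

section \<open>Evaluation of the polynomials of a valid instance\<close>

locale instance_code =
  fixes c :: nat
  assumes valid: "valid_inst c"
begin

lemma inst_length: "length (list_decode c) = 6" using valid by (simp add: valid_inst_def inst_def)

lemma accessors:
  "dd c = i_d c" "kk c = i_k c" "SS c = i_s0c c" "UU c = i_Uc c" "BB c = i_Bc c" "LL c = i_lc c"
  by (simp_all add: dd_def kk_def SS_def UU_def BB_def LL_def i_d_def i_k_def i_s0c_def i_Uc_def i_Bc_def i_lc_def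
      nth0_def inst_length inst_def)

abbreviation "d \<equiv> i_d c"
abbreviation "k \<equiv> i_k c"
abbreviation "m \<equiv> length (i_Bc c)"
abbreviation "R \<equiv> RR c"

lemma lengths:
  "length (i_s0c c) = d" "length (i_Uc c) = k"
  "\<And>\<sigma>. \<sigma> < k \<Longrightarrow> length (i_Uc c ! \<sigma>) = d"
  "\<And>\<sigma> i. \<sigma> < k \<Longrightarrow> i < d \<Longrightarrow> length (i_Uc c ! \<sigma> ! i) = d"
  "\<And>l. l < m \<Longrightarrow> length (i_Bc c ! l) = d"
proof -
  note v = valid[unfolded valid_inst_def]
  show "length (i_s0c c) = d" and U: "length (i_Uc c) = k" using v by auto
  show 1: "length (i_Uc c ! \<sigma>) = d" if "\<sigma> < k" for \<sigma> using v nth_mem[of \<sigma> "i_Uc c"] U that by auto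
  show "length (i_Uc c ! \<sigma> ! i) = d" if "\<sigma> < k" "i < d" for \<sigma> i
  proof -
    have "i_Uc c ! \<sigma> \<in> set (i_Uc c)" "i_Uc c ! \<sigma> ! i \<in> set (i_Uc c ! \<sigma>)"
      using U 1[OF that(1)] that by auto
    then show ?thesis using v by blast
  qed
  show "length (i_Bc c ! l) = d" if "l < m" for l using v nth_mem[of l "i_Bc c"] that by auto
qed

lemma codes_eq: "set (codes c) = set (i_s0c c) \<union> (\<Union>M\<in>set (i_Uc c). \<Union>r\<in>set M. set r) \<union> (\<Union>v\<in>set (i_Bc c). set v) \<union> {i_lc c}"
  by (auto simp: codes_def accessors)

lemma codes_ok: "a \<in> set (codes c) \<Longrightarrow> alg_ok a"
  using valid unfolding valid_inst_def codes_eq by blast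

lemma codes_le: assumes "a \<in> set (codes c)" shows "a \<le> c"
proof -
  have le1: "x \<le> c" if "x \<in> set (list_decode (nth0 (list_decode c) i))" for x i
    using list_decode_less[OF that] nth0_list_decode_le[of c i] by linarith
  from assms consider "a \<in> set (SS c)" | M r where "M \<in> set (UU c)" "r \<in> set M" "a \<in> set r"
    | v where "v \<in> set (BB c)" "a \<in> set v" | "a = LL c" by (auto simp: codes_def)
  then show ?thesis
  proof cases
    case 1 then show ?thesis using le1[of a 2] by (simp add: SS_def)
  next
    case 2
    then obtain x y where "x \<in> set (list_decode (nth0 (list_decode c) 3))" "y \<in> set (list_decode x)" "a \<in> set (list_decode y)"
      by (auto simp: UU_def)
    then show ?thesis using le1[of x 3] list_decode_less[of y x] list_decode_less[of a y] by linarith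
  next
    case 3
    then obtain y where "y \<in> set (list_decode (nth0 (list_decode c) 4))" "a \<in> set (list_decode y)"
      by (auto simp: BB_def)
    then show ?thesis using le1[of y 4] list_decode_less[of a y] by linarith
  next
    case 4 then show ?thesis using nth0_list_decode_le[of c 5] by (simp add: LL_def)
  qed
qed

lemma ev_CON: "ev (CON c) z = (\<Sum>a<Suc c. if a \<in> set (codes c) then ev (con a) z else (\<Sum>r<6. (z (6 * a + r))\<^sup>2))"
proof -
  have e: "ev (concat (map (\<lambda>r. [(1, [6 * a + r, 6 * a + r])]) [0..<6])) z = (\<Sum>r<6. (z (6 * a + r))\<^sup>2)" for a
    unfolding ev_concat map_map sum_list_upt_lessThan[symmetric] by (simp add: o_def power2_eq_square)
  have "ev (CON c) z = (\<Sum>a\<leftarrow>[0..<Suc c]. if a \<in> set (codes c) then ev (con a) z else (\<Sum>r<6. (z (6 * a + r))\<^sup>2))"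
    unfolding CON_def ev_concat[of "map _ [0..<Suc c]"] map_map o_def if_distrib[of "\<lambda>p. ev p z"] e ..
  then show ?thesis by (simp only: sum_list_upt_lessThan)
qed

lemma CON_nonneg: "ev (CON c) z \<ge> 0"
  unfolding ev_CON by (intro sum_nonneg) (auto intro: con_nonneg sum_nonneg)

lemma CON_eq_0_iff: "ev (CON c) z = 0 \<longleftrightarrow> (\<forall>a\<le>c. (a \<in> set (codes c) \<longrightarrow> ev (con a) z = 0) \<and>
    (a \<notin> set (codes c) \<longrightarrow> (\<forall>r<6. z (6 * a + r) = 0)))"
proof -
  have "ev (CON c) z = 0 \<longleftrightarrow> (\<forall>a\<in>{..<Suc c}. (if a \<in> set (codes c) then ev (con a) z else (\<Sum>r<6. (z (6 * a + r))\<^sup>2)) = 0)"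
    unfolding ev_CON by (rule sum_nonneg_eq_0_iff) (auto intro: con_nonneg sum_nonneg)
  moreover have "(\<Sum>r<6. (z (6 * a + r))\<^sup>2) = 0 \<longleftrightarrow> (\<forall>r\<in>{..<6}. (z (6 * a + r))\<^sup>2 = 0)" for a
    by (rule sum_nonneg_eq_0_iff) auto
  ultimately show ?thesis by (auto simp: less_Suc_eq_le split: if_splits)
qed

lemma CON_value:
  assumes "ev (CON c) z = 0" "a \<in> set (codes c)"
  shows "Complex (z (6 * a)) (z (Suc (6 * a))) = alg_val a"
  using assms CON_eq_0_iff con_eq_0D(1)[OF codes_ok[OF assms(2)], of z] codes_le by simp

lemma CON_bound:
  assumes "ev (CON c) z = 0" "i < X0 c"
  shows "\<bar>z i\<bar> \<le> real R"
proof -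
  define a r where "a = i div 6" and "r = i mod 6"
  have i: "i = 6 * a + r" "r < 6" and a: "a \<le> c" using assms(2) by (auto simp: a_def r_def X0_def)
  show ?thesis
  proof (cases "a \<in> set (codes c)")
    case True
    then have "ev (con a) z = 0" using assms CON_eq_0_iff a by auto
    then have "\<bar>z i\<bar> \<le> real ((a + 2) ^ 3 + 1)" using con_eq_0D(2)[OF codes_ok[OF True]] i by simp
    also have "\<dots> \<le> real R" using a unfolding RR_def by (intro of_nat_mono add_mono power_mono) auto
    finally show ?thesis .
  next
    case False
    then show ?thesis using assms CON_eq_0_iff a i by auto
  qed
qed

text \<open>Implications that start from \<open>CON\<close> could otherwise hold vacuously; a zero
  carries them back to the actual automaton. The slacks are square roots, real because each number
  lies in its rectangle.\<close>

lemma CON_solvable: "\<exists>z. ev (CON c) z = 0"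
proof -
  define z where "z i = (let a = i div 6; r = i mod 6 in
     if a \<in> set (codes c) then
       (if r = 0 then Re (alg_val a) else if r = 1 then Im (alg_val a)
        else if r = 2 then sqrt (of_int (rden (rect_code a 0)) * Re (alg_val a) - of_int (rnum (rect_code a 0)))
        else if r = 3 then sqrt (of_int (rnum (rect_code a 1)) - of_int (rden (rect_code a 1)) * Re (alg_val a))
        else if r = 4 then sqrt (of_int (rden (rect_code a 2)) * Im (alg_val a) - of_int (rnum (rect_code a 2)))
        else sqrt (of_int (rnum (rect_code a 3)) - of_int (rden (rect_code a 3)) * Im (alg_val a)))
     else 0)" for i
  have "ev (CON c) z = 0" unfolding CON_eq_0_iff
  proof (intro allI impI conjI)
    fix a assume a: "a \<in> set (codes c)"
    show "ev (con a) z = 0"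
    proof (rule con_eq_0I[OF codes_ok[OF a]])
      have dm: "(6 * a + r) div 6 = a" "(6 * a + r) mod 6 = r" if "r < 6" for r using that by auto
      show "z (6 * a) = Re (alg_val a)" using dm[of 0] a by (simp add: z_def)
      have dm1: "(6 * a + 1) div 6 = a" "(6 * a + 1) mod 6 = 1" by presburger+
      show "z (6 * a + 1) = Im (alg_val a)" unfolding z_def dm1 Let_def using a by simp
      show "z (6 * a + 2) = sqrt (of_int (rden (rect_code a 0)) * Re (alg_val a) - of_int (rnum (rect_code a 0)))"
        using dm[of 2] a by (simp add: z_def)
      show "z (6 * a + 3) = sqrt (of_int (rnum (rect_code a 1)) - of_int (rden (rect_code a 1)) * Re (alg_val a))"
        using dm[of 3] a by (simp add: z_def)
      show "z (6 * a + 4) = sqrt (of_int (rden (rect_code a 2)) * Im (alg_val a) - of_int (rnum (rect_code a 2)))"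
        using dm[of 4] a by (simp add: z_def)
      show "z (6 * a + 5) = sqrt (of_int (rnum (rect_code a 3)) - of_int (rden (rect_code a 3)) * Im (alg_val a))"
        using dm[of 5] a by (simp add: z_def)
    qed
  qed (auto simp: z_def Let_def)
  then show ?thesis by (rule exI[of _ z])
qed

definition Y :: "nat set" where "Y = {..<X0 c}"

lemma vars_in_CON: "vars_in Y (CON c)"
proof -
  have 1: "vars_in Y (con a)" if "a \<le> c" for a
    using vars_in_con by (rule vars_in_mono) (use that in \<open>auto simp: Y_def X0_def\<close>)
  have 2: "vars_in Y (concat (map (\<lambda>r. [(1, [6 * a + r, 6 * a + r])]) [0..<6]))" if "a \<le> c" for a
    using that by (auto simp: vars_in_def Y_def X0_def)
  show ?thesis unfolding CON_def vars_in_concat[of _ "map _ [0..<Suc c]"] using 1 2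
    by (auto simp del: upt_Suc simp: less_Suc_eq_le)
qed

lemma cvars_code: "a \<in> set (codes c) \<Longrightarrow> cvars Y (cvar (6 * a))"
  using codes_le[of a] by (intro cvars_intros) (auto simp: Y_def X0_def)

lemma cvars_code_mono: "Y \<subseteq> V \<Longrightarrow> a \<in> set (codes c) \<Longrightarrow> cvars V (cvar (6 * a))"
  using cvars_code[of a] by (auto simp: cvars_def intro: vars_in_mono)

lemma code_mems:
  "j < d \<Longrightarrow> i_s0c c ! j \<in> set (codes c)"
  "\<sigma> < k \<Longrightarrow> i < d \<Longrightarrow> j < d \<Longrightarrow> i_Uc c ! \<sigma> ! i ! j \<in> set (codes c)"
  "l < m \<Longrightarrow> j < d \<Longrightarrow> i_Bc c ! l ! j \<in> set (codes c)"
  "i_lc c \<in> set (codes c)"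
proof -
  show "j < d \<Longrightarrow> i_s0c c ! j \<in> set (codes c)" using lengths by (auto simp: codes_eq)
  show "i_Uc c ! \<sigma> ! i ! j \<in> set (codes c)" if "\<sigma> < k" "i < d" "j < d"
  proof -
    have "i_Uc c ! \<sigma> \<in> set (i_Uc c)" "i_Uc c ! \<sigma> ! i \<in> set (i_Uc c ! \<sigma>)" "i_Uc c ! \<sigma> ! i ! j \<in> set (i_Uc c ! \<sigma> ! i)"
      using that lengths by auto
    then show ?thesis unfolding codes_eq by blast
  qed
  show "i_Bc c ! l ! j \<in> set (codes c)" if "l < m" "j < d"
  proof -
    have "i_Bc c ! l \<in> set (i_Bc c)" "i_Bc c ! l ! j \<in> set (i_Bc c ! l)" using that lengths by auto
    then show ?thesis unfolding codes_eq by blast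
  qed
  show "i_lc c \<in> set (codes c)" by (simp add: codes_eq)
qed

lemma nth0_in [simp]: "i < length l \<Longrightarrow> nth0 l i = l ! i" by (simp add: nth0_def)

lemma cvars_S0:
  assumes "\<And>a. a \<in> set (codes c) \<Longrightarrow> cvars V (cvar (6 * a))" "j < d"
  shows "cvars V (nth0 (S0 c) j)"
  using assms(2) lengths by (auto simp: S0_def accessors intro!: assms(1) code_mems)

lemma cev_S0: "ev (CON c) z = 0 \<Longrightarrow> j < d \<Longrightarrow> cev (nth0 (S0 c) j) z = i_s0 c j"
  using lengths by (auto simp: S0_def accessors i_s0_def intro!: CON_value code_mems)

lemma cvars_MV:
  assumes "\<And>a. a \<in> set (codes c) \<Longrightarrow> cvars V (cvar (6 * a))" "\<sigma> < k"
    "\<And>j. j < d \<Longrightarrow> cvars V (nth0 xs j)" "i < d"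
  shows "cvars V (nth0 (MV c \<sigma> xs) i)"
  using assms(2-) lengths by (auto simp: MV_def accessors intro!: cvars_intros(1,4) assms(1) code_mems)

lemma cev_MV:
  assumes "ev (CON c) z = 0" "\<sigma> < k" "\<And>j. j < d \<Longrightarrow> cev (nth0 xs j) z = x j" "i < d"
  shows "cev (nth0 (MV c \<sigma> xs) i) z = mat_vec d (i_U c \<sigma>) x i"
proof -
  have "cev (nth0 (MV c \<sigma> xs) i) z = (\<Sum>j\<leftarrow>[0..<d]. cev (cmul (cvar (6 * nth0 (nth0 (nth0 (i_Uc c) \<sigma>) i) j)) (nth0 xs j)) z)"
    using assms(4) by (simp add: MV_def accessors o_def)
  also have "\<dots> = (\<Sum>j<d. cev (cmul (cvar (6 * nth0 (nth0 (nth0 (i_Uc c) \<sigma>) i) j)) (nth0 xs j)) z)"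
    by (rule sum_list_upt_lessThan)
  also have "\<dots> = mat_vec d (i_U c \<sigma>) x i"
    unfolding mat_vec_def i_U_def
    using assms lengths by (intro sum.cong) (auto simp: CON_value[OF assms(1) code_mems(2)])
  finally show ?thesis .
qed

definition Bc :: "(nat \<Rightarrow> complex) \<Rightarrow> nat \<Rightarrow> complex" where
  "Bc \<gamma> j = (\<Sum>l<m. \<gamma> l * (i_B c ! l) j)"

definition hval :: "(nat \<Rightarrow> complex) \<Rightarrow> (nat \<Rightarrow> complex) \<Rightarrow> real" where
  "hval \<gamma> x = (cmod (cinner d (Bc \<gamma>) x))\<^sup>2 - i_lambda c * (\<Sum>j<d. (cmod (Bc \<gamma> j))\<^sup>2)"

lemma cev_BV:
  assumes "ev (CON c) z = 0" "\<And>l. l < m \<Longrightarrow> cev (nth0 cs l) z = \<gamma> l" "j < d"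
  shows "cev (nth0 (BV c cs) j) z = Bc \<gamma> j"
proof -
  have "cev (nth0 (BV c cs) j) z = (\<Sum>l\<leftarrow>[0..<m]. cev (cmul (nth0 cs l) (cvar (6 * nth0 (nth0 (i_Bc c) l) j))) z)"
    using assms(3) by (simp add: BV_def accessors o_def)
  also have "\<dots> = (\<Sum>l<m. cev (cmul (nth0 cs l) (cvar (6 * nth0 (nth0 (i_Bc c) l) j))) z)"
    by (rule sum_list_upt_lessThan)
  also have "\<dots> = Bc \<gamma> j"
    unfolding Bc_def i_B_def
    using assms lengths by (intro sum.cong) (auto simp: CON_value[OF assms(1) code_mems(3)])
  finally show ?thesis .
qed

lemma ev_hform:
  assumes "ev (CON c) z = 0" "\<And>l. l < m \<Longrightarrow> cev (nth0 cs l) z = \<gamma> l" "\<And>j. j < d \<Longrightarrow> cev (nth0 xs j) z = x j"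
  shows "ev (hform c cs xs) z = hval \<gamma> x"
proof -
  have 1: "cev (csum (map (\<lambda>j. cmul (ccnj (nth0 (BV c cs) j)) (nth0 xs j)) [0..<d])) z = cinner d (Bc \<gamma>) x"
  proof -
    have "cev (csum (map (\<lambda>j. cmul (ccnj (nth0 (BV c cs) j)) (nth0 xs j)) [0..<d])) z
      = (\<Sum>j\<leftarrow>[0..<d]. cev (cmul (ccnj (nth0 (BV c cs) j)) (nth0 xs j)) z)" by (simp add: o_def)
    also have "\<dots> = (\<Sum>j<d. cev (cmul (ccnj (nth0 (BV c cs) j)) (nth0 xs j)) z)" by (rule sum_list_upt_lessThan)
    also have "\<dots> = cinner d (Bc \<gamma>) x"
      unfolding cinner_def using assms(3) cev_BV[OF assms(1,2)] by (intro sum.cong) auto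
    finally show ?thesis .
  qed
  have 2: "ev (concat (map (\<lambda>j. cabs2 (nth0 (BV c cs) j)) [0..<d])) z = (\<Sum>j<d. (cmod (Bc \<gamma> j))\<^sup>2)"
  proof -
    have "ev (concat (map (\<lambda>j. cabs2 (nth0 (BV c cs) j)) [0..<d])) z = (\<Sum>j\<leftarrow>[0..<d]. ev (cabs2 (nth0 (BV c cs) j)) z)"
      by (simp add: ev_concat o_def)
    also have "\<dots> = (\<Sum>j<d. ev (cabs2 (nth0 (BV c cs) j)) z)" by (rule sum_list_upt_lessThan)
    also have "\<dots> = (\<Sum>j<d. (cmod (Bc \<gamma> j))\<^sup>2)" using cev_BV[OF assms(1,2)] by (intro sum.cong) auto
    finally show ?thesis .
  qed
  have 3: "z (6 * i_lc c) = i_lambda c"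
    using CON_value[OF assms(1) code_mems(4)] by (simp add: i_lambda_def complex_eq_iff)
  show ?thesis by (simp add: hform_def accessors 1 2 3 hval_def del: cev_simps)
qed

lemma vars_in_hform:
  assumes "Y \<subseteq> V" "\<And>l. l < m \<Longrightarrow> cvars V (nth0 cs l)" "\<And>j. j < d \<Longrightarrow> cvars V (nth0 xs j)"
  shows "vars_in V (hform c cs xs)"
proof -
  have cv: "cvars V (cvar (6 * a))" if "a \<in> set (codes c)" for a
    using cvars_code[OF that] assms(1) by (auto simp: cvars_def intro: vars_in_mono)
  have B: "cvars V (nth0 (BV c cs) j)" if "j < d" for j
    using assms that lengths by (auto simp: BV_def accessors intro!: cvars_intros(1,4) cv code_mems)
  have "cvars V (csum (map (\<lambda>j. cmul (ccnj (nth0 (BV c cs) j)) (nth0 xs j)) [0..<d]))"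
    using B assms(3) by (auto intro!: cvars_intros(1,3,4))
  moreover have "vars_in V (concat (map (\<lambda>j. cabs2 (nth0 (BV c cs) j)) [0..<d]))"
    using B by (auto simp: vars_in_concat intro: vars_in_cabs2)
  moreover have "6 * i_lc c \<in> V" using cv[OF code_mems(4)] by (simp add: cvars_def cvar_def)
  ultimately show ?thesis by (simp add: hform_def accessors vars_in_cabs2)
qed

end

section \<open>Orbits of isometries\<close>

definition nrm :: "nat \<Rightarrow> (nat \<Rightarrow> real) \<Rightarrow> real" where
  "nrm n x = L2_set x {..<n}"

definition ds :: "nat \<Rightarrow> (nat \<Rightarrow> real) \<Rightarrow> (nat \<Rightarrow> real) \<Rightarrow> real" where
  "ds n x y = nrm n (\<lambda>i. x i - y i)"

lemma ds_nonneg [simp]: "ds n x y \<ge> 0" by (simp add: ds_def nrm_def)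

lemma ds_commute: "ds n x y = ds n y x"
  by (simp add: ds_def nrm_def L2_set_def power2_commute)

lemma ds_self [simp]: "ds n x x = 0" by (simp add: ds_def nrm_def L2_set_def)

lemma ds_triangle: "ds n x z \<le> ds n x y + ds n y z"
proof -
  have "L2_set (\<lambda>i. (x i - y i) + (y i - z i)) {..<n} \<le> L2_set (\<lambda>i. x i - y i) {..<n} + L2_set (\<lambda>i. y i - z i) {..<n}"
    by (rule L2_set_triangle_ineq)
  then show ?thesis by (simp add: ds_def nrm_def)
qed

lemma coord_le_nrm: "i < n \<Longrightarrow> \<bar>x i\<bar> \<le> nrm n x"
proof -
  assume "i < n"
  then have "(x i)\<^sup>2 \<le> (\<Sum>i<n. (x i)\<^sup>2)" by (intro member_le_sum) auto
  then have "sqrt ((x i)\<^sup>2) \<le> sqrt (\<Sum>i<n. (x i)\<^sup>2)" by (rule real_sqrt_le_mono)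
  then show ?thesis by (simp add: nrm_def L2_set_def)
qed

lemma tendsto_ds:
  assumes "\<And>i. i < n \<Longrightarrow> ((\<lambda>s. X s i) \<longlongrightarrow> x i) F"
  shows "((\<lambda>s. ds n (X s) x) \<longlongrightarrow> 0) F"
proof -
  have "((\<lambda>s. sqrt (\<Sum>i<n. (X s i - x i)\<^sup>2)) \<longlongrightarrow> sqrt (\<Sum>i<n. (x i - x i)\<^sup>2)) F"
    by (intro tendsto_intros assms) auto
  then show ?thesis by (simp add: ds_def nrm_def L2_set_def)
qed

lemma tendsto_of_ds:
  assumes "((\<lambda>s. ds n (X s) x) \<longlongrightarrow> 0) F" "i < n"
  shows "((\<lambda>s. X s i) \<longlongrightarrow> x i) F"
proof -
  have "((\<lambda>s. X s i - x i) \<longlongrightarrow> 0) F"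
    by (rule Lim_null_comparison[OF _ assms(1)])
       (auto simp: ds_def intro!: always_eventually coord_le_nrm[of i n "\<lambda>i. _ i - x i", OF assms(2)])
  then show ?thesis by (simp add: LIM_zero_iff)
qed

definition usph :: "nat \<Rightarrow> (nat \<Rightarrow> real) set" where
  "usph n = {x. (\<forall>i\<ge>n. x i = 0) \<and> nrm n x = 1}"

lemma continuous_coord: "continuous_on S (\<lambda>x::nat \<Rightarrow> real. x i)"
  by (rule continuous_on_subset[OF continuous_on_product_coordinates]) auto

lemma compact_usph: "compact (usph n)"
proof -
  have "continuous_on UNIV (\<lambda>x. nrm n x)"
    unfolding nrm_def L2_set_def by (intro continuous_intros continuous_coord)
  then have "closed {x. nrm n x = 1}" by (intro closed_Collect_eq) auto
  then have "compact (cbx n 1 \<inter> {x. nrm n x = 1})" by (intro compact_Int_closed compact_cbx)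
  moreover have "cbx n 1 \<inter> {x. nrm n x = 1} = usph n"
  proof (rule Set.set_eqI)
    fix x
    have "\<bar>x i\<bar> \<le> nrm n x" if "i < n" for i by (rule coord_le_nrm[OF that])
    then show "x \<in> cbx n 1 \<inter> {x. nrm n x = 1} \<longleftrightarrow> x \<in> usph n"
      unfolding cbx_def usph_def Int_iff mem_Collect_eq by metis
  qed
  ultimately show ?thesis by simp
qed

section \<open>Recurrence and the orbit closure\<close>

locale isometries =
  fixes n k :: nat and A :: "nat \<Rightarrow> nat \<Rightarrow> nat \<Rightarrow> real" and s0 :: "nat \<Rightarrow> real"
  assumes iso: "\<And>\<sigma> x. \<sigma> < k \<Longrightarrow> nrm n (\<lambda>i. \<Sum>j<n. A \<sigma> i j * x j) = nrm n x"
    and k: "k > 0" and s0: "s0 \<in> usph n"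
begin

definition T :: "nat \<Rightarrow> (nat \<Rightarrow> real) \<Rightarrow> nat \<Rightarrow> real" where
  "T \<sigma> x = (\<lambda>i. if i < n then \<Sum>j<n. A \<sigma> i j * x j else 0)"

definition Tw :: "nat list \<Rightarrow> (nat \<Rightarrow> real) \<Rightarrow> nat \<Rightarrow> real" where
  "Tw u x = foldl (\<lambda>v \<sigma>. T \<sigma> v) x u"

definition W :: "nat list set" where "W = {u. set u \<subseteq> {..<k}}"

lemma W_simps [simp]: "[] \<in> W" "u @ v \<in> W \<longleftrightarrow> u \<in> W \<and> v \<in> W" "\<sigma> # u \<in> W \<longleftrightarrow> \<sigma> < k \<and> u \<in> W"
  by (auto simp: W_def)

lemma Tw_simps [simp]: "Tw [] x = x" "Tw (u @ v) x = Tw v (Tw u x)" "Tw (\<sigma> # u) x = Tw u (T \<sigma> x)"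
  by (simp_all add: Tw_def)

lemma nrm_T: "\<sigma> < k \<Longrightarrow> nrm n (T \<sigma> x) = nrm n x"
proof -
  assume "\<sigma> < k"
  have "nrm n (T \<sigma> x) = nrm n (\<lambda>i. \<Sum>j<n. A \<sigma> i j * x j)"
    by (simp add: nrm_def L2_set_def T_def)
  with iso[OF \<open>\<sigma> < k\<close>] show ?thesis by simp
qed

lemma ds_T: "\<sigma> < k \<Longrightarrow> ds n (T \<sigma> x) (T \<sigma> y) = ds n x y"
proof -
  assume s: "\<sigma> < k"
  have "(\<lambda>i. T \<sigma> x i - T \<sigma> y i) = T \<sigma> (\<lambda>i. x i - y i)"
    by (auto simp: T_def right_diff_distrib sum_subtractf)
  with nrm_T[OF s] show ?thesis by (simp add: ds_def)
qed

lemma ds_Tw: "u \<in> W \<Longrightarrow> ds n (Tw u x) (Tw u y) = ds n x y"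
  by (induction u arbitrary: x y) (auto simp: ds_T)

lemma nrm_Tw: "u \<in> W \<Longrightarrow> nrm n (Tw u x) = nrm n x"
  by (induction u arbitrary: x) (auto simp: nrm_T)

lemma Tw_supp: "\<forall>i\<ge>n. x i = 0 \<Longrightarrow> i \<ge> n \<Longrightarrow> Tw u x i = 0"
  by (induction u arbitrary: x) (auto simp: T_def)

lemma Tw_usph: "u \<in> W \<Longrightarrow> x \<in> usph n \<Longrightarrow> Tw u x \<in> usph n"
  by (auto simp: usph_def nrm_Tw Tw_supp)

definition pw :: "nat \<Rightarrow> nat list \<Rightarrow> nat list" where "pw m u = concat (replicate m u)"

lemma pw_simps [simp]: "pw 0 u = []" "pw (Suc m) u = u @ pw m u" by (simp_all add: pw_def)
lemma pw_add: "pw (m + l) u = pw m u @ pw l u" by (induction m) auto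
lemma pw_W [simp]: "u \<in> W \<Longrightarrow> pw m u \<in> W" by (induction m) auto
text \<open>By compactness two different powers of \<open>u\<close> take \<open>x\<close> to points
  within \<epsilon> of each other; the isometry property cancels the smaller power.\<close>

lemma recurrence:
  assumes u: "u \<in> W" and e: "\<epsilon> > 0" and x: "\<forall>i\<ge>n. x i = 0"
  obtains m where "m \<ge> 1" "ds n (Tw (pw m u) x) x < \<epsilon>"
proof -
  have "Tw (pw m u) x \<in> cbx n (nrm n x)" for m
    using coord_le_nrm[of _ n "Tw (pw m u) x"] nrm_Tw[of "pw m u" x] u Tw_supp[OF x] by (auto simp: cbx_def)
  then obtain r y where r: "strict_mono r" and y: "\<And>i. (\<lambda>s. Tw (pw (r s) u) x i) \<longlonglongrightarrow> y i"
    using cbx_subsequence[of "\<lambda>m. Tw (pw m u) x"] by metis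
  have "(\<lambda>s. ds n (Tw (pw (r s) u) x) y) \<longlonglongrightarrow> 0" by (intro tendsto_ds y)
  then have "\<forall>\<^sub>F s in sequentially. ds n (Tw (pw (r s) u) x) y < \<epsilon> / 2" using e by (intro order_tendstoD) auto
  then obtain s where s: "\<And>t. t \<ge> s \<Longrightarrow> ds n (Tw (pw (r t) u) x) y < \<epsilon> / 2" by (auto simp: eventually_sequentially)
  have lt: "r s < r (Suc s)" using r by (simp add: strict_mono_def)
  define m where "m = r (Suc s) - r s"
  have m: "m \<ge> 1" "r (Suc s) = m + r s" using lt by (auto simp: m_def)
  have "ds n (Tw (pw (r (Suc s)) u) x) (Tw (pw (r s) u) x) < \<epsilon>"
    using ds_triangle[of n "Tw (pw (r (Suc s)) u) x" "Tw (pw (r s) u) x" y] s[of s] s[of "Suc s"] ds_commute[of n y]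
    by (smt (verit) field_sum_of_halves le_SucI order_refl)
  moreover have "Tw (pw (r (Suc s)) u) x = Tw (pw (r s) u) (Tw (pw m u) x)" by (simp add: m(2) pw_add)
  ultimately have "ds n (Tw (pw m u) x) x < \<epsilon>" using ds_Tw[of "pw (r s) u" "Tw (pw m u) x" x] u by simp
  with m show ?thesis using that by blast
qed

text \<open>A power of \<open>v\<close> returns close to \<open>x\<close>, so the preceding power acts like the inverse of \<open>v\<close>.\<close>

lemma approx_inverse:
  assumes "v \<in> W" "\<epsilon> > 0" and x: "\<forall>i\<ge>n. x i = 0"
  obtains v' where "v' \<in> W" "\<And>y. ds n x (Tw v' y) < ds n (Tw v x) y + \<epsilon>"
proof -
  obtain m where m: "m \<ge> 1" "ds n (Tw (pw m v) x) x < \<epsilon>" using recurrence[OF assms] by blast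
  obtain l where l: "m = Suc l" using m(1) by (cases m) auto
  have "ds n x (Tw (pw l v) y) < ds n (Tw v x) y + \<epsilon>" for y
  proof -
    have "ds n x (Tw (pw l v) y) \<le> ds n x (Tw (pw l v) (Tw v x)) + ds n (Tw (pw l v) (Tw v x)) (Tw (pw l v) y)"
      by (rule ds_triangle)
    also have "ds n x (Tw (pw l v) (Tw v x)) = ds n (Tw (pw m v) x) x" by (simp add: l ds_commute)
    also have "ds n (Tw (pw l v) (Tw v x)) (Tw (pw l v) y) = ds n (Tw v x) y" using assms(1) by (simp add: ds_Tw)
    finally show ?thesis using m(2) by simp
  qed
  then show ?thesis using that[of "pw l v"] assms(1) by auto
qed

definition \<phi> :: "(nat \<Rightarrow> real) \<Rightarrow> real" where
  "\<phi> x = (INF u\<in>W. ds n x (Tw u s0))"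

lemma bdd_ds: "bdd_below ((\<lambda>u. ds n x (Tw u s0)) ` W)" by (rule bdd_belowI[of _ 0]) auto
lemma W_ne: "W \<noteq> {}" using W_simps(1) by blast

lemma phi_le: "u \<in> W \<Longrightarrow> \<phi> x \<le> ds n x (Tw u s0)"
  unfolding \<phi>_def by (rule cINF_lower[OF bdd_ds])

lemma phi_nonneg: "\<phi> x \<ge> 0"
  unfolding \<phi>_def by (rule cINF_greatest[OF W_ne]) auto

lemma phi_less: assumes "\<phi> x < t" obtains u where "u \<in> W" "ds n x (Tw u s0) < t"
  using assms cINF_less_iff[OF W_ne bdd_ds] unfolding \<phi>_def by blast

lemma phi_lipschitz: "\<phi> x \<le> \<phi> y + ds n x y"
proof -
  have "\<phi> x - ds n x y \<le> \<phi> y"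
    unfolding \<phi>_def[of y]
  proof (rule cINF_greatest[OF W_ne])
    fix u assume "u \<in> W"
    then show "\<phi> x - ds n x y \<le> ds n y (Tw u s0)" using phi_le[of u x] ds_triangle[of n x "Tw u s0" y] by simp
  qed
  then show ?thesis by simp
qed

lemma continuous_phi: "continuous_on S \<phi>"
  unfolding continuous_on_def
proof
  fix x assume "x \<in> S"
  have c: "((\<lambda>y. y i) \<longlongrightarrow> x i) (at x within S)" for i
    using continuous_coord[of S i] \<open>x \<in> S\<close> by (auto simp: continuous_on_def)
  have "((\<lambda>y. \<phi> y - \<phi> x) \<longlongrightarrow> 0) (at x within S)"
  proof (rule Lim_null_comparison[OF _ tendsto_ds[OF c]])
    show "\<forall>\<^sub>F y in at x within S. norm (\<phi> y - \<phi> x) \<le> ds n y x"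
      using phi_lipschitz phi_lipschitz[of x] ds_commute[of n x] by (intro always_eventually allI) (smt (verit) real_norm_def)
  qed
  then show "(\<phi> \<longlongrightarrow> \<phi> x) (at x within S)" by (simp add: LIM_zero_iff)
qed

text \<open>If a word brought \<open>x\<close> nearer to the orbit, an approximate inverse of that
  word would carry the nearby orbit point to one about as near to \<open>x\<close>.\<close>

lemma phi_Tw_ge: assumes "v \<in> W" "\<forall>i\<ge>n. x i = 0" shows "\<phi> x \<le> \<phi> (Tw v x)"
proof (rule field_le_epsilon)
  fix \<epsilon> :: real assume e: "\<epsilon> > 0"
  obtain u where u: "u \<in> W" "ds n (Tw v x) (Tw u s0) < \<phi> (Tw v x) + \<epsilon> / 2" using phi_less[of "Tw v x" "\<phi> (Tw v x) + \<epsilon> / 2"] e by auto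
  obtain v' where v': "v' \<in> W" "\<And>y. ds n x (Tw v' y) < ds n (Tw v x) y + \<epsilon> / 2"
    using approx_inverse[OF assms(1) _ assms(2), of "\<epsilon> / 2"] e by auto
  have "\<phi> x \<le> ds n x (Tw (u @ v') s0)" using u v' by (intro phi_le) auto
  then show "\<phi> x \<le> \<phi> (Tw v x) + \<epsilon>" using u(2) v'(2)[of "Tw u s0"] by simp
qed

definition Ob :: "(nat \<Rightarrow> real) set" where "Ob = {z \<in> usph n. \<phi> z = 0}"

lemma compact_Ob: "compact Ob"
proof -
  have "closed {x. \<phi> x = 0}" by (rule closed_Collect_eq[OF continuous_phi]) auto
  from compact_Int_closed[OF compact_usph[of n] this] show ?thesis by (simp add: Ob_def Int_def)
qed

lemma s0_Ob: "s0 \<in> Ob"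
  using s0 phi_le[of "[]" s0] phi_nonneg[of s0] by (auto simp: Ob_def)

lemma T_Ob: assumes "\<sigma> < k" "z \<in> Ob" shows "T \<sigma> z \<in> Ob"
proof -
  have "\<phi> (T \<sigma> z) \<le> 0 + \<epsilon>" if e: "\<epsilon> > 0" for \<epsilon>
  proof -
    obtain u where "u \<in> W" "ds n z (Tw u s0) < \<epsilon>" using phi_less[of z \<epsilon>] assms e by (auto simp: Ob_def)
    moreover have "ds n (T \<sigma> z) (Tw (u @ [\<sigma>]) s0) = ds n z (Tw u s0)" using assms by (simp add: ds_T)
    ultimately show ?thesis using phi_le[of "u @ [\<sigma>]" "T \<sigma> z"] assms by simp
  qed
  then have "\<phi> (T \<sigma> z) \<le> 0" by (rule field_le_epsilon)
  then show ?thesis using phi_nonneg[of "T \<sigma> z"] Tw_usph[of "[\<sigma>]" z] assms by (auto simp: Ob_def)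
qed

lemma Tw_Ob: "u \<in> W \<Longrightarrow> z \<in> Ob \<Longrightarrow> Tw u z \<in> Ob"
  by (induction u arbitrary: z) (auto simp: T_Ob)

text \<open>Minimality of the orbit closure: a point near \<open>Tw u s0\<close> is led back near
  \<open>s0\<close> by an approximate inverse of \<open>u\<close>.\<close>

lemma Ob_minimal:
  assumes "z \<in> Ob" "\<epsilon> > 0"
  obtains v where "v \<in> W" "ds n (Tw v z) s0 < \<epsilon>"
proof -
  obtain u where u: "u \<in> W" "ds n z (Tw u s0) < \<epsilon> / 2" using phi_less[of z "\<epsilon> / 2"] assms by (auto simp: Ob_def)
  have "\<forall>i\<ge>n. s0 i = 0" using s0 by (simp add: usph_def)
  then obtain v where v: "v \<in> W" "\<And>y. ds n s0 (Tw v y) < ds n (Tw u s0) y + \<epsilon> / 2"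
    using approx_inverse[OF u(1), of "\<epsilon> / 2" s0] assms by auto
  have "ds n (Tw v z) s0 < \<epsilon>" using v(2)[of z] u(2) ds_commute[of n z] ds_commute[of n s0] by simp
  with v show ?thesis using that by blast
qed

end

section \<open>Separating an orbit closure by polynomials\<close>

text \<open>Words of variables instead of exponent vectors. Several words may denote one monomial,
  but a linear substitution can be expanded letter by letter.\<close>

definition Mon :: "nat \<Rightarrow> nat \<Rightarrow> nat list set" where
  "Mon n D = {m. set m \<subseteq> {..<n} \<and> length m \<le> D}"

definition pe :: "nat \<Rightarrow> nat \<Rightarrow> (nat list \<Rightarrow> real) \<Rightarrow> (nat \<Rightarrow> real) \<Rightarrow> real" where
  "pe n D a x = (\<Sum>m\<in>Mon n D. a m * mon m x)"

lemma finite_Mon: "finite (Mon n D)"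
  unfolding Mon_def by (rule finite_lists_length_le) auto

definition evr :: "(real \<times> nat list) list \<Rightarrow> (nat \<Rightarrow> real) \<Rightarrow> real" where
  "evr P x = (\<Sum>t\<leftarrow>P. fst t * mon (snd t) x)"

lemma evr_simps [simp]: "evr [] x = 0" "evr (t # P) x = fst t * mon (snd t) x + evr P x"
  "evr (P @ Q) x = evr P x + evr Q x"
  by (simp_all add: evr_def)

lemma evr_mult: "evr P x * evr Q x = evr (concat (map (\<lambda>t. map (\<lambda>s. (fst t * fst s, snd t @ snd s)) Q) P)) x"
proof (induction P)
  case (Cons t P)
  have "evr (map (\<lambda>s. (fst t * fst s, snd t @ snd s)) Q) x = fst t * mon (snd t) x * evr Q x"
    by (induction Q) (auto simp: algebra_simps)
  with Cons show ?case by (simp add: algebra_simps)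
qed simp

lemma continuous_evr: "continuous_on S (evr P)"
proof (induction P)
  case (Cons t P)
  have "continuous_on S (\<lambda>x. fst t * mon (snd t) x + evr P x)"
    by (intro continuous_on_add continuous_on_mult continuous_on_const continuous_on_mon Cons)
  moreover have "evr (t # P) = (\<lambda>x. fst t * mon (snd t) x + evr P x)" by (rule ext) simp
  ultimately show ?case by simp
qed (simp add: evr_def)

lemma continuous_pe: "continuous_on S (pe n D a)"
  unfolding pe_def by (intro continuous_on_sum continuous_on_mult continuous_on_const continuous_on_mon)

lemma tendsto_pe:
  assumes "\<And>i. i < n \<Longrightarrow> ((\<lambda>s. X s i) \<longlongrightarrow> x i) F"
  shows "((\<lambda>s. pe n D a (X s)) \<longlongrightarrow> pe n D a x) F"
  unfolding pe_def by (intro tendsto_intros tendsto_mon assms) (auto simp: Mon_def)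

text \<open>The coefficient of the second word when every letter of the first is replaced by its row
  of \<open>M\<close>: a product of matrix entries.\<close>

fun cfm :: "(nat \<Rightarrow> nat \<Rightarrow> real) \<Rightarrow> nat list \<Rightarrow> nat list \<Rightarrow> real" where
  "cfm M (i # m) (j # m') = M i j * cfm M m m'"
| "cfm M _ _ = 1"

lemma abs_cfm_le:
  assumes M: "\<And>i j. i < n \<Longrightarrow> j < n \<Longrightarrow> \<bar>M i j\<bar> \<le> 1"
  shows "set m \<subseteq> {..<n} \<Longrightarrow> set m' \<subseteq> {..<n} \<Longrightarrow> \<bar>cfm M m m'\<bar> \<le> 1"
proof (induction m arbitrary: m')
  case (Cons i m)
  show ?case
  proof (cases m')
    case m': (Cons j l)
    have "\<bar>M i j\<bar> * \<bar>cfm M m l\<bar> \<le> 1 * 1" using Cons.IH[of l] Cons.prems m' by (intro mult_mono M) auto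
    then show ?thesis by (simp add: m' abs_mult)
  qed simp
qed simp

lemma mon_linear:
  assumes "\<And>i. i < n \<Longrightarrow> y i = (\<Sum>j<n. M i j * x j)" and "set m \<subseteq> {..<n}"
  shows "mon m y = (\<Sum>m'\<in>{m'. set m' \<subseteq> {..<n} \<and> length m' = length m}. cfm M m m' * mon m' x)"
  using assms(2)
proof (induction m)
  case Nil
  have "{m'. set m' \<subseteq> {..<n} \<and> length m' = length ([]::nat list)} = {[]}" by auto
  then show ?case by simp
next
  case (Cons i m)
  let ?L = "{m'. set m' \<subseteq> {..<n} \<and> length m' = length m}"
  have eq: "{m'. set m' \<subseteq> {..<n} \<and> length m' = length (i # m)} = (\<lambda>(j, m'). j # m') ` ({..<n} \<times> ?L)"
    by (auto simp: length_Suc_conv image_iff)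
  have inj: "inj_on (\<lambda>(j, m'). j # m') ({..<n} \<times> ?L)" by (auto simp: inj_on_def)
  have "mon (i # m) y = (\<Sum>j<n. M i j * x j) * (\<Sum>m'\<in>?L. cfm M m m' * mon m' x)"
    using Cons assms(1) by simp
  also have "\<dots> = (\<Sum>(j, m')\<in>{..<n} \<times> ?L. cfm M (i # m) (j # m') * mon (j # m') x)"
    unfolding sum_product sum.cartesian_product by (intro sum.cong) (auto simp: algebra_simps)
  also have "\<dots> = (\<Sum>m'\<in>{m'. set m' \<subseteq> {..<n} \<and> length m' = length (i # m)}. cfm M (i # m) m' * mon m' x)"
    unfolding eq sum.reindex[OF inj] by (simp add: case_prod_unfold)
  finally show ?case .
qed

lemma evr_linear:
  assumes y: "\<And>i. i < n \<Longrightarrow> y i = (\<Sum>j<n. M i j * x j)"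
    and P: "\<And>t. t \<in> set P \<Longrightarrow> set (snd t) \<subseteq> {..<n} \<and> length (snd t) \<le> D"
  shows "evr P y = pe n D (\<lambda>m'. \<Sum>t\<leftarrow>P. if length (snd t) = length m' then fst t * cfm M (snd t) m' else 0) x"
  using P
proof (induction P)
  case Nil
  then show ?case by (simp add: pe_def)
next
  case (Cons t P)
  let ?L = "{m'. set m' \<subseteq> {..<n} \<and> length m' = length (snd t)}"
  have "pe n D (\<lambda>m'. \<Sum>t\<leftarrow>t # P. if length (snd t) = length m' then fst t * cfm M (snd t) m' else 0) x
    = (\<Sum>m'\<in>Mon n D. (if length (snd t) = length m' then fst t * cfm M (snd t) m' * mon m' x else 0)) + evr P y"
    using Cons by (simp add: pe_def distrib_right sum.distrib if_distrib[of "\<lambda>c. c * _"] cong: if_cong)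
  also have "(\<Sum>m'\<in>Mon n D. (if length (snd t) = length m' then fst t * cfm M (snd t) m' * mon m' x else 0))
     = (\<Sum>m'\<in>?L. fst t * cfm M (snd t) m' * mon m' x)"
    using Cons.prems[of t] finite_Mon[of n D] by (intro sum.mono_neutral_cong_right) (auto simp: Mon_def)
  also have "\<dots> = fst t * mon (snd t) y"
    using Cons.prems[of t] by (subst mon_linear[OF y]) (auto simp: sum_distrib_left mult.assoc)
  finally show ?case by simp
qed

text \<open>Fixed degree and coefficients in a fixed interval: a family that is stable under
  averages and has a compact coefficient space.\<close>

definition bp :: "nat \<Rightarrow> nat \<Rightarrow> real \<Rightarrow> ((nat \<Rightarrow> real) \<Rightarrow> real) set" where
  "bp n D C = {w. \<exists>a. (\<forall>m. \<bar>a m\<bar> \<le> C) \<and> w = pe n D a}"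

lemma bp_average:
  assumes I: "finite I" "I \<noteq> {}" and w: "\<And>i. i \<in> I \<Longrightarrow> w i \<in> bp n D C"
  shows "(\<lambda>x. (\<Sum>i\<in>I. w i x) / real (card I)) \<in> bp n D C"
proof -
  have "\<forall>i\<in>I. \<exists>a. (\<forall>m. \<bar>a m\<bar> \<le> C) \<and> w i = pe n D a" using w by (auto simp: bp_def)
  then obtain a where a: "\<And>i m. i \<in> I \<Longrightarrow> \<bar>a i m\<bar> \<le> C" "\<And>i. i \<in> I \<Longrightarrow> w i = pe n D (a i)" by metis
  define b where "b m = (\<Sum>i\<in>I. a i m) / real (card I)" for m
  have card: "real (card I) > 0" using I by (simp add: card_gt_0_iff)
  have "\<bar>b m\<bar> \<le> C" for m
  proof -
    have "\<bar>\<Sum>i\<in>I. a i m\<bar> \<le> (\<Sum>i\<in>I. C)" by (rule order_trans[OF sum_abs], rule sum_mono) (auto intro: a)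
    then show ?thesis using card by (simp add: b_def abs_divide divide_le_eq mult.commute)
  qed
  moreover have "(\<lambda>x. (\<Sum>i\<in>I. w i x) / real (card I)) = pe n D b"
  proof
    fix x
    have "(\<Sum>i\<in>I. w i x) = (\<Sum>i\<in>I. \<Sum>m\<in>Mon n D. a i m * mon m x)" using a(2) by (simp add: pe_def)
    also have "\<dots> = (\<Sum>m\<in>Mon n D. (\<Sum>i\<in>I. a i m) * mon m x)" by (subst sum.swap) (simp add: sum_distrib_right)
    finally have e: "(\<Sum>i\<in>I. w i x) = (\<Sum>m\<in>Mon n D. (\<Sum>i\<in>I. a i m) * mon m x)" .
    show "(\<Sum>i\<in>I. w i x) / real (card I) = pe n D b x"
      unfolding e pe_def b_def by (subst sum_divide_distrib) simp
  qed
  ultimately show ?thesis unfolding bp_def by blast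
qed

section \<open>Invariant polynomials by averaging\<close>

context isometries
begin

lemma Tw_linear: "\<exists>M. \<forall>x. \<forall>i<n. Tw u x i = (\<Sum>j<n. M i j * x j)"
proof (induction u rule: rev_induct)
  case Nil
  show ?case by (rule exI[of _ "\<lambda>i j. if j = i then 1 else 0"]) (auto simp: if_distrib[of "\<lambda>c. c * _"] cong: if_cong)
next
  case (snoc \<sigma> u)
  then obtain M where M: "\<And>x i. i < n \<Longrightarrow> Tw u x i = (\<Sum>j<n. M i j * x j)" by blast
  have "Tw (u @ [\<sigma>]) x i = (\<Sum>j<n. (\<Sum>l<n. A \<sigma> i l * M l j) * x j)" if "i < n" for x i
  proof -
    have "Tw (u @ [\<sigma>]) x i = (\<Sum>l<n. \<Sum>j<n. A \<sigma> i l * (M l j * x j))"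
      using that M by (simp add: T_def sum_distrib_left)
    also have "\<dots> = (\<Sum>j<n. (\<Sum>l<n. A \<sigma> i l * M l j) * x j)"
      by (subst sum.swap) (simp add: sum_distrib_right mult.assoc)
    finally show ?thesis .
  qed
  then show ?case by (intro exI[of _ "\<lambda>i j. \<Sum>l<n. A \<sigma> i l * M l j"]) simp
qed

lemma Tw_matrix:
  assumes u: "u \<in> W"
  obtains M where "\<And>x i. i < n \<Longrightarrow> Tw u x i = (\<Sum>j<n. M i j * x j)" "\<And>i j. i < n \<Longrightarrow> j < n \<Longrightarrow> \<bar>M i j\<bar> \<le> 1"
proof -
  obtain M where M: "\<And>x i. i < n \<Longrightarrow> Tw u x i = (\<Sum>j<n. M i j * x j)" using Tw_linear by blast
  have "\<bar>M i j\<bar> \<le> 1" if "i < n" "j < n" for i j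
  proof -
    define e where "e l = (if l = j then 1 else 0 :: real)" for l
    have "Tw u e i = M i j" using M[OF that(1), of e] that by (simp add: e_def if_distrib[of "\<lambda>c. _ * c"] cong: if_cong)
    moreover have "nrm n e = 1" using that by (simp add: nrm_def L2_set_def e_def if_distrib[of "\<lambda>c. c\<^sup>2"] cong: if_cong)
    ultimately show ?thesis using coord_le_nrm[OF that(1), of "Tw u e"] nrm_Tw[OF u, of e] by simp
  qed
  with M show ?thesis using that by blast
qed

text \<open>Cesaro means of the iterates of \<open>Aop\<close> have a limit point fixed by \<open>Aop\<close>; by the maximum principle it
  is constant on the minimal set \<open>Ob\<close>.\<close>

definition Aop :: "((nat \<Rightarrow> real) \<Rightarrow> real) \<Rightarrow> (nat \<Rightarrow> real) \<Rightarrow> real" where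
  "Aop w x = (\<Sum>\<sigma><k. w (T \<sigma> x)) / real k"

lemma Aop_Suc: "(Aop ^^ Suc j) w x = (\<Sum>\<sigma><k. (Aop ^^ j) w (T \<sigma> x)) / real k"
  by (simp add: Aop_def[of "(Aop ^^ j) w"])

lemma Aop_bounds:
  assumes "\<And>v. v \<in> W \<Longrightarrow> lo \<le> w (Tw v x) \<and> w (Tw v x) \<le> hi" "v \<in> W"
  shows "lo \<le> (Aop ^^ j) w (Tw v x) \<and> (Aop ^^ j) w (Tw v x) \<le> hi"
  using assms(2)
proof (induction j arbitrary: v)
  case 0
  then show ?case using assms(1) by simp
next
  case (Suc j)
  have b: "lo \<le> (Aop ^^ j) w (T \<sigma> (Tw v x)) \<and> (Aop ^^ j) w (T \<sigma> (Tw v x)) \<le> hi" if "\<sigma> < k" for \<sigma>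
    using Suc.IH[of "v @ [\<sigma>]"] Suc.prems that by simp
  have "real k * lo \<le> (\<Sum>\<sigma><k. (Aop ^^ j) w (T \<sigma> (Tw v x)))"
    using sum_mono[of "{..<k}" "\<lambda>_. lo"] b by simp
  moreover have "(\<Sum>\<sigma><k. (Aop ^^ j) w (T \<sigma> (Tw v x))) \<le> real k * hi"
    using sum_mono[of "{..<k}" _ "\<lambda>_. hi"] b by simp
  ultimately show ?case using k unfolding Aop_Suc by (simp add: field_simps)
qed

lemma Aop_bp:
  assumes "\<And>v. v \<in> W \<Longrightarrow> (\<lambda>x. w (Tw v x)) \<in> bp n D C" "v \<in> W"
  shows "(\<lambda>x. (Aop ^^ j) w (Tw v x)) \<in> bp n D C"
  using assms(2)
proof (induction j arbitrary: v)
  case 0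
  then show ?case using assms(1) by simp
next
  case (Suc j)
  have "(\<lambda>x. (\<Sum>\<sigma>\<in>{..<k}. (Aop ^^ j) w (Tw (v @ [\<sigma>]) x)) / real (card {..<k})) \<in> bp n D C"
    using Suc k by (intro bp_average) (auto simp del: Tw_simps)
  then show ?case unfolding Aop_Suc by simp
qed

text \<open>Matrices of words have entries of absolute value at most 1, so composing
  \<open>P\<close> with a word keeps its coefficients below the l1 norm \<open>C\<close> of
  \<open>P\<close>, in fixed degree. Hence the coefficients of the Cesaro means converge along a
  subsequence, and the limit inherits every bound valid on the whole orbit of a point.\<close>

lemma ergodic_limit:
  assumes P: "\<And>t. t \<in> set P \<Longrightarrow> set (snd t) \<subseteq> {..<n}"
  obtains D a where "\<And>x. x \<in> usph n \<Longrightarrow> Aop (pe n D a) x = pe n D a x"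
    "\<And>x lo hi. (\<And>v. v \<in> W \<Longrightarrow> lo \<le> evr P (Tw v x) \<and> evr P (Tw v x) \<le> hi) \<Longrightarrow> lo \<le> pe n D a x \<and> pe n D a x \<le> hi"
proof -
  define D where "D = (\<Sum>t\<leftarrow>P. length (snd t))"
  define C where "C = (\<Sum>t\<leftarrow>P. \<bar>fst t\<bar>)"
  have len: "length (snd t) \<le> D" if "t \<in> set P" for t
    unfolding D_def using that by (intro member_le_sum_list) auto
  have B0: "(\<lambda>x. evr P (Tw v x)) \<in> bp n D C" if v: "v \<in> W" for v
  proof -
    obtain M where M: "\<And>x i. i < n \<Longrightarrow> Tw v x i = (\<Sum>j<n. M i j * x j)" "\<And>i j. i < n \<Longrightarrow> j < n \<Longrightarrow> \<bar>M i j\<bar> \<le> 1"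
      using Tw_matrix[OF v] by blast
    define a where "a m' = (if m' \<in> Mon n D then \<Sum>t\<leftarrow>P. if length (snd t) = length m' then fst t * cfm M (snd t) m' else 0 else 0)" for m'
    have "evr P (Tw v x) = pe n D a x" for x
    proof -
      have "evr P (Tw v x) = pe n D (\<lambda>m'. \<Sum>t\<leftarrow>P. if length (snd t) = length m' then fst t * cfm M (snd t) m' else 0) x"
        using P len M(1) by (intro evr_linear) auto
      then show ?thesis by (simp add: pe_def a_def)
    qed
    moreover have C0: "0 \<le> C" unfolding C_def by (intro sum_list_nonneg) auto
    have "\<bar>a m'\<bar> \<le> C" for m'
    proof (cases "m' \<in> Mon n D")
      case True
      have "\<bar>\<Sum>t\<leftarrow>Q. if length (snd t) = length m' then fst t * cfm M (snd t) m' else 0\<bar> \<le> (\<Sum>t\<leftarrow>Q. \<bar>fst t\<bar>)"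
        if "set Q \<subseteq> set P" for Q
        using that
      proof (induction Q)
        case (Cons t Q)
        have "\<bar>cfm M (snd t) m'\<bar> \<le> 1" using Cons.prems P True M(2) by (intro abs_cfm_le[of n]) (auto simp: Mon_def)
        then have "\<bar>fst t\<bar> * \<bar>cfm M (snd t) m'\<bar> \<le> \<bar>fst t\<bar> * 1" by (intro mult_left_mono) auto
        then have "\<bar>if length (snd t) = length m' then fst t * cfm M (snd t) m' else 0\<bar> \<le> \<bar>fst t\<bar>"
          by (simp add: abs_mult)
        with Cons show ?case by (simp only: list.map sum_list.Cons) (smt (verit) list.set_intros(2) subset_iff)
      qed simp
      then show ?thesis using True by (simp add: a_def C_def)
    qed (simp add: a_def C0)
    ultimately show ?thesis unfolding bp_def by (auto intro!: exI[of _ a])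
  qed
  define w where "w j = (Aop ^^ j) (evr P)" for j
  have wB: "w j \<in> bp n D C" for j
    using Aop_bp[where w = "evr P" and v = "[]", OF B0] by (simp add: w_def)
  define S where "S N x = (\<Sum>j\<in>{..<Suc N}. w j x) / real (card {..<Suc N})" for N x
  have "S N \<in> bp n D C" for N
    unfolding S_def using wB by (intro bp_average) auto
  then have "\<forall>N. \<exists>a. (\<forall>m. \<bar>a m\<bar> \<le> C) \<and> S N = pe n D a" by (auto simp: bp_def)
  then obtain a where a: "\<And>N m. \<bar>a N m\<bar> \<le> C" "\<And>N. S N = pe n D (a N)" by metis
  have "seq_compact {z :: nat list \<Rightarrow> real. \<forall>m. z m \<in> {-C..C}}"
    by (intro compact_imp_seq_compact compact_PiE_UNIV) auto
  moreover have "\<forall>N. a N \<in> {z. \<forall>m. z m \<in> {-C..C}}" using a(1) by (auto simp: abs_le_iff minus_le_iff)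
  ultimately obtain b r where r: "strict_mono r" and "(a \<circ> r) \<longlonglongrightarrow> b"
    unfolding seq_compact_def by metis
  then have b: "(\<lambda>N. a (r N) m) \<longlonglongrightarrow> b m" for m
    using continuous_on_tendsto_compose[OF continuous_on_product_coordinates[of m] \<open>(a \<circ> r) \<longlonglongrightarrow> b\<close>] by (simp add: o_def)
  have lim: "(\<lambda>N. S (r N) x) \<longlonglongrightarrow> pe n D b x" for x
    unfolding a(2) pe_def by (intro tendsto_intros b)
  show ?thesis
  proof (rule that[of D b])
    fix x assume x: "x \<in> usph n"
    have "(\<lambda>N. Aop (S (r N)) x) \<longlonglongrightarrow> Aop (pe n D b) x"
      unfolding Aop_def using k by (intro tendsto_intros lim) auto
    moreover have "(\<lambda>N. Aop (S (r N)) x - S (r N) x) \<longlonglongrightarrow> 0"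
    proof -
      have "compact (evr P ` usph n)" by (intro compact_continuous_image continuous_evr compact_usph)
      then obtain K where K: "\<And>y. y \<in> usph n \<Longrightarrow> \<bar>evr P y\<bar> \<le> K"
        using compact_imp_bounded bounded_iff by (metis imageI real_norm_def)
      have wK: "\<bar>w j x\<bar> \<le> K" for j
        using Aop_bounds[of "-K" "evr P" x K "[]" j] K Tw_usph[OF _ x] by (force simp: w_def abs_le_iff)
      \<comment> \<open>The sum telescopes: applying \<open>Aop\<close> to a mean changes it only by
        the two end terms, divided by the number of terms.\<close>
      have diff: "Aop (S N) x - S N x = (w (Suc N) x - w 0 x) / real (Suc N)" for N
      proof -
        have "Aop (S N) x = (\<Sum>\<sigma><k. \<Sum>j<Suc N. w j (T \<sigma> x)) / real (Suc N) / real k"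
          by (simp add: Aop_def S_def sum_divide_distrib[symmetric])
        also have "\<dots> = (\<Sum>j<Suc N. \<Sum>\<sigma><k. w j (T \<sigma> x)) / real k / real (Suc N)"
          by (subst sum.swap) (simp only: divide_divide_eq_left mult.commute)
        also have "\<dots> = (\<Sum>j<Suc N. Aop (w j) x) / real (Suc N)"
          by (simp only: Aop_def sum_divide_distrib[of _ "{..<Suc N}" "real k"])
        also have "\<dots> = (\<Sum>j<Suc N. w (Suc j) x) / real (Suc N)" by (simp add: w_def)
        finally have "Aop (S N) x - S N x = (\<Sum>j<Suc N. w (Suc j) x - w j x) / real (Suc N)"
          by (simp add: S_def sum_subtractf diff_divide_distrib)
        then show ?thesis by (simp only: sum_lessThan_telescope[of "\<lambda>j. w j x" "Suc N"])
      qed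
      have "(\<lambda>N. 2 * K * inverse (real (Suc (r N)))) \<longlonglongrightarrow> 2 * K * 0"
        by (intro tendsto_intros LIMSEQ_subseq_LIMSEQ[OF LIMSEQ_inverse_real_of_nat r, unfolded o_def])
      then have "(\<lambda>N. 2 * K * inverse (real (Suc (r N)))) \<longlonglongrightarrow> 0" by simp
      then show ?thesis
      proof (rule Lim_null_comparison[rotated])
        show "\<forall>\<^sub>F N in sequentially. norm (Aop (S (r N)) x - S (r N) x) \<le> 2 * K * inverse (real (Suc (r N)))"
        proof (intro always_eventually allI)
          fix N
          have "\<bar>w (Suc (r N)) x - w 0 x\<bar> \<le> 2 * K" using wK[of "Suc (r N)"] wK[of 0] by linarith
          then show "norm (Aop (S (r N)) x - S (r N) x) \<le> 2 * K * inverse (real (Suc (r N)))"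
            unfolding diff real_norm_def divide_inverse abs_mult
            by (intro mult_mono) auto
        qed
      qed
    qed
    moreover have "(\<lambda>N. Aop (S (r N)) x - S (r N) x) \<longlonglongrightarrow> Aop (pe n D b) x - pe n D b x"
      using calculation(1) lim by (rule tendsto_diff)
    ultimately have "Aop (pe n D b) x - pe n D b x = 0" using LIMSEQ_unique by blast
    then show "Aop (pe n D b) x = pe n D b x" by simp
  next
    fix x lo hi assume h: "\<And>v. v \<in> W \<Longrightarrow> lo \<le> evr P (Tw v x) \<and> evr P (Tw v x) \<le> hi"
    have w: "lo \<le> w j x" "w j x \<le> hi" for j using Aop_bounds[of lo "evr P" x hi "[]" j] h by (auto simp: w_def)
    have "real (Suc N) * lo \<le> (\<Sum>j<Suc N. w j x)" "(\<Sum>j<Suc N. w j x) \<le> real (Suc N) * hi" for N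
      using sum_mono[of "{..<Suc N}" "\<lambda>_. lo" "\<lambda>j. w j x"] sum_mono[of "{..<Suc N}" "\<lambda>j. w j x" "\<lambda>_. hi"] w by auto
    then have "lo \<le> S N x" "S N x \<le> hi" for N unfolding S_def by (simp_all add: field_simps)
    then show "lo \<le> pe n D b x \<and> pe n D b x \<le> hi"
      using LIMSEQ_le_const[OF lim, of lo] LIMSEQ_le_const2[OF lim, of _ hi] by blast
  qed
qed

lemma harmonic_const_on_orbit:
  assumes h: "\<And>x. x \<in> usph n \<Longrightarrow> Aop (pe n D a) x = pe n D a x" and u: "u \<in> W"
  shows "pe n D a (Tw u s0) = pe n D a s0"
proof -
  define f where "f = pe n D a"
  obtain z where z: "z \<in> Ob" "\<And>y. y \<in> Ob \<Longrightarrow> f y \<le> f z"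
    using continuous_attains_sup[OF compact_Ob _ continuous_pe[of Ob n D a]] s0_Ob unfolding f_def by blast
  have step: "f (T \<sigma> y) = f z" if y: "y \<in> Ob" "f y = f z" and \<sigma>: "\<sigma> < k" for y \<sigma>
  proof (rule ccontr)
    assume "f (T \<sigma> y) \<noteq> f z"
    moreover have le: "f (T \<tau> y) \<le> f z" if "\<tau> < k" for \<tau> using z(2) T_Ob[OF that y(1)] by blast
    ultimately have "f (T \<sigma> y) < f z" using \<sigma> by force
    then have "(\<Sum>\<tau><k. f (T \<tau> y)) < (\<Sum>\<tau><k. f z)" using le \<sigma> by (intro sum_strict_mono_ex1) auto
    then have "(\<Sum>\<tau><k. f (T \<tau> y)) < real k * f z" by simp
    moreover have "(\<Sum>\<tau><k. f (T \<tau> y)) = real k * f y"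
      using h[of y] y(1) k by (auto simp: Ob_def Aop_def f_def field_simps)
    ultimately show False using y(2) by simp
  qed
  have all: "f (Tw v y) = f z" if "y \<in> Ob" "f y = f z" "v \<in> W" for y v
    using that by (induction v arbitrary: y) (auto simp: step T_Ob)
  \<comment> \<open>Words keep the value at the maximiser \<open>z\<close> and, by minimality, bring
    it arbitrarily near \<open>s0\<close>; continuity transfers the maximum to
    \<open>s0\<close>.\<close>
  have "f s0 = f z"
  proof -
    have "\<exists>v. v \<in> W \<and> ds n (Tw v z) s0 < inverse (real (Suc N))" for N
      using Ob_minimal[OF z(1), of "inverse (real (Suc N))"] by (metis inverse_positive_iff_positive of_nat_0_less_iff zero_less_Suc)
    then obtain v where v: "\<And>N. v N \<in> W" "\<And>N. ds n (Tw (v N) z) s0 < inverse (real (Suc N))" by metis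
    have L: "(\<lambda>N. ds n (Tw (v N) z) s0) \<longlonglongrightarrow> 0"
      by (rule Lim_null_comparison[OF _ LIMSEQ_inverse_real_of_nat]) (use v(2) in \<open>auto intro!: always_eventually less_imp_le\<close>)
    have "(\<lambda>N. f (Tw (v N) z)) \<longlonglongrightarrow> f s0" unfolding f_def by (rule tendsto_pe) (rule tendsto_of_ds[OF L])
    moreover have "f (Tw (v N) z) = f z" for N using all[OF z(1) refl v(1)] .
    ultimately show ?thesis by (simp add: LIMSEQ_const_iff)
  qed
  then show ?thesis using all[OF s0_Ob _ u] by (simp add: f_def)
qed

text \<open>Approximate \<open>\<phi>\<close> within \<open>\<eta> / 3\<close>, where
  \<open>\<eta> = \<phi> x\<close>. On the orbit of \<open>s0\<close> the approximation stays below
  \<open>\<eta> / 3\<close>; on that of \<open>x\<close> it stays above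
  \<open>2 * \<eta> / 3\<close>, since words never decrease \<open>\<phi>\<close>. Averaging
  respects both bounds and makes the polynomial constant on the orbit of \<open>s0\<close>.\<close>

theorem orbit_separation:
  assumes x: "x \<in> usph n" and out: "x \<notin> Ob"
  obtains D a where "\<And>u. u \<in> W \<Longrightarrow> pe n D a (Tw u s0) = 0" "pe n D a x \<noteq> 0"
proof -
  define \<eta> where "\<eta> = \<phi> x"
  have eta: "\<eta> > 0" using x out phi_nonneg[of x] by (auto simp: Ob_def \<eta>_def)
  define poly where "poly f \<longleftrightarrow> (\<exists>P. (\<forall>t\<in>set P. set (snd t) \<subseteq> {..<n}) \<and> f = evr P)" for f
  have "\<exists>g. poly g \<and> (\<forall>x\<in>usph n. \<bar>\<phi> x - g x\<bar> < \<eta> / 3)"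
  proof (rule Stone_Weierstrass_HOL)
    show "compact (usph n)" by (rule compact_usph)
    show "poly (\<lambda>x. c)" for c unfolding poly_def by (rule exI[of _ "[(c, [])]"]) (auto simp: fun_eq_iff)
    show "continuous_on (usph n) f" if "poly f" for f using that continuous_evr by (auto simp: poly_def)
    show "poly (\<lambda>x. f x + g x)" if "poly f \<and> poly g" for f g
    proof -
      from that obtain P Q where "\<forall>t\<in>set P. set (snd t) \<subseteq> {..<n}" "f = evr P" "\<forall>t\<in>set Q. set (snd t) \<subseteq> {..<n}" "g = evr Q"
        by (auto simp: poly_def)
      then show ?thesis unfolding poly_def by (intro exI[of _ "P @ Q"]) (auto simp: fun_eq_iff)
    qed
    show "poly (\<lambda>x. f x * g x)" if "poly f \<and> poly g" for f g
    proof -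
      from that obtain P Q where "\<forall>t\<in>set P. set (snd t) \<subseteq> {..<n}" "f = evr P" "\<forall>t\<in>set Q. set (snd t) \<subseteq> {..<n}" "g = evr Q"
        by (auto simp: poly_def)
      then show ?thesis unfolding poly_def
        by (intro exI[of _ "concat (map (\<lambda>t. map (\<lambda>s. (fst t * fst s, snd t @ snd s)) Q) P)"])
           (fastforce simp: fun_eq_iff evr_mult)
    qed
    show "\<exists>f. poly f \<and> f x \<noteq> f y" if "x \<in> usph n \<and> y \<in> usph n \<and> x \<noteq> y" for x y
    proof -
      from that obtain i where i: "x i \<noteq> y i" by auto
      then have "i < n" using that by (auto simp: usph_def not_less[symmetric])
      then have "poly (\<lambda>x. x i)" unfolding poly_def by (intro exI[of _ "[(1, [i])]"]) (auto simp: fun_eq_iff)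
      with i show ?thesis by blast
    qed
    show "continuous_on (usph n) \<phi>" by (rule continuous_phi)
    show "0 < \<eta> / 3" using eta by simp
  qed
  then obtain P where P: "\<forall>t\<in>set P. set (snd t) \<subseteq> {..<n}" "\<And>y. y \<in> usph n \<Longrightarrow> \<bar>\<phi> y - evr P y\<bar> < \<eta> / 3"
    by (auto simp: poly_def)
  obtain D a where a: "\<And>x. x \<in> usph n \<Longrightarrow> Aop (pe n D a) x = pe n D a x"
    "\<And>x lo hi. (\<And>v. v \<in> W \<Longrightarrow> lo \<le> evr P (Tw v x) \<and> evr P (Tw v x) \<le> hi) \<Longrightarrow> lo \<le> pe n D a x \<and> pe n D a x \<le> hi"
    using ergodic_limit[of P] P(1) by blast
  define M where "M = pe n D a s0"
  have "compact (evr P ` usph n)" by (intro compact_continuous_image continuous_evr compact_usph)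
  then obtain K where K: "\<And>y. y \<in> usph n \<Longrightarrow> \<bar>evr P y\<bar> \<le> K"
    using compact_imp_bounded bounded_iff by (metis imageI real_norm_def)
  have "M \<le> \<eta> / 3"
  proof -
    have "- K \<le> evr P (Tw v s0) \<and> evr P (Tw v s0) \<le> \<eta> / 3" if "v \<in> W" for v
      using P(2)[OF Tw_usph[OF that s0]] K[OF Tw_usph[OF that s0]] Tw_Ob[OF that s0_Ob] by (auto simp: Ob_def)
    from a(2)[OF this] show ?thesis by (simp add: M_def)
  qed
  moreover have "2 * \<eta> / 3 \<le> pe n D a x"
  proof -
    have "2 * \<eta> / 3 \<le> evr P (Tw v x) \<and> evr P (Tw v x) \<le> K" if v: "v \<in> W" for v
    proof -
      have "\<eta> \<le> \<phi> (Tw v x)" using phi_Tw_ge[OF v, of x] x by (auto simp: \<eta>_def usph_def)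
      then show ?thesis using P(2)[OF Tw_usph[OF v x]] K[OF Tw_usph[OF v x]] by linarith
    qed
    from a(2)[OF this] show ?thesis by simp
  qed
  ultimately have lt: "M < pe n D a x" using eta by linarith
  \<comment> \<open>Subtracting the constant value \<open>M\<close> changes only the coefficient of
    the empty word.\<close>
  define b where "b = a([] := a [] - M)"
  have "pe n D b y = pe n D a y - M" for y
  proof -
    have nil: "[] \<in> Mon n D" by (simp add: Mon_def)
    have "pe n D b y = b [] + (\<Sum>m\<in>Mon n D - {[]}. b m * mon m y)"
      unfolding pe_def using nil finite_Mon by (subst sum.remove[of _ "[]"]) auto
    also have "(\<Sum>m\<in>Mon n D - {[]}. b m * mon m y) = (\<Sum>m\<in>Mon n D - {[]}. a m * mon m y)"
      by (intro sum.cong) (auto simp: b_def)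
    also have "b [] + \<dots> = pe n D a y - M"
      unfolding pe_def using nil finite_Mon by (subst sum.remove[of "Mon n D" "[]"]) (auto simp: b_def)
    finally show ?thesis .
  qed
  then show ?thesis using that[of D b] harmonic_const_on_orbit[OF a(1)] lt by (simp add: M_def)
qed

end

section \<open>Hilbert's basis theorem for polynomial functions\<close>

text \<open>\<open>d\<close> counts coefficients: the degree in variable \<open>n\<close> is below
  \<open>d\<close>, and \<open>d = 0\<close> gives the zero function.\<close>

definition rep :: "((nat \<Rightarrow> real) \<Rightarrow> real) set \<Rightarrow> nat \<Rightarrow> nat \<Rightarrow> ((nat \<Rightarrow> real) \<Rightarrow> real) \<Rightarrow> bool" where
  "rep Q n d f \<longleftrightarrow> (\<exists>a. (\<forall>j. a j \<in> Q) \<and> f = (\<lambda>x. \<Sum>j<d. a j x * x n ^ j))"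

text \<open>Polynomial functions rather than formal polynomials, built one variable at a time to
  support the induction of Hilbert's theorem.\<close>

fun Pn :: "nat \<Rightarrow> ((nat \<Rightarrow> real) \<Rightarrow> real) set" where
  "Pn 0 = {f. \<exists>c. f = (\<lambda>_. c)}"
| "Pn (Suc n) = {f. \<exists>d. rep (Pn n) n d f}"

definition fring :: "((nat \<Rightarrow> real) \<Rightarrow> real) set \<Rightarrow> bool" where
  "fring Q \<longleftrightarrow> (\<forall>c. (\<lambda>_. c) \<in> Q) \<and> (\<forall>f\<in>Q. \<forall>g\<in>Q. (\<lambda>x. f x + g x) \<in> Q \<and> (\<lambda>x. f x * g x) \<in> Q)"

lemma fringD:
  assumes "fring Q"
  shows "(\<lambda>_. c) \<in> Q" "f \<in> Q \<Longrightarrow> g \<in> Q \<Longrightarrow> (\<lambda>x. f x + g x) \<in> Q" "f \<in> Q \<Longrightarrow> g \<in> Q \<Longrightarrow> (\<lambda>x. f x * g x) \<in> Q"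
  using assms by (auto simp: fring_def)

lemma rep_mono: assumes "fring Q" "rep Q n d f" "d \<le> e" shows "rep Q n e f"
proof -
  from assms(2) obtain a where a: "\<forall>j. a j \<in> Q" "f = (\<lambda>x. \<Sum>j<d. a j x * x n ^ j)" by (auto simp: rep_def)
  have "f = (\<lambda>x. \<Sum>j<e. (if j < d then a j else (\<lambda>_. 0)) x * x n ^ j)"
    unfolding a(2) using assms(3) by (intro ext sum.mono_neutral_cong_left) auto
  moreover have "(if j < d then a j else (\<lambda>_. 0)) \<in> Q" for j using a(1) fringD(1)[OF assms(1)] by auto
  ultimately show ?thesis unfolding rep_def by (intro exI[of _ "\<lambda>j. if j < d then a j else (\<lambda>_. 0)"]) auto
qed

lemma rep_0: "fring Q \<Longrightarrow> rep Q n d (\<lambda>_. 0)"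
  unfolding rep_def using fringD(1)[of Q 0] by (intro exI[of _ "\<lambda>_ _. 0"]) auto

lemma rep_add: assumes "fring Q" "rep Q n d f" "rep Q n d g" shows "rep Q n d (\<lambda>x. f x + g x)"
proof -
  from assms obtain a b where "\<forall>j. a j \<in> Q" "f = (\<lambda>x. \<Sum>j<d. a j x * x n ^ j)"
    "\<forall>j. b j \<in> Q" "g = (\<lambda>x. \<Sum>j<d. b j x * x n ^ j)" by (auto simp: rep_def)
  then show ?thesis unfolding rep_def using fringD(2)[OF assms(1)]
    by (intro exI[of _ "\<lambda>j x. a j x + b j x"]) (auto simp: sum.distrib distrib_right)
qed

lemma rep_scale: assumes "fring Q" "rep Q n d f" "b \<in> Q" shows "rep Q n d (\<lambda>x. b x * f x)"
proof -
  from assms obtain a where "\<forall>j. a j \<in> Q" "f = (\<lambda>x. \<Sum>j<d. a j x * x n ^ j)" by (auto simp: rep_def)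
  then show ?thesis unfolding rep_def using fringD(3)[OF assms(1) assms(3)]
    by (intro exI[of _ "\<lambda>j x. b x * a j x"]) (auto simp: sum_distrib_left mult.assoc)
qed

lemma rep_shift: assumes "fring Q" "rep Q n d f" shows "rep Q n (d + e) (\<lambda>x. x n ^ e * f x)"
proof (induction e)
  case (Suc e)
  then obtain a where a: "\<forall>j. a j \<in> Q" "(\<lambda>x. x n ^ e * f x) = (\<lambda>x. \<Sum>j<d + e. a j x * x n ^ j)" by (auto simp: rep_def)
  have "(\<lambda>x. x n ^ Suc e * f x) = (\<lambda>x. x n * (\<Sum>j<d + e. a j x * x n ^ j))"
    using fun_cong[OF a(2)] by (simp add: mult.assoc)
  also have "\<dots> = (\<lambda>x. \<Sum>j<Suc (d + e). (case j of 0 \<Rightarrow> (\<lambda>_. 0) | Suc i \<Rightarrow> a i) x * x n ^ j)"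
    unfolding sum.lessThan_Suc_shift by (simp add: sum_distrib_left algebra_simps)
  finally show ?case unfolding rep_def using a(1) fringD(1)[OF assms(1), of 0]
    by (intro exI[of _ "\<lambda>j. case j of 0 \<Rightarrow> (\<lambda>_. 0) | Suc i \<Rightarrow> a i"]) (auto split: nat.splits)
qed (use assms in simp)

lemma fring_Pn: "fring (Pn n)"
proof (induction n)
  case 0
  show ?case by (auto simp: fring_def)
next
  case (Suc n)
  note Q = Suc
  have c: "f \<in> Pn (Suc n)" if "f \<in> Pn n" for f
  proof -
    have "rep (Pn n) n 1 f" unfolding rep_def using that by (intro exI[of _ "\<lambda>_. f"]) auto
    then show ?thesis by auto
  qed
  have add: "(\<lambda>x. f x + g x) \<in> Pn (Suc n)" if "f \<in> Pn (Suc n)" "g \<in> Pn (Suc n)" for f g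
  proof -
    from that obtain d e where "rep (Pn n) n d f" "rep (Pn n) n e g" by auto
    then have "rep (Pn n) n (max d e) f" "rep (Pn n) n (max d e) g" using rep_mono[OF Q] by auto
    then show ?thesis using rep_add[OF Q, of n "max d e" f g] by auto
  qed
  have mult: "(\<lambda>x. f x * g x) \<in> Pn (Suc n)" if f: "f \<in> Pn (Suc n)" and g: "g \<in> Pn (Suc n)" for f g
  proof -
    from f obtain d a where a: "\<forall>j. a j \<in> Pn n" "f = (\<lambda>x. \<Sum>j<d. a j x * x n ^ j)" by (auto simp: rep_def)
    from g obtain e where e: "rep (Pn n) n e g" by auto
    have "(\<lambda>x. \<Sum>j<l. a j x * (x n ^ j * g x)) \<in> Pn (Suc n)" for l
    proof (induction l)
      case 0
      then show ?case using c[OF fringD(1)[OF Q, of 0]] by simp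
    next
      case (Suc l)
      have "rep (Pn n) n (e + l) (\<lambda>x. a l x * (x n ^ l * g x))" using a by (intro rep_scale[OF Q] rep_shift[OF Q] e) auto
      then have "(\<lambda>x. a l x * (x n ^ l * g x)) \<in> Pn (Suc n)" by auto
      from add[OF Suc this] show ?case by simp
    qed
    from this[of d] show ?thesis by (simp add: a(2) sum_distrib_right mult.assoc)
  qed
  show ?case unfolding fring_def using c fringD(1)[OF Q] add mult by blast
qed

lemma Pn_mono: "f \<in> Pn n \<Longrightarrow> f \<in> Pn (Suc n)"
proof -
  assume "f \<in> Pn n"
  then have "rep (Pn n) n 1 f" unfolding rep_def by (intro exI[of _ "\<lambda>_. f"]) auto
  then show ?thesis by auto
qed

lemma Pn_coord: "i < n \<Longrightarrow> (\<lambda>x. x i) \<in> Pn n"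
proof (induction n)
  case (Suc n)
  show ?case
  proof (cases "i = n")
    case True
    have "rep (Pn n) n (1 + 1) (\<lambda>x. x n ^ 1 * 1)"
      by (rule rep_shift[OF fring_Pn]) (auto simp: rep_def intro!: exI[of _ "\<lambda>_ _. 1"] fringD(1)[OF fring_Pn])
    then show ?thesis using True by auto
  next
    case False
    then show ?thesis using Suc Pn_mono[of "\<lambda>x. x i" n] by auto
  qed
qed simp

lemma Pn_mon: "set m \<subseteq> {..<n} \<Longrightarrow> mon m \<in> Pn n"
proof (induction m)
  case Nil
  have "mon [] = (\<lambda>_. 1)" by (rule ext) simp
  then show ?case using fringD(1)[OF fring_Pn] by simp
next
  case (Cons i m)
  have "mon (i # m) = (\<lambda>x. x i * mon m x)" by (rule ext) simp
  then show ?case using Cons fringD(3)[OF fring_Pn Pn_coord] by simp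
qed

lemma Pn_sum: "finite I \<Longrightarrow> (\<And>i. i \<in> I \<Longrightarrow> f i \<in> Pn n) \<Longrightarrow> (\<lambda>x. \<Sum>i\<in>I. f i x) \<in> Pn n"
  by (induction I rule: finite_induct) (auto intro: fringD[OF fring_Pn])

lemma Pn_pe: "pe n D a \<in> Pn n"
proof -
  have "(\<lambda>x. \<Sum>m\<in>Mon n D. a m * mon m x) \<in> Pn n"
    by (intro Pn_sum finite_Mon fringD(3)[OF fring_Pn fringD(1)[OF fring_Pn] Pn_mon]) (auto simp: Mon_def)
  then show ?thesis by (simp add: pe_def[abs_def])
qed

section \<open>Ideals of polynomial functions\<close>

inductive_set idl :: "((nat \<Rightarrow> real) \<Rightarrow> real) set \<Rightarrow> ((nat \<Rightarrow> real) \<Rightarrow> real) set \<Rightarrow> ((nat \<Rightarrow> real) \<Rightarrow> real) set"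
  for Q J where
  zero: "(\<lambda>_. 0) \<in> idl Q J"
| step: "a \<in> Q \<Longrightarrow> f \<in> J \<Longrightarrow> g \<in> idl Q J \<Longrightarrow> (\<lambda>x. a x * f x + g x) \<in> idl Q J"

lemma idl_mono: "f \<in> idl Q J \<Longrightarrow> J \<subseteq> J' \<Longrightarrow> f \<in> idl Q J'"
  by (induction rule: idl.induct) (auto intro: idl.intros)

lemma idl_add: "f \<in> idl Q J \<Longrightarrow> g \<in> idl Q J \<Longrightarrow> (\<lambda>x. f x + g x) \<in> idl Q J"
proof (induction rule: idl.induct)
  case (step a f h)
  then have "(\<lambda>x. a x * f x + (h x + g x)) \<in> idl Q J" by (intro idl.step) auto
  then show ?case by (simp add: add.assoc)
qed simp

lemma idl_mult:
  assumes "fring Q" "b \<in> Q" "f \<in> idl Q J" shows "(\<lambda>x. b x * f x) \<in> idl Q J"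
  using assms(3)
proof (induction rule: idl.induct)
  case (step a f h)
  then have "(\<lambda>x. (b x * a x) * f x + b x * h x) \<in> idl Q J"
    using assms by (intro idl.step fringD(3)[of Q]) auto
  then show ?case by (simp add: algebra_simps)
qed (simp add: idl.zero)

lemma idl_base: "fring Q \<Longrightarrow> f \<in> J \<Longrightarrow> f \<in> idl Q J"
  using idl.step[of "\<lambda>_. 1" Q f J "\<lambda>_. 0"] fringD(1)[of Q 1] idl.zero by auto

lemma idl_trans:
  assumes "fring Q" "f \<in> idl Q J'" "J' \<subseteq> idl Q J" shows "f \<in> idl Q J"
  using assms(2)
proof (induction rule: idl.induct)
  case (step a f g)
  then show ?case using assms idl_add[of "\<lambda>x. a x * f x" Q J g] idl_mult[of Q a f J] by auto
qed (rule idl.zero)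

lemma idl_zeros: "f \<in> idl Q J \<Longrightarrow> (\<And>g. g \<in> J \<Longrightarrow> g x = 0) \<Longrightarrow> f x = 0"
  by (induction rule: idl.induct) auto

text \<open>Choose elements of minimal degree outside the ideal generated by their predecessors; a relation
  between the leading coefficients lowers the degree.\<close>

lemma hilbert_sequence:
  "(\<And>i. f i \<in> Pn n) \<Longrightarrow> \<exists>N::nat. f N \<in> idl (Pn n) (f ` {..<N})"
proof (induction n arbitrary: f)
  case 0
  show ?case
  proof (cases "f 0 = (\<lambda>_. 0)")
    case True
    then show ?thesis using idl.zero by (intro exI[of _ 0]) simp
  next
    case False
    obtain b d where bd: "f 0 = (\<lambda>_. b)" "f 1 = (\<lambda>_. d)" using 0[of 0] 0[of 1] by auto
    with False have b: "b \<noteq> 0" by auto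
    have "(\<lambda>x. (\<lambda>_. d / b) x * f 0 x + (\<lambda>_. 0) x) \<in> idl (Pn 0) (f ` {..<1})"
      by (intro idl.step idl.zero) auto
    moreover have "(\<lambda>x. (\<lambda>_. d / b) x * f 0 x + (\<lambda>_. 0) x) = f 1" using b bd by auto
    ultimately show ?thesis by (intro exI[of _ 1]) simp
  qed
next
  case (Suc n)
  let ?P = "Pn (Suc n)"
  note R = fring_Pn[of "Suc n"] and Rn = fring_Pn[of n]
  show ?case
  proof (rule ccontr)
    assume neg: "\<not> ?thesis"
    \<comment> \<open>The ideal generated by the whole sequence.\<close>
    define I where "I = (\<Union>N. idl ?P (f ` {..<N}))"
    have I_add: "(\<lambda>x. g x + h x) \<in> I" if "g \<in> I" "h \<in> I" for g h
    proof -
      from that obtain N M where "g \<in> idl ?P (f ` {..<N})" "h \<in> idl ?P (f ` {..<M})" by (auto simp: I_def)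
      then have "g \<in> idl ?P (f ` {..<max N M})" "h \<in> idl ?P (f ` {..<max N M})" by (auto elim!: idl_mono)
      then show ?thesis unfolding I_def using idl_add by blast
    qed
    have I_mult: "(\<lambda>x. b x * g x) \<in> I" if "g \<in> I" "b \<in> ?P" for g b
      using that idl_mult[OF R that(2)] by (auto simp: I_def)
    have I_P: "g \<in> ?P" if "g \<in> I" for g
    proof -
      from that obtain N where "g \<in> idl ?P (f ` {..<N})" by (auto simp: I_def)
      then show ?thesis by (induction rule: idl.induct) (use Suc.prems in \<open>auto intro!: fringD[OF R] simp del: Pn.simps\<close>)
    qed
    have I_sub: "g \<in> I" if "g \<in> idl ?P J" "J \<subseteq> I" for g J
      using that
    proof (induction rule: idl.induct)
      case zero
      show ?case using idl.zero by (auto simp: I_def)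
    next
      case (step a h g)
      then show ?case using I_add I_mult by blast
    qed
    define md where "md g = (LEAST d. rep (Pn n) n d g)" for g
    have md: "rep (Pn n) n (md g) g" if "g \<in> I" for g
      unfolding md_def using I_P[OF that] by (auto intro: LeastI_ex)
    have md_le: "md g \<le> d" if "rep (Pn n) n d g" for g d unfolding md_def using that by (rule Least_le)
    define Ch where "Ch g i r \<longleftrightarrow> r \<in> I \<and> r \<notin> idl ?P (g ` {..<i}) \<and> (\<forall>r'\<in>I. r' \<notin> idl ?P (g ` {..<i}) \<longrightarrow> md r \<le> md r')" for g and i :: nat and r
    have "\<exists>g. \<forall>i. Ch g i (g i)"
    proof (rule dependent_wellorder_choice)
      fix r :: "(nat \<Rightarrow> real) \<Rightarrow> real" and g h :: "nat \<Rightarrow> (nat \<Rightarrow> real) \<Rightarrow> real" and i :: nat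
      assume "\<And>j. j < i \<Longrightarrow> g j = h j"
      then have "g ` {..<i} = h ` {..<i}" by auto
      then show "Ch g i r = Ch h i r" by (simp add: Ch_def)
    next
      fix i :: nat and g :: "nat \<Rightarrow> (nat \<Rightarrow> real) \<Rightarrow> real" assume g: "\<And>j. j < i \<Longrightarrow> Ch g j (g j)"
      have "\<exists>N. \<forall>j<l. g j \<in> idl ?P (f ` {..<N})" if "l \<le> i" for l
        using that
      proof (induction l)
        case (Suc l)
        then obtain N where N: "\<forall>j<l. g j \<in> idl ?P (f ` {..<N})" by auto
        obtain M where M: "g l \<in> idl ?P (f ` {..<M})" using g[of l] Suc.prems by (auto simp: Ch_def I_def)
        show ?case using N M by (intro exI[of _ "max N M"]) (auto simp: less_Suc_eq elim!: idl_mono)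
      qed simp
      then obtain N where N: "\<forall>j<i. g j \<in> idl ?P (f ` {..<N})" by blast
      have fI: "f N \<in> I" unfolding I_def using idl_base[OF R, of "f N" "f ` {..<Suc N}"] by blast
      have "f N \<notin> idl ?P (g ` {..<i})"
      proof
        assume "f N \<in> idl ?P (g ` {..<i})"
        then have "f N \<in> idl ?P (f ` {..<N})" by (rule idl_trans[OF R]) (use N in auto)
        with neg show False by blast
      qed
      with fI obtain r where "r \<in> I \<and> r \<notin> idl ?P (g ` {..<i})" "\<forall>r'. r' \<in> I \<and> r' \<notin> idl ?P (g ` {..<i}) \<longrightarrow> md r \<le> md r'"
        using ex_has_least_nat[of "\<lambda>r. r \<in> I \<and> r \<notin> idl ?P (g ` {..<i})" "f N" md] by blast
      then show "\<exists>r. Ch g i r" unfolding Ch_def by blast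
    qed
    then obtain g where g: "\<And>i. Ch g i (g i)" by blast
    have gI: "g i \<in> I" and gn: "g i \<notin> idl ?P (g ` {..<i})" and gm: "\<And>r'. r' \<in> I \<Longrightarrow> r' \<notin> idl ?P (g ` {..<i}) \<Longrightarrow> md (g i) \<le> md r'" for i
      using g[of i] by (auto simp: Ch_def)
    have mdmono: "md (g i) \<le> md (g j)" if "i \<le> j" for i j
    proof -
      have "g ` {..<i} \<subseteq> g ` {..<j}" using that by auto
      then have "g j \<notin> idl ?P (g ` {..<i})" using gn[of j] idl_mono by blast
      then show ?thesis by (rule gm[OF gI])
    qed
    \<comment> \<open>\<open>md\<close> counts coefficients, so the degree is one less.\<close>
    define e where "e i = md (g i) - 1" for i
    have "\<exists>p. md (g i) = Suc (e i) \<and> fst p \<in> Pn n \<and> rep (Pn n) n (e i) (snd p) \<and> g i = (\<lambda>x. fst p x * x n ^ e i + snd p x)" for i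
    proof -
      obtain a where a: "\<forall>j. a j \<in> Pn n" "g i = (\<lambda>x. \<Sum>j<md (g i). a j x * x n ^ j)"
        using md[OF gI[of i]] by (auto simp: rep_def)
      have "md (g i) \<noteq> 0"
      proof
        assume "md (g i) = 0"
        then have "g i = (\<lambda>_. 0)" using a(2) by simp
        then show False using gn[of i] idl.zero by simp
      qed
      then have e: "md (g i) = Suc (e i)" by (simp add: e_def)
      have "rep (Pn n) n (e i) (\<lambda>x. \<Sum>j<e i. a j x * x n ^ j)" using a(1) by (auto simp: rep_def)
      moreover have "g i = (\<lambda>x. a (e i) x * x n ^ e i + (\<Sum>j<e i. a j x * x n ^ j))" by (subst a(2)) (simp add: e add.commute)
      ultimately show ?thesis using a(1) e by (intro exI[of _ "(a (e i), \<lambda>x. \<Sum>j<e i. a j x * x n ^ j)"]) auto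
    qed
    then have "\<exists>p. \<forall>i. md (g i) = Suc (e i) \<and> fst (p i) \<in> Pn n \<and> rep (Pn n) n (e i) (snd (p i)) \<and> g i = (\<lambda>x. fst (p i) x * x n ^ e i + snd (p i) x)"
      by (intro choice allI)
    then obtain p where p: "\<forall>i. md (g i) = Suc (e i) \<and> fst (p i) \<in> Pn n \<and> rep (Pn n) n (e i) (snd (p i)) \<and> g i = (\<lambda>x. fst (p i) x * x n ^ e i + snd (p i) x)"
      by (elim exE)
    define b l where "b i = fst (p i)" and "l i = snd (p i)" for i
    have ebl: "\<And>i. md (g i) = Suc (e i)" "\<And>i. b i \<in> Pn n" "\<And>i. rep (Pn n) n (e i) (l i)"
      "\<And>i. g i = (\<lambda>x. b i x * x n ^ e i + l i x)" using p unfolding b_def l_def by blast+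
    \<comment> \<open>The induction hypothesis is applied to the leading coefficients. Below,
      earlier elements are shifted up to degree \<open>e N\<close>, which is possible because the
      minimal degrees never decrease.\<close>
    obtain N where N: "b N \<in> idl (Pn n) (b ` {..<N})" using Suc.IH[of b] ebl(2) by blast
    have xn: "(\<lambda>x. x n ^ k) \<in> ?P" for k
    proof (induction k)
      case (Suc k)
      have "(\<lambda>x. x n) \<in> ?P" by (rule Pn_coord) simp
      from fringD(3)[OF R this Suc] show ?case by simp
    qed (use fringD(1)[OF R] in simp)
    have "\<exists>h\<in>idl ?P (g ` {..<N}). \<exists>r. rep (Pn n) n (e N) r \<and> h = (\<lambda>x. \<beta> x * x n ^ e N + r x)"
      if "\<beta> \<in> idl (Pn n) (b ` {..<N})" for \<beta>
      using that
    proof (induction rule: idl.induct)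
      case zero
      show ?case using idl.zero[of ?P "g ` {..<N}"] rep_0[OF Rn, of n "e N"] by (intro bexI[of _ "\<lambda>_. 0"]) auto
    next
      case (step a f' \<beta>')
      then obtain h' r' where h': "h' \<in> idl ?P (g ` {..<N})" "rep (Pn n) n (e N) r'" "h' = (\<lambda>x. \<beta>' x * x n ^ e N + r' x)" by blast
      from step obtain i where i: "i < N" "f' = b i" by auto
      have ei: "e i \<le> e N" using mdmono[of i N] i ebl(1) by simp
      define q where "q = e N - e i"
      have q: "e N = e i + q" using ei by (simp add: q_def)
      have "a \<in> ?P" using step Pn_mono by blast
      then have aq: "(\<lambda>x. a x * x n ^ q) \<in> ?P" by (rule fringD(3)[OF R _ xn])
      define h where "h = (\<lambda>x. (a x * x n ^ q) * g i x + h' x)"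
      have "h \<in> idl ?P (g ` {..<N})" unfolding h_def using aq i h' by (intro idl.step) auto
      moreover have "rep (Pn n) n (e N) (\<lambda>x. a x * (x n ^ q * l i x) + r' x)"
        using step h' ebl(3)[of i] unfolding q by (intro rep_add[OF Rn] rep_scale[OF Rn] rep_shift[OF Rn]) (auto simp: q)
      moreover have "h = (\<lambda>x. (a x * f' x + \<beta>' x) * x n ^ e N + (a x * (x n ^ q * l i x) + r' x))"
        unfolding h_def h'(3) i(2) ebl(4)[of i] by (rule ext) (simp add: q power_add algebra_simps)
      ultimately show ?case by blast
    qed
    from this[OF N] obtain h r where h: "h \<in> idl ?P (g ` {..<N})" "rep (Pn n) n (e N) r" "h = (\<lambda>x. b N x * x n ^ e N + r x)" by blast
    \<comment> \<open>The leading terms of \<open>g N\<close> and \<open>h\<close> agree, so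
      \<open>w\<close> has smaller degree than \<open>g N\<close> and yet stays outside the ideal of
      the predecessors.\<close>
    define w where "w = (\<lambda>x. g N x + - 1 * h x)"
    have m1: "(\<lambda>_. -1) \<in> Pn n" "(\<lambda>_. -1) \<in> ?P" using fringD(1)[OF Rn] fringD(1)[OF R] by auto
    have "w = (\<lambda>x. l N x + (-1) * r x)" unfolding w_def h(3) by (subst ebl(4)[of N]) (rule ext, simp)
    moreover have "rep (Pn n) n (e N) (\<lambda>x. l N x + (\<lambda>_. -1) x * r x)"
      by (intro rep_add[OF Rn] ebl(3) rep_scale[OF Rn h(2) m1(1)])
    ultimately have wr: "rep (Pn n) n (e N) w" by simp
    have hI: "h \<in> I" using h(1) gI by (intro I_sub[of _ "g ` {..<N}"]) auto
    have "w \<in> I" unfolding w_def using I_add[OF gI[of N] I_mult[OF hI m1(2)]] by simp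
    moreover have "w \<notin> idl ?P (g ` {..<N})"
    proof
      assume "w \<in> idl ?P (g ` {..<N})"
      from idl_add[OF this h(1)] have "g N \<in> idl ?P (g ` {..<N})" by (simp add: w_def)
      with gn[of N] show False by simp
    qed
    ultimately have "md (g N) \<le> md w" by (rule gm)
    also have "\<dots> \<le> e N" by (rule md_le[OF wr])
    finally show False using ebl(1)[of N] by simp
  qed
qed

text \<open>If no finite subset had the same zeros, each finite choice could be followed by an
  equation violated at one of its common zeros, hence outside its ideal. Such a sequence contradicts
  \<open>hilbert_sequence\<close>.\<close>

theorem finitely_many_equations:
  assumes "I \<subseteq> Pn n"
  shows "\<exists>J. finite J \<and> J \<subseteq> I \<and> (\<forall>x. (\<forall>f\<in>J. f x = 0) \<longrightarrow> (\<forall>f\<in>I. f x = 0))"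
proof (rule ccontr)
  assume neg: "\<not> ?thesis"
  define Ch where "Ch g i r \<longleftrightarrow> r \<in> I \<and> r \<notin> idl (Pn n) (g ` {..<i})" for g and i :: nat and r
  have "\<exists>g. \<forall>i. Ch g i (g i)"
  proof (rule dependent_wellorder_choice)
    fix r :: "(nat \<Rightarrow> real) \<Rightarrow> real" and g h :: "nat \<Rightarrow> (nat \<Rightarrow> real) \<Rightarrow> real" and i :: nat
    assume "\<And>j. j < i \<Longrightarrow> g j = h j"
    then have "g ` {..<i} = h ` {..<i}" by auto
    then show "Ch g i r = Ch h i r" by (simp add: Ch_def)
  next
    fix i :: nat and g :: "nat \<Rightarrow> (nat \<Rightarrow> real) \<Rightarrow> real" assume "\<And>j. j < i \<Longrightarrow> Ch g j (g j)"
    then have J: "finite (g ` {..<i})" "g ` {..<i} \<subseteq> I" by (auto simp: Ch_def)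
    have "\<not> (\<forall>x. (\<forall>f\<in>g ` {..<i}. f x = 0) \<longrightarrow> (\<forall>f\<in>I. f x = 0))"
    proof
      assume A: "\<forall>x. (\<forall>f\<in>g ` {..<i}. f x = 0) \<longrightarrow> (\<forall>f\<in>I. f x = 0)"
      from neg show False by (rule notE) (rule exI[of _ "g ` {..<i}"], intro conjI J A)
    qed
    then obtain x f where "\<forall>f\<in>g ` {..<i}. f x = 0" "f \<in> I" "f x \<noteq> 0" by blast
    then show "\<exists>r. Ch g i r" unfolding Ch_def using idl_zeros[of f _ "g ` {..<i}" x] by blast
  qed
  then obtain g where g: "\<And>i. Ch g i (g i)" by blast
  have "g i \<in> Pn n" for i using g[of i] assms by (auto simp: Ch_def)
  then obtain N where "g N \<in> idl (Pn n) (g ` {..<N})" using hilbert_sequence[of g n] by blast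
  with g[of N] show False by (simp add: Ch_def)
qed

section \<open>Descent to a subring of the reals\<close>

definition subfield_of :: "real set \<Rightarrow> bool" where
  "subfield_of K \<longleftrightarrow> 0 \<in> K \<and> 1 \<in> K \<and> (\<forall>a\<in>K. \<forall>b\<in>K. a + b \<in> K \<and> a - b \<in> K \<and> a * b \<in> K \<and> a / b \<in> K)"

lemma subfieldD:
  assumes "subfield_of K"
  shows "0 \<in> K" "1 \<in> K" "a \<in> K \<Longrightarrow> b \<in> K \<Longrightarrow> a + b \<in> K" "a \<in> K \<Longrightarrow> b \<in> K \<Longrightarrow> a - b \<in> K"
    "a \<in> K \<Longrightarrow> b \<in> K \<Longrightarrow> a * b \<in> K" "a \<in> K \<Longrightarrow> b \<in> K \<Longrightarrow> a / b \<in> K"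
  using assms by (auto simp: subfield_of_def)

text \<open>Gaussian elimination: a linear system with coefficients in \<open>K\<close> has its
  solution space spanned over the reals by solutions in \<open>K\<close>, so one of these is nonzero
  at \<open>x\<close>. The vector \<open>x\<close> itself may lie outside \<open>K\<close>.\<close>

lemma linear_form_over_subfield:
  fixes w x :: "'a \<Rightarrow> real"
  assumes K: "subfield_of K" and "finite I"
    and "\<forall>s\<in>S. \<forall>i\<in>I. s i \<in> K" "\<forall>s\<in>S. (\<Sum>i\<in>I. w i * s i) = 0" "(\<Sum>i\<in>I. w i * x i) \<noteq> 0"
  shows "\<exists>q. (\<forall>i\<in>I. q i \<in> K) \<and> (\<forall>s\<in>S. (\<Sum>i\<in>I. q i * s i) = 0) \<and> (\<Sum>i\<in>I. q i * x i) \<noteq> 0"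
  using assms(2-)
proof (induction I arbitrary: S x rule: finite_induct)
  case empty
  then show ?case by simp
next
  case (insert i0 I)
  show ?case
  proof (cases "\<forall>s\<in>S. s i0 = 0")
    case True
    show ?thesis
    proof (cases "x i0 = 0")
      case False
      define q where "q i = (if i = i0 then 1 else 0 :: real)" for i
      have "(\<Sum>i\<in>insert i0 I. q i * v i) = v i0" for v
      proof -
        have "(\<Sum>i\<in>I. q i * v i) = (\<Sum>i\<in>I. 0)" using insert.hyps by (intro sum.cong) (auto simp: q_def)
        then show ?thesis using insert.hyps by (simp add: q_def)
      qed
      then show ?thesis using True False subfieldD(1,2)[OF K] by (intro exI[of _ q]) (auto simp: q_def)
    next
      case x0: True
      have "\<exists>q. (\<forall>i\<in>I. q i \<in> K) \<and> (\<forall>s\<in>S. (\<Sum>i\<in>I. q i * s i) = 0) \<and> (\<Sum>i\<in>I. q i * x i) \<noteq> 0"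
      proof (rule insert.IH)
        show "\<forall>s\<in>S. \<forall>i\<in>I. s i \<in> K" using insert.prems(1) by auto
        show "\<forall>s\<in>S. (\<Sum>i\<in>I. w i * s i) = 0"
        proof
          fix s assume "s \<in> S"
          from bspec[OF insert.prems(2) this] bspec[OF True this] show "(\<Sum>i\<in>I. w i * s i) = 0"
            using insert.hyps by simp
        qed
        show "(\<Sum>i\<in>I. w i * x i) \<noteq> 0" using insert.prems(3) insert.hyps x0 by simp
      qed
      then obtain q where q: "\<forall>i\<in>I. q i \<in> K" "\<forall>s\<in>S. (\<Sum>i\<in>I. q i * s i) = 0" "(\<Sum>i\<in>I. q i * x i) \<noteq> 0" by blast
      define q' where "q' = q(i0 := 0)"
      have same: "(\<Sum>i\<in>insert i0 I. q' i * v i) = (\<Sum>i\<in>I. q i * v i)" for v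
      proof -
        have "(\<Sum>i\<in>I. q' i * v i) = (\<Sum>i\<in>I. q i * v i)"
          using insert.hyps by (intro sum.cong) (auto simp: q'_def)
        then show ?thesis using insert.hyps by (simp add: q'_def)
      qed
      have "\<forall>i\<in>insert i0 I. q' i \<in> K" using q(1) subfieldD(1)[OF K] by (auto simp: q'_def)
      then show ?thesis using q(2,3) unfolding same[symmetric] by blast
    qed
  next
    case False
    then obtain p where p: "p \<in> S" "p i0 \<noteq> 0" by blast
    \<comment> \<open>\<open>p\<close> serves as pivot: \<open>el\<close> clears coordinate
      \<open>i0\<close>, and on \<open>S\<close> it stays within \<open>K\<close>.\<close>
    define el where "el v i = v i - v i0 / p i0 * p i" for v i
    have el0: "el v i0 = 0" for v using p by (simp add: el_def)
    have dot: "(\<Sum>i\<in>insert i0 I. c i * el v i) = (\<Sum>i\<in>insert i0 I. c i * v i) - v i0 / p i0 * (\<Sum>i\<in>insert i0 I. c i * p i)" for c v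
      unfolding el_def right_diff_distrib sum_subtractf sum_distrib_left by (simp only: mult.left_commute)
    have wel: "(\<Sum>i\<in>I. w i * el v i) = (\<Sum>i\<in>insert i0 I. w i * v i)" for v
    proof -
      have "(\<Sum>i\<in>I. w i * el v i) = (\<Sum>i\<in>insert i0 I. w i * el v i)" using insert.hyps el0[of v] by simp
      also have "\<dots> = (\<Sum>i\<in>insert i0 I. w i * v i)" using dot[of w v] insert.prems(2) p(1) by simp
      finally show ?thesis .
    qed
    have "\<exists>q. (\<forall>i\<in>I. q i \<in> K) \<and> (\<forall>s\<in>el ` S. (\<Sum>i\<in>I. q i * s i) = 0) \<and> (\<Sum>i\<in>I. q i * el x i) \<noteq> 0"
    proof (rule insert.IH)
      show "\<forall>s\<in>el ` S. \<forall>i\<in>I. s i \<in> K"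
        using insert.prems(1) p(1) by (auto simp: el_def intro!: subfieldD(4,5,6)[OF K])
      show "\<forall>s\<in>el ` S. (\<Sum>i\<in>I. w i * s i) = 0" using insert.prems(2) by (simp only: ball_simps wel)
      show "(\<Sum>i\<in>I. w i * el x i) \<noteq> 0" using insert.prems(3) by (simp only: wel not_False_eq_True)
    qed
    then obtain q where q: "\<forall>i\<in>I. q i \<in> K" "\<forall>s\<in>S. (\<Sum>i\<in>I. q i * el s i) = 0" "(\<Sum>i\<in>I. q i * el x i) \<noteq> 0" by auto
    \<comment> \<open>The coefficient at \<open>i0\<close> is chosen so that the form also
      annihilates the pivot.\<close>
    define q' where "q' = q(i0 := - (\<Sum>i\<in>I. q i * p i) / p i0)"
    have same: "(\<Sum>i\<in>I. q' i * v i) = (\<Sum>i\<in>I. q i * v i)" for v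
      using insert.hyps by (intro sum.cong) (auto simp: q'_def)
    have p0: "(\<Sum>i\<in>insert i0 I. q' i * p i) = 0"
      using insert.hyps p(2) by (simp add: same) (simp add: q'_def)
    have "(\<Sum>i\<in>insert i0 I. q' i * v i) = (\<Sum>i\<in>I. q i * el v i)" for v
    proof -
      have "(\<Sum>i\<in>insert i0 I. q' i * v i) = (\<Sum>i\<in>insert i0 I. q' i * el v i)" using dot[of q' v] p0 by simp
      then show ?thesis using insert.hyps el0[of v] by (simp add: same)
    qed
    moreover have "\<forall>i\<in>insert i0 I. q' i \<in> K"
    proof -
      have "(\<Sum>i\<in>I'. q i * p i) \<in> K" if "I' \<subseteq> I" for I'
        using finite_subset[OF that insert.hyps(1)] that
        by (induction I' rule: finite_induct) (use q(1) insert.prems(1) p(1) in \<open>auto intro!: subfieldD[OF K]\<close>)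
      from subfieldD(4)[OF K subfieldD(1)[OF K] this[of I]] have "- (\<Sum>i\<in>I. q i * p i) \<in> K" by simp
      then show ?thesis using q(1) p(1) insert.prems(1) by (auto simp: q'_def intro!: subfieldD(6)[OF K, of "- (\<Sum>i\<in>I. q i * p i)", simplified])
    qed
    ultimately show ?thesis using q(2,3) by (intro exI[of _ q']) auto
  qed
qed

section \<open>Subrings and their fractions\<close>

definition subring_of :: "real set \<Rightarrow> bool" where
  "subring_of K \<longleftrightarrow> 0 \<in> K \<and> 1 \<in> K \<and> (\<forall>a\<in>K. \<forall>b\<in>K. a + b \<in> K \<and> a * b \<in> K \<and> - a \<in> K)"

lemma subringD:
  assumes "subring_of K"
  shows "0 \<in> K" "1 \<in> K" "a \<in> K \<Longrightarrow> b \<in> K \<Longrightarrow> a + b \<in> K" "a \<in> K \<Longrightarrow> b \<in> K \<Longrightarrow> a * b \<in> K" "a \<in> K \<Longrightarrow> - a \<in> K"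
  using assms by (auto simp: subring_of_def)

definition fracs :: "real set \<Rightarrow> real set" where
  "fracs K = {a / b |a b. a \<in> K \<and> b \<in> K}"

lemma subfield_fracs: assumes K: "subring_of K" shows "subfield_of (fracs K)"
proof -
  note k = subringD[OF K]
  have i: "a / b \<in> fracs K" if "a \<in> K" "b \<in> K" for a b using that by (auto simp: fracs_def)
  have "a / b + p / q \<in> fracs K \<and> a / b - p / q \<in> fracs K \<and> a / b * (p / q) \<in> fracs K \<and> a / b / (p / q) \<in> fracs K"
    if "a \<in> K" "b \<in> K" "p \<in> K" "q \<in> K" for a b p q
  proof -
    have 1: "a / b + p / q \<in> fracs K" if "p \<in> K" for p
    proof (cases "b = 0 \<or> q = 0")
      case True
      then show ?thesis using i[of a b] i[of p q] \<open>a \<in> K\<close> \<open>b \<in> K\<close> \<open>q \<in> K\<close> that by auto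
    next
      case False
      then have "a / b + p / q = (a * q + p * b) / (b * q)" by (simp add: field_simps)
      then show ?thesis using \<open>a \<in> K\<close> \<open>b \<in> K\<close> \<open>q \<in> K\<close> that by (simp only:) (intro i k)
    qed
    have 2: "a / b - p / q \<in> fracs K" using 1[of "- p"] k(5)[of p] that by simp
    have 3: "a / b * (p / q) = (a * p) / (b * q)" "a / b / (p / q) = (a * q) / (b * p)" by auto
    show ?thesis unfolding 3 using 1 2 that by (auto intro!: i k)
  qed
  then show ?thesis unfolding subfield_of_def using i[of 0 1] i[of 1 1] k(1,2) by (auto simp: fracs_def)
qed

lemma subring_fracs: "subring_of K \<Longrightarrow> a \<in> K \<Longrightarrow> a \<in> fracs K"
  unfolding fracs_def using subringD(2)[of K] by (intro CollectI exI[of _ a] exI[of _ 1]) simp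

lemma common_denominator:
  assumes K: "subring_of K" and "finite I" "\<forall>i\<in>I. q i \<in> fracs K"
  shows "\<exists>b\<in>K. b \<noteq> 0 \<and> (\<forall>i\<in>I. b * q i \<in> K)"
  using assms(2-)
proof (induction I rule: finite_induct)
  case empty
  then show ?case using subringD(2)[OF K] by (intro bexI[of _ 1]) auto
next
  case (insert i I)
  then obtain b where b: "b \<in> K" "b \<noteq> 0" "\<forall>i\<in>I. b * q i \<in> K" by auto
  obtain p r where pr: "q i = p / r" "p \<in> K" "r \<in> K" using insert.prems by (auto simp: fracs_def)
  show ?case
  proof (cases "r = 0")
    case True
    then show ?thesis using b pr subringD(1)[OF K] by (intro bexI[of _ b]) auto
  next
    case False
    have "b * r * q i = b * p" using False pr by simp
    moreover have "b * r * q j \<in> K" if "j \<in> I" for j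
      using subringD(4)[OF K pr(3), of "b * q j"] b(3) that by (simp add: mult.commute mult.left_commute)
    ultimately show ?thesis using b pr False subringD(4)[OF K] by (intro bexI[of _ "b * r"]) auto
  qed
qed

lemma subring_mon: "subring_of K \<Longrightarrow> (\<And>i. i \<in> set m \<Longrightarrow> x i \<in> K) \<Longrightarrow> mon m x \<in> K"
  by (induction m) (auto intro: subringD)

text \<open>Combines separation, descent and Hilbert's theorem: on the sphere, the orbit closure is
  cut out by finitely many equations with coefficients in the ring generated by the data.\<close>

theorem (in isometries) orbit_equations:
  assumes K: "subring_of K" and co: "\<And>u i. u \<in> W \<Longrightarrow> i < n \<Longrightarrow> Tw u s0 i \<in> K"
  obtains F where "finite F" "\<And>D a m. (D, a) \<in> F \<Longrightarrow> a m \<in> K"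
    "\<And>D a u. (D, a) \<in> F \<Longrightarrow> u \<in> W \<Longrightarrow> pe n D a (Tw u s0) = 0"
    "\<And>x. x \<in> usph n \<Longrightarrow> (\<And>D a. (D, a) \<in> F \<Longrightarrow> pe n D a x = 0) \<Longrightarrow> x \<in> Ob"
proof -
  define G where "G = {(D, a). (\<forall>m. a m \<in> K) \<and> (\<forall>u\<in>W. pe n D a (Tw u s0) = 0)}"
  define I where "I = (\<lambda>(D, a). pe n D a) ` G"
  have "I \<subseteq> Pn n" using Pn_pe by (auto simp: I_def)
  from finitely_many_equations[OF this] obtain J
    where J: "finite J" "J \<subseteq> I" "\<forall>x. (\<forall>f\<in>J. f x = 0) \<longrightarrow> (\<forall>f\<in>I. f x = 0)"
    by (elim exE conjE)
  obtain F where F: "finite F" "F \<subseteq> G" "J = (\<lambda>(D, a). pe n D a) ` F"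
    using finite_subset_image[OF J(1) J(2)[unfolded I_def]] by blast
  show ?thesis
  proof (rule that[OF F(1)])
    show "a m \<in> K" if "(D, a) \<in> F" for D a m using that F(2) by (auto simp: G_def)
    show "pe n D a (Tw u s0) = 0" if "(D, a) \<in> F" "u \<in> W" for D a u using that F(2) by (auto simp: G_def)
    fix x assume x: "x \<in> usph n" and zero: "\<And>D a. (D, a) \<in> F \<Longrightarrow> pe n D a x = 0"
    have all: "f x = 0" if "f \<in> I" for f
      using J(3) zero that unfolding F(3) by fastforce
    show "x \<in> Ob"
    proof (rule ccontr)
      assume "x \<notin> Ob"
      then obtain D w where w: "\<And>u. u \<in> W \<Longrightarrow> pe n D w (Tw u s0) = 0" "pe n D w x \<noteq> 0"
        using orbit_separation[OF x] by blast
      \<comment> \<open>The monomial vectors of the orbit points. Vanishing on the orbit is a linear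
        system on coefficients with entries in \<open>K\<close>, so the real solution
        \<open>w\<close> can be replaced by one over the fractions of \<open>K\<close>.\<close>
      define S where "S = (\<lambda>u m. mon m (Tw u s0)) ` W"
      have "\<exists>q. (\<forall>m\<in>Mon n D. q m \<in> fracs K) \<and> (\<forall>s\<in>S. (\<Sum>m\<in>Mon n D. q m * s m) = 0) \<and> (\<Sum>m\<in>Mon n D. q m * mon m x) \<noteq> 0"
      proof (rule linear_form_over_subfield[OF subfield_fracs[OF K] finite_Mon])
        show "\<forall>s\<in>S. \<forall>m\<in>Mon n D. s m \<in> fracs K"
          using co by (fastforce simp: S_def Mon_def intro!: subring_fracs[OF K] subring_mon[OF K])
        show "\<forall>s\<in>S. (\<Sum>m\<in>Mon n D. w m * s m) = 0" using w(1) by (auto simp: S_def pe_def)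
        show "(\<Sum>m\<in>Mon n D. w m * mon m x) \<noteq> 0" using w(2) by (simp add: pe_def)
      qed
      then obtain q where q: "\<forall>m\<in>Mon n D. q m \<in> fracs K" "\<forall>s\<in>S. (\<Sum>m\<in>Mon n D. q m * s m) = 0"
        "(\<Sum>m\<in>Mon n D. q m * mon m x) \<noteq> 0" by blast
      obtain b where b: "b \<in> K" "b \<noteq> 0" "\<forall>m\<in>Mon n D. b * q m \<in> K"
        using common_denominator[OF K finite_Mon q(1)] by blast
      define a where "a m = (if m \<in> Mon n D then b * q m else 0)" for m
      have pa: "pe n D a y = b * (\<Sum>m\<in>Mon n D. q m * mon m y)" for y
        unfolding pe_def sum_distrib_left by (intro sum.cong) (auto simp: a_def)
      have "(D, a) \<in> G" using b(3) subringD(1)[OF K] q(2) by (auto simp: G_def pa S_def) (auto simp: a_def)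
      then have "pe n D a \<in> I" by (force simp: I_def)
      from all[OF this] show False using b(2) q(3) by (simp add: pa)
    qed
  qed
qed

section \<open>Quantum automata as real isometries\<close>

definition rl :: "nat \<Rightarrow> (nat \<Rightarrow> complex) \<Rightarrow> nat \<Rightarrow> real" where
  "rl d v i = (if i < 2 * d then (if even i then Re (v (i div 2)) else Im (v (i div 2))) else 0)"

definition cx :: "(nat \<Rightarrow> real) \<Rightarrow> nat \<Rightarrow> complex" where
  "cx x q = Complex (x (2 * q)) (x (2 * q + 1))"

text \<open>Each complex entry becomes the real 2 by 2 matrix of multiplication by it, matching the
  interleaved parts in \<open>rl\<close>.\<close>

definition AR :: "(nat \<Rightarrow> nat \<Rightarrow> complex) \<Rightarrow> nat \<Rightarrow> nat \<Rightarrow> real" where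
  "AR U i j = (if even i then (if even j then Re (U (i div 2) (j div 2)) else - Im (U (i div 2) (j div 2)))
     else (if even j then Im (U (i div 2) (j div 2)) else Re (U (i div 2) (j div 2))))"

lemma sum_pairs: "(\<Sum>j<2 * d. f j) = (\<Sum>q<d. f (2 * q) + f (2 * q + 1 :: nat) :: 'a::comm_monoid_add)"
  by (induction d) (auto simp: add.assoc)

lemma rl_simps [simp]: "q < d \<Longrightarrow> rl d v (2 * q) = Re (v q)" "q < d \<Longrightarrow> rl d v (Suc (2 * q)) = Im (v q)"
  "i \<ge> 2 * d \<Longrightarrow> rl d v i = 0"
  by (auto simp: rl_def)

lemma rl_cx: "i < 2 * d \<Longrightarrow> rl d (cx x) i = x i"
  by (auto simp: rl_def cx_def elim!: evenE oddE)

lemma rl_mat_vec: assumes "i < 2 * d" shows "(\<Sum>j<2 * d. AR U i j * rl d v j) = rl d (mat_vec d U v) i"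
proof -
  have e: "(\<Sum>j<2 * d. AR U i j * rl d v j) = (\<Sum>q<d. AR U i (2 * q) * Re (v q) + AR U i (2 * q + 1) * Im (v q))"
    unfolding sum_pairs by (intro sum.cong) auto
  show ?thesis
  proof (cases "even i")
    case True
    then show ?thesis using assms unfolding e
      by (auto simp: AR_def rl_def mat_vec_def Re_sum intro!: sum.cong)
  next
    case False
    then show ?thesis using assms unfolding e
      by (auto simp: AR_def rl_def mat_vec_def Im_sum intro!: sum.cong)
  qed
qed

lemma nrm_rl: "nrm (2 * d) (rl d v) = sqrt (\<Sum>q<d. (cmod (v q))\<^sup>2)"
  unfolding nrm_def L2_set_def sum_pairs by (auto simp: cmod_power2 intro!: arg_cong[where f = sqrt] sum.cong)

lemma ds_rl: "ds (2 * d) (rl d x) (rl d y) = sqrt (\<Sum>q<d. (cmod (x q - y q))\<^sup>2)"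
proof -
  have "(\<lambda>i. rl d x i - rl d y i) = rl d (\<lambda>q. x q - y q)" by (auto simp: rl_def)
  then show ?thesis by (simp add: ds_def nrm_rl)
qed

lemma unitary_norm:
  assumes "unitary_mat d U"
  shows "(\<Sum>i<d. (cmod (mat_vec d U v i))\<^sup>2) = (\<Sum>i<d. (cmod (v i))\<^sup>2)"
proof -
  have sq: "complex_of_real ((cmod z)\<^sup>2) = cnj z * z" for z
    unfolding complex_norm_square by (rule mult.commute)
  have "complex_of_real (\<Sum>i<d. (cmod (mat_vec d U v i))\<^sup>2) = (\<Sum>i<d. \<Sum>j<d. \<Sum>l<d. (cnj (v j) * v l) * (cnj (U i j) * U i l))"
    unfolding of_real_sum sq mat_vec_def cnj_sum sum_product by (intro sum.cong) (auto simp: algebra_simps)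
  also have "\<dots> = (\<Sum>j<d. \<Sum>i<d. \<Sum>l<d. (cnj (v j) * v l) * (cnj (U i j) * U i l))" by (rule sum.swap)
  also have "\<dots> = (\<Sum>j<d. \<Sum>l<d. \<Sum>i<d. (cnj (v j) * v l) * (cnj (U i j) * U i l))" by (intro sum.cong refl sum.swap)
  also have "\<dots> = (\<Sum>j<d. \<Sum>l<d. (cnj (v j) * v l) * (\<Sum>i<d. cnj (U i j) * U i l))" by (simp add: sum_distrib_left)
  also have "\<dots> = (\<Sum>j<d. \<Sum>l<d. if l = j then cnj (v j) * v l else 0)"
    using assms unfolding unitary_mat_def by (intro sum.cong) auto
  also have "\<dots> = complex_of_real (\<Sum>j<d. (cmod (v j))\<^sup>2)" unfolding of_real_sum sq by simp
  finally show ?thesis by (simp only: of_real_eq_iff)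
qed

lemma cinner_le: "cmod (cinner d \<psi> v) \<le> sqrt (\<Sum>j<d. (cmod (\<psi> j))\<^sup>2) * sqrt (\<Sum>j<d. (cmod (v j))\<^sup>2)"
proof -
  have "cmod (cinner d \<psi> v) \<le> (\<Sum>j<d. \<bar>cmod (\<psi> j)\<bar> * \<bar>cmod (v j)\<bar>)"
    unfolding cinner_def by (rule order_trans[OF norm_sum]) (simp add: norm_mult)
  also have "\<dots> \<le> L2_set (\<lambda>j. cmod (\<psi> j)) {..<d} * L2_set (\<lambda>j. cmod (v j)) {..<d}" by (rule L2_set_mult_ineq)
  finally show ?thesis by (simp add: L2_set_def)
qed

lemma cinner_diff: "cinner d \<psi> (\<lambda>j. x j - y j) = cinner d \<psi> x - cinner d \<psi> y"
  by (simp add: cinner_def right_diff_distrib sum_subtractf)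

lemma cinner_self: "unit_vec d \<psi> \<Longrightarrow> cinner d \<psi> \<psi> = 1"
proof -
  assume "unit_vec d \<psi>"
  moreover have "cinner d \<psi> \<psi> = complex_of_real (\<Sum>j<d. (cmod (\<psi> j))\<^sup>2)"
    unfolding cinner_def of_real_sum complex_norm_square by (simp add: mult.commute)
  ultimately show ?thesis by (simp add: Defs.unit_vec_def)
qed

text \<open>The margin \<open>\<mu>\<close> is uniform in \<open>y\<close>: an infimum over
  infinitely many checkpoints then still exceeds \<open>lam\<close> strictly.\<close>

lemma cinner_close:
  assumes \<psi>: "unit_vec d \<psi>" and a: "(cmod (cinner d \<psi> x))\<^sup>2 > lam" and lam: "lam \<ge> 0"
  obtains \<epsilon> \<mu> where "\<epsilon> > 0" "\<mu> > lam" "\<And>y. ds (2 * d) (rl d y) (rl d x) < \<epsilon> \<Longrightarrow> (cmod (cinner d \<psi> y))\<^sup>2 \<ge> \<mu>"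
proof -
  define A where "A = cmod (cinner d \<psi> x)"
  define b where "b = (A + sqrt lam) / 2"
  have "sqrt lam < sqrt (A\<^sup>2)" using a lam by (intro real_sqrt_less_mono) (simp add: A_def)
  then have Al: "sqrt lam < A" by (simp add: A_def)
  have b: "b > sqrt lam" "b \<ge> 0" using Al lam by (auto simp: b_def A_def)
  show ?thesis
  proof (rule that[of "A - b" "b\<^sup>2"])
    show "A - b > 0" using Al by (simp add: b_def)
    have "(sqrt lam)\<^sup>2 < b\<^sup>2" using b lam by (intro power_strict_mono) auto
    then show "b\<^sup>2 > lam" using lam by simp
    fix y assume y: "ds (2 * d) (rl d y) (rl d x) < A - b"
    have "cmod (cinner d \<psi> y - cinner d \<psi> x) \<le> 1 * ds (2 * d) (rl d y) (rl d x)"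
      using cinner_le[of d \<psi> "\<lambda>j. y j - x j"] \<psi> unfolding cinner_diff ds_rl Defs.unit_vec_def by simp
    then have "cmod (cinner d \<psi> y) \<ge> b"
      using y norm_triangle_ineq2[of "cinner d \<psi> x" "cinner d \<psi> y"] by (simp add: A_def norm_minus_commute)
    then show "(cmod (cinner d \<psi> y))\<^sup>2 \<ge> b\<^sup>2" using b by (intro power_mono) auto
  qed
qed

section \<open>Acceptance decided by one finite word\<close>

locale qautomaton =
  fixes d k :: nat and U :: "nat \<Rightarrow> nat \<Rightarrow> nat \<Rightarrow> complex" and s0 :: "nat \<Rightarrow> complex"
  assumes unitary: "\<And>\<sigma>. \<sigma> < k \<Longrightarrow> unitary_mat d (U \<sigma>)" and unit: "unit_vec d s0" and kpos: "k > 0"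
begin

sublocale isometries "2 * d" k "\<lambda>\<sigma>. AR (U \<sigma>)" "rl d s0"
proof
  fix \<sigma> x assume s: "\<sigma> < k"
  have "nrm (2 * d) (\<lambda>i. \<Sum>j<2 * d. AR (U \<sigma>) i j * x j) = nrm (2 * d) (rl d (mat_vec d (U \<sigma>) (cx x)))"
    unfolding nrm_def L2_set_def
    by (intro arg_cong[where f = sqrt] sum.cong refl arg_cong[where f = "\<lambda>t. t\<^sup>2"], subst rl_mat_vec[symmetric])
       (auto simp: rl_cx intro!: sum.cong)
  also have "\<dots> = nrm (2 * d) (rl d (cx x))" unfolding nrm_rl unitary_norm[OF unitary[OF s]] ..
  also have "\<dots> = nrm (2 * d) x" unfolding nrm_def L2_set_def by (intro arg_cong[where f = sqrt] sum.cong) (auto simp: rl_cx)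
  finally show "nrm (2 * d) (\<lambda>i. \<Sum>j<2 * d. AR (U \<sigma>) i j * x j) = nrm (2 * d) x" .
next
  show "rl d s0 \<in> usph (2 * d)" using unit by (auto simp: usph_def nrm_rl Defs.unit_vec_def)
qed (rule kpos)

definition xw :: "nat list \<Rightarrow> (nat \<Rightarrow> complex) \<Rightarrow> nat \<Rightarrow> complex" where
  "xw u v = foldl (\<lambda>v \<sigma>. mat_vec d (U \<sigma>) v) v u"

lemma xw_simps [simp]: "xw [] v = v" "xw (\<sigma> # u) v = xw u (mat_vec d (U \<sigma>) v)" "xw (u @ w) v = xw w (xw u v)"
  by (simp_all add: xw_def)

lemma T_rl: "T \<sigma> (rl d v) = rl d (mat_vec d (U \<sigma>) v)"
  by (rule ext) (auto simp: T_def rl_mat_vec)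

lemma Tw_rl: "Tw u (rl d v) = rl d (xw u v)"
  by (induction u arbitrary: v) (auto simp: T_rl)

lemma xw_unit: assumes "u \<in> W" "unit_vec d v" shows "unit_vec d (xw u v)"
proof -
  have "nrm (2 * d) (rl d (xw u v)) = nrm (2 * d) (rl d v)" unfolding Tw_rl[symmetric] by (rule nrm_Tw[OF assms(1)])
  then show ?thesis using assms(2) by (simp add: nrm_rl Defs.unit_vec_def)
qed

lemma nd_run_xw: "nd_run d U w s0 N = xw (map w [0..<N]) s0"
  by (induction N) auto

text \<open>Recurrence is applied to the word of \<open>Suc M\<close> equal letters, so that the
  return time is a positive multiple of \<open>Suc M\<close> and exceeds \<open>M\<close>.\<close>

lemma infinite_returns:
  assumes "\<sigma> < k" "\<epsilon> > 0"
  shows "infinite {l. ds (2 * d) (rl d (xw (replicate l \<sigma>) x)) (rl d x) < \<epsilon>}"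
proof -
  have "\<exists>l>M. ds (2 * d) (rl d (xw (replicate l \<sigma>) x)) (rl d x) < \<epsilon>" for M
  proof -
    have pwr: "pw m (replicate (Suc M) \<sigma>) = replicate (m * Suc M) \<sigma>" for m
    proof (induction m)
      case (Suc m)
      have "pw (Suc m) (replicate (Suc M) \<sigma>) = replicate (Suc M) \<sigma> @ replicate (m * Suc M) \<sigma>"
        by (simp only: pw_simps Suc)
      then show ?case by (simp only: replicate_add mult_Suc)
    qed simp
    have "replicate (Suc M) \<sigma> \<in> W" using assms(1) by (auto simp: W_def)
    then obtain m where m: "m \<ge> 1" "ds (2 * d) (Tw (pw m (replicate (Suc M) \<sigma>)) (rl d x)) (rl d x) < \<epsilon>"
      using recurrence[OF _ assms(2), of "replicate (Suc M) \<sigma>" "rl d x"] by auto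
    have "m * Suc M > M" using m(1) by (cases m) auto
    then show ?thesis using m(2) unfolding pwr Tw_rl by blast
  qed
  then show ?thesis unfolding infinite_nat_iff_unbounded by blast
qed

definition accepts :: "(nat \<Rightarrow> complex) list \<Rightarrow> real \<Rightarrow> bool" where
  "accepts B lam \<longleftrightarrow> (\<exists>u \<psi>. u \<in> W \<and> unit_vec d \<psi> \<and> in_span d B \<psi> \<and> (cmod (cinner d \<psi> (xw u s0)))\<^sup>2 > lam)"

lemma map_word_W: "(\<And>i. w i < k) \<Longrightarrow> map w [0..<N] \<in> W"
  by (auto simp: W_def)

lemma lang_ND_accepts: assumes "lang_ND d k U B s0 lam \<noteq> {}" shows "accepts B lam"
proof -
  from assms obtain w where w: "\<And>i. w i < k" "f_ND d U B s0 w > ereal lam" by (auto simp: lang_ND_def)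
  from w(2) obtain \<psi> and N :: "nat \<Rightarrow> nat" where p: "unit_vec d \<psi>" "in_span d B \<psi>"
    "ereal lam < (INF i. ereal ((cmod (cinner d \<psi> (nd_run d U w s0 (N i))))\<^sup>2))"
    unfolding f_ND_def less_SUP_iff by auto
  have "ereal lam < ereal ((cmod (cinner d \<psi> (nd_run d U w s0 (N 0))))\<^sup>2)"
    by (rule less_le_trans[OF p(3)]) (rule INF_lower, simp)
  then show ?thesis unfolding accepts_def using p(1,2) map_word_W[OF w(1)]
    by (intro exI[of _ "map w [0..<N 0]"] exI[of _ \<psi>]) (simp add: nd_run_xw)
qed

lemma lang_D_accepts: assumes "lang_D d k U B s0 lam \<noteq> {}" shows "accepts B lam"
proof -
  from assms obtain w where w: "\<And>i. w i < k" "f_D d U B s0 w > ereal lam" by (auto simp: lang_D_def)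
  from w(2) obtain \<psi> and N :: "nat \<Rightarrow> nat" where p: "unit_vec d \<psi>" "in_span d B \<psi>" "strict_mono N"
    "ereal lam < (INF i. ereal ((cmod (cinner d \<psi> (d_run d U w s0 \<psi> N (N i))))\<^sup>2))"
    unfolding f_D_def less_SUP_iff by auto
  have "ereal lam < ereal ((cmod (cinner d \<psi> (d_run d U w s0 \<psi> N (N 0))))\<^sup>2)"
    by (rule less_le_trans[OF p(4)]) (rule INF_lower, simp)
  \<comment> \<open>Before the first checkpoint nothing has been reset, so both runs agree.\<close>
  moreover have "d_run d U w s0 \<psi> N j = nd_run d U w s0 j" if "j \<le> N 0" for j
    using that
  proof (induction j)
    case (Suc j)
    have "j \<notin> range N"
    proof
      assume "j \<in> range N"
      then obtain i where "j = N i" by blast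
      then show False using Suc.prems strict_mono_less_eq[OF p(3), of 0 i] by simp
    qed
    with Suc show ?case by simp
  qed simp
  ultimately show ?thesis unfolding accepts_def using p(1,2) map_word_W[OF w(1)]
    by (intro exI[of _ "map w [0..<N 0]"] exI[of _ \<psi>]) (simp add: nd_run_xw)
qed

text \<open>The word \<open>u\<close> is continued by the letter 0 forever; checkpoints are the
  infinitely many times at which the state returns near the one reached by \<open>u\<close>.\<close>

lemma accepts_lang_ND: assumes acc: "accepts B lam" and lam: "lam \<ge> 0" shows "lang_ND d k U B s0 lam \<noteq> {}"
proof -
  from acc obtain u \<psi> where u: "u \<in> W" and \<psi>: "unit_vec d \<psi>" "in_span d B \<psi>"
    and gt: "(cmod (cinner d \<psi> (xw u s0)))\<^sup>2 > lam" by (auto simp: accepts_def)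
  obtain \<epsilon> \<mu> where e: "\<epsilon> > 0" "\<mu> > lam"
    "\<And>y. ds (2 * d) (rl d y) (rl d (xw u s0)) < \<epsilon> \<Longrightarrow> (cmod (cinner d \<psi> y))\<^sup>2 \<ge> \<mu>"
    by (rule cinner_close[OF \<psi>(1) gt lam]) blast
  define S where "S = {l. ds (2 * d) (rl d (xw (replicate l 0) (xw u s0))) (rl d (xw u s0)) < \<epsilon>}"
  have inf: "infinite S" unfolding S_def by (rule infinite_returns[OF kpos e(1)])
  define w where "w i = (if i < length u then u ! i else 0)" for i
  have wk: "w i < k" for i using u kpos by (auto simp: w_def W_def) (meson lessThan_iff nth_mem subsetD)
  define N where "N i = length u + enumerate S i" for i
  have N: "strict_mono N" using strict_mono_enumerate[OF inf] by (auto simp: strict_mono_def N_def)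
  have mw: "map w [0..<length u + l] = u @ replicate l 0" for l
    by (rule nth_equalityI) (auto simp: w_def nth_append)
  have "\<mu> \<le> (cmod (cinner d \<psi> (nd_run d U w s0 (N i))))\<^sup>2" for i
  proof -
    have "enumerate S i \<in> S" using enumerate_in_set[OF inf] .
    then show ?thesis unfolding nd_run_xw N_def mw by (intro e(3)) (simp add: S_def)
  qed
  then have I: "ereal \<mu> \<le> (INF i. ereal ((cmod (cinner d \<psi> (nd_run d U w s0 (N i))))\<^sup>2))"
    by (intro INF_greatest) simp
  have "ereal lam < (INF i. ereal ((cmod (cinner d \<psi> (nd_run d U w s0 (N i))))\<^sup>2))"
    by (rule less_le_trans[OF _ I]) (use e(2) in simp)
  then have "ereal lam < f_ND d U B s0 w" unfolding f_ND_def less_SUP_iff using \<psi> N by blast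
  then have "w \<in> lang_ND d k U B s0 lam" using wk by (simp add: lang_ND_def)
  then show ?thesis by blast
qed

text \<open>After the first checkpoint the run restarts at \<open>\<psi>\<close> and comes back near
  it every \<open>m\<close> letters, where the overlap is close to 1 and so above
  \<open>lam\<close>. Periodic checkpoints therefore suffice.\<close>

lemma accepts_lang_D: assumes acc: "accepts B lam" and lam: "lam \<ge> 0" "lam < 1" shows "lang_D d k U B s0 lam \<noteq> {}"
proof -
  from acc obtain u \<psi> where u: "u \<in> W" and \<psi>: "unit_vec d \<psi>" "in_span d B \<psi>"
    and gt: "(cmod (cinner d \<psi> (xw u s0)))\<^sup>2 > lam" by (auto simp: accepts_def)
  have "(cmod (cinner d \<psi> \<psi>))\<^sup>2 > lam" using lam(2) by (simp add: cinner_self[OF \<psi>(1)])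
  then obtain \<epsilon> \<mu> where e: "\<epsilon> > 0" "\<mu> > lam"
    "\<And>y. ds (2 * d) (rl d y) (rl d \<psi>) < \<epsilon> \<Longrightarrow> (cmod (cinner d \<psi> y))\<^sup>2 \<ge> \<mu>"
    by (rule cinner_close[OF \<psi>(1) _ lam(1)]) blast
  obtain m where m: "m > 0" "ds (2 * d) (rl d (xw (replicate m 0) \<psi>)) (rl d \<psi>) < \<epsilon>"
    using infinite_returns[OF kpos e(1), of \<psi>] unfolding infinite_nat_iff_unbounded by blast
  define w where "w i = (if i < length u then u ! i else 0)" for i
  have wk: "w i < k" for i using u kpos by (auto simp: w_def W_def) (meson lessThan_iff nth_mem subsetD)
  define N where "N i = length u + i * m" for i
  have N: "strict_mono N" using m(1) by (auto simp: strict_mono_def N_def)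
  have first: "d_run d U w s0 \<psi> N j = nd_run d U w s0 j" if "j \<le> length u" for j
    using that
  proof (induction j)
    case (Suc j)
    then have "j \<notin> range N" by (auto simp: N_def)
    with Suc show ?case by simp
  qed simp
  have later: "d_run d U w s0 \<psi> N (N i + Suc r) = xw (replicate (Suc r) 0) \<psi>" if "r < m" for i r
    using that
  proof (induction r)
    case 0
    then show ?case by (simp add: w_def N_def)
  next
    case (Suc r)
    have "N i + Suc r \<notin> range N"
    proof
      assume "N i + Suc r \<in> range N"
      then obtain j where "N i + Suc r = N j" by blast
      then have "i * m + Suc r = j * m" by (simp add: N_def)
      moreover have "i < j" using calculation by (metis less_add_same_cancel1 mult_less_cancel2 zero_less_Suc)
      then have "Suc i * m \<le> j * m" by (intro mult_right_mono) auto
      ultimately show False using Suc.prems by simp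
    qed
    moreover have "w (N i + Suc r) = 0" by (simp add: w_def N_def)
    ultimately have "d_run d U w s0 \<psi> N (N i + Suc (Suc r)) = mat_vec d (U 0) (xw (replicate (Suc r) 0) \<psi>)"
      using Suc by simp
    also have "\<dots> = xw (replicate (Suc r) 0 @ [0]) \<psi>" by (simp only: xw_simps)
    also have "replicate (Suc r) 0 @ [0] = replicate (Suc (Suc r)) (0::nat)" by (metis replicate_append_same replicate_Suc)
    finally show ?case .
  qed
  \<comment> \<open>The first checkpoint has the overlap reached by \<open>u\<close>, all later ones
    at least \<open>\<mu>\<close>.\<close>
  define \<nu> where "\<nu> = min \<mu> ((cmod (cinner d \<psi> (xw u s0)))\<^sup>2)"
  have "\<nu> \<le> (cmod (cinner d \<psi> (d_run d U w s0 \<psi> N (N i))))\<^sup>2" for i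
  proof (cases i)
    case 0
    have "map w [0..<length u] = u" by (rule nth_equalityI) (auto simp: w_def)
    then show ?thesis using 0 first[of "length u"] by (simp add: N_def nd_run_xw \<nu>_def)
  next
    case (Suc j)
    have "N i = N j + Suc (m - 1)" using m(1) by (simp add: N_def Suc)
    then have "d_run d U w s0 \<psi> N (N i) = xw (replicate m 0) \<psi>" using later[of "m - 1" j] m(1) by simp
    then show ?thesis using e(3)[OF m(2)] by (simp add: \<nu>_def)
  qed
  then have I: "ereal \<nu> \<le> (INF i. ereal ((cmod (cinner d \<psi> (d_run d U w s0 \<psi> N (N i))))\<^sup>2))"
    by (intro INF_greatest) simp
  have nu: "\<nu> > lam" using e(2) gt by (simp add: \<nu>_def)
  have "ereal lam < (INF i. ereal ((cmod (cinner d \<psi> (d_run d U w s0 \<psi> N (N i))))\<^sup>2))"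
    by (rule less_le_trans[OF _ I]) (use nu in simp)
  then have "ereal lam < f_D d U B s0 w" unfolding f_D_def less_SUP_iff using \<psi> N by blast
  then have "w \<in> lang_D d k U B s0 lam" using wk by (simp add: lang_D_def)
  then show ?thesis by blast
qed

end

section \<open>Correctness of the two searches\<close>

lemma mon_map: "mon (map g ms) z = mon ms (\<lambda>i. z (g i))"
  by (induction ms) auto

lemma floor_approx: "(\<lambda>N. real_of_int \<lfloor>real N * r\<rfloor> / real N) \<longlonglongrightarrow> r"
proof -
  have "(\<lambda>N. real_of_int \<lfloor>real N * r\<rfloor> / real N - r) \<longlonglongrightarrow> 0"
  proof (rule Lim_null_comparison[OF _ lim_1_over_n])
    show "\<forall>\<^sub>F N in sequentially. norm (real_of_int \<lfloor>real N * r\<rfloor> / real N - r) \<le> 1 / of_nat N"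
      using eventually_gt_at_top[of 0]
    proof eventually_elim
      case (elim N)
      have "\<bar>real_of_int \<lfloor>real N * r\<rfloor> - real N * r\<bar> \<le> 1" by linarith
      then have "\<bar>(real_of_int \<lfloor>real N * r\<rfloor> - real N * r) / real N\<bar> \<le> 1 / real N"
        using elim by (simp add: abs_divide divide_right_mono)
      then show ?case using elim by (simp add: diff_divide_distrib)
    qed
  qed
  then show ?thesis by (simp add: LIM_zero_iff)
qed

section \<open>The threshold form on states and coefficients\<close>

context instance_code
begin

lemma Bc_scale: "Bc (\<lambda>l. complex_of_real t * \<gamma> l) j = complex_of_real t * Bc \<gamma> j"
  by (simp add: Bc_def sum_distrib_left mult.assoc)

lemma hval_scale: "hval (\<lambda>l. complex_of_real t * \<gamma> l) x = t\<^sup>2 * hval \<gamma> x"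
proof -
  have "cinner d (Bc (\<lambda>l. complex_of_real t * \<gamma> l)) x = complex_of_real t * cinner d (Bc \<gamma>) x"
    by (simp add: cinner_def Bc_scale sum_distrib_left mult.assoc)
  moreover have "(\<Sum>j<d. (cmod (Bc (\<lambda>l. complex_of_real t * \<gamma> l) j))\<^sup>2) = t\<^sup>2 * (\<Sum>j<d. (cmod (Bc \<gamma> j))\<^sup>2)"
    by (simp add: Bc_scale norm_mult power_mult_distrib sum_distrib_left)
  ultimately show ?thesis by (simp add: hval_def norm_mult power_mult_distrib algebra_simps)
qed

lemma hval_cong: "(\<And>l. l < m \<Longrightarrow> \<gamma> l = \<gamma>' l) \<Longrightarrow> (\<And>j. j < d \<Longrightarrow> x j = x' j) \<Longrightarrow> hval \<gamma> x = hval \<gamma>' x'"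
proof -
  assume g: "\<And>l. l < m \<Longrightarrow> \<gamma> l = \<gamma>' l" and x: "\<And>j. j < d \<Longrightarrow> x j = x' j"
  have "Bc \<gamma> = Bc \<gamma>'" unfolding Bc_def using g by (intro ext sum.cong) auto
  moreover have "cinner d (Bc \<gamma>') x = cinner d (Bc \<gamma>') x'" unfolding cinner_def using x by (intro sum.cong) auto
  ultimately show ?thesis by (simp add: hval_def)
qed

lemma tendsto_hval:
  assumes "\<And>l. l < m \<Longrightarrow> ((\<lambda>s. \<gamma>s s l) \<longlongrightarrow> \<gamma> l) G" "\<And>j. j < d \<Longrightarrow> ((\<lambda>s. xs s j) \<longlongrightarrow> x j) G"
  shows "((\<lambda>s. hval (\<gamma>s s) (xs s)) \<longlongrightarrow> hval \<gamma> x) G"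
  unfolding hval_def cinner_def Bc_def by (intro tendsto_intros assms) auto

lemma length_iB: "length (i_B c) = m" by (simp add: i_B_def)

text \<open>A positive form forces a nonzero vector, which can be normalised by homogeneity.\<close>

lemma hval_pos_iff:
  "(\<exists>\<psi>. unit_vec d \<psi> \<and> in_span d (i_B c) \<psi> \<and> (cmod (cinner d \<psi> x))\<^sup>2 > i_lambda c) \<longleftrightarrow> (\<exists>\<gamma>. hval \<gamma> x > 0)"
proof
  assume "\<exists>\<psi>. unit_vec d \<psi> \<and> in_span d (i_B c) \<psi> \<and> (cmod (cinner d \<psi> x))\<^sup>2 > i_lambda c"
  then obtain \<psi> \<gamma> where p: "unit_vec d \<psi>" "(cmod (cinner d \<psi> x))\<^sup>2 > i_lambda c"
    and g: "\<forall>j<d. \<psi> j = (\<Sum>l<m. \<gamma> l * (i_B c ! l) j)" by (auto simp: in_span_def length_iB)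
  have b: "Bc \<gamma> j = \<psi> j" if "j < d" for j using g that by (simp add: Bc_def)
  have "cinner d (Bc \<gamma>) x = cinner d \<psi> x" unfolding cinner_def using b by (intro sum.cong) auto
  moreover have "(\<Sum>j<d. (cmod (Bc \<gamma> j))\<^sup>2) = 1" using b p(1) by (simp add: Defs.unit_vec_def)
  ultimately show "\<exists>\<gamma>. hval \<gamma> x > 0" using p(2) by (intro exI[of _ \<gamma>]) (simp add: hval_def)
next
  assume "\<exists>\<gamma>. hval \<gamma> x > 0"
  then obtain \<gamma> where g: "hval \<gamma> x > 0" by blast
  define G where "G = (\<Sum>j<d. (cmod (Bc \<gamma> j))\<^sup>2)"
  have "G \<noteq> 0"
  proof
    assume "G = 0"
    then have "\<forall>j\<in>{..<d}. (cmod (Bc \<gamma> j))\<^sup>2 = 0" unfolding G_def by (subst (asm) sum_nonneg_eq_0_iff) auto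
    then have "cinner d (Bc \<gamma>) x = 0" unfolding cinner_def by (intro sum.neutral) auto
    then show False using g \<open>G = 0\<close> by (simp add: hval_def G_def)
  qed
  moreover have "G \<ge> 0" unfolding G_def by (intro sum_nonneg) auto
  ultimately have G: "G > 0" by simp
  define t where "t = 1 / sqrt G"
  define \<psi> where "\<psi> = Bc (\<lambda>l. complex_of_real t * \<gamma> l)"
  have t2: "t\<^sup>2 = 1 / G" using G by (simp add: t_def power_divide)
  have "(\<Sum>j<d. (cmod (\<psi> j))\<^sup>2) = t\<^sup>2 * G"
    unfolding \<psi>_def G_def by (simp add: Bc_scale norm_mult power_mult_distrib sum_distrib_left)
  then have u: "(\<Sum>j<d. (cmod (\<psi> j))\<^sup>2) = 1" using G t2 by simp
  have "hval (\<lambda>l. complex_of_real t * \<gamma> l) x > 0" unfolding hval_scale t2 using g G by simp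
  then have "(cmod (cinner d \<psi> x))\<^sup>2 > i_lambda c" unfolding hval_def \<psi>_def[symmetric] u by simp
  moreover have "in_span d (i_B c) \<psi>" unfolding in_span_def \<psi>_def Bc_def length_iB
    by (intro exI[of _ "\<lambda>l. complex_of_real t * \<gamma> l"]) simp
  ultimately show "\<exists>\<psi>. unit_vec d \<psi> \<and> in_span d (i_B c) \<psi> \<and> (cmod (cinner d \<psi> x))\<^sup>2 > i_lambda c"
    using u by (auto simp: Defs.unit_vec_def)
qed

text \<open>Rounding \<open>N\<close> times the coefficients to Gaussian integers and rescaling by
  \<open>1 / N\<close> converges to the original vector. Positivity is open and invariant under
  scaling, so some rounded vector works.\<close>

lemma integer_coefficients:
  assumes "hval \<gamma> x > 0"
  obtains cs :: "(int \<times> int) list" where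
    "hval (\<lambda>l. if l < length cs then Complex (of_int (fst (cs ! l))) (of_int (snd (cs ! l))) else 0) x > 0"
proof -
  define f where "f N l = Complex (of_int \<lfloor>real N * Re (\<gamma> l)\<rfloor>) (of_int \<lfloor>real N * Im (\<gamma> l)\<rfloor>)" for N l
  have "(\<lambda>N. complex_of_real (1 / real N) * f N l) \<longlonglongrightarrow> \<gamma> l" for l
  proof -
    have "complex_of_real (1 / real N) * f N l
      = Complex (of_int \<lfloor>real N * Re (\<gamma> l)\<rfloor> / real N) (of_int \<lfloor>real N * Im (\<gamma> l)\<rfloor> / real N)" for N
      by (simp add: f_def complex_eq_iff)
    then show ?thesis using tendsto_Complex[OF floor_approx[of "Re (\<gamma> l)"] floor_approx[of "Im (\<gamma> l)"]] by simp
  qed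
  then have "(\<lambda>N. hval (\<lambda>l. complex_of_real (1 / real N) * f N l) x) \<longlonglongrightarrow> hval \<gamma> x"
    by (intro tendsto_hval) auto
  then have "\<forall>\<^sub>F N in sequentially. hval (\<lambda>l. complex_of_real (1 / real N) * f N l) x > 0"
    using assms by (rule order_tendstoD)
  then obtain N where N: "hval (\<lambda>l. complex_of_real (1 / real N) * f N l) x > 0"
    using eventually_happens[of _ sequentially] by auto
  then have "hval (f N) x > 0" unfolding hval_scale by (simp add: zero_less_mult_iff)
  moreover define cs where "cs = map (\<lambda>l. (\<lfloor>real N * Re (\<gamma> l)\<rfloor>, \<lfloor>real N * Im (\<gamma> l)\<rfloor>)) [0..<m]"
  have "hval (\<lambda>l. if l < length cs then Complex (of_int (fst (cs ! l))) (of_int (snd (cs ! l))) else 0) x = hval (f N) x"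
    by (rule hval_cong) (auto simp: cs_def f_def)
  ultimately show ?thesis using that[of cs] by simp
qed

definition xp :: "(nat \<Rightarrow> real) \<Rightarrow> nat \<Rightarrow> complex" where
  "xp z j = Complex (z (X0 c + 2 * j)) (z (X0 c + 2 * j + 1))"

definition gp :: "(nat \<Rightarrow> real) \<Rightarrow> nat \<Rightarrow> complex" where
  "gp z l = Complex (z (X0 c + 2 * d + 2 * l)) (z (X0 c + 2 * d + 2 * l + 1))"

text \<open>Keeps the variables of the input numbers and overwrites the state and coefficient
  blocks, as a substitution does semantically.\<close>

definition zz :: "(nat \<Rightarrow> real) \<Rightarrow> (nat \<Rightarrow> complex) \<Rightarrow> (nat \<Rightarrow> complex) \<Rightarrow> nat \<Rightarrow> real" where
  "zz z x \<gamma> i = (if i < X0 c then z i else if i < X0 c + 2 * d then rl d x (i - X0 c) else rl m \<gamma> (i - X0 c - 2 * d))"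

lemma xp_zz: "j < d \<Longrightarrow> xp (zz z x \<gamma>) j = x j"
  by (simp add: xp_def zz_def)

lemma gp_zz: "l < m \<Longrightarrow> gp (zz z x \<gamma>) l = \<gamma> l"
  by (simp add: gp_def zz_def)

lemma CON_zz: "ev (CON c) (zz z x \<gamma>) = ev (CON c) z"
  by (rule ev_cong[OF vars_in_CON]) (simp add: zz_def Y_def)

lemma cev_XV: "j < d \<Longrightarrow> cev (nth0 (XV c) j) z = xp z j"
  by (simp add: XV_def accessors xp_def)

lemma cev_CV: "l < m \<Longrightarrow> cev (nth0 (CV c) l) z = gp z l"
  by (simp add: CV_def accessors gp_def)

lemma ev_sph: "ev (sph (map f [0..<a])) z = ((\<Sum>j<a. (cmod (cev (f j) z))\<^sup>2) - 1)\<^sup>2"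
proof -
  have "ev (concat (map cabs2 (map f [0..<a]))) z = (\<Sum>j\<leftarrow>[0..<a]. (cmod (cev (f j) z))\<^sup>2)"
    unfolding ev_concat map_map by (simp add: o_def)
  then show ?thesis unfolding sph_def sum_list_upt_lessThan by simp
qed

lemma ev_sph_XV: "ev (sph (XV c)) z = ((\<Sum>j<d. (cmod (xp z j))\<^sup>2) - 1)\<^sup>2"
  unfolding XV_def accessors ev_sph by (simp add: xp_def)

lemma ev_sph_CV: "ev (sph (CV c)) z = ((\<Sum>l<m. (cmod (gp z l))\<^sup>2) - 1)\<^sup>2"
  unfolding CV_def accessors ev_sph by (simp add: gp_def)

lemma ev_psub_zz:
  assumes "vars_in {..<X0 c + 2 * d} q"
  shows "ev (psub (X0 c) xs q) z = ev q (zz z (\<lambda>j. cev (nth0 xs j) z) \<gamma>)"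
  unfolding ev_psub
proof (rule ev_cong[OF assms])
  fix i assume "i \<in> {..<X0 c + 2 * d}"
  then show "(if i < X0 c then z i else if (i - X0 c) mod 2 = 0 then Re (cev (nth0 xs ((i - X0 c) div 2)) z)
      else Im (cev (nth0 xs ((i - X0 c) div 2)) z)) = zz z (\<lambda>j. cev (nth0 xs j) z) \<gamma> i"
    by (auto simp: zz_def rl_def even_iff_mod_2_eq_zero)
qed

lemma ev_q_zz: "vars_in {..<X0 c + 2 * d} q \<Longrightarrow> (\<And>j. j < d \<Longrightarrow> x j = x' j) \<Longrightarrow> ev q (zz z x \<gamma>) = ev q (zz z x' \<gamma>')"
  by (rule ev_cong) (auto simp: zz_def rl_def)

lemma cvars_XV: "j < d \<Longrightarrow> cvars {..<X0 c + 2 * d} (nth0 (XV c) j)"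
  by (auto simp: XV_def accessors intro!: cvars_intros)

lemma vars_in_sub1:
  assumes "Y \<subseteq> V" "\<And>j. j < d \<Longrightarrow> cvars V (nth0 xs j)" "i < X0 c + 2 * d"
  shows "vars_in V (sub1 (X0 c) xs i)"
proof (cases "i < X0 c")
  case True
  then show ?thesis using assms(1) by (auto simp: sub1_def Y_def)
next
  case False
  then have "(i - X0 c) div 2 < d" using assms(3) by auto
  then show ?thesis using False assms(2) by (auto simp: sub1_def cvars_def)
qed

lemma vars_psub:
  assumes "Y \<subseteq> V" "\<And>j. j < d \<Longrightarrow> cvars V (nth0 xs j)" "vars_in {..<X0 c + 2 * d} q"
  shows "vars_in V (psub (X0 c) xs q)"
proof (rule vars_in_psub)
  fix t i assume "t \<in> set q" "i \<in> set (snd t)"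
  then have i: "i < X0 c + 2 * d" using assms(3) by (auto simp: vars_in_def)
  show "vars_in V (sub1 (X0 c) xs i)" by (rule vars_in_sub1[OF assms(1) _ i]) (rule assms(2))
qed

lemma RR_ge: "1 \<le> R" by (simp add: RR_def)

lemma vars_in_sph: "(\<And>p. p \<in> set vs \<Longrightarrow> cvars V p) \<Longrightarrow> vars_in V (sph vs)"
  by (auto simp: sph_def vars_in_concat intro!: vars_in_psq vars_in_cabs2)

lemma LEc1: 
  assumes "vars_in {..<X0 c} h"
  shows "LEc (X0 c) R (CON c) h \<longleftrightarrow> (\<forall>z. ev (CON c) z = 0 \<longrightarrow> ev h z \<le> 0)"
  by (rule LEc_iff) (use assms vars_in_CON CON_nonneg CON_bound RR_ge in \<open>auto simp: Y_def\<close>)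

lemma coord_bound:
  fixes a :: nat
  assumes "(\<Sum>j<a. (cmod (f j))\<^sup>2) = 1" "j < a"
  shows "\<bar>Re (f j)\<bar> \<le> real R" "\<bar>Im (f j)\<bar> \<le> real R"
proof -
  have "(cmod (f j))\<^sup>2 \<le> 1" unfolding assms(1)[symmetric] using assms(2) by (intro member_le_sum) auto
  then have "cmod (f j) \<le> 1" by (simp add: power_le_one_iff abs_square_le_1)
  then show "\<bar>Re (f j)\<bar> \<le> real R" "\<bar>Im (f j)\<bar> \<le> real R"
    using abs_Re_le_cmod[of "f j"] abs_Im_le_cmod[of "f j"] RR_ge by linarith+
qed

lemma xp_bound:
  assumes "(\<Sum>j<d. (cmod (xp z j))\<^sup>2) = 1" "X0 c \<le> i" "i < X0 c + 2 * d"
  shows "\<bar>z i\<bar> \<le> real R"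
proof -
  obtain j where j: "i = X0 c + j" using assms(2) by (metis le_iff_add)
  have "j div 2 < d" using assms(3) j by auto
  from coord_bound[OF assms(1) this] show ?thesis unfolding j xp_def
    by (cases "even j") (auto elim!: evenE oddE)
qed

lemma gp_bound:
  assumes "(\<Sum>l<m. (cmod (gp z l))\<^sup>2) = 1" "X0 c + 2 * d \<le> i" "i < X0 c + 2 * d + 2 * m"
  shows "\<bar>z i\<bar> \<le> real R"
proof -
  obtain j where j: "i = X0 c + 2 * d + j" using assms(2) by (metis le_iff_add)
  have "j div 2 < m" using assms(3) j by auto
  from coord_bound[OF assms(1) this] show ?thesis unfolding j gp_def
    by (cases "even j") (auto elim!: evenE oddE)
qed

lemma p2_eq_0_iff: "ev (CON c @ psq q @ sph (XV c)) z = 0 \<longleftrightarrow>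
    ev (CON c) z = 0 \<and> ev q z = 0 \<and> (\<Sum>j<d. (cmod (xp z j))\<^sup>2) = 1"
proof -
  have "A + (B\<^sup>2 + C\<^sup>2) = 0 \<longleftrightarrow> A = 0 \<and> B = 0 \<and> C = 0" if "A \<ge> 0" for A B C :: real
    using that by (smt (verit) zero_eq_power2 zero_le_power2)
  from this[OF CON_nonneg] show ?thesis by (simp add: ev_sph_XV)
qed

lemma p3_eq_0_iff: "ev (CON c @ psq q @ sph (XV c) @ sph (CV c)) z = 0 \<longleftrightarrow>
    ev (CON c) z = 0 \<and> ev q z = 0 \<and> (\<Sum>j<d. (cmod (xp z j))\<^sup>2) = 1 \<and> (\<Sum>l<m. (cmod (gp z l))\<^sup>2) = 1"
proof -
  have "A + (B\<^sup>2 + (C\<^sup>2 + D\<^sup>2)) = 0 \<longleftrightarrow> A = 0 \<and> B = 0 \<and> C = 0 \<and> D = 0" if "A \<ge> 0" for A B C D :: real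
    using that by (smt (verit) zero_eq_power2 zero_le_power2)
  from this[OF CON_nonneg] show ?thesis by (simp add: ev_sph_XV ev_sph_CV)
qed

lemma LEc2:
  assumes q: "vars_in {..<X0 c + 2 * d} q" and h: "vars_in {..<X0 c + 2 * d} h"
  shows "LEc (X0 c + 2 * d) R (CON c @ psq q @ sph (XV c)) h \<longleftrightarrow>
    (\<forall>z. ev (CON c) z = 0 \<and> ev q z = 0 \<and> (\<Sum>j<d. (cmod (xp z j))\<^sup>2) = 1 \<longrightarrow> ev h z \<le> 0)"
proof -
  have "LEc (X0 c + 2 * d) R (CON c @ psq q @ sph (XV c)) h \<longleftrightarrow>
    (\<forall>z. ev (CON c @ psq q @ sph (XV c)) z = 0 \<longrightarrow> ev h z \<le> 0)"
  proof (rule LEc_iff[OF _ h _ _ RR_ge])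
    show "vars_in {..<X0 c + 2 * d} (CON c @ psq q @ sph (XV c))"
      using q cvars_XV by (auto simp: XV_def accessors intro!: vars_in_sph cvars_intros vars_in_mono[OF vars_in_CON])
         (auto simp: Y_def)
    show "0 \<le> ev (CON c @ psq q @ sph (XV c)) z" for z using CON_nonneg[of z] by (simp add: ev_sph_XV)
    show "\<bar>z i\<bar> \<le> real R" if "ev (CON c @ psq q @ sph (XV c)) z = 0" "i < X0 c + 2 * d" for z i
      using that CON_bound[of z i] xp_bound[of z i] unfolding p2_eq_0_iff by (cases "i < X0 c") auto
  qed
  then show ?thesis unfolding p2_eq_0_iff .
qed

lemma LEc3:
  assumes q: "vars_in {..<X0 c + 2 * d} q" and h: "vars_in {..<X0 c + 2 * d + 2 * m} h"
  shows "LEc (X0 c + 2 * d + 2 * m) R (CON c @ psq q @ sph (XV c) @ sph (CV c)) h \<longleftrightarrow>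
    (\<forall>z. ev (CON c) z = 0 \<and> ev q z = 0 \<and> (\<Sum>j<d. (cmod (xp z j))\<^sup>2) = 1 \<and> (\<Sum>l<m. (cmod (gp z l))\<^sup>2) = 1 \<longrightarrow> ev h z \<le> 0)"
proof -
  have "LEc (X0 c + 2 * d + 2 * m) R (CON c @ psq q @ sph (XV c) @ sph (CV c)) h \<longleftrightarrow>
    (\<forall>z. ev (CON c @ psq q @ sph (XV c) @ sph (CV c)) z = 0 \<longrightarrow> ev h z \<le> 0)"
  proof (rule LEc_iff[OF _ h _ _ RR_ge])
    have "vars_in {..<X0 c + 2 * d + 2 * m} q" using q by (rule vars_in_mono) auto
    then show "vars_in {..<X0 c + 2 * d + 2 * m} (CON c @ psq q @ sph (XV c) @ sph (CV c))"
      by (auto simp: XV_def CV_def accessors intro!: vars_in_sph cvars_intros vars_in_mono[OF vars_in_CON])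
         (auto simp: Y_def)
    show "0 \<le> ev (CON c @ psq q @ sph (XV c) @ sph (CV c)) z" for z
      using CON_nonneg[of z] by (simp add: ev_sph_XV ev_sph_CV)
    show "\<bar>z i\<bar> \<le> real R" if "ev (CON c @ psq q @ sph (XV c) @ sph (CV c)) z = 0" "i < X0 c + 2 * d + 2 * m" for z i
      using that CON_bound[of z i] xp_bound[of z i] gp_bound[of z i] unfolding p3_eq_0_iff
      by (cases "i < X0 c"; cases "i < X0 c + 2 * d") auto
  qed
  then show ?thesis unfolding p3_eq_0_iff .
qed

end

section \<open>Instances with a nonempty alphabet\<close>

locale positive_instance = instance_code +
  assumes letters: "i_k c > 0"
begin

sublocale qautomaton "i_d c" "i_k c" "i_U c" "i_s0 c"
  using valid letters by unfold_locales (auto simp: valid_inst_def)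

lemma cev_WV:
  assumes "ev (CON c) z = 0" "u \<in> W" "j < d"
  shows "cev (nth0 (WV c u) j) z = xw u (i_s0 c) j"
  using assms(2,3)
proof (induction u arbitrary: j rule: rev_induct)
  case Nil
  then show ?case by (simp add: WV_def cev_S0[OF assms(1)])
next
  case (snoc \<sigma> u)
  have "cev (nth0 (MV c \<sigma> (WV c u)) j) z = mat_vec d (i_U c \<sigma>) (xw u (i_s0 c)) j"
    using snoc by (intro cev_MV[OF assms(1)]) auto
  then show ?case by (simp add: WV_def)
qed

lemma cvars_WV:
  assumes "\<And>a. a \<in> set (codes c) \<Longrightarrow> cvars V (cvar (6 * a))" "u \<in> W" "j < d"
  shows "cvars V (nth0 (WV c u) j)"
  using assms(2,3)
proof (induction u arbitrary: j rule: rev_induct)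
  case Nil
  then show ?case using cvars_S0[OF assms(1)] by (simp add: WV_def)
next
  case (snoc \<sigma> u)
  have "cvars V (nth0 (MV c \<sigma> (WV c u)) j)"
    using snoc by (intro cvars_MV[OF assms(1)]) auto
  then show ?case by (simp add: WV_def)
qed

lemma accepts_iff: "accepts (i_B c) (i_lambda c) \<longleftrightarrow> (\<exists>u\<in>W. \<exists>\<gamma>. hval \<gamma> (xw u (i_s0 c)) > 0)"
  unfolding accepts_def hval_pos_iff[symmetric] by blast

text \<open>At every zero of \<open>CON\<close> the form has the same value, determined by the
  automaton. One zero therefore extracts positivity from a certificate, and conversely a positive
  value allows a penalty weight and a mesh.\<close>

lemma POS_iff: "POS c \<longleftrightarrow> (\<exists>u\<in>W. \<exists>\<gamma>. hval \<gamma> (xw u (i_s0 c)) > 0)"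
proof -
  define g where "g cs l = (if l < length cs then Complex (of_int (fst (cs ! l))) (of_int (snd (cs ! l))) else 0)"
    for cs :: "(int \<times> int) list" and l
  define h where "h u cs = hform c (map (\<lambda>p. cconst (fst p) (snd p)) cs) (WV c u)" for u cs
  \<comment> \<open>Beyond the end of \<open>cs\<close>, \<open>nth0\<close> yields the value with
    code 0, a pair of empty polynomials, in agreement with the 0 in \<open>g\<close>.\<close>
  have cst: "cev (nth0 (map (\<lambda>p. cconst (fst p) (snd p)) cs) l) z = g cs l" for cs l z
    by (auto simp: nth0_def g_def cev_def cconst_def complex_eq_iff dec_prod_def dec_list_def zero_complex.code prod_decode_def prod_decode_aux.simps)
  have cvc: "cvars V (nth0 (map (\<lambda>p. cconst (fst p) (snd p)) cs) l)" for cs l V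
    by (auto simp: nth0_def cvars_def cconst_def dec_prod_def dec_list_def prod_decode_def prod_decode_aux.simps)
  have hv: "vars_in {..<X0 c} (h u cs)" if "u \<in> W" for u cs
    unfolding h_def using that cvc
    by (intro vars_in_hform cvars_WV) (auto simp: Y_def intro!: cvars_code_mono)
  have he: "ev (h u cs) z = hval (g cs) (xw u (i_s0 c))" if "ev (CON c) z = 0" "u \<in> W" for u cs z
    unfolding h_def by (rule ev_hform[OF that(1)]) (use cst cev_WV[OF that] in auto)
  have vC: "vars_in {..<X0 c} (CON c)" using vars_in_CON by (simp add: Y_def)
  have P: "POS c \<longleftrightarrow> (\<exists>u\<in>W. \<exists>cs K s. grid (X0 c) R (pscale (int K) (CON c) @ h u cs) s)"
    unfolding POS_def h_def using letters by (auto simp: accessors W_def)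
  show ?thesis
  proof
    assume "POS c"
    then obtain u cs K s where u: "u \<in> W" and g: "grid (X0 c) R (pscale (int K) (CON c) @ h u cs) s"
      using P by blast
    obtain z where z: "ev (CON c) z = 0" using CON_solvable by blast
    have "ev (pscale (int K) (CON c) @ h u cs) z > 0"
      by (rule grid_imp_pos[OF _ RR_ge g]) (use vC hv[OF u] CON_bound[OF z] in auto)
    then have "hval (g cs) (xw u (i_s0 c)) > 0" using he[OF z u] z by simp
    then show "\<exists>u\<in>W. \<exists>\<gamma>. hval \<gamma> (xw u (i_s0 c)) > 0" using u by blast
  next
    assume "\<exists>u\<in>W. \<exists>\<gamma>. hval \<gamma> (xw u (i_s0 c)) > 0"
    then obtain u \<gamma> where u: "u \<in> W" and "hval \<gamma> (xw u (i_s0 c)) > 0" by blast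
    then obtain cs where cs: "hval (g cs) (xw u (i_s0 c)) > 0"
      using integer_coefficients[of \<gamma> "xw u (i_s0 c)"] unfolding g_def by blast
    have "\<exists>K::nat. \<forall>z. (\<forall>i<X0 c. \<bar>z i\<bar> \<le> real R) \<longrightarrow> real K * ev (CON c) z + ev (h u cs) z > 0"
      by (rule penalty_pos[OF vC hv[OF u] CON_nonneg]) (use he[OF _ u] cs in simp)
    then obtain K :: nat where K: "\<And>z. (\<forall>i<X0 c. \<bar>z i\<bar> \<le> real R) \<Longrightarrow> real K * ev (CON c) z + ev (h u cs) z > 0" by blast
    have "\<exists>s. grid (X0 c) R (pscale (int K) (CON c) @ h u cs) s"
      by (rule pos_imp_grid[OF _ RR_ge]) (use vC hv[OF u] K in auto)
    then show "POS c" using P u by blast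
  qed
qed

definition invariant_for :: "ipoly \<Rightarrow> bool" where
  "invariant_for q \<longleftrightarrow> vars_in {..<X0 c + 2 * d} q \<and>
     (\<forall>z. ev (CON c) z = 0 \<longrightarrow> ev q (zz z (i_s0 c) (\<lambda>_. 0)) = 0) \<and>
     (\<forall>\<sigma><k. \<forall>z. ev (CON c) z = 0 \<and> ev q z = 0 \<and> (\<Sum>j<d. (cmod (xp z j))\<^sup>2) = 1 \<longrightarrow>
        ev q (zz z (mat_vec d (i_U c \<sigma>) (xp z)) (\<lambda>_. 0)) = 0) \<and>
     (\<forall>z. ev (CON c) z = 0 \<and> ev q z = 0 \<and> (\<Sum>j<d. (cmod (xp z j))\<^sup>2) = 1 \<and> (\<Sum>l<m. (cmod (gp z l))\<^sup>2) = 1 \<longrightarrow>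
        hval (gp z) (xp z) \<le> 0)"

lemma NEG_iff_invariant: "NEG c \<longleftrightarrow> (\<exists>q. invariant_for q)"
proof -
  have v: "(\<forall>t\<in>set q. \<forall>i\<in>set (snd t). i < X0 c + 2 * d) \<longleftrightarrow> vars_in {..<X0 c + 2 * d} q" for q
    by (auto simp: vars_in_def)
  have Ysub: "Y \<subseteq> {..<X0 c}" "Y \<subseteq> {..<X0 c + 2 * d}" "Y \<subseteq> {..<X0 c + 2 * d + 2 * m}" by (auto simp: Y_def)
  have sq: "t\<^sup>2 \<le> 0 \<longleftrightarrow> t = 0" for t :: real by simp
  have 1: "LEc (X0 c) R (CON c) (psq (psub (X0 c) (S0 c) q)) \<longleftrightarrow>
      (\<forall>z. ev (CON c) z = 0 \<longrightarrow> ev q (zz z (i_s0 c) (\<lambda>_. 0)) = 0)" if q: "vars_in {..<X0 c + 2 * d} q" for q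
  proof -
    have "vars_in {..<X0 c} (psub (X0 c) (S0 c) q)"
      by (rule vars_psub[OF Ysub(1) _ q]) (rule cvars_S0[OF cvars_code_mono[OF Ysub(1)]])
    moreover have "ev (psub (X0 c) (S0 c) q) z = ev q (zz z (i_s0 c) (\<lambda>_. 0))" if "ev (CON c) z = 0" for z
      unfolding ev_psub_zz[OF q, where \<gamma> = "\<lambda>_. 0"] by (rule ev_q_zz[OF q]) (rule cev_S0[OF that])
    ultimately show ?thesis by (subst LEc1) (auto simp: sq)
  qed
  have 2: "LEc (X0 c + 2 * d) R (CON c @ psq q @ sph (XV c)) (psq (psub (X0 c) (MV c \<sigma> (XV c)) q)) \<longleftrightarrow>
      (\<forall>z. ev (CON c) z = 0 \<and> ev q z = 0 \<and> (\<Sum>j<d. (cmod (xp z j))\<^sup>2) = 1 \<longrightarrow>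
        ev q (zz z (mat_vec d (i_U c \<sigma>) (xp z)) (\<lambda>_. 0)) = 0)" if q: "vars_in {..<X0 c + 2 * d} q" and \<sigma>: "\<sigma> < k" for q \<sigma>
  proof -
    have "vars_in {..<X0 c + 2 * d} (psub (X0 c) (MV c \<sigma> (XV c)) q)"
      by (rule vars_psub[OF Ysub(2) _ q]) (rule cvars_MV[OF cvars_code_mono[OF Ysub(2)] \<sigma> cvars_XV])
    moreover have "ev (psub (X0 c) (MV c \<sigma> (XV c)) q) z = ev q (zz z (mat_vec d (i_U c \<sigma>) (xp z)) (\<lambda>_. 0))" if "ev (CON c) z = 0" for z
      unfolding ev_psub_zz[OF q, where \<gamma> = "\<lambda>_. 0"] by (rule ev_q_zz[OF q]) (rule cev_MV[OF that \<sigma> cev_XV])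
    ultimately show ?thesis by (subst LEc2[OF q]) (auto simp: sq)
  qed
  have 3: "LEc (X0 c + 2 * d + 2 * m) R (CON c @ psq q @ sph (XV c) @ sph (CV c)) (hform c (CV c) (XV c)) \<longleftrightarrow>
      (\<forall>z. ev (CON c) z = 0 \<and> ev q z = 0 \<and> (\<Sum>j<d. (cmod (xp z j))\<^sup>2) = 1 \<and> (\<Sum>l<m. (cmod (gp z l))\<^sup>2) = 1 \<longrightarrow>
        hval (gp z) (xp z) \<le> 0)" if q: "vars_in {..<X0 c + 2 * d} q" for q
  proof -
    have "vars_in {..<X0 c + 2 * d + 2 * m} (hform c (CV c) (XV c))"
      by (rule vars_in_hform[OF Ysub(3)]) (auto simp: XV_def CV_def accessors intro!: cvars_intros)
    moreover have "ev (hform c (CV c) (XV c)) z = hval (gp z) (xp z)" if "ev (CON c) z = 0" for z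
      by (rule ev_hform[OF that cev_CV cev_XV])
    ultimately show ?thesis by (subst LEc3[OF q]) auto
  qed
  show ?thesis
    unfolding NEG_def invariant_for_def accessors v using letters 1 2 3 by auto
qed

text \<open>Induction along the word keeps the state in the variety; unitarity keeps it on the
  sphere, where invariance was certified. A coefficient vector with positive value is nonzero and
  may be scaled to norm 1.\<close>

lemma invariant_sound:
  assumes inv: "invariant_for q" and u: "u \<in> W"
  shows "hval \<gamma> (xw u (i_s0 c)) \<le> 0"
proof -
  note q = inv[unfolded invariant_for_def]
  have qv: "vars_in {..<X0 c + 2 * d} q" using q by blast
  obtain z where z: "ev (CON c) z = 0" using CON_solvable by blast
  have un: "(\<Sum>j<d. (cmod (xw u (i_s0 c) j))\<^sup>2) = 1" if "u \<in> W" for u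
    using xw_unit[OF that unit] by (simp add: Defs.unit_vec_def)
  have on: "ev q (zz z (xw u (i_s0 c)) (\<lambda>_. 0)) = 0" if "u \<in> W" for u
    using that
  proof (induction u rule: rev_induct)
    case Nil
    then show ?case using q z by simp
  next
    case (snoc \<sigma> u)
    then have uW: "u \<in> W" "\<sigma> < k" by auto
    define y where "y = zz z (xw u (i_s0 c)) (\<lambda>_. 0)"
    have y: "ev (CON c) y = 0" "ev q y = 0" unfolding y_def using z snoc.IH[OF uW(1)] by (simp_all add: CON_zz)
    have xy: "xp y j = xw u (i_s0 c) j" if "j < d" for j unfolding y_def by (rule xp_zz[OF that])
    have s1: "(\<Sum>j<d. (cmod (xp y j))\<^sup>2) = 1" using un[OF uW(1)] xy by simp
    have "ev q (zz y (mat_vec d (i_U c \<sigma>) (xp y)) (\<lambda>_. 0)) = 0" using q uW(2) y s1 by blast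
    moreover have "mat_vec d (i_U c \<sigma>) (xp y) = mat_vec d (i_U c \<sigma>) (xw u (i_s0 c))"
      unfolding mat_vec_def using xy by (intro ext sum.cong) auto
    moreover have "zz y x' g = zz z x' g" for x' g by (auto simp: y_def zz_def)
    ultimately show ?case by simp
  qed
  show ?thesis
  proof (rule ccontr)
    assume "\<not> ?thesis"
    then have pos: "hval \<gamma> (xw u (i_s0 c)) > 0" by simp
    define G where "G = (\<Sum>l<m. (cmod (\<gamma> l))\<^sup>2)"
    have "G \<noteq> 0"
    proof
      assume "G = 0"
      then have "\<forall>l\<in>{..<m}. (cmod (\<gamma> l))\<^sup>2 = 0" unfolding G_def by (subst (asm) sum_nonneg_eq_0_iff) auto
      then have "hval \<gamma> (xw u (i_s0 c)) = hval (\<lambda>l. complex_of_real 0 * \<gamma> l) (xw u (i_s0 c))" by (intro hval_cong) auto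
      then show False using pos hval_scale[of 0 \<gamma>] by simp
    qed
    moreover have "G \<ge> 0" unfolding G_def by (intro sum_nonneg) auto
    ultimately have G: "G > 0" by simp
    define t where "t = 1 / sqrt G"
    have t2: "t\<^sup>2 = 1 / G" using G by (simp add: t_def power_divide)
    define \<delta> where "\<delta> l = complex_of_real t * \<gamma> l" for l
    have dn: "(\<Sum>l<m. (cmod (\<delta> l))\<^sup>2) = 1"
    proof -
      have "(\<Sum>l<m. (cmod (\<delta> l))\<^sup>2) = t\<^sup>2 * G"
        unfolding \<delta>_def G_def by (simp add: norm_mult power_mult_distrib sum_distrib_left)
      then show ?thesis using G t2 by simp
    qed
    define y where "y = zz z (xw u (i_s0 c)) \<delta>"
    have "ev (CON c) y = 0" unfolding y_def using z by (simp add: CON_zz)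
    moreover have "ev q y = 0" unfolding y_def using on[OF u] ev_q_zz[OF qv, of "xw u (i_s0 c)" "xw u (i_s0 c)" z \<delta> "\<lambda>_. 0"] by simp
    moreover have "(\<Sum>j<d. (cmod (xp y j))\<^sup>2) = 1" using un[OF u] by (simp add: y_def xp_zz)
    moreover have "(\<Sum>l<m. (cmod (gp y l))\<^sup>2) = 1" using dn by (simp add: y_def gp_zz)
    ultimately have "hval (gp y) (xp y) \<le> 0" using q by blast
    moreover have "hval (gp y) (xp y) = hval \<delta> (xw u (i_s0 c))" by (rule hval_cong) (simp_all add: y_def gp_zz xp_zz)
    moreover have "hval \<delta> (xw u (i_s0 c)) = t\<^sup>2 * hval \<gamma> (xw u (i_s0 c))" unfolding \<delta>_def by (rule hval_scale)
    moreover have "\<dots> > 0" unfolding t2 using pos G by simp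
    ultimately show False by simp
  qed
qed

lemma Ob_limit:
  assumes "x \<in> Ob"
  obtains us where "\<And>s::nat. us s \<in> W" "\<And>i. i < 2 * d \<Longrightarrow> (\<lambda>s. rl d (xw (us s) (i_s0 c)) i) \<longlonglongrightarrow> x i"
proof -
  have "\<exists>u. u \<in> W \<and> ds (2 * d) x (Tw u (rl d (i_s0 c))) < inverse (real (Suc s))" for s
    using phi_less[of x "inverse (real (Suc s))"] assms by (auto simp: Ob_def)
  then obtain us where us: "\<And>s. us s \<in> W" "\<And>s. ds (2 * d) x (Tw (us s) (rl d (i_s0 c))) < inverse (real (Suc s))" by metis
  have L: "(\<lambda>s. ds (2 * d) (rl d (xw (us s) (i_s0 c))) x) \<longlonglongrightarrow> 0"
  proof (rule Lim_null_comparison[OF _ LIMSEQ_inverse_real_of_nat])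
    show "\<forall>\<^sub>F s in sequentially. norm (ds (2 * d) (rl d (xw (us s) (i_s0 c))) x) \<le> inverse (real (Suc s))"
      using us(2) unfolding Tw_rl ds_commute[of _ x] by (intro always_eventually allI) (auto intro: less_imp_le)
  qed
  show ?thesis by (rule that[of us]) (use us(1) tendsto_of_ds[OF L] in auto)
qed

text \<open>The orbit closure itself serves as invariant. Its equations have coefficients that are
  values of integer polynomials at the input numbers; reading these polynomials as coefficients
  gives one integer polynomial, and the threshold inequality passes to limits of orbit
  points.\<close>

lemma invariant_complete:
  assumes neg: "\<And>u \<gamma>. u \<in> W \<Longrightarrow> hval \<gamma> (xw u (i_s0 c)) \<le> 0"
  shows "\<exists>q. invariant_for q"
proof -
  obtain z where z: "ev (CON c) z = 0" using CON_solvable by blast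
  \<comment> \<open>Only the variables for real and imaginary parts: these are determined by
    \<open>CON\<close>, whereas a slack is determined only up to sign.\<close>
  define Yr where "Yr = {i. \<exists>a\<in>set (codes c). i = 6 * a \<or> i = Suc (6 * a)}"
  have cvr: "cvars Yr (cvar (6 * a))" if "a \<in> set (codes c)" for a
    using that by (intro cvars_intros) (auto simp: Yr_def)
  have same: "ev P z' = ev P z" if "vars_in Yr P" "ev (CON c) z' = 0" for P z'
  proof (rule ev_cong[OF that(1)])
    fix i assume "i \<in> Yr"
    then obtain a where a: "a \<in> set (codes c)" "i = 6 * a \<or> i = Suc (6 * a)" by (auto simp: Yr_def)
    have "Complex (z' (6 * a)) (z' (Suc (6 * a))) = Complex (z (6 * a)) (z (Suc (6 * a)))"
      using CON_value[OF z a(1)] CON_value[OF that(2) a(1)] by simp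
    then show "z' i = z i" using a(2) by auto
  qed
  define K where "K = {ev P z |P. vars_in Yr P}"
  have KI: "vars_in Yr P \<Longrightarrow> ev P z = t \<Longrightarrow> t \<in> K" for P t by (auto simp: K_def)
  have sub: "subring_of K"
    unfolding subring_of_def
  proof (intro conjI ballI)
    show "0 \<in> K" by (rule KI[of "[]"]) auto
    show "1 \<in> K" by (rule KI[of "[(1, [])]"]) auto
    fix a b assume "a \<in> K" "b \<in> K"
    then obtain P Q where P: "vars_in Yr P" "a = ev P z" and Q: "vars_in Yr Q" "b = ev Q z" by (auto simp: K_def)
    show "a + b \<in> K" by (rule KI[of "P @ Q"]) (use P Q in auto)
    show "a * b \<in> K" by (rule KI[of "pmul P Q"]) (use P Q in auto)
    show "- a \<in> K" by (rule KI[of "pscale (-1) P"]) (use P in auto)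
  qed
  have co: "Tw u (rl d (i_s0 c)) i \<in> K" if u: "u \<in> W" and i: "i < 2 * d" for u i
  proof -
    have j: "i div 2 < d" using i by auto
    have cv: "cvars Yr (nth0 (WV c u) (i div 2))" by (rule cvars_WV[OF cvr u j])
    have "Complex (ev (fst (nth0 (WV c u) (i div 2))) z) (ev (snd (nth0 (WV c u) (i div 2))) z) = xw u (i_s0 c) (i div 2)"
      using cev_WV[OF z u j] by (simp add: cev_def)
    then have "ev (fst (nth0 (WV c u) (i div 2))) z = Re (xw u (i_s0 c) (i div 2))"
      "ev (snd (nth0 (WV c u) (i div 2))) z = Im (xw u (i_s0 c) (i div 2))" by (auto simp: complex_eq_iff)
    with cv have "Re (xw u (i_s0 c) (i div 2)) \<in> K" "Im (xw u (i_s0 c) (i div 2)) \<in> K"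
      unfolding cvars_def by (blast intro: KI)+
    then show ?thesis unfolding Tw_rl rl_def using i by auto
  qed
  obtain F where F: "finite F" "\<And>D a ms. (D, a) \<in> F \<Longrightarrow> a ms \<in> K"
    "\<And>D a u. (D, a) \<in> F \<Longrightarrow> u \<in> W \<Longrightarrow> pe (2 * d) D a (Tw u (rl d (i_s0 c))) = 0"
    "\<And>x. x \<in> usph (2 * d) \<Longrightarrow> (\<And>D a. (D, a) \<in> F \<Longrightarrow> pe (2 * d) D a x = 0) \<Longrightarrow> x \<in> Ob"
  proof (rule orbit_equations[OF sub co])
    fix F assume "finite F" "\<And>D a ms. (D, a) \<in> F \<Longrightarrow> a ms \<in> K"
      "\<And>D a u. (D, a) \<in> F \<Longrightarrow> u \<in> W \<Longrightarrow> pe (2 * d) D a (Tw u (rl d (i_s0 c))) = 0"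
      "\<And>x. x \<in> usph (2 * d) \<Longrightarrow> (\<And>D a. (D, a) \<in> F \<Longrightarrow> pe (2 * d) D a x = 0) \<Longrightarrow> x \<in> Ob"
    then show thesis by (rule that)
  qed
  \<comment> \<open>Each coefficient is replaced by an integer polynomial in the variables
    \<open>Yr\<close> with that value at \<open>z\<close>, hence at every zero of
    \<open>CON\<close>.\<close>
  have "\<exists>Q. vars_in {..<X0 c + 2 * d} Q \<and> (\<forall>z'. ev (CON c) z' = 0 \<longrightarrow> ev Q z' = pe (2 * d) (fst f) (snd f) (rl d (xp z')))"
    if fF: "f \<in> F" for f
  proof -
    obtain D a where f: "f = (D, a)" "(D, a) \<in> F" using fF by (cases f) auto
    have "\<forall>ms. \<exists>P. vars_in Yr P \<and> ev P z = a ms"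
    proof
      fix ms
      have "a ms \<in> K" by (rule F(2)[OF f(2)])
      then show "\<exists>P. vars_in Yr P \<and> ev P z = a ms" unfolding K_def by force
    qed
    then obtain P where P: "\<And>ms. vars_in Yr (P ms)" "\<And>ms. ev (P ms) z = a ms" by metis
    obtain ml where ml: "set ml = Mon (2 * d) D" "distinct ml" using finite_distinct_list[OF finite_Mon] by blast
    define Q where "Q = concat (map (\<lambda>ms. pmul (P ms) [(1, map (\<lambda>i. X0 c + i) ms)]) ml)"
    have "vars_in {..<X0 c + 2 * d} Q"
      unfolding Q_def vars_in_concat
    proof (clarsimp, rule vars_in_pmul)
      fix ms assume "ms \<in> set ml"
      then show "vars_in {..<X0 c + 2 * d} [(1, map ((+) (X0 c)) ms)]" by (auto simp: ml Mon_def)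
      show "vars_in {..<X0 c + 2 * d} (P ms)"
        using P(1) by (rule vars_in_mono) (use codes_le in \<open>fastforce simp: Yr_def X0_def\<close>)
    qed
    moreover have "ev Q z' = pe (2 * d) D a (rl d (xp z'))" if "ev (CON c) z' = 0" for z'
    proof -
      have "ev Q z' = (\<Sum>ms\<leftarrow>ml. a ms * mon ms (\<lambda>i. z' (X0 c + i)))"
        unfolding Q_def ev_concat map_map by (simp add: o_def mon_map same[OF P(1) that] P(2))
      also have "\<dots> = (\<Sum>ms\<in>Mon (2 * d) D. a ms * mon ms (\<lambda>i. z' (X0 c + i)))"
        using ml by (simp add: sum_list_distinct_conv_sum_set)
      also have "\<dots> = pe (2 * d) D a (rl d (xp z'))"
        unfolding pe_def
      proof (rule sum.cong[OF refl])
        fix ms assume "ms \<in> Mon (2 * d) D"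
        then have "mon ms (\<lambda>i. z' (X0 c + i)) = mon ms (rl d (xp z'))"
          by (intro mon_cong) (auto simp: Mon_def rl_def xp_def elim!: evenE oddE)
        then show "a ms * mon ms (\<lambda>i. z' (X0 c + i)) = a ms * mon ms (rl d (xp z'))" by simp
      qed
      finally show ?thesis .
    qed
    ultimately show ?thesis using f(1) by auto
  qed
  then obtain Qf where Qf: "\<And>f. f \<in> F \<Longrightarrow> vars_in {..<X0 c + 2 * d} (Qf f)"
    "\<And>f z'. f \<in> F \<Longrightarrow> ev (CON c) z' = 0 \<Longrightarrow> ev (Qf f) z' = pe (2 * d) (fst f) (snd f) (rl d (xp z'))" by metis
  obtain fl where fl: "set fl = F" using finite_list[OF F(1)] by blast
  \<comment> \<open>A sum of squares turns the finite system into a single equation.\<close>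
  define q where "q = concat (map (\<lambda>f. psq (Qf f)) fl)"
  have qv: "vars_in {..<X0 c + 2 * d} q" using Qf(1) fl by (auto simp: q_def vars_in_concat)
  have q0: "ev q z' = 0 \<longleftrightarrow> (\<forall>f\<in>F. pe (2 * d) (fst f) (snd f) (rl d (xp z')) = 0)" if "ev (CON c) z' = 0" for z'
  proof -
    have "ev q z' = (\<Sum>f\<leftarrow>fl. (ev (Qf f) z')\<^sup>2)" unfolding q_def ev_concat map_map by (simp add: o_def)
    moreover have "(\<Sum>f\<leftarrow>L. (ev (Qf f) z')\<^sup>2) = 0 \<longleftrightarrow> (\<forall>f\<in>set L. ev (Qf f) z' = 0)" for L
      by (subst sum_list_nonneg_eq_0_iff) auto
    ultimately show ?thesis using Qf(2)[OF _ that] fl by auto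
  qed
  have Fob: "pe (2 * d) (fst f) (snd f) x = 0" if x: "x \<in> Ob" and f: "f \<in> F" for x f
  proof -
    obtain us where us: "\<And>s::nat. us s \<in> W" "\<And>i. i < 2 * d \<Longrightarrow> (\<lambda>s. rl d (xw (us s) (i_s0 c)) i) \<longlonglongrightarrow> x i"
      using Ob_limit[OF x] by blast
    have "(\<lambda>s. pe (2 * d) (fst f) (snd f) (rl d (xw (us s) (i_s0 c)))) \<longlonglongrightarrow> pe (2 * d) (fst f) (snd f) x"
      by (rule tendsto_pe) (rule us(2))
    moreover have "pe (2 * d) (fst f) (snd f) (rl d (xw (us s) (i_s0 c))) = 0" for s
      using F(3)[of "fst f" "snd f" "us s"] f us(1) by (simp add: Tw_rl)
    ultimately show ?thesis by (simp add: LIMSEQ_const_iff)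
  qed
  have qob: "rl d (xp z') \<in> Ob" if "ev (CON c) z' = 0" "ev q z' = 0" "(\<Sum>j<d. (cmod (xp z' j))\<^sup>2) = 1" for z'
  proof (rule F(4))
    show "rl d (xp z') \<in> usph (2 * d)" using that(3) by (simp add: usph_def nrm_rl)
    show "pe (2 * d) D a (rl d (xp z')) = 0" if "(D, a) \<in> F" for D a
      using that q0[OF \<open>ev (CON c) z' = 0\<close>] \<open>ev q z' = 0\<close> by force
  qed
  have rlx: "rl d (xp (zz z' x g)) = rl d x" for z' x g
    by (rule ext) (auto simp: rl_def xp_zz)
  have "invariant_for q"
    unfolding invariant_for_def
  proof (intro conjI qv allI impI)
    fix z' assume "ev (CON c) z' = 0"
    then have "ev (CON c) (zz z' (i_s0 c) (\<lambda>_. 0)) = 0" by (simp add: CON_zz)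
    from q0[OF this] show "ev q (zz z' (i_s0 c) (\<lambda>_. 0)) = 0" using Fob[OF s0_Ob] by (simp add: rlx)
  next
    fix \<sigma> z' assume \<sigma>: "\<sigma> < k" and a: "ev (CON c) z' = 0 \<and> ev q z' = 0 \<and> (\<Sum>j<d. (cmod (xp z' j))\<^sup>2) = 1"
    have "T \<sigma> (rl d (xp z')) \<in> Ob" using qob a \<sigma> by (intro T_Ob) auto
    then have ob: "rl d (mat_vec d (i_U c \<sigma>) (xp z')) \<in> Ob" by (simp add: T_rl)
    have "ev (CON c) (zz z' (mat_vec d (i_U c \<sigma>) (xp z')) (\<lambda>_. 0)) = 0" using a by (simp add: CON_zz)
    from q0[OF this] show "ev q (zz z' (mat_vec d (i_U c \<sigma>) (xp z')) (\<lambda>_. 0)) = 0"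
      using Fob[OF ob] by (simp add: rlx)
  next
    fix z' assume a: "ev (CON c) z' = 0 \<and> ev q z' = 0 \<and> (\<Sum>j<d. (cmod (xp z' j))\<^sup>2) = 1 \<and> (\<Sum>l<m. (cmod (gp z' l))\<^sup>2) = 1"
    then have "rl d (xp z') \<in> Ob" using qob by blast
    then obtain us where us: "\<And>s::nat. us s \<in> W"
      "\<And>i. i < 2 * d \<Longrightarrow> (\<lambda>s. rl d (xw (us s) (i_s0 c)) i) \<longlonglongrightarrow> rl d (xp z') i"
      using Ob_limit by blast
    have "(\<lambda>s. xw (us s) (i_s0 c) j) \<longlonglongrightarrow> xp z' j" if "j < d" for j
      using tendsto_Complex[OF us(2)[of "2 * j"] us(2)[of "Suc (2 * j)"]] that by simp
    then have "(\<lambda>s. hval (gp z') (xw (us s) (i_s0 c))) \<longlonglongrightarrow> hval (gp z') (xp z')"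
      by (intro tendsto_hval) auto
    then show "hval (gp z') (xp z') \<le> 0"
      by (rule LIMSEQ_le_const2) (use neg us(1) in blast)
  qed
  then show ?thesis ..
qed

lemma NEG_iff: "NEG c \<longleftrightarrow> \<not> (\<exists>u\<in>W. \<exists>\<gamma>. hval \<gamma> (xw u (i_s0 c)) > 0)"
  unfolding NEG_iff_invariant using invariant_sound invariant_complete by (meson linorder_not_le)

lemma lang_iff:
  "inst_lang_ND c = {} \<longleftrightarrow> \<not> accepts (i_B c) (i_lambda c)"
  "inst_lang_D c = {} \<longleftrightarrow> \<not> accepts (i_B c) (i_lambda c)"
proof -
  have l: "0 \<le> i_lambda c" "i_lambda c < 1" using valid by (auto simp: valid_inst_def)
  show "inst_lang_ND c = {} \<longleftrightarrow> \<not> accepts (i_B c) (i_lambda c)"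
    unfolding inst_lang_ND_def using lang_ND_accepts accepts_lang_ND[OF _ l(1)] by blast
  show "inst_lang_D c = {} \<longleftrightarrow> \<not> accepts (i_B c) (i_lambda c)"
    unfolding inst_lang_D_def using lang_D_accepts accepts_lang_D[OF _ l] by blast
qed

end

lemma search_correct:
  assumes "valid_inst c"
  shows "inst_lang_ND c = {} \<longleftrightarrow> NEG c" "inst_lang_D c = {} \<longleftrightarrow> NEG c" "NEG c \<longleftrightarrow> \<not> POS c"
proof -
  interpret instance_code c using assms by unfold_locales
  have "(inst_lang_ND c = {} \<longleftrightarrow> NEG c) \<and> (inst_lang_D c = {} \<longleftrightarrow> NEG c) \<and> (NEG c \<longleftrightarrow> \<not> POS c)"
  proof (cases "i_k c = 0")
    \<comment> \<open>Over an empty alphabet there are no infinite words, so both languages are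
      empty; the conditions on \<open>kk c\<close> in \<open>NEG\<close> and \<open>POS\<close> give
      the matching answers.\<close>
    case True
    then show ?thesis by (auto simp: NEG_def POS_def accessors inst_lang_ND_def inst_lang_D_def lang_ND_def lang_D_def)
  next
    case False
    interpret positive_instance c using False by unfold_locales simp
    show ?thesis using lang_iff accepts_iff NEG_iff POS_iff by simp
  qed
  then show "inst_lang_ND c = {} \<longleftrightarrow> NEG c" "inst_lang_D c = {} \<longleftrightarrow> NEG c" "NEG c \<longleftrightarrow> \<not> POS c" by auto
qed

theorem theorem12:
  shows "decidable_on {c. valid_inst c} (\<lambda>c. inst_lang_ND c = {}) \<and>
         decidable_on {c. valid_inst c} (\<lambda>c. inst_lang_D c = {})"
proof -
  have "decidable_on {c. valid_inst c} NEG"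
    using re_NEG re_POS by (rule re_imp_decidable_on) (simp add: search_correct(3))
  then show ?thesis unfolding decidable_on_def using search_correct(1,2) by auto
qed

end
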